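(* Let the damping parameters $\omega_j$ ($j=2,\dots,p$) satisfy $0<\omega_j\,\rho(\mathbb{D}_j^{-1}\mathbb{A}_j)\le 1$ and $\omega_j\lesssim (j+1)^{-1}$. Then there exists a constant $C_0>0$ independent of $h$ and $k$ such that, when $m> C_0 k$, the $W$-cycle algorithm of the $k$-level $p$-multigrid method (with non-inherited bilinear forms, $k\in\{2,\dots,p\}$) converges with a rate $\delta\in(0,1)$ independent of $h$ and $k$, i.e. its error propagation matrix $\mathbb{E}^{\rm W}_{k,m}$ satisfies $$\|\mathbb{E}^{\rm W}_{k,m}\mathbf{g}_k\|_{\mathbb{A}_k,1}\le \delta\,\|\mathbf{g}_k\|_{\mathbb{A}_k,1}\qquad\forall\,\mathbf{g}_k\in\mathbb{R}^{N_hN_k}.$$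
   Context: Setting. $\Omega\subset\mathbb{R}^d$ is an axis-parallel open rectangular box, $\mathcal{T}_h$ a uniform Cartesian mesh of $\Omega$ by $N_h$ cubes (intervals/squares if $d=1,2$) of edge length $h$, and $\mathcal{F}_h$ the set of all interior and boundary faces. For $T\in\mathcal{T}_h$ with affine map $\boldsymbol{F}_T:[-1,1]^d\to T$ and $\boldsymbol\sigma\in\mathbb{N}^d$ let $\Psi_T^{\boldsymbol\sigma}(\boldsymbol{x})=\prod_{i=1}^d l_{\sigma_i}(\xi_i)$, $\boldsymbol\xi=\boldsymbol{F}_T^{-1}(\boldsymbol{x})$, where $l_n$ is the Legendre polynomial of degree $n$ with $l_n(1)=1$; $\Psi_T^{\boldsymbol\sigma}$ is extended by zero outside $T$. $U_k(\mathcal{T}_h)=\mathrm{span}\{\Psi_T^{\boldsymbol\sigma}:\|\boldsymbol\sigma\|_\infty\le k,\ T\in\mathcal{T}_h\}$ is the broken space of polynomials of degree $\le k$ in each variable; $N_k=(k+1)^d$. Levels are $k=1,\dots,p$. A function $v_k\in U_k(\mathcal{T}_h)$ is identified with its coefficient vector $\mathbf{v}_k\in\mathbb{R}^{N_hN_k}$ in this basis. On an interior face $F=T_1\cap T_2$: $\{\!\{u\}\!\}=\frac12(u|_{T_1}+u|_{T_2})$, $[\![u]\!]=u|_{T_1}-u|_{T_2}$, and $\boldsymbol{n}$ is the unit normal from $T_1$ to $T_2$ (fixed orientation); on a boundary face $\{\!\{u\}\!\}=[\![u]\!]=u$ and $\boldsymbol{n}$ is the outward unit normal. For $u,v\in U_k(\mathcal{T}_h)$,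 $$\mathcal{A}_k(u,v)=\sum_{T}\int_T\nabla u\cdot\nabla v-\sum_{F\in\mathcal{F}_h}\int_F\{\!\{\nabla u\}\!\}\cdot\boldsymbol{n}\,[\![v]\!]-\sum_{F\in\mathcal{F}_h}\int_F\{\!\{\nabla v\}\!\}\cdot\boldsymbol{n}\,[\![u]\!]+\sum_{F\in\mathcal{F}_h}\frac{\alpha_0k^2}{h}\int_F[\![u]\!][\![v]\!],$$ where $\alpha_0>0$ is a fixed constant, large enough that $\mathcal{A}_k$ is coercive and continuous, uniformly in $h$ and $k$, in the norm $\|v\|_{1,k,h}^2=\sum_T\|\nabla v\|_{L^2(T)}^2+\frac{k^2}{h}\sum_F\|[\![v]\!]\|_{L^2(F)}^2$. The symmetric positive definite matrix $\mathbb{A}_k$ is defined by $\mathbf{v}_k^\top\mathbb{A}_k\mathbf{w}_k=\mathcal{A}_k(v_k,w_k)$; $\mathbb{D}_k$ is the diagonal part of $\mathbb{A}_k$; $\|\mathbf{v}\|_{\mathbb{A}_k,s}^2=\mathbf{v}^\top\mathbb{A}_k^s\mathbf{v}$; $\rho$ is the spectral radius. $\mathbb{P}_{k-1}^k$ is the matrix of the natural injection $U_{k-1}(\mathcal{T}_h)\hookrightarrow U_k(\mathcal{T}_h)$ (entries 0 or 1), and $\mathbb{R}_k^{k-1}=(\mathbb{P}_{k-1}^k)^\top$. $x\lesssim y$ means $x\le Cy$ for a constant $C>0$ independent of the mesh size and the polynomial degrees. Smoother. $m$ steps of the fourth-kind Chebyshev iteration for $\mathbb{A}_k\mathbf{z}_k=\mathbf{f}_k$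 from $\mathbf{z}_k^0$: $\mathbf{w}^0=\mathbf{0}$, $\mathbf{w}^i=\frac{2i-3}{2i+1}\mathbf{w}^{i-1}+\frac{8i-4}{2i+1}\omega_k\mathbb{D}_k^{-1}(\mathbf{f}_k-\mathbb{A}_k\mathbf{z}_k^{i-1})$, $\mathbf{z}_k^i=\mathbf{z}_k^{i-1}+\mathbf{w}^i$, $i=1,\dots,m$. Equivalently $\mathbf{z}_k^m-\mathbf{z}_k=P_m(\omega_k\mathbb{D}_k^{-1}\mathbb{A}_k)(\mathbf{z}_k^0-\mathbf{z}_k)$, with $P_0=1$, $P_1(x)=1-\frac43x$, $P_i(x)=\frac{4i-2}{2i+1}(1-2x)P_{i-1}(x)-\frac{2i-3}{2i+1}P_{i-2}(x)$ for $i\ge2$. $W$-cycle. $W\mathrm{cycle}(k,\mathbb{A}_k,\mathbf{f}_k,\mathbf{z}_k^0,m)$: if $k=1$, return $\mathbb{A}_1^{-1}\mathbf{f}_1$. Otherwise: apply $m$ smoothing steps from $\mathbf{z}_k^0$ to get $\mathbf{z}_k^m$; set $\mathbf{r}_{k-1}=\mathbb{R}_k^{k-1}(\mathbf{f}_k-\mathbb{A}_k\mathbf{z}_k^m)$; set $\mathbf{e}_{k-1}=W\mathrm{cycle}(k-1,\mathbb{A}_{k-1},\mathbf{r}_{k-1},\mathbf{0},m)$ and then $\mathbf{e}_{k-1}\leftarrow W\mathrm{cycle}(k-1,\mathbb{A}_{k-1},\mathbf{r}_{k-1},\mathbf{e}_{k-1},m)$; set $\mathbf{z}_k^{m+1}=\mathbf{z}_k^m+\mathbb{P}_{k-1}^k\mathbf{e}_{k-1}$;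 apply $m$ smoothing steps from $\mathbf{z}_k^{m+1}$ and return the result. Its error propagation matrix is defined by $\mathbb{E}^{\rm W}_{k,m}(\mathbf{z}_k-\mathbf{z}_k^0)=\mathbf{z}_k-W\mathrm{cycle}(k,\mathbb{A}_k,\mathbf{f}_k,\mathbf{z}_k^0,m)$ where $\mathbb{A}_k\mathbf{z}_k=\mathbf{f}_k$; explicitly $\mathbb{E}^{\rm W}_{1,m}=0$ and, with $\mathbb{G}=P_m(\omega_k\mathbb{D}_k^{-1}\mathbb{A}_k)$ and $\mathbb{I}_{k-1}$ the identity matrix, $$\mathbb{E}^{\rm W}_{k,m}=\mathbb{G}\big[\mathbb{A}_k^{-1}-\mathbb{P}_{k-1}^k\big(\mathbb{I}_{k-1}-(\mathbb{E}^{\rm W}_{k-1,m})^2\big)\mathbb{A}_{k-1}^{-1}\mathbb{R}_k^{k-1}\big]\mathbb{A}_k\mathbb{G}.$$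
   Formalization: The damping parameters are also assumed to satisfy ω_j ≥ c/(j+1) for a constant c>0, on which C_0 and δ may depend; with only the stated upper bounds, ω_j could tend to 0, the smoother would tend to the identity, and no uniform δ<1 would exist. *)

theory Defs
  imports "HOL-Analysis.Analysis" "Jordan_Normal_Form.Spectral_Radius"
begin

no_notation vec_index (infixl "$" 100)
no_notation inner (infix "\<bullet>" 70)

section \<open>Mesh and broken polynomial space\<close>

text \<open>The domain is \<open>box a b\<close>. A cell is addressed by its multi-index \<open>q\<close> in the Cartesian grid
  with origin \<open>a\<close> and spacing \<open>h\<close>.\<close>

definition uniform_mesh :: "real^'d \<Rightarrow> real^'d \<Rightarrow> real \<Rightarrow> bool" where
  "uniform_mesh a b h \<longleftrightarrow> 0 < h \<and> (\<forall>i. \<exists>n::nat. b $ i - a $ i = real n * h)"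

definition cell :: "real^'d \<Rightarrow> real \<Rightarrow> ('d \<Rightarrow> nat) \<Rightarrow> (real^'d) set" where
  "cell a h q = cbox (\<chi> i. a $ i + h * real (q i)) (\<chi> i. a $ i + h * (real (q i) + 1))"

definition cells :: "real^'d \<Rightarrow> real^'d \<Rightarrow> real \<Rightarrow> ('d \<Rightarrow> nat) set" where
  "cells a b h = {q. \<forall>i. a $ i + h * (real (q i) + 1) \<le> b $ i}"

fun legendre :: "nat \<Rightarrow> real poly" where
  "legendre 0 = 1"
| "legendre (Suc 0) = [:0, 1:]"
| "legendre (Suc (Suc n)) =
     Polynomial.smult (1 / real (n + 2))
       (Polynomial.smult (real (2 * n + 3)) ([:0, 1:] * legendre (Suc n)) - Polynomial.smult (real (n + 1)) (legendre n))"

lemma poly_legendre_1: "poly (legendre n) 1 = 1"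
  by (induction n rule: legendre.induct) (auto simp: field_simps)

text \<open>The argument of the Legendre polynomial is the reference coordinate, in \<open>{-1..1}\<close> on the cell.\<close>

definition basis_fun :: "real^'d \<Rightarrow> real \<Rightarrow> ('d \<Rightarrow> nat) \<times> ('d \<Rightarrow> nat) \<Rightarrow> real^'d \<Rightarrow> real" where
  "basis_fun a h = (\<lambda>(q, \<sigma>) x.
     if x \<in> cell a h q
     then \<Prod>i\<in>UNIV. poly (legendre (\<sigma> i)) (2 * (x $ i - a $ i) / h - 2 * real (q i) - 1)
     else 0)"

definition basis_index ::
    "real^'d \<Rightarrow> real^'d \<Rightarrow> real \<Rightarrow> nat \<Rightarrow> (('d \<Rightarrow> nat) \<times> ('d \<Rightarrow> nat)) set" where
  "basis_index a b h k = cells a b h \<times> {\<sigma>. \<forall>i. \<sigma> i \<le> k}"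

definition dg_space :: "real^'d \<Rightarrow> real^'d \<Rightarrow> real \<Rightarrow> nat \<Rightarrow> (real^'d \<Rightarrow> real) set" where
  "dg_space a b h k = {\<lambda>x. \<Sum>j\<in>basis_index a b h k. c j * basis_fun a h j x | c. True}"

section \<open>Faces, traces, averages and jumps\<close>

text \<open>The face \<open>(i, q)\<close> is the facet of the grid cube \<open>q\<close> orthogonal to the \<open>i\<close>-th axis at its lower
  side. Its neighbours are the cube \<open>q\<close> above and the cube \<open>q(i := q i - 1)\<close> below, as far
  as they belong to the mesh; the face is interior if both do.\<close>

definition has_below :: "real^'d \<Rightarrow> real^'d \<Rightarrow> real \<Rightarrow> 'd \<times> ('d \<Rightarrow> nat) \<Rightarrow> bool" where
  "has_below a b h = (\<lambda>(i, q). 0 < q i \<and> q(i := q i - 1) \<in> cells a b h)"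

definition has_above :: "real^'d \<Rightarrow> real^'d \<Rightarrow> real \<Rightarrow> 'd \<times> ('d \<Rightarrow> nat) \<Rightarrow> bool" where
  "has_above a b h = (\<lambda>(i, q). q \<in> cells a b h)"

definition faces :: "real^'d \<Rightarrow> real^'d \<Rightarrow> real \<Rightarrow> ('d \<times> ('d \<Rightarrow> nat)) set" where
  "faces a b h = {F. has_below a b h F \<or> has_above a b h F}"

text \<open>On a cell \<open>T\<close>, \<open>g|\<^sub>T\<close> at a point of the boundary is the limit from inside \<open>T\<close>; the value of
  a broken function on a face itself is immaterial.\<close>

definition cell_trace :: "(real^'d) set \<Rightarrow> (real^'d \<Rightarrow> 'b::t2_space) \<Rightarrow> real^'d \<Rightarrow> 'b" where
  "cell_trace T g x = Lim (at x within interior T) g"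

definition trace_below ::
    "real^'d \<Rightarrow> real \<Rightarrow> 'd \<times> ('d \<Rightarrow> nat) \<Rightarrow> (real^'d \<Rightarrow> 'b::t2_space) \<Rightarrow> real^'d \<Rightarrow> 'b" where
  "trace_below a h = (\<lambda>(i, q). cell_trace (cell a h (q(i := q i - 1))))"

definition trace_above ::
    "real^'d \<Rightarrow> real \<Rightarrow> 'd \<times> ('d \<Rightarrow> nat) \<Rightarrow> (real^'d \<Rightarrow> 'b::t2_space) \<Rightarrow> real^'d \<Rightarrow> 'b" where
  "trace_above a h = (\<lambda>(i, q). cell_trace (cell a h q))"

text \<open>On interior faces the fixed orientation is along the positive axis: \<open>T\<^sub>1\<close> is the cell below.\<close>

definition average :: "real^'d \<Rightarrow> real^'d \<Rightarrow> real \<Rightarrow> 'd \<times> ('d \<Rightarrow> nat) \<Rightarrow>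
    (real^'d \<Rightarrow> 'b::{real_vector,t2_space}) \<Rightarrow> real^'d \<Rightarrow> 'b" where
  "average a b h F g x =
    (if has_below a b h F \<and> has_above a b h F
     then (1/2) *\<^sub>R (trace_below a h F g x + trace_above a h F g x)
     else if has_below a b h F then trace_below a h F g x
     else trace_above a h F g x)"

definition jump :: "real^'d \<Rightarrow> real^'d \<Rightarrow> real \<Rightarrow> 'd \<times> ('d \<Rightarrow> nat) \<Rightarrow>
    (real^'d \<Rightarrow> real) \<Rightarrow> real^'d \<Rightarrow> real" where
  "jump a b h F g x =
    (if has_below a b h F \<and> has_above a b h F
     then trace_below a h F g x - trace_above a h F g x
     else if has_below a b h F then trace_below a h F g x
     else trace_above a h F g x)"

definition face_normal :: "real^'d \<Rightarrow> real^'d \<Rightarrow> real \<Rightarrow> 'd \<times> ('d \<Rightarrow> nat) \<Rightarrow> real^'d" where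
  "face_normal a b h F = (if has_below a b h F then axis (fst F) 1 else - axis (fst F) 1)"

text \<open>The surface measure of a face is Lebesgue measure in the remaining coordinates; for \<open>d = 1\<close>
  the index set is empty and this is evaluation at a point.\<close>

definition face_integral ::
    "real^'d \<Rightarrow> real \<Rightarrow> 'd \<times> ('d \<Rightarrow> nat) \<Rightarrow> (real^'d \<Rightarrow> real) \<Rightarrow> real" where
  "face_integral a h = (\<lambda>(i, q) f.
     set_lebesgue_integral (Pi\<^sub>M (UNIV - {i}) (\<lambda>_. lborel))
       (\<Pi>\<^sub>E j\<in>UNIV - {i}. {a $ j + h * real (q j) .. a $ j + h * (real (q j) + 1)})
       (\<lambda>y. f (\<chi> j. if j = i then a $ i + h * real (q i) else y j)))"

definition grad :: "(real^'d \<Rightarrow> real) \<Rightarrow> real^'d \<Rightarrow> real^'d" where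
  "grad u x = (\<chi> i. frechet_derivative u (at x) (axis i 1))"

section \<open>Bilinear form\<close>

text \<open>Volume integrals run over the interior of the cells, where broken polynomials are smooth.\<close>

definition dg_form :: "real^'d \<Rightarrow> real^'d \<Rightarrow> real \<Rightarrow> real \<Rightarrow> nat \<Rightarrow>
    (real^'d \<Rightarrow> real) \<Rightarrow> (real^'d \<Rightarrow> real) \<Rightarrow> real" where
  "dg_form a b \<alpha>0 h k u v =
     (\<Sum>q\<in>cells a b h. set_lebesgue_integral lborel (interior (cell a h q))
        (\<lambda>x. inner (grad u x) (grad v x)))
   - (\<Sum>F\<in>faces a b h. face_integral a h F
        (\<lambda>x. inner (average a b h F (grad u) x) (face_normal a b h F) * jump a b h F v x))
   - (\<Sum>F\<in>faces a b h. face_integral a h F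
        (\<lambda>x. inner (average a b h F (grad v) x) (face_normal a b h F) * jump a b h F u x))
   + (\<Sum>F\<in>faces a b h. \<alpha>0 * (real k)\<^sup>2 / h * face_integral a h F
        (\<lambda>x. jump a b h F u x * jump a b h F v x))"

definition dg_norm :: "real^'d \<Rightarrow> real^'d \<Rightarrow> real \<Rightarrow> nat \<Rightarrow> (real^'d \<Rightarrow> real) \<Rightarrow> real" where
  "dg_norm a b h k v = sqrt (
     (\<Sum>q\<in>cells a b h. set_lebesgue_integral lborel (interior (cell a h q)) (\<lambda>x. (norm (grad v x))\<^sup>2))
   + (real k)\<^sup>2 / h * (\<Sum>F\<in>faces a b h. face_integral a h F (\<lambda>x. (jump a b h F v x)\<^sup>2)))"

text \<open>Coercivity and continuity with constants independent of the mesh size and the degree.\<close>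

definition uniformly_stable :: "real^'d \<Rightarrow> real^'d \<Rightarrow> real \<Rightarrow> bool" where
  "uniformly_stable a b \<alpha>0 \<longleftrightarrow> (\<exists>\<beta>>0. \<exists>M>0. \<forall>h k. uniform_mesh a b h \<longrightarrow> 1 \<le> k \<longrightarrow>
     (\<forall>v\<in>dg_space a b h k. \<beta> * (dg_norm a b h k v)\<^sup>2 \<le> dg_form a b \<alpha>0 h k v v) \<and>
     (\<forall>u\<in>dg_space a b h k. \<forall>v\<in>dg_space a b h k.
        \<bar>dg_form a b \<alpha>0 h k u v\<bar> \<le> M * dg_norm a b h k u * dg_norm a b h k v))"

section \<open>Matrices\<close>

text \<open>The basis functions of each level are numbered in an arbitrary way.\<close>

definition dg_dim :: "real^'d \<Rightarrow> real^'d \<Rightarrow> real \<Rightarrow> nat \<Rightarrow> nat" where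
  "dg_dim a b h k = card (basis_index a b h k)"

definition basis_enum ::
    "real^'d \<Rightarrow> real^'d \<Rightarrow> real \<Rightarrow> nat \<Rightarrow> nat \<Rightarrow> ('d \<Rightarrow> nat) \<times> ('d \<Rightarrow> nat)" where
  "basis_enum a b h k = from_nat_into (basis_index a b h k)"

definition stiff :: "real^'d \<Rightarrow> real^'d \<Rightarrow> real \<Rightarrow> real \<Rightarrow> nat \<Rightarrow> real mat" where
  "stiff a b \<alpha>0 h k = Matrix.mat (dg_dim a b h k) (dg_dim a b h k) (\<lambda>(i, j).
     dg_form a b \<alpha>0 h k (basis_fun a h (basis_enum a b h k i)) (basis_fun a h (basis_enum a b h k j)))"

text \<open>\<open>prolong a b h k\<close> injects level \<open>k - 1\<close> into level \<open>k\<close>.\<close>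

definition prolong :: "real^'d \<Rightarrow> real^'d \<Rightarrow> real \<Rightarrow> nat \<Rightarrow> real mat" where
  "prolong a b h k = Matrix.mat (dg_dim a b h k) (dg_dim a b h (k - 1)) (\<lambda>(i, j).
     if basis_enum a b h k i = basis_enum a b h (k - 1) j then 1 else 0)"

definition diag_part :: "real mat \<Rightarrow> real mat" where
  "diag_part A = mat_diag (dim_row A) (\<lambda>i. A $$ (i, i))"

definition minv :: "real mat \<Rightarrow> real mat" where
  "minv A = the (mat_inverse A)"

definition precond :: "real mat \<Rightarrow> real mat" where
  "precond A = minv (diag_part A) * A"

definition spec_rad :: "real mat \<Rightarrow> real" where
  "spec_rad X = spectral_radius (map_mat complex_of_real X)"

definition energy_norm :: "real mat \<Rightarrow> real Matrix.vec \<Rightarrow> real" where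
  "energy_norm A v = sqrt (v \<bullet> (A *\<^sub>v v))"

section \<open>Smoother and W-cycle\<close>

text \<open>The pair is \<open>(w\<^sup>i, z\<^sup>i)\<close>.\<close>

primrec cheb_step :: "real mat \<Rightarrow> real \<Rightarrow> real Matrix.vec \<Rightarrow> real Matrix.vec \<Rightarrow> nat \<Rightarrow>
    real Matrix.vec \<times> real Matrix.vec" where
  "cheb_step A \<omega> f z0 0 = (0\<^sub>v (dim_row A), z0)"
| "cheb_step A \<omega> f z0 (Suc n) =
    (let (w, z) = cheb_step A \<omega> f z0 n; i = real (Suc n);
         w' = ((2 * i - 3) / (2 * i + 1)) \<cdot>\<^sub>v w
            + ((8 * i - 4) / (2 * i + 1) * \<omega>) \<cdot>\<^sub>v (minv (diag_part A) *\<^sub>v (f - A *\<^sub>v z))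
     in (w', z + w'))"

definition smooth :: "real mat \<Rightarrow> real \<Rightarrow> nat \<Rightarrow> real Matrix.vec \<Rightarrow> real Matrix.vec \<Rightarrow>
    real Matrix.vec" where
  "smooth A \<omega> m f z0 = snd (cheb_step A \<omega> f z0 m)"

text \<open>In the following \<open>A k\<close> is the matrix of level \<open>k\<close>, \<open>P k\<close> the prolongation from level
  \<open>k - 1\<close> to level \<open>k\<close>, and \<open>\<omega> k\<close> the damping parameter. Levels start at 1; the
  value at level 0 is a dummy.\<close>

fun wcycle :: "(nat \<Rightarrow> real mat) \<Rightarrow> (nat \<Rightarrow> real mat) \<Rightarrow> (nat \<Rightarrow> real) \<Rightarrow> nat \<Rightarrow>
    nat \<Rightarrow> real Matrix.vec \<Rightarrow> real Matrix.vec \<Rightarrow> real Matrix.vec" where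
  "wcycle A P \<omega> m 0 f z0 = z0"
| "wcycle A P \<omega> m (Suc 0) f z0 = minv (A 1) *\<^sub>v f"
| "wcycle A P \<omega> m (Suc (Suc l)) f z0 =
    (let k = Suc (Suc l);
         zm = smooth (A k) (\<omega> k) m f z0;
         r = (P k)\<^sup>T *\<^sub>v (f - A k *\<^sub>v zm);
         e1 = wcycle A P \<omega> m (Suc l) r (0\<^sub>v (dim_row (A (Suc l))));
         e2 = wcycle A P \<omega> m (Suc l) r e1
     in smooth (A k) (\<omega> k) m f (zm + P k *\<^sub>v e2))"

text \<open>The polynomials \<open>P\<^sub>n\<close> of the smoother, evaluated at a matrix.\<close>

fun cheb_mat :: "real mat \<Rightarrow> nat \<Rightarrow> real mat" where
  "cheb_mat X 0 = 1\<^sub>m (dim_row X)"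
| "cheb_mat X (Suc 0) = 1\<^sub>m (dim_row X) - (4/3) \<cdot>\<^sub>m X"
| "cheb_mat X (Suc (Suc n)) = (let i = real (Suc (Suc n)) in
     ((4 * i - 2) / (2 * i + 1)) \<cdot>\<^sub>m ((1\<^sub>m (dim_row X) - 2 \<cdot>\<^sub>m X) * cheb_mat X (Suc n))
     - ((2 * i - 3) / (2 * i + 1)) \<cdot>\<^sub>m cheb_mat X n)"

text \<open>The error propagation matrix of \<open>wcycle\<close>; see \<open>wcycle_error\<close> below.\<close>

fun wcycle_err :: "(nat \<Rightarrow> real mat) \<Rightarrow> (nat \<Rightarrow> real mat) \<Rightarrow> (nat \<Rightarrow> real) \<Rightarrow> nat \<Rightarrow> nat \<Rightarrow> real mat" where
  "wcycle_err A P \<omega> m 0 = 1\<^sub>m (dim_row (A 0))"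
| "wcycle_err A P \<omega> m (Suc 0) = 0\<^sub>m (dim_row (A 1)) (dim_row (A 1))"
| "wcycle_err A P \<omega> m (Suc (Suc l)) =
    (let k = Suc (Suc l);
         G = cheb_mat (\<omega> k \<cdot>\<^sub>m precond (A k)) m;
         E = wcycle_err A P \<omega> m (Suc l)
     in G * (minv (A k)
             - P k * ((1\<^sub>m (dim_row (A (Suc l))) - E * E) * minv (A (Suc l)) * (P k)\<^sup>T)) * A k * G)"


lemma minv_mult:
  assumes A: "A \<in> carrier_mat n n" and inv: "invertible_mat A"
  shows "minv A \<in> carrier_mat n n" "minv A * A = 1\<^sub>m n" "A * minv A = 1\<^sub>m n"
proof -
  from inv obtain B where B: "A * B = 1\<^sub>m (dim_row A)" "B * A = 1\<^sub>m (dim_row B)"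
    unfolding invertible_mat_def inverts_mat_def by auto
  have "dim_col (A * B) = dim_col (1\<^sub>m (dim_row A) :: real mat)" using B(1) by simp
  moreover have "dim_col (B * A) = dim_col (1\<^sub>m (dim_row B) :: real mat)" using B(2) by simp
  ultimately have "B \<in> carrier_mat n n" using A by auto
  then have "A \<in> Units (ring_mat TYPE(real) n ())"
    using A B by (auto simp: Units_def ring_mat_def)
  with mat_inverse(1)[OF A, of "()"] obtain C where C: "mat_inverse A = Some C"
    by (cases "mat_inverse A") auto
  from mat_inverse(2)[OF A C] C
  show "minv A \<in> carrier_mat n n" "minv A * A = 1\<^sub>m n" "A * minv A = 1\<^sub>m n"
    by (auto simp: minv_def)
qed

lemma smult_mat_vec: "A \<in> carrier_mat nr nc \<Longrightarrow> v \<in> carrier_vec nc \<Longrightarrow> (c \<cdot>\<^sub>m A) *\<^sub>v v = c \<cdot>\<^sub>v (A *\<^sub>v v)"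
  for A :: "real mat"
  by (intro eq_vecI) auto

lemma cheb_mat_carrier: "X \<in> carrier_mat n n \<Longrightarrow> cheb_mat X i \<in> carrier_mat n n"
  by (induction X i rule: cheb_mat.induct) (auto simp: Let_def)

lemma cheb_step_carrier:
  assumes "A \<in> carrier_mat n n" "minv (diag_part A) \<in> carrier_mat n n"
    "f \<in> carrier_vec n" "z0 \<in> carrier_vec n"
  shows "fst (cheb_step A \<omega> f z0 i) \<in> carrier_vec n \<and> snd (cheb_step A \<omega> f z0 i) \<in> carrier_vec n"
  using assms by (induction i) (auto simp: Let_def split: prod.splits)

lemma vec_carrier_minusD: "x - y \<in> carrier_vec n \<Longrightarrow> y \<in> carrier_vec n" for x y :: "real Matrix.vec"
  by (metis carrier_vecD carrier_vecI index_minus_vec(2))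

lemma vec_minus_add: "x \<in> carrier_vec n \<Longrightarrow> y \<in> carrier_vec n \<Longrightarrow> w \<in> carrier_vec n \<Longrightarrow> x - (y + w) = x - y - w"
  for x y w :: "real Matrix.vec"
  by (intro eq_vecI) auto

lemma vec_minus_minus: "x \<in> carrier_vec n \<Longrightarrow> y \<in> carrier_vec n \<Longrightarrow> x - (x - y) = y"
  for x y :: "real Matrix.vec"
  by (intro eq_vecI) auto

lemma cheb_vec_identity:
  fixes u v x :: "real Matrix.vec"
  assumes "u \<in> carrier_vec n" "v \<in> carrier_vec n" "x \<in> carrier_vec n" and i: "(i::real) \<ge> 0"
  shows "((2 * i - 3) / (2 * i + 1)) \<cdot>\<^sub>v (v - u) + ((8 * i - 4) / (2 * i + 1)) \<cdot>\<^sub>v x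
    = u - (((4 * i - 2) / (2 * i + 1)) \<cdot>\<^sub>v (u - 2 \<cdot>\<^sub>v x) - ((2 * i - 3) / (2 * i + 1)) \<cdot>\<^sub>v v)"
proof -
  have "2 * i + 1 \<noteq> 0" using i by simp
  then have "(2 * i - 3) / (2 * i + 1) * (b - a) + (8 * i - 4) / (2 * i + 1) * c
    = a - ((4 * i - 2) / (2 * i + 1) * (a - 2 * c) - (2 * i - 3) / (2 * i + 1) * b)" for a b c :: real
    by (simp add: divide_simps) (simp add: algebra_simps)
  then show ?thesis using assms(1-3) by (intro eq_vecI) auto
qed

lemma cheb_step_error:
  fixes \<omega> :: real
  assumes A: "A \<in> carrier_mat n n" and D: "minv (diag_part A) \<in> carrier_mat n n"
    and z: "z \<in> carrier_vec n" and z0: "z0 \<in> carrier_vec n"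
  defines "X \<equiv> \<omega> \<cdot>\<^sub>m precond A"
  shows "z - snd (cheb_step A \<omega> (A *\<^sub>v z) z0 i) = cheb_mat X i *\<^sub>v (z - z0) \<and>
    (i > 0 \<longrightarrow> fst (cheb_step A \<omega> (A *\<^sub>v z) z0 i)
       = cheb_mat X (i - 1) *\<^sub>v (z - z0) - cheb_mat X i *\<^sub>v (z - z0))"
proof -
  let ?e = "z - z0" and ?f = "A *\<^sub>v z"
  let ?W = "\<lambda>i. fst (cheb_step A \<omega> ?f z0 i)" and ?Z = "\<lambda>i. snd (cheb_step A \<omega> ?f z0 i)"
  have X: "X \<in> carrier_mat n n" using A D by (simp add: X_def precond_def)
  have e: "?e \<in> carrier_vec n" using z z0 by simp
  have f: "?f \<in> carrier_vec n" using A z by simp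
  have W: "?W i \<in> carrier_vec n" and Z: "?Z i \<in> carrier_vec n" for i
    using cheb_step_carrier[OF A D f z0] by auto
  have C: "cheb_mat X i \<in> carrier_mat n n" for i by (rule cheb_mat_carrier[OF X])
  have res: "\<omega> \<cdot>\<^sub>v (minv (diag_part A) *\<^sub>v (?f - A *\<^sub>v ?Z i)) = X *\<^sub>v (z - ?Z i)" for i
  proof -
    have "?f - A *\<^sub>v ?Z i = A *\<^sub>v (z - ?Z i)"
      using mult_minus_distrib_mat_vec[OF A z Z] by simp
    then have "minv (diag_part A) *\<^sub>v (?f - A *\<^sub>v ?Z i) = precond A *\<^sub>v (z - ?Z i)"
      unfolding precond_def using A D z Z[of i] by (simp add: assoc_mult_mat_vec)
    moreover have "precond A \<in> carrier_mat n n" using A D by (simp add: precond_def)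
    ultimately show ?thesis
      unfolding X_def using z Z[of i] by (simp add: smult_mat_vec)
  qed
  have Wstep: "?W (Suc i) = ((2 * real (Suc i) - 3) / (2 * real (Suc i) + 1)) \<cdot>\<^sub>v ?W i
      + ((8 * real (Suc i) - 4) / (2 * real (Suc i) + 1)) \<cdot>\<^sub>v (X *\<^sub>v (z - ?Z i))" for i
    unfolding res[symmetric] by (simp add: Let_def case_prod_unfold smult_smult_assoc)
  have Zstep: "?Z (Suc i) = ?Z i + ?W (Suc i)" for i
    by (simp add: Let_def case_prod_unfold)
  show ?thesis
  proof (induction i rule: induct_nat_012)
    case 0
    then show ?case using X e by simp
  next
    case 1
    have Z0: "?Z 0 = z0" "?W 0 = 0\<^sub>v n" using A by auto
    have Xe: "X *\<^sub>v ?e \<in> carrier_vec n" using X e by simp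
    have c1: "cheb_mat X (Suc 0) *\<^sub>v ?e = ?e - (4/3) \<cdot>\<^sub>v (X *\<^sub>v ?e)"
      using X e by (simp add: minus_mult_distrib_mat_vec[of _ n n] smult_mat_vec)
    have w1: "?W (Suc 0) = (4/3) \<cdot>\<^sub>v (X *\<^sub>v ?e)"
      unfolding Wstep Z0 using X Xe by (intro eq_vecI) auto
    show ?case
      unfolding c1 Zstep w1 Z0(1) using X Xe z z0 e by (intro conjI impI eq_vecI) (auto)
  next
    case (ge2 i)
    let ?i = "real (Suc (Suc i))" and ?a = "cheb_mat X (Suc i) *\<^sub>v ?e" and ?b = "cheb_mat X i *\<^sub>v ?e"
    have IH: "z - ?Z (Suc i) = ?a" "?W (Suc i) = ?b - ?a" using ge2(2) by (simp_all del: cheb_step.simps cheb_mat.simps)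
    have ca: "?a \<in> carrier_vec n" "?b \<in> carrier_vec n" using C e by (metis mult_mat_vec_carrier)+
    have Xa: "X *\<^sub>v ?a \<in> carrier_vec n" using X ca by simp
    have c: "cheb_mat X (Suc (Suc i)) *\<^sub>v ?e = ((4 * ?i - 2) / (2 * ?i + 1)) \<cdot>\<^sub>v (?a - 2 \<cdot>\<^sub>v (X *\<^sub>v ?a))
        - ((2 * ?i - 3) / (2 * ?i + 1)) \<cdot>\<^sub>v ?b"
    proof -
      define B where "B = 1\<^sub>m n - 2 \<cdot>\<^sub>m X"
      have B: "B \<in> carrier_mat n n" unfolding B_def
        by (rule minus_carrier_mat, rule smult_carrier_mat, rule X)
      have Ba: "B *\<^sub>v ?a = ?a - 2 \<cdot>\<^sub>v (X *\<^sub>v ?a)"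
        unfolding B_def using minus_mult_distrib_mat_vec[of "1\<^sub>m n" n n "2 \<cdot>\<^sub>m X" ?a] X ca(1)
        by (simp add: smult_mat_vec[OF X ca(1)] del: cheb_mat.simps)
      have BC: "B * cheb_mat X (Suc i) \<in> carrier_mat n n" using B C by (meson mult_carrier_mat)
      have rec: "cheb_mat X (Suc (Suc i)) = ((4 * ?i - 2) / (2 * ?i + 1)) \<cdot>\<^sub>m (B * cheb_mat X (Suc i))
          - ((2 * ?i - 3) / (2 * ?i + 1)) \<cdot>\<^sub>m cheb_mat X i"
        using X by (simp add: Let_def B_def)
      show ?thesis
        unfolding rec Ba[symmetric] assoc_mult_mat_vec[OF B C e, symmetric]
          smult_mat_vec[OF BC e, symmetric] smult_mat_vec[OF C e, symmetric]
        by (rule minus_mult_distrib_mat_vec[OF smult_carrier_mat[OF BC] smult_carrier_mat[OF C] e])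
    qed
    have w: "?W (Suc (Suc i)) = ?a - cheb_mat X (Suc (Suc i)) *\<^sub>v ?e"
      unfolding c Wstep[of "Suc i"] IH by (rule cheb_vec_identity[OF ca Xa]) simp
    moreover have "z - ?Z (Suc (Suc i)) = ?a - ?W (Suc (Suc i))"
      unfolding Zstep[of "Suc i"] IH(1)[symmetric] by (rule vec_minus_add[OF z Z W])
    moreover have "cheb_mat X (Suc (Suc i)) *\<^sub>v ?e \<in> carrier_vec n" using C e by (metis mult_mat_vec_carrier)
    then have "?a - (?a - cheb_mat X (Suc (Suc i)) *\<^sub>v ?e) = cheb_mat X (Suc (Suc i)) *\<^sub>v ?e"
      by (rule vec_minus_minus[OF ca(1)])
    ultimately show ?case
      by (simp del: cheb_step.simps cheb_mat.simps)
  qed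
qed

text \<open>The error of the algorithm is propagated by \<open>wcycle_err\<close>.\<close>

lemma wcycle_error:
  assumes "\<And>j. 1 \<le> j \<Longrightarrow> j \<le> k \<Longrightarrow> A j \<in> carrier_mat (n j) (n j)"
    and "\<And>j. 1 \<le> j \<Longrightarrow> j \<le> k \<Longrightarrow> invertible_mat (A j)"
    and "\<And>j. 1 \<le> j \<Longrightarrow> j \<le> k \<Longrightarrow> invertible_mat (diag_part (A j))"
    and "\<And>j. 2 \<le> j \<Longrightarrow> j \<le> k \<Longrightarrow> P j \<in> carrier_mat (n j) (n (j - 1))"
    and "1 \<le> k" and "z \<in> carrier_vec (n k)" and "z0 \<in> carrier_vec (n k)"
  shows "wcycle_err A P \<omega> m k \<in> carrier_mat (n k) (n k) \<and>
    wcycle_err A P \<omega> m k *\<^sub>v (z - z0) = z - wcycle A P \<omega> m k (A k *\<^sub>v z) z0"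
  using assms
proof (induction k arbitrary: z z0 rule: less_induct)
  case (less k)
  show ?case
  proof (cases "k = 1")
    case True
    have A1: "A 1 \<in> carrier_mat (n 1) (n 1)" "invertible_mat (A 1)" using less.prems True by auto
    note M = minv_mult[OF A1]
    have zz: "z \<in> carrier_vec (n 1)" "z0 \<in> carrier_vec (n 1)" using less.prems True by auto
    have "minv (A 1) *\<^sub>v (A 1 *\<^sub>v z) = z"
      using assoc_mult_mat_vec[OF M(1) A1(1) zz(1)] M zz by simp
    then show ?thesis using True A1 zz by (auto intro!: eq_vecI)
  next
    case False
    then obtain l where k: "k = Suc (Suc l)" using less.prems(5) by (metis One_nat_def not0_implies_Suc not_one_le_zero)
    let ?l = "Suc l"
    have lk: "?l < k" "1 \<le> ?l" using k by auto
    have Ak: "A k \<in> carrier_mat (n k) (n k)" "invertible_mat (A k)" "invertible_mat (diag_part (A k))"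
      using less.prems by auto
    have Al: "A ?l \<in> carrier_mat (n ?l) (n ?l)" "invertible_mat (A ?l)" using less.prems k by auto
    have P: "P k \<in> carrier_mat (n k) (n ?l)" using less.prems(4)[of k] k by simp
    have R: "(P k)\<^sup>T \<in> carrier_mat (n ?l) (n k)" using P by simp
    note Mk = minv_mult[OF Ak(1,2)] and Ml = minv_mult[OF Al]
    have "diag_part (A k) \<in> carrier_mat (n k) (n k)" using Ak by (auto simp: diag_part_def)
    note D = minv_mult(1)[OF this Ak(3)]
    define G where "G = cheb_mat (\<omega> k \<cdot>\<^sub>m precond (A k)) m"
    have G: "G \<in> carrier_mat (n k) (n k)"
      unfolding G_def using Ak D by (intro cheb_mat_carrier) (simp add: precond_def)
    define E where "E = wcycle_err A P \<omega> m ?l"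
    have IH0: "z \<in> carrier_vec (n ?l) \<Longrightarrow> z0 \<in> carrier_vec (n ?l) \<Longrightarrow>
        wcycle_err A P \<omega> m ?l \<in> carrier_mat (n ?l) (n ?l) \<and>
        wcycle_err A P \<omega> m ?l *\<^sub>v (z - z0) = z - wcycle A P \<omega> m ?l (A ?l *\<^sub>v z) z0" for z z0
      by (rule less.IH[OF lk(1)]) (use less.prems(1-4) lk in auto)
    have IH: "E \<in> carrier_mat (n ?l) (n ?l)"
      "\<And>z z0. z \<in> carrier_vec (n ?l) \<Longrightarrow> z0 \<in> carrier_vec (n ?l) \<Longrightarrow>
        E *\<^sub>v (z - z0) = z - wcycle A P \<omega> m ?l (A ?l *\<^sub>v z) z0"
      using IH0[OF zero_carrier_vec zero_carrier_vec] IH0 by (simp_all add: E_def)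
    have sm: "y \<in> carrier_vec (n k) \<Longrightarrow> smooth (A k) (\<omega> k) m (A k *\<^sub>v z) y \<in> carrier_vec (n k) \<and>
        z - smooth (A k) (\<omega> k) m (A k *\<^sub>v z) y = G *\<^sub>v (z - y)" for y
      unfolding smooth_def G_def
      using cheb_step_error[OF Ak(1) D less.prems(6), of y] Ak less.prems(6)
        cheb_step_carrier[OF Ak(1) D, of "A k *\<^sub>v z" y] by auto
    define f where "f = A k *\<^sub>v z"
    define zm where "zm = smooth (A k) (\<omega> k) m f z0"
    define d where "d = z - zm"
    have z: "z \<in> carrier_vec (n k)" "z0 \<in> carrier_vec (n k)" using less.prems by auto
    have zm: "zm \<in> carrier_vec (n k)" and d_eq: "d = G *\<^sub>v (z - z0)" using sm[OF z(2)] by (auto simp: zm_def d_def f_def)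
    have d: "d \<in> carrier_vec (n k)" using z zm by (simp add: d_def)
    have Ad: "A k *\<^sub>v d = f - A k *\<^sub>v zm"
      unfolding d_def f_def by (rule mult_minus_distrib_mat_vec[OF Ak(1) z(1) zm])
    have Adc: "A k *\<^sub>v d \<in> carrier_vec (n k)" using Ak d by simp
    define r where "r = (P k)\<^sup>T *\<^sub>v (f - A k *\<^sub>v zm)"
    have r: "r \<in> carrier_vec (n ?l)" unfolding r_def Ad[symmetric] using R Adc by (metis mult_mat_vec_carrier)
    define s where "s = minv (A ?l) *\<^sub>v r"
    have s: "s \<in> carrier_vec (n ?l)" unfolding s_def using Ml(1) r by (metis mult_mat_vec_carrier)
    have As: "A ?l *\<^sub>v s = r"
      unfolding s_def assoc_mult_mat_vec[OF Al(1) Ml(1) r, symmetric] Ml(3) using r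
      by (rule one_mult_mat_vec)
    define e1 where "e1 = wcycle A P \<omega> m ?l r (0\<^sub>v (dim_row (A ?l)))"
    define e2 where "e2 = wcycle A P \<omega> m ?l r e1"
    have Es: "E *\<^sub>v s \<in> carrier_vec (n ?l)" using IH(1) s by (metis mult_mat_vec_carrier)
    have EEs: "E *\<^sub>v (E *\<^sub>v s) \<in> carrier_vec (n ?l)" using IH(1) Es by (metis mult_mat_vec_carrier)
    have 1: "s - e1 = E *\<^sub>v s"
    proof -
      have "dim_row (A ?l) = n ?l" "s - 0\<^sub>v (n ?l) = s" using Al s by auto
      then show ?thesis using IH(2)[OF s zero_carrier_vec] unfolding As e1_def by simp
    qed
    have e1: "e1 \<in> carrier_vec (n ?l)" using vec_carrier_minusD[of s e1] Es 1 by simp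
    have 2: "s - e2 = E *\<^sub>v (E *\<^sub>v s)"
      using IH(2)[OF s e1] unfolding As 1 e2_def by simp
    have e2: "e2 \<in> carrier_vec (n ?l)" using vec_carrier_minusD[of s e2] EEs 2 by simp
    have e2_eq: "e2 = (1\<^sub>m (n ?l) - E * E) *\<^sub>v s"
    proof -
      have "(1\<^sub>m (n ?l) - E * E) *\<^sub>v s = s - (s - e2)"
        unfolding 2 minus_mult_distrib_mat_vec[OF one_carrier_mat mult_carrier_mat[OF IH(1) IH(1)] s]
          assoc_mult_mat_vec[OF IH(1) IH(1) s] using s by simp
      also have "\<dots> = e2" by (rule vec_minus_minus[OF s e2])
      finally show ?thesis ..
    qed
    define Q where "Q = (1\<^sub>m (n ?l) - E * E) * minv (A ?l) * (P k)\<^sup>T"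
    have IE: "1\<^sub>m (n ?l) - E * E \<in> carrier_mat (n ?l) (n ?l)"
      by (rule minus_carrier_mat, rule mult_carrier_mat, rule IH(1), rule IH(1))
    have Q: "Q \<in> carrier_mat (n ?l) (n k)" unfolding Q_def using IE Ml(1) R by (meson mult_carrier_mat)
    have Qd: "Q *\<^sub>v (A k *\<^sub>v d) = e2"
      unfolding Q_def assoc_mult_mat_vec[OF mult_carrier_mat[OF IE Ml(1)] R Adc]
        assoc_mult_mat_vec[OF IE Ml(1) mult_mat_vec_carrier[OF R Adc]]
      unfolding e2_eq s_def r_def Ad ..
    have Pe: "P k *\<^sub>v e2 \<in> carrier_vec (n k)" using P e2 by (metis mult_mat_vec_carrier)
    have err: "wcycle_err A P \<omega> m k = G * (minv (A k) - P k * Q) * A k * G"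
      using Al(1) unfolding k by (simp add: Let_def Q_def E_def G_def k)
    have PQ: "P k * Q \<in> carrier_mat (n k) (n k)" using P Q by (meson mult_carrier_mat)
    have B: "minv (A k) - P k * Q \<in> carrier_mat (n k) (n k)" using PQ by (rule minus_carrier_mat)
    have GB: "G * (minv (A k) - P k * Q) \<in> carrier_mat (n k) (n k)" using G B by (meson mult_carrier_mat)
    have GBA: "G * (minv (A k) - P k * Q) * A k \<in> carrier_mat (n k) (n k)" using GB Ak by (meson mult_carrier_mat)
    have "z - (zm + P k *\<^sub>v e2) = d - P k *\<^sub>v e2" unfolding d_def by (rule vec_minus_add[OF z(1) zm Pe])
    moreover have "(minv (A k) - P k * Q) *\<^sub>v (A k *\<^sub>v d) = d - P k *\<^sub>v e2"
    proof -
      have "minv (A k) *\<^sub>v (A k *\<^sub>v d) = d"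
        unfolding assoc_mult_mat_vec[OF Mk(1) Ak(1) d, symmetric] Mk(2) using d
        by (rule one_mult_mat_vec)
      then show ?thesis
        using minus_mult_distrib_mat_vec[OF Mk(1) PQ Adc] assoc_mult_mat_vec[OF P Q Adc] Qd by simp
    qed
    moreover have "wcycle_err A P \<omega> m k *\<^sub>v (z - z0) = G *\<^sub>v ((minv (A k) - P k * Q) *\<^sub>v (A k *\<^sub>v d))"
    proof -
      have e: "z - z0 \<in> carrier_vec (n k)" using z by simp
      show ?thesis unfolding err
        using assoc_mult_mat_vec[OF GBA G e] assoc_mult_mat_vec[OF GB Ak(1) d] assoc_mult_mat_vec[OF G B Adc]
        by (simp add: d_eq)
    qed
    moreover have "wcycle A P \<omega> m k f z0 = smooth (A k) (\<omega> k) m f (zm + P k *\<^sub>v e2)"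
      unfolding k by (simp add: Let_def zm_def e1_def e2_def r_def k)
    moreover have "z - smooth (A k) (\<omega> k) m f (zm + P k *\<^sub>v e2) = G *\<^sub>v (z - (zm + P k *\<^sub>v e2))"
      using sm[of "zm + P k *\<^sub>v e2"] zm Pe by (simp add: f_def)
    ultimately have "wcycle_err A P \<omega> m k *\<^sub>v (z - z0) = z - wcycle A P \<omega> m k f z0" by simp
    moreover have "wcycle_err A P \<omega> m k \<in> carrier_mat (n k) (n k)"
      unfolding err using GBA G by (meson mult_carrier_mat)
    ultimately show ?thesis by (simp add: f_def)
  qed
qed

end

theory Submission imports Defs begin

text \<open>In the tensor Legendre basis the bilinear form is \<open>h\<^sup>d\<^sup>-\<^sup>2\<close> times a Kronecker sum of one-dimensional
  forms \<open>a\<close> and diagonal mass forms \<open>m\<close> that do not depend on \<open>h\<close>. Testing coercivity with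
  products \<open>x \<otimes> 1 \<otimes> \<dots> \<otimes> 1\<close> shows that \<open>a\<close> is coercive as soon as the number of cells
  times \<open>k\<close> is large in each direction; on the remaining coarse meshes a Poincare inequality replaces
  duality. Subtracting from each Legendre mode of degree \<open>k\<close> the one of degree \<open>k - 2\<close> removes the
  highest modes without changing traces. This and a bound of the jumps by the residual give the approximation property
  \<open>\<bar>r \<bullet> A\<^sub>k\<^sup>-\<^sup>1 r - r \<bullet> P A\<^sub>k\<^sub>-\<^sub>1\<^sup>-\<^sup>1 P\<^sup>T r\<bar> \<le> C k\<^sup>2 \<omega>\<^sub>k r \<bullet> D\<^sub>k\<^sup>-\<^sup>1 r\<close>,
  without elliptic regularity. The fourth-kind Chebyshev polynomials satisfy \<open>x (2 m + 1)\<^sup>2 P\<^sub>m(x)\<^sup>2 \<le> 1\<close> on \<open>[0, 1]\<close>,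
  so the two-grid rate is \<open>O(k\<^sup>2 / m\<^sup>2)\<close>, and \<open>\<delta>\<^sub>k \<le> \<eta> + S \<delta>\<^sub>k\<^sub>-\<^sub>1\<^sup>2\<close> yields \<open>\<delta>\<^sub>k \<le> 2 \<eta>\<close> for small \<open>\<eta>\<close>.\<close>

section \<open>Legendre polynomials\<close>

text \<open>The hypothesis gives coercivity in d dimensions only. In a product with constants, the
  penalty of the constant factors adds a positive mass term, so a one-dimensional factor may itself
  fail to be positive on few cells, although every tensor comparison needs positive factors. This
  forces the split into fine and coarse meshes. Regularity is replaced by algebra: the mass form M
  is diagonal, so the squared residual v A M^-1 A v is a sum of tensor products in which two
  directions carry a, or one carries a M^-1 a. All are positive semidefinite, so each is bounded by
  the sum. The penalty grows with the level, so A_k exceeds A_(k-1) on the coarse space and the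
  coarse correction may overshoot: A_k^-1 - P A_(k-1)^-1 P^T need not be semidefinite, its lower
  bound is paid by jumps, and the two-grid estimate has to polarise. The error is of order k^-2
  against M^-1. Since diag A_k is at most of order k^3 M, it is of order k against D_k^-1, and the
  lower bound c / (k + 1) on \<omega> makes k at most of order k^2 \<omega>.\<close>

definition pint :: "real poly \<Rightarrow> real" where
  "pint p = integral {-1..1} (poly p)"

lemma pint_integrable [simp]: "(poly p :: real \<Rightarrow> real) integrable_on {u..v}"
  by (intro integrable_continuous_interval continuous_intros)

lemma pint_pderiv: "pint (pderiv p) = poly p 1 - poly p (-1)"
proof -
  have "((\<lambda>x. poly (pderiv p) x) has_integral (poly p 1 - poly p (-1))) {-1..1}"
    by (rule fundamental_theorem_of_calculus)
      (auto intro!: poly_DERIV has_field_derivative_at_within simp flip: has_real_derivative_iff_has_vector_derivative)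
  then show ?thesis unfolding pint_def by (rule integral_unique)
qed

lemma pint_add: "pint (p + q) = pint p + pint q"
proof -
  have "poly (p + q) = (\<lambda>x. poly p x + poly q x)" by auto
  then show ?thesis by (simp only: pint_def Henstock_Kurzweil_Integration.integral_add pint_integrable)
qed

lemma pint_smult: "pint (Polynomial.smult c p) = c * pint p"
proof -
  have "poly (Polynomial.smult c p) = (\<lambda>x. c * poly p x)" by auto
  then show ?thesis by (simp only: pint_def integral_mult_right)
qed

lemma pint_minus: "pint (- p) = - pint p"
  using pint_smult[of "-1" p] by simp

lemma pint_diff: "pint (p - q) = pint p - pint q"
  using pint_add[of p "- q"] by (simp add: pint_minus)

lemma pint_0 [simp]: "pint 0 = 0"
  using pint_smult[of 0 0] by simp

lemma pint_1 [simp]: "pint 1 = 2"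
  using pint_pderiv[of "[:0, 1:]"] by (simp add: pderiv_pCons one_pCons)

lemma pint_sum: "pint (\<Sum>i\<in>A. f i) = (\<Sum>i\<in>A. pint (f i))"
  by (induction A rule: infinite_finite_induct) (auto simp: pint_add)

lemma pint_nonneg: "(\<And>x. 0 \<le> poly p x) \<Longrightarrow> 0 \<le> pint p"
  unfolding pint_def by (intro Henstock_Kurzweil_Integration.integral_nonneg) auto

lemma pint_sq_nonneg [simp]: "0 \<le> pint (p * p)"
  by (intro pint_nonneg) simp

lemma pint_by_parts: "pint (pderiv p * q) = poly (p * q) 1 - poly (p * q) (-1) - pint (p * pderiv q)"
  unfolding pint_pderiv[symmetric] pderiv_mult by (simp add: pint_add mult.commute)

text \<open>For \<open>A > 0\<close> the direction s = - B, t = A is tested; the value there is A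
  times the discriminant A C - B^2. For A = 0 the form is affine in s, so B must vanish.\<close>

lemma CS_of_nonneg:
  fixes A B C :: real
  assumes *: "\<And>s t. 0 \<le> A * s\<^sup>2 + 2 * B * s * t + C * t\<^sup>2"
  shows "B\<^sup>2 \<le> A * C"
proof (cases "A = 0")
  case True
  show ?thesis
  proof (cases "B = 0")
    case False
    have "0 \<le> 2 * B * (- (C + 1) / (2 * B)) * 1 + C * 1"
      using *[of "- (C + 1) / (2 * B)" 1] True by simp
    with False show ?thesis by simp
  qed (use True in simp)
next
  case False
  moreover have "0 \<le> A" using *[of 1 0] by simp
  ultimately have "A > 0" by simp
  have "0 \<le> A * (- B)\<^sup>2 + 2 * B * (-B) * A + C * A\<^sup>2" using *[of "-B" A] by simp
  then have "0 \<le> A * (A * C - B\<^sup>2)" by (simp add: power2_eq_square algebra_simps)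
  with \<open>A > 0\<close> show ?thesis by (simp add: zero_le_mult_iff)
qed

lemma pint_Cauchy_Schwarz: "(pint (p * q))\<^sup>2 \<le> pint (p * p) * pint (q * q)"
proof -
  define A B C where "A = pint (p * p)" and "B = pint (p * q)" and "C = pint (q * q)"
  have *: "0 \<le> A * s\<^sup>2 + 2 * B * s * t + C * t\<^sup>2" for s t
  proof -
    define r where "r = Polynomial.smult s p + Polynomial.smult t q"
    have "0 \<le> pint (r * r)" by simp
    also have "pint (r * r) = A * s\<^sup>2 + 2 * B * s * t + C * t\<^sup>2"
      unfolding r_def A_def B_def C_def
      by (simp add: distrib_left distrib_right pint_add pint_smult power2_eq_square mult.commute[of q p])
    finally show ?thesis .
  qed
  then have "B\<^sup>2 \<le> A * C" by (rule CS_of_nonneg)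
  then show ?thesis by (simp add: A_def B_def C_def)
qed

section \<open>Differential identities, orthogonality and expansion\<close>

lemma degree_legendre_le: "degree (legendre n) \<le> n"
proof (induction n rule: legendre.induct)
  case (3 n)
  have "degree ([:0, 1:] * legendre (Suc n)) \<le> Suc (Suc n)"
    using degree_mult_le[of "[:0, 1:]" "legendre (Suc n)"] 3 by simp
  then show ?case using 3
    by (auto intro!: degree_diff_le order.trans[OF degree_smult_le] simp del: mult_pCons_left)
qed auto

lemma legendre_coeff_pos: "coeff (legendre n) n > 0"
proof (induction n rule: legendre.induct)
  case (3 n)
  have "coeff (legendre n) (Suc (Suc n)) = 0"
    by (rule coeff_eq_0) (use degree_legendre_le[of n] in simp)
  then show ?case using 3(1) by (simp add: coeff_pCons)
qed auto

lemma poly_legendre_minus_1: "poly (legendre n) (-1) = (-1) ^ n"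
  by (induction n rule: legendre.induct) (auto simp: field_simps)

lemma smult_cancel_left: "Polynomial.smult c p = Polynomial.smult c q \<Longrightarrow> c \<noteq> 0 \<Longrightarrow> p = q" for c :: real
  by (metis left_inverse smult_1_left smult_smult)

text \<open>The two identities need each other: differentiating the three-term recurrence brings in
  both x P' for the current index and P' for the previous one, and each is eliminated by one
  identity at the previous index.\<close>

lemma legendre_deriv_aux:
  "pderiv (legendre (Suc n)) = Polynomial.smult (real n + 1) (legendre n) + [:0, 1:] * pderiv (legendre n) \<and>
   [:0, 1:] * pderiv (legendre (Suc n)) - pderiv (legendre n) = Polynomial.smult (real n + 1) (legendre (Suc n))"
proof (induction n rule: nat_less_induct)
  case (1 n)
  consider "n = 0" | m where "n = Suc m" by (cases n) auto
  then show ?case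
  proof cases
    case 1
    then show ?thesis by (simp add: pderiv_pCons)
  next
    case 2
    have IH: "pderiv (legendre (Suc m)) = Polynomial.smult (real m + 1) (legendre m) + [:0, 1:] * pderiv (legendre m)"
      "[:0, 1:] * pderiv (legendre (Suc m)) - pderiv (legendre m) = Polynomial.smult (real m + 1) (legendre (Suc m))"
      using 1 2 by blast+
    define p q where "p = legendre (Suc m)" and "q = legendre m"
    define X :: "real poly" where "X = [:0, 1:]"
    define r :: real where "r = real m + 1"
    have r: "r > 0" by (simp add: r_def)
    have L: "Polynomial.smult (r + 1) (legendre (Suc (Suc m))) = Polynomial.smult (2 * r + 1) (X * p) - Polynomial.smult r q"
    proof -
      have "(r + 1) * (1 / real (m + 2)) = 1" "real (2 * m + 3) = 2 * r + 1" "real (m + 1) = r" by (auto simp: r_def field_simps)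
      then show ?thesis unfolding legendre.simps(3) smult_smult p_def q_def X_def by (simp only: smult_1_left)
    qed
    have IH1: "X * pderiv q = pderiv p - Polynomial.smult r q" using IH(1) by (simp add: p_def q_def X_def r_def)
    have IH2: "X * pderiv p = pderiv q + Polynomial.smult r p" using IH(2)
      unfolding p_def[symmetric] q_def[symmetric] X_def[symmetric] r_def[symmetric] by (simp add: algebra_simps)
    have dX: "pderiv X = 1" by (simp add: X_def pderiv_pCons)
    have "Polynomial.smult (r + 1) (pderiv (legendre (Suc (Suc m)))) = pderiv (Polynomial.smult (2 * r + 1) (X * p) - Polynomial.smult r q)"
      unfolding L[symmetric] by (simp add: pderiv_smult)
    also have "\<dots> = Polynomial.smult (2 * r + 1) (p + X * pderiv p) - Polynomial.smult r (pderiv q)"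
      by (simp add: pderiv_diff pderiv_smult pderiv_mult dX add.commute)
    also have "\<dots> = Polynomial.smult (r + 1) (Polynomial.smult (r + 1) p + X * pderiv p)"
    proof (rule poly_eqI)
      fix i
      have "coeff (X * pderiv p) i = coeff (pderiv q) i + r * coeff p i" unfolding IH2 by simp
      then show "coeff (Polynomial.smult (2 * r + 1) (p + X * pderiv p) - Polynomial.smult r (pderiv q)) i
         = coeff (Polynomial.smult (r + 1) (Polynomial.smult (r + 1) p + X * pderiv p)) i"
        by (simp add: algebra_simps)
    qed
    finally have a: "pderiv (legendre (Suc (Suc m))) = Polynomial.smult (r + 1) p + X * pderiv p"
      by (rule smult_cancel_left) (use r in simp)
    have "Polynomial.smult (r + 1) (X * pderiv (legendre (Suc (Suc m))) - pderiv p)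
        = Polynomial.smult (r + 1) (Polynomial.smult (r + 1) (legendre (Suc (Suc m))))"
    proof (rule poly_eqI)
      fix i
      have e1: "X * pderiv (legendre (Suc (Suc m))) = Polynomial.smult (r + 1) (X * p) + X * (X * pderiv p)"
        unfolding a by (simp add: algebra_simps)
      have "X * (X * pderiv p) = X * pderiv q + Polynomial.smult r (X * p)" unfolding IH2 by (simp add: algebra_simps)
      then have e2: "X * (X * pderiv p) = pderiv p - Polynomial.smult r q + Polynomial.smult r (X * p)"
        unfolding IH1 .
      show "coeff (Polynomial.smult (r + 1) (X * pderiv (legendre (Suc (Suc m))) - pderiv p)) i
        = coeff (Polynomial.smult (r + 1) (Polynomial.smult (r + 1) (legendre (Suc (Suc m))))) i"
        unfolding e1 e2 L by (simp add: algebra_simps)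
    qed
    then have b: "X * pderiv (legendre (Suc (Suc m))) - pderiv p = Polynomial.smult (r + 1) (legendre (Suc (Suc m)))"
      by (rule smult_cancel_left) (use r in simp)
    show ?thesis using a b unfolding 2 p_def X_def r_def by (simp add: add.commute)
  qed
qed

text \<open>The difference is a primitive of a multiple of \<open>legendre (Suc n)\<close> that
  vanishes at both endpoints. Orthogonality, norms, decay of coefficients and the bubbles of the cut
  all rest on this primitive.\<close>

lemma pderiv_legendre_diff:
  "pderiv (legendre (Suc (Suc n)) - legendre n) = Polynomial.smult (2 * real n + 3) (legendre (Suc n))"
proof (rule poly_eqI)
  fix i
  let ?X = "[:0, 1:] :: real poly"
  have "pderiv (legendre (Suc (Suc n))) = Polynomial.smult (real (Suc n) + 1) (legendre (Suc n)) + ?X * pderiv (legendre (Suc n))"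
    "?X * pderiv (legendre (Suc n)) - pderiv (legendre n) = Polynomial.smult (real n + 1) (legendre (Suc n))"
    using legendre_deriv_aux[of "Suc n"] legendre_deriv_aux[of n] by blast+
  from arg_cong[OF this(1), of "\<lambda>p. coeff p i"] arg_cong[OF this(2), of "\<lambda>p. coeff p i"]
  show "coeff (pderiv (legendre (Suc (Suc n)) - legendre n)) i = coeff (Polynomial.smult (2 * real n + 3) (legendre (Suc n))) i"
    by (simp add: pderiv_diff algebra_simps)
qed

text \<open>By parts with the primitive of \<open>pderiv_legendre_diff\<close>: there are no
  boundary terms, the derivative falls on \<open>p\<close>, and its degree drops while both Legendre
  indices stay above it.\<close>

lemma legendre_orthogonal_poly: "degree p < n \<Longrightarrow> pint (legendre n * p) = 0"
proof (induction "degree p" arbitrary: p n rule: less_induct)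
  case less
  then obtain m where n: "n = Suc m" by (cases n) auto
  consider "m = 0" | l where "m = Suc l" by (cases m) auto
  then show ?case
  proof cases
    case 1
    with less n have "degree p = 0" by simp
    then obtain c where "p = [:c:]" by (metis degree_eq_zeroE)
    moreover have "pint [:0, 1:] = 0"
      using pint_pderiv[of "[:0, 0, 1/2:]"] by (simp add: pderiv_pCons)
    ultimately show ?thesis using pint_smult[of c "[:0, 1:]"] by (simp add: 1 n)
  next
    case 2
    define D where "D = legendre (Suc (Suc (Suc l))) - legendre (Suc l)"
    have "(2 * real (Suc l) + 3) * pint (legendre n * p) = pint (pderiv D * p)"
      unfolding D_def pderiv_legendre_diff n 2 by (simp add: pint_smult)
    also have "\<dots> = - pint (D * pderiv p)"
      unfolding pint_by_parts by (simp add: D_def poly_legendre_1 poly_legendre_minus_1 del: legendre.simps)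
    also have "\<dots> = - (pint (legendre (Suc (Suc (Suc l))) * pderiv p) - pint (legendre (Suc l) * pderiv p))"
      by (simp add: D_def pint_diff algebra_simps del: legendre.simps)
    also have "\<dots> = 0"
    proof (cases "degree p = 0")
      case True
      then have "pderiv p = 0" by (simp add: pderiv_eq_0_iff)
      then show ?thesis by simp
    next
      case False
      then have "degree (pderiv p) < degree p" "degree (pderiv p) < Suc l"
        using less.prems by (auto simp: degree_pderiv n 2)
      then show ?thesis using less.hyps[of "pderiv p" "Suc l"] less.hyps[of "pderiv p" "Suc (Suc (Suc l))"] by simp
    qed
    finally show ?thesis by (metis mult_eq_0_iff of_nat_0_le_iff add_nonneg_pos zero_less_numeral less_irrefl mult_nonneg_nonneg zero_le_numeral)
  qed
qed

lemma degree_pderiv_legendre_less: "n > 0 \<Longrightarrow> degree (pderiv (legendre n)) < n"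
  using degree_legendre_le[of n] by (simp add: degree_pderiv)

text \<open>The same primitive shows that (2 n + 1) times the squared norm does not change from n to
  n + 1, once n is positive. The value 2 is computed by hand for the first two indices.\<close>

lemma legendre_norm: "pint (legendre n * legendre n) = 2 / (2 * real n + 1)"
proof (induction n)
  case (Suc n)
  show ?case
  proof (cases n)
    case 0
    have "pint ([:0, 1:] * [:0, 1:]) = 2 / 3"
      using pint_pderiv[of "[:0, 0, 0, 1/3:]"] by (simp add: pderiv_pCons)
    then show ?thesis by (simp add: 0)
  next
    case (Suc m)
    define D where "D = legendre (Suc (Suc (Suc m))) - legendre (Suc m)"
    have "(2 * real (Suc m) + 3) * pint (legendre (Suc n) * legendre (Suc n)) = pint (pderiv D * legendre (Suc n))"
      unfolding D_def pderiv_legendre_diff Suc by (simp add: pint_smult del: legendre.simps)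
    also have "\<dots> = - pint (D * pderiv (legendre (Suc n)))"
      unfolding pint_by_parts by (simp add: D_def poly_legendre_1 poly_legendre_minus_1 del: legendre.simps)
    also have "\<dots> = pint (legendre (Suc m) * pderiv (legendre (Suc n)))
        - pint (legendre (Suc (Suc (Suc m))) * pderiv (legendre (Suc n)))"
      by (simp add: D_def pint_diff algebra_simps del: legendre.simps)
    also have "pint (legendre (Suc (Suc (Suc m))) * pderiv (legendre (Suc n))) = 0"
      using degree_pderiv_legendre_less[of "Suc n"] Suc by (intro legendre_orthogonal_poly) simp
    also have "pderiv (legendre (Suc n)) = Polynomial.smult (2 * real m + 3) (legendre (Suc m)) + pderiv (legendre m)"
      unfolding Suc pderiv_legendre_diff[symmetric] by (simp add: pderiv_diff del: legendre.simps)
    also have "pint (legendre (Suc m) * (Polynomial.smult (2 * real m + 3) (legendre (Suc m)) + pderiv (legendre m)))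
       = (2 * real m + 3) * pint (legendre (Suc m) * legendre (Suc m)) + pint (legendre (Suc m) * pderiv (legendre m))"
      by (simp add: distrib_left pint_add pint_smult del: legendre.simps)
    also have "pint (legendre (Suc m) * pderiv (legendre m)) = 0"
      by (intro legendre_orthogonal_poly) (use degree_legendre_le[of m] in \<open>simp add: degree_pderiv del: legendre.simps\<close>)
    also have "(2 * real m + 3) * pint (legendre (Suc m) * legendre (Suc m)) = 2"
      using Suc.IH unfolding Suc by (simp add: field_simps del: legendre.simps)
    finally show ?thesis unfolding Suc by (simp add: field_simps del: legendre.simps)
  qed
qed simp

lemma legendre_orthogonal: "pint (legendre m * legendre n) = (if m = n then 2 / (2 * real n + 1) else 0)"
proof -
  consider "m = n" | "m < n" | "n < m" by linarith
  then show ?thesis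
  proof cases
    case 2
    then show ?thesis using legendre_orthogonal_poly[of "legendre m" n] degree_legendre_le[of m]
      by (simp add: mult.commute)
  next
    case 3
    then show ?thesis using legendre_orthogonal_poly[of "legendre n" m] degree_legendre_le[of n] by simp
  qed (simp add: legendre_norm)
qed

lemma legendre_expansion_exists:
  assumes "degree p \<le> k"
  obtains c where "p = (\<Sum>n\<le>k. Polynomial.smult (c n) (legendre n))"
  using assms
proof (induction k arbitrary: p thesis)
  case 0
  then obtain a where "p = [:a:]" by (metis degree_eq_zeroE le_zero_eq)
  then show ?case using 0(1)[of "\<lambda>_. a"] by simp
next
  case (Suc k)
  define l where "l = coeff (legendre (Suc k)) (Suc k)"
  define b where "b = coeff p (Suc k) / l"
  define r where "r = p - Polynomial.smult b (legendre (Suc k))"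
  have l: "l \<noteq> 0" using legendre_coeff_pos[of "Suc k"] by (simp add: l_def)
  have "coeff r i = 0" if "i > k" for i
  proof (cases "i = Suc k")
    case True
    then show ?thesis using l by (simp add: r_def b_def l_def)
  next
    case False
    then have "coeff p i = 0" "coeff (legendre (Suc k)) i = 0"
      using that Suc.prems(2) degree_legendre_le[of "Suc k"] by (auto intro!: coeff_eq_0)
    then show ?thesis by (simp add: r_def)
  qed
  then have "degree r \<le> k" by (intro degree_le) auto
  then obtain c where c: "r = (\<Sum>n\<le>k. Polynomial.smult (c n) (legendre n))" using Suc.IH by blast
  have "p = r + Polynomial.smult b (legendre (Suc k))" by (simp add: r_def)
  also have "\<dots> = (\<Sum>n\<le>Suc k. Polynomial.smult ((c(Suc k := b)) n) (legendre n))"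
    unfolding c by (simp del: legendre.simps)
  finally show ?case using Suc.prems(1) by blast
qed

definition lcoef :: "real poly \<Rightarrow> nat \<Rightarrow> real" where
  "lcoef p n = (2 * real n + 1) / 2 * pint (p * legendre n)"

lemma lcoef_sum: "lcoef (\<Sum>n\<le>k. Polynomial.smult (c n) (legendre n)) m = (if m \<le> k then c m else 0)"
proof -
  have "pint ((\<Sum>n\<le>k. Polynomial.smult (c n) (legendre n)) * legendre m)
      = (\<Sum>n\<le>k. c n * (if n = m then 2 / (2 * real m + 1) else 0))"
    by (simp add: sum_distrib_right pint_sum pint_smult legendre_orthogonal)
  also have "\<dots> = (if m \<le> k then c m * (2 / (2 * real m + 1)) else 0)"
    by (simp add: if_distrib cong: if_cong)
  finally show ?thesis by (simp add: lcoef_def)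
qed

lemma legendre_expansion: "degree p \<le> k \<Longrightarrow> p = (\<Sum>n\<le>k. Polynomial.smult (lcoef p n) (legendre n))"
proof -
  assume "degree p \<le> k"
  then obtain c where c: "p = (\<Sum>n\<le>k. Polynomial.smult (c n) (legendre n))" by (rule legendre_expansion_exists)
  have "lcoef p n = c n" if "n \<le> k" for n unfolding c lcoef_sum using that by simp
  then show ?thesis by (subst (1) c) (intro sum.cong, auto)
qed

section \<open>One-dimensional forms\<close>

text \<open>A broken polynomial on \<open>N\<close> cells of length 1 is a family \<open>x\<close> whose member \<open>x q\<close> is the
  restriction to cell \<open>q\<close> pulled back to \<open>{-1..1}\<close>; this is where the factors 2 come from.
  Node \<open>j\<close> lies between the cells \<open>j - 1\<close> and \<open>j\<close>. The sign of \<open>jmp\<close> at node 0 is that of the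
  outward normal there, which \<open>avg\<close> omits.\<close>

definition jmp :: "nat \<Rightarrow> nat \<Rightarrow> (nat \<Rightarrow> real poly) \<Rightarrow> real" where
  "jmp N j x = (if 0 < j then poly (x (j - 1)) 1 else 0) - (if j < N then poly (x j) (-1) else 0)"

definition avg :: "nat \<Rightarrow> nat \<Rightarrow> (nat \<Rightarrow> real poly) \<Rightarrow> real" where
  "avg N j g = (if 0 < j \<and> j < N then (poly (g (j - 1)) 1 + poly (g j) (-1)) / 2
     else if j = 0 then poly (g 0) (-1) else poly (g (j - 1)) 1)"

definition mass :: "nat \<Rightarrow> (nat \<Rightarrow> real poly) \<Rightarrow> (nat \<Rightarrow> real poly) \<Rightarrow> real" where
  "mass N x y = (\<Sum>q<N. pint (x q * y q)) / 2"

definition dir :: "nat \<Rightarrow> (nat \<Rightarrow> real poly) \<Rightarrow> (nat \<Rightarrow> real poly) \<Rightarrow> real" where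
  "dir N x y = 2 * (\<Sum>q<N. pint (pderiv (x q) * pderiv (y q)))"

definition flux :: "nat \<Rightarrow> (nat \<Rightarrow> real poly) \<Rightarrow> (nat \<Rightarrow> real poly) \<Rightarrow> real" where
  "flux N x y = 2 * (\<Sum>j\<le>N. avg N j (\<lambda>q. pderiv (x q)) * jmp N j y)"

definition jmps :: "nat \<Rightarrow> (nat \<Rightarrow> real poly) \<Rightarrow> (nat \<Rightarrow> real poly) \<Rightarrow> real" where
  "jmps N x y = (\<Sum>j\<le>N. jmp N j x * jmp N j y)"

text \<open>The symmetric interior penalty form on \<open>N\<close> unit cells. The argument
  \<open>k\<close> enters through the penalty alone and is independent of the degrees of
  \<open>x\<close> and \<open>y\<close>, so the form of level \<open>k\<close> can be evaluated on
  functions of degree \<open>k - 1\<close>, where it differs from the form of that level.\<close>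

definition ip :: "nat \<Rightarrow> real \<Rightarrow> nat \<Rightarrow> (nat \<Rightarrow> real poly) \<Rightarrow> (nat \<Rightarrow> real poly) \<Rightarrow> real" where
  "ip N \<alpha> k x y = dir N x y - flux N x y - flux N y x + \<alpha> * (real k)\<^sup>2 * jmps N x y"

text \<open>The bilinear form behind the square of \<open>dg_norm\<close> in one dimension for h =
  1.\<close>

definition en :: "nat \<Rightarrow> nat \<Rightarrow> (nat \<Rightarrow> real poly) \<Rightarrow> (nat \<Rightarrow> real poly) \<Rightarrow> real" where
  "en N k x y = dir N x y + (real k)\<^sup>2 * jmps N x y"

text \<open>Members with \<open>q \<ge> N\<close> are arbitrary; this is why the forms come with
  congruence lemmas restricted to \<open>q < N\<close>.\<close>

definition bpoly :: "nat \<Rightarrow> nat \<Rightarrow> (nat \<Rightarrow> real poly) set" where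
  "bpoly N k = {x. \<forall>q<N. degree (x q) \<le> k}"

section \<open>Linearity, symmetry and locality of the one-dimensional forms\<close>

lemma jmp_sum: "jmp N j (\<lambda>q. \<Sum>s\<in>S. Polynomial.smult (c s) (b s q)) = (\<Sum>s\<in>S. c s * jmp N j (b s))"
  by (simp add: jmp_def poly_sum sum_subtractf right_diff_distrib)

lemma avg_sum: "avg N j (\<lambda>q. \<Sum>s\<in>S. Polynomial.smult (c s) (b s q)) = (\<Sum>s\<in>S. c s * avg N j (b s))"
  by (simp add: avg_def poly_sum sum.distrib sum_divide_distrib add_divide_distrib distrib_left)

lemma pderiv_sum_smult: "pderiv (\<Sum>s\<in>S. Polynomial.smult (c s) (p s)) = (\<Sum>s\<in>S. Polynomial.smult (c s) (pderiv (p s)))"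
  by (induction S rule: infinite_finite_induct) (auto simp: pderiv_add pderiv_smult)

lemma mass_sum_left: "mass N (\<lambda>q. \<Sum>s\<in>S. Polynomial.smult (c s) (b s q)) y = (\<Sum>s\<in>S. c s * mass N (b s) y)"
  unfolding mass_def
  by (simp add: sum_distrib_right pint_sum pint_smult sum_distrib_left sum_divide_distrib)
    (rule sum.swap)

lemma dir_sum_left: "dir N (\<lambda>q. \<Sum>s\<in>S. Polynomial.smult (c s) (b s q)) y = (\<Sum>s\<in>S. c s * dir N (b s) y)"
  unfolding dir_def pderiv_sum_smult
  by (simp add: sum_distrib_right pint_sum pint_smult sum_distrib_left mult_ac)
    (rule sum.swap)

lemma flux_sum_left: "flux N (\<lambda>q. \<Sum>s\<in>S. Polynomial.smult (c s) (b s q)) y = (\<Sum>s\<in>S. c s * flux N (b s) y)"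
  unfolding flux_def pderiv_sum_smult avg_sum
  by (simp add: sum_distrib_right sum_distrib_left mult_ac) (rule sum.swap)

lemma flux_sum_right: "flux N y (\<lambda>q. \<Sum>s\<in>S. Polynomial.smult (c s) (b s q)) = (\<Sum>s\<in>S. c s * flux N y (b s))"
  unfolding flux_def jmp_sum
  by (simp add: sum_distrib_right sum_distrib_left mult_ac) (rule sum.swap)

lemma jmps_sum_left: "jmps N (\<lambda>q. \<Sum>s\<in>S. Polynomial.smult (c s) (b s q)) y = (\<Sum>s\<in>S. c s * jmps N (b s) y)"
  unfolding jmps_def jmp_sum
  by (simp add: sum_distrib_right sum_distrib_left mult_ac) (rule sum.swap)

lemma ip_sum_left: "ip N \<alpha> k (\<lambda>q. \<Sum>s\<in>S. Polynomial.smult (c s) (b s q)) y = (\<Sum>s\<in>S. c s * ip N \<alpha> k (b s) y)"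
  unfolding ip_def dir_sum_left flux_sum_left flux_sum_right jmps_sum_left
  by (simp add: sum_distrib_left algebra_simps sum.distrib sum_subtractf)

lemma en_sum_left: "en N k (\<lambda>q. \<Sum>s\<in>S. Polynomial.smult (c s) (b s q)) y = (\<Sum>s\<in>S. c s * en N k (b s) y)"
  unfolding en_def dir_sum_left jmps_sum_left
  by (simp add: sum_distrib_left algebra_simps sum.distrib)

lemma mass_sym: "mass N x y = mass N y x" by (simp add: mass_def mult.commute)
lemma dir_sym: "dir N x y = dir N y x" by (simp add: dir_def mult.commute)
lemma jmps_sym: "jmps N x y = jmps N y x" by (simp add: jmps_def mult.commute)
lemma ip_sym: "ip N \<alpha> k x y = ip N \<alpha> k y x" by (simp add: ip_def dir_sym[of N x] jmps_sym[of N x])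
lemma en_sym: "en N k x y = en N k y x" by (simp add: en_def dir_sym[of N x] jmps_sym[of N x])

lemma jmp_cong: "(\<And>q. q < N \<Longrightarrow> x q = y q) \<Longrightarrow> j \<le> N \<Longrightarrow> jmp N j x = jmp N j y"
  by (auto simp: jmp_def)

text \<open>For \<open>N = 0\<close> the node 0 would read the missing cell 0, hence the assumption
  on \<open>N\<close> here and in all statements involving \<open>flux\<close>.\<close>

lemma avg_cong: "(\<And>q. q < N \<Longrightarrow> x q = y q) \<Longrightarrow> j \<le> N \<Longrightarrow> 0 < N \<Longrightarrow> avg N j x = avg N j y"
  by (auto simp: avg_def)

lemma mass_cong: "(\<And>q. q < N \<Longrightarrow> x q = y q) \<Longrightarrow> (\<And>q. q < N \<Longrightarrow> x' q = y' q) \<Longrightarrow> mass N x x' = mass N y y'"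
  by (auto simp: mass_def)

lemma dir_cong: "(\<And>q. q < N \<Longrightarrow> x q = y q) \<Longrightarrow> (\<And>q. q < N \<Longrightarrow> x' q = y' q) \<Longrightarrow> dir N x x' = dir N y y'"
  by (auto simp: dir_def)

lemma flux_cong: "(\<And>q. q < N \<Longrightarrow> x q = y q) \<Longrightarrow> (\<And>q. q < N \<Longrightarrow> x' q = y' q) \<Longrightarrow> 0 < N \<Longrightarrow> flux N x x' = flux N y y'"
  unfolding flux_def
  by (intro arg_cong[of _ _ "\<lambda>t. 2 * t"] sum.cong refl arg_cong2[of _ _ _ _ "(*)"] avg_cong jmp_cong) auto

lemma jmps_cong: "(\<And>q. q < N \<Longrightarrow> x q = y q) \<Longrightarrow> (\<And>q. q < N \<Longrightarrow> x' q = y' q) \<Longrightarrow> jmps N x x' = jmps N y y'"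
  unfolding jmps_def
  by (intro sum.cong refl arg_cong2[of _ _ _ _ "(*)"] jmp_cong) auto

lemma ip_cong: "(\<And>q. q < N \<Longrightarrow> x q = y q) \<Longrightarrow> (\<And>q. q < N \<Longrightarrow> x' q = y' q) \<Longrightarrow> 0 < N \<Longrightarrow> ip N \<alpha> k x x' = ip N \<alpha> k y y'"
  unfolding ip_def
  using dir_cong[of N x y x' y'] flux_cong[of N x y x' y'] flux_cong[of N x' y' x y] jmps_cong[of N x y x' y'] by simp

lemma jmp_diff: "jmp N j (\<lambda>q. x q - y q) = jmp N j x - jmp N j y"
  by (simp add: jmp_def)

lemma avg_diff: "avg N j (\<lambda>q. x q - y q) = avg N j x - avg N j y"
  by (simp add: avg_def field_simps)

lemma mass_diff_left: "mass N (\<lambda>q. x q - z q) y = mass N x y - mass N z y"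
  by (simp add: mass_def left_diff_distrib pint_diff sum_subtractf diff_divide_distrib)

lemma ip_diff_left: "ip N \<alpha> k (\<lambda>q. x q - z q) y = ip N \<alpha> k x y - ip N \<alpha> k z y"
proof -
  have "dir N (\<lambda>q. x q - z q) y = dir N x y - dir N z y"
    by (simp add: dir_def pderiv_diff left_diff_distrib pint_diff sum_subtractf right_diff_distrib)
  moreover have "flux N (\<lambda>q. x q - z q) y = flux N x y - flux N z y"
    by (simp add: flux_def pderiv_diff avg_diff left_diff_distrib sum_subtractf right_diff_distrib)
  moreover have "flux N y (\<lambda>q. x q - z q) = flux N y x - flux N y z"
    by (simp add: flux_def jmp_diff sum_subtractf right_diff_distrib)
  moreover have "jmps N (\<lambda>q. x q - z q) y = jmps N x y - jmps N z y"
    by (simp add: jmps_def jmp_diff left_diff_distrib sum_subtractf)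
  ultimately show ?thesis by (simp add: ip_def right_diff_distrib)
qed

lemma ip_diff_right: "ip N \<alpha> k y (\<lambda>q. x q - z q) = ip N \<alpha> k y x - ip N \<alpha> k y z"
  using ip_diff_left[of N \<alpha> k x z y] by (simp only: ip_sym[of N \<alpha> k y])

lemma dir_nonneg: "0 \<le> dir N x x"
  by (simp add: dir_def sum_nonneg)

lemma mass_nonneg: "0 \<le> mass N x x"
  by (simp add: mass_def sum_nonneg)

lemma jmps_nonneg: "0 \<le> jmps N x x"
  by (simp add: jmps_def sum_nonneg)

lemma en_nonneg: "0 \<le> en N k x x"
  by (simp add: en_def dir_nonneg jmps_nonneg)

lemma bpoly_diff: "x \<in> bpoly N k \<Longrightarrow> y \<in> bpoly N k \<Longrightarrow> (\<lambda>q. x q - y q) \<in> bpoly N k"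
  by (auto simp: bpoly_def intro!: degree_diff_le)

subsection \<open>Coefficients\<close>

definition bas :: "nat \<times> nat \<Rightarrow> nat \<Rightarrow> real poly" where
  "bas s q = (if q = fst s then legendre (snd s) else 0)"

definition idx :: "nat \<Rightarrow> nat \<Rightarrow> (nat \<times> nat) set" where
  "idx N k = {..<N} \<times> {..k}"

definition rep :: "nat \<Rightarrow> nat \<Rightarrow> (nat \<times> nat \<Rightarrow> real) \<Rightarrow> nat \<Rightarrow> real poly" where
  "rep N k c = (\<lambda>q. \<Sum>s\<in>idx N k. Polynomial.smult (c s) (bas s q))"

lemma finite_idx [simp]: "finite (idx N k)" by (simp add: idx_def)

lemma rep_eq: "q < N \<Longrightarrow> rep N k c q = (\<Sum>n\<le>k. Polynomial.smult (c (q, n)) (legendre n))"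
proof -
  assume q: "q < N"
  have "rep N k c q = (\<Sum>p<N. \<Sum>n\<le>k. if p = q then Polynomial.smult (c (p, n)) (legendre n) else 0)"
    unfolding rep_def idx_def by (subst sum.cartesian_product) (intro sum.cong; auto simp: bas_def)
  also have "\<dots> = (\<Sum>p<N. if p = q then (\<Sum>n\<le>k. Polynomial.smult (c (p, n)) (legendre n)) else 0)"
    by (intro sum.cong) auto
  also have "\<dots> = (\<Sum>n\<le>k. Polynomial.smult (c (q, n)) (legendre n))"
    using q by (subst sum.delta) auto
  finally show ?thesis .
qed

lemma rep_bpoly [simp]: "rep N k c \<in> bpoly N k"
  unfolding bpoly_def
  by (auto simp: rep_eq intro!: degree_sum_le order.trans[OF degree_smult_le] order.trans[OF degree_legendre_le])

lemma lcoef_rep: "q < N \<Longrightarrow> n \<le> k \<Longrightarrow> lcoef (rep N k c q) n = c (q, n)"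
  unfolding rep_eq lcoef_sum by simp

definition coe :: "(nat \<Rightarrow> real poly) \<Rightarrow> nat \<times> nat \<Rightarrow> real" where
  "coe x s = lcoef (x (fst s)) (snd s)"

lemma rep_coe: "x \<in> bpoly N k \<Longrightarrow> q < N \<Longrightarrow> rep N k (coe x) q = x q"
  using legendre_expansion[of "x q" k] by (simp add: rep_eq coe_def bpoly_def)

lemma mass_bas: "s \<in> idx N k \<Longrightarrow> t \<in> idx N k \<Longrightarrow> mass N (bas s) (bas t) = (if s = t then 1 / (2 * real (snd s) + 1) else 0)"
proof -
  assume s: "s \<in> idx N k" "t \<in> idx N k"
  have "mass N (bas s) (bas t) = (\<Sum>q<N. if q = fst s then (if fst s = fst t then pint (legendre (snd s) * legendre (snd t)) else 0) else 0) / 2"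
    unfolding mass_def by (intro arg_cong[of _ _ "\<lambda>t. t / 2"] sum.cong) (auto simp: bas_def)
  also have "\<dots> = (if fst s = fst t then pint (legendre (snd s) * legendre (snd t)) else 0) / 2"
    using s by (subst sum.delta) (auto simp: idx_def)
  also have "\<dots> = (if s = t then 1 / (2 * real (snd s) + 1) else 0)"
    by (auto simp: legendre_orthogonal prod_eq_iff)
  finally show ?thesis .
qed

text \<open>\<open>f x\<close> represents the residual functional \<open>ip N \<alpha> l x\<close>
  in the mass product; it is explicit because the Legendre mass matrix is diagonal with entries 1 /
  (2 n + 1). \<open>f\<close> is given by an equation so that callers can supply a local
  definition.\<close>

lemma Riesz_1d:
  fixes k l :: nat
  assumes "0 < N"
    and f_def: "\<And>x. f x = rep N k (\<lambda>u. (2 * real (snd u) + 1) * ip N \<alpha> l x (bas u))"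
  shows "y \<in> bpoly N k \<Longrightarrow> ip N \<alpha> l x y = mass N (f x) y"
    and "mass N (f x) (f x) = (\<Sum>u\<in>idx N k. (2 * real (snd u) + 1) * (ip N \<alpha> l x (bas u))\<^sup>2)"
proof -
  have m: "mass N (f x) (rep N k c) = (\<Sum>u\<in>idx N k. c u * ip N \<alpha> l x (bas u))" for c
  proof -
    have "mass N (bas t) (rep N k c) = c t / (2 * real (snd t) + 1)" if "t \<in> idx N k" for t
    proof -
      have "mass N (bas t) (rep N k c) = (\<Sum>s\<in>idx N k. c s * mass N (bas s) (bas t))"
        unfolding rep_def by (subst mass_sym) (rule mass_sum_left)
      also have "\<dots> = (\<Sum>s\<in>idx N k. if s = t then c s / (2 * real (snd s) + 1) else 0)"
        using that by (intro sum.cong refl) (simp add: mass_bas)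
      also have "\<dots> = c t / (2 * real (snd t) + 1)" using that by (subst sum.delta) auto
      finally show ?thesis .
    qed
    then show ?thesis unfolding f_def
      by (subst rep_def, subst mass_sum_left) (auto intro!: sum.cong simp: add_nonneg_pos[THEN less_imp_neq, symmetric])
  qed
  show "ip N \<alpha> l x y = mass N (f x) y" if y: "y \<in> bpoly N k"
  proof -
    have "ip N \<alpha> l x y = ip N \<alpha> l (rep N k (coe y)) x"
      by (subst ip_sym, rule ip_cong) (auto simp: rep_coe[OF y] assms)
    also have "\<dots> = (\<Sum>u\<in>idx N k. coe y u * ip N \<alpha> l x (bas u))"
      unfolding rep_def ip_sum_left by (simp add: ip_sym[of N \<alpha> l x])
    also have "\<dots> = mass N (f x) (rep N k (coe y))" unfolding m ..
    also have "\<dots> = mass N (f x) y" by (rule mass_cong) (auto simp: rep_coe[OF y])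
    finally show ?thesis .
  qed
  show "mass N (f x) (f x) = (\<Sum>u\<in>idx N k. (2 * real (snd u) + 1) * (ip N \<alpha> l x (bas u))\<^sup>2)"
    by (subst (2) f_def, subst m) (simp add: power2_eq_square mult_ac)
qed

subsection \<open>Conforming splitting\<close>

lemma antiderivative_poly:
  fixes p :: "real poly"
  obtains P where "pderiv P = p" "degree P \<le> Suc (degree p)"
proof -
  define P where "P = (\<Sum>i\<le>degree p. Polynomial.monom (coeff p i / real (Suc i)) (Suc i))"
  have "pderiv P = (\<Sum>i\<le>degree p. pderiv (Polynomial.monom (coeff p i / real (Suc i)) (Suc i)))"
    unfolding P_def by (rule higher_pderiv_sum[of 1, simplified])
  also have "\<dots> = (\<Sum>i\<le>degree p. Polynomial.monom (coeff p i) i)"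
    by (intro sum.cong) (auto simp: pderiv_monom)
  also have "\<dots> = p" by (rule poly_as_sum_of_monoms)
  finally have "pderiv P = p" .
  moreover have "degree P \<le> Suc (degree p)"
    unfolding P_def by (intro degree_sum_le) (auto intro: order.trans[OF degree_monom_le])
  ultimately show ?thesis by (rule that)
qed

lemma antiderivative_poly_value:
  fixes p :: "real poly"
  obtains P where "pderiv P = p" "degree P \<le> Suc (degree p)" "poly P (-1) = c" "poly P 1 = c + pint p"
proof -
  obtain P where P: "pderiv P = p" "degree P \<le> Suc (degree p)" by (rule antiderivative_poly)
  define Q where "Q = P + [:c - poly P (-1):]"
  have "pderiv Q = p" using P by (simp add: Q_def pderiv_add pderiv_pCons)
  moreover have "degree Q \<le> Suc (degree p)" unfolding Q_def using P(2) by (intro degree_add_le) auto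
  moreover have "poly Q (-1) = c" by (simp add: Q_def)
  moreover have "poly Q 1 = c + pint p"
    using pint_pderiv[of P] unfolding P(1) by (simp add: Q_def)
  ultimately show ?thesis by (rule that)
qed

lemma antiderivative_poly_family:
  fixes p :: "nat \<Rightarrow> real poly"
  obtains P where "\<And>q. pderiv (P q) = p q" "\<And>q. degree (P q) \<le> Suc (degree (p q))"
    "\<And>q. poly (P q) (-1) = c q" "\<And>q. poly (P q) 1 = c q + pint (p q)"
proof -
  define R where "R q P \<longleftrightarrow> pderiv P = p q \<and> degree P \<le> Suc (degree (p q)) \<and> poly P (-1) = c q \<and> poly P 1 = c q + pint (p q)" for q P
  have "\<exists>P. R q P" for q unfolding R_def by (rule antiderivative_poly_value[of "p q" "c q"]) blast
  then have "R q ((\<lambda>q. SOME P. R q P) q)" for q by (simp add: someI_ex)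
  then show ?thesis using that[of "\<lambda>q. SOME P. R q P"] unfolding R_def by blast
qed

text \<open>Summation by parts: each cell collects the two nodes at its ends. No boundary terms
  arise because \<open>jmp\<close> takes the exterior value to be zero.\<close>

lemma sum_jmp: "(\<Sum>j\<le>N. c j * jmp N j y) = (\<Sum>q<N. c (Suc q) * poly (y q) 1 - c q * poly (y q) (-1))"
proof -
  have "(\<Sum>j\<le>N. c j * jmp N j y) = (\<Sum>j\<le>N. c j * (if 0 < j then poly (y (j - 1)) 1 else 0))
      - (\<Sum>j\<le>N. c j * (if j < N then poly (y j) (-1) else 0))"
    by (simp add: jmp_def right_diff_distrib sum_subtractf)
  also have "(\<Sum>j\<le>N. c j * (if 0 < j then poly (y (j - 1)) 1 else 0)) = (\<Sum>q<N. c (Suc q) * poly (y q) 1)"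
    by (subst sum.atMost_shift) simp
  also have "(\<Sum>j\<le>N. c j * (if j < N then poly (y j) (-1) else 0)) = (\<Sum>q<N. c q * poly (y q) (-1))"
    by (simp flip: lessThan_Suc_atMost)
  finally show ?thesis by (simp add: sum_subtractf)
qed

lemma pint_diff_square: "pint ((p - r) * (p - r)) = pint (p * p) - 2 * pint (p * r) + pint (r * r)"
  unfolding left_diff_distrib right_diff_distrib pint_diff mult.commute[of r p] by simp

text \<open>\<open>legendre n\<close> is a multiple of the derivative of \<open>D\<close>, which
  vanishes at the endpoints. By parts the coefficient pairs the derivative of \<open>G\<close> with
  half of \<open>D\<close>, and the squared norm of \<open>D\<close> is of order 1 / n.\<close>

lemma lcoef_bound:
  assumes "0 < n"
  shows "(lcoef G n)\<^sup>2 \<le> pint (pderiv G * pderiv G) / real n"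
proof -
  obtain l where n: "n = Suc l" using assms by (cases n) auto
  define D where "D = legendre (Suc (Suc l)) - legendre l"
  have "lcoef G n = pint (pderiv D * G) / 2"
    unfolding D_def pderiv_legendre_diff lcoef_def n by (simp add: pint_smult mult.commute algebra_simps del: legendre.simps)
  also have "pint (pderiv D * G) = - pint (D * pderiv G)"
    unfolding pint_by_parts by (simp add: D_def poly_legendre_1 poly_legendre_minus_1 del: legendre.simps)
  finally have "4 * (lcoef G n)\<^sup>2 = (pint (D * pderiv G))\<^sup>2" by (simp add: power2_eq_square)
  also have "\<dots> \<le> pint (D * D) * pint (pderiv G * pderiv G)" by (rule pint_Cauchy_Schwarz)
  also have "pint (D * D) = 2 / (2 * real l + 5) + 2 / (2 * real l + 1)"
    unfolding D_def
    by (simp add: pint_diff_square legendre_orthogonal del: legendre.simps)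
  also have "\<dots> * pint (pderiv G * pderiv G) \<le> 4 / real n * pint (pderiv G * pderiv G)"
  proof (rule mult_right_mono)
    have "2 / (2 * real l + 5) \<le> 2 / real n" "2 / (2 * real l + 1) \<le> 2 / real n"
      unfolding n by (intro divide_left_mono; simp)+
    then show "2 / (2 * real l + 5) + 2 / (2 * real l + 1) \<le> 4 / real n" by simp
  qed simp
  finally show ?thesis by simp
qed

text \<open>Take \<open>G\<close> continuous with mean zero and \<open>G' = - f / 4\<close> on each cell, and as \<open>z'\<close> the truncation of \<open>G\<close>
  to degree \<open>k - 1\<close>. The truncation error is orthogonal to the derivative of every test function, hence only seen at
  the nodes.\<close>

lemma conforming_split:
  assumes N: "0 < N" and k: "0 < k" and f: "f \<in> bpoly N k"
  obtains z \<epsilon> where "z \<in> bpoly N k" "\<And>j. j \<le> N \<Longrightarrow> jmp N j z = 0"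
    "\<And>y. y \<in> bpoly N k \<Longrightarrow> mass N f y = dir N z y - flux N z y + 2 * (\<Sum>j\<le>N. \<epsilon> j * jmp N j y)"
    "(\<Sum>j\<le>N. (\<epsilon> j)\<^sup>2) \<le> mass N f f / real k"
proof -
  obtain l where l: "k = Suc l" using k by (cases k) auto
  \<comment> \<open>Origin of the 1/4: \<open>mass\<close> carries a factor 1/2 and
    \<open>dir\<close> a factor 2, so the strong form of mass f y = dir z y is f / 2 = - 2
    z''.\<close>
  define p where "p q = Polynomial.smult (-1/4) (f q)" for q
  define S where "S q = (\<Sum>r<q. pint (p r))" for q
  obtain G0 where G0: "\<And>q. pderiv (G0 q) = p q" "\<And>q. degree (G0 q) \<le> Suc (degree (p q))"
    "\<And>q. poly (G0 q) (-1) = S q" "\<And>q. poly (G0 q) 1 = S q + pint (p q)"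
    using antiderivative_poly_family[of p S] by blast
  \<comment> \<open>The additive constant of G is free. Total mean zero makes the primitive z of the
    truncation return to 0 at node \<open>N\<close>, so that z has no jump at the right boundary
    either.\<close>
  define \<gamma> where "\<gamma> = - (\<Sum>q<N. pint (G0 q)) / (2 * real N)"
  define G where "G q = G0 q + [:\<gamma>:]" for q
  define \<Gamma> where "\<Gamma> q = S q + \<gamma>" for q
  have G': "pderiv (G q) = p q" for q by (simp add: G_def pderiv_add G0 pderiv_pCons)
  have Gv: "poly (G q) (-1) = \<Gamma> q" "poly (G q) 1 = \<Gamma> (Suc q)" for q
    by (auto simp: G_def G0 \<Gamma>_def S_def)
  have Gd: "degree (G q) \<le> Suc k" if "q < N" for q
    unfolding G_def using G0(2)[of q] f that
    by (intro degree_add_le) (auto simp: p_def bpoly_def intro: order.trans)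
  define H where "H q = (\<Sum>n\<le>l. Polynomial.smult (lcoef (G q) n) (legendre n))" for q
  have GH: "G q = H q + Polynomial.smult (lcoef (G q) k) (legendre k) + Polynomial.smult (lcoef (G q) (Suc k)) (legendre (Suc k))"
    if "q < N" for q
    by (subst legendre_expansion[OF Gd[OF that]]) (simp add: l H_def del: legendre.simps)
  have Hd: "degree (H q) \<le> l" for q unfolding H_def
    by (auto intro!: degree_sum_le order.trans[OF degree_smult_le] order.trans[OF degree_legendre_le])
  have GHint: "pint (G q * r) = pint (H q * r)" if "q < N" "degree r \<le> l" for q r
  proof -
    have "pint (legendre k * r) = 0" "pint (legendre (Suc k) * r) = 0"
      using that(2) l by (auto intro!: legendre_orthogonal_poly simp del: legendre.simps)
    then show ?thesis
      by (subst GH[OF that(1)]) (simp add: distrib_right pint_add pint_smult del: legendre.simps)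
  qed
  define T where "T q = (\<Sum>r<q. pint (H r))" for q
  have "T N = (\<Sum>q<N. pint (G0 q)) + 2 * real N * \<gamma>"
  proof -
    have "pint (H q) = pint (G0 q) + 2 * \<gamma>" if "q < N" for q
    proof -
      have "pint [:\<gamma>:] = 2 * \<gamma>" using pint_smult[of \<gamma> 1] by simp
      then show ?thesis using GHint[OF that, of 1] by (simp add: G_def pint_add)
    qed
    then show ?thesis unfolding T_def by (simp add: sum.distrib)
  qed
  then have TN: "T N = 0" using N by (simp add: \<gamma>_def)
  have TS: "T (Suc q) = T q + pint (H q)" for q by (simp add: T_def)
  obtain z where z: "\<And>q. pderiv (z q) = H q" "\<And>q. degree (z q) \<le> Suc (degree (H q))"
    "\<And>q. poly (z q) (-1) = T q" "\<And>q. poly (z q) 1 = T (Suc q)"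
    unfolding TS using antiderivative_poly_family[of H T] by blast
  \<comment> \<open>\<open>\<Gamma> j\<close> is the value of the continuous G at node j, and the
    average of H is the numerical flux of z up to a factor; so \<open>\<epsilon>\<close> is the flux
    error at the nodes.\<close>
  define \<epsilon> where "\<epsilon> j = avg N j H - \<Gamma> j" for j
  show ?thesis
  proof (rule that[of z \<epsilon>])
    show "z \<in> bpoly N k" unfolding bpoly_def l using z(2) Hd by (auto intro: order.trans)
    show "jmp N j z = 0" if "j \<le> N" for j
    proof -
      have "T 0 = 0" by (simp add: T_def)
      with TN that show ?thesis by (cases "j = 0"; cases "j = N") (auto simp: jmp_def z)
    qed
    show "mass N f y = dir N z y - flux N z y + 2 * (\<Sum>j\<le>N. \<epsilon> j * jmp N j y)" if y: "y \<in> bpoly N k" for y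
    proof -
      have "pint (f q * y q) = -4 * (\<Gamma> (Suc q) * poly (y q) 1 - \<Gamma> q * poly (y q) (-1)) + 4 * pint (H q * pderiv (y q))"
        if q: "q < N" for q
      proof -
        have "f q = Polynomial.smult (-4) (pderiv (G q))" unfolding G' by (simp add: p_def)
        then have "pint (f q * y q) = -4 * pint (pderiv (G q) * y q)"
          using pint_smult[of "-4" "pderiv (G q) * y q"] by simp
        moreover have "degree (pderiv (y q)) \<le> l" using y q by (auto simp: degree_pderiv bpoly_def l)
        ultimately show ?thesis unfolding pint_by_parts by (simp add: Gv GHint[OF q])
      qed
      then have "mass N f y = -2 * (\<Sum>q<N. \<Gamma> (Suc q) * poly (y q) 1 - \<Gamma> q * poly (y q) (-1)) + 2 * (\<Sum>q<N. pint (H q * pderiv (y q)))"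
      proof -
        assume "\<And>q. q < N \<Longrightarrow> pint (f q * y q) = -4 * (\<Gamma> (Suc q) * poly (y q) 1 - \<Gamma> q * poly (y q) (-1)) + 4 * pint (H q * pderiv (y q))"
        then have "(\<Sum>q<N. pint (f q * y q))
            = (\<Sum>q<N. -4 * (\<Gamma> (Suc q) * poly (y q) 1 - \<Gamma> q * poly (y q) (-1)) + 4 * pint (H q * pderiv (y q)))"
          by (intro sum.cong) auto
        also have "\<dots> = -4 * (\<Sum>q<N. \<Gamma> (Suc q) * poly (y q) 1 - \<Gamma> q * poly (y q) (-1)) + 4 * (\<Sum>q<N. pint (H q * pderiv (y q)))"
          by (simp only: sum.distrib sum_distrib_left)
        finally show ?thesis unfolding mass_def by simp
      qed
      also have "\<dots> = -2 * (\<Sum>j\<le>N. \<Gamma> j * jmp N j y) + dir N z y"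
        by (simp add: sum_jmp dir_def z)
      finally show ?thesis by (simp add: flux_def z \<epsilon>_def left_diff_distrib sum_subtractf)
    qed
    define \<delta> where "\<delta> q = \<bar>lcoef (G q) k\<bar> + \<bar>lcoef (G q) (Suc k)\<bar>" for q
    \<comment> \<open>Legendre polynomials have modulus 1 at the endpoints, so dropping two modes
      moves an endpoint value by at most the sum of the two coefficients. By
      \<open>lcoef_bound\<close> their squares are of order 1 / k times that of f.\<close>
    have dev: "\<bar>poly (H q) s - poly (G q) s\<bar> \<le> \<delta> q" if q: "q < N" and s: "s = 1 \<or> s = -1" for q s
    proof -
      have "poly (H q) s - poly (G q) s = - lcoef (G q) k * poly (legendre k) s - lcoef (G q) (Suc k) * poly (legendre (Suc k)) s"
        using arg_cong[OF GH[OF q], of "\<lambda>p. poly p s"] by (simp only: poly_add poly_smult)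
      moreover have "\<bar>poly (legendre n) s\<bar> = 1" for n using s by (auto simp: poly_legendre_1 poly_legendre_minus_1)
      ultimately show ?thesis unfolding \<delta>_def
        by (metis (no_types, lifting) abs_minus abs_mult abs_triangle_ineq4 mult.right_neutral mult_minus_left)
    qed
    have d2: "(\<delta> q)\<^sup>2 \<le> pint (f q * f q) / (4 * real k)" for q
    proof -
      have p: "pint (pderiv (G q) * pderiv (G q)) = pint (f q * f q) / 16"
        unfolding G' p_def by (simp add: pint_smult)
      have "(lcoef (G q) k)\<^sup>2 \<le> pint (f q * f q) / (16 * real k)"
        using lcoef_bound[OF k, of "G q"] unfolding p by simp
      moreover have "(lcoef (G q) (Suc k))\<^sup>2 \<le> pint (f q * f q) / (16 * real k)"
      proof -
        have "pint (f q * f q) / (16 * real (Suc k)) \<le> pint (f q * f q) / (16 * real k)"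
          using k by (intro divide_left_mono) auto
        then show ?thesis using lcoef_bound[of "Suc k" "G q"] unfolding p by simp
      qed
      moreover have "(\<delta> q)\<^sup>2 \<le> 2 * (lcoef (G q) k)\<^sup>2 + 2 * (lcoef (G q) (Suc k))\<^sup>2"
        unfolding \<delta>_def using sum_squares_bound[of "\<bar>lcoef (G q) k\<bar>" "\<bar>lcoef (G q) (Suc k)\<bar>"]
        by (simp add: power2_sum)
      ultimately show ?thesis by simp
    qed
    have "(\<epsilon> j)\<^sup>2 \<le> (if 0 < j then (\<delta> (j - 1))\<^sup>2 else 0) + (if j < N then (\<delta> j)\<^sup>2 else 0)" if "j \<le> N" for j
    proof -
      consider "j = 0" | "j = N" "0 < j" | "0 < j" "j < N" using \<open>j \<le> N\<close> by linarith
      then show ?thesis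
      proof cases
        case 1
        then have "\<bar>\<epsilon> j\<bar> \<le> \<delta> j" using dev[of 0 "-1"] N by (simp add: \<epsilon>_def avg_def Gv)
        then show ?thesis using 1 N by (simp add: abs_le_square_iff[symmetric])
      next
        case 2
        then have "\<bar>\<epsilon> j\<bar> \<le> \<delta> (j - 1)" using dev[of "j - 1" 1] by (simp add: \<epsilon>_def avg_def Gv)
        then show ?thesis using 2 by (simp add: abs_le_square_iff[symmetric])
      next
        case 3
        define u v where "u = poly (H (j - 1)) 1 - \<Gamma> j" and "v = poly (H j) (-1) - \<Gamma> j"
        have uv: "\<bar>u\<bar> \<le> \<delta> (j - 1)" "\<bar>v\<bar> \<le> \<delta> j"
          using dev[of "j - 1" 1] dev[of j "-1"] 3 by (simp_all add: Gv u_def v_def)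
        have "\<epsilon> j = (u + v) / 2" using 3 by (simp add: \<epsilon>_def avg_def u_def v_def field_simps)
        then have "(\<epsilon> j)\<^sup>2 = ((u + v) / 2)\<^sup>2" by (simp only:)
        also have "((u + v) / 2)\<^sup>2 = (u\<^sup>2 + 2 * u * v + v\<^sup>2) / 4" unfolding power_divide power2_sum by simp
        also have "\<dots> \<le> u\<^sup>2 + v\<^sup>2"
        proof -
          have *: "(A + T + B) / 4 \<le> A + B" if "T \<le> A + B" "0 \<le> A" "0 \<le> B" for A B T :: real using that by simp
          show ?thesis by (rule *[OF sum_squares_bound]) auto
        qed
        also have "\<dots> \<le> (\<delta> (j - 1))\<^sup>2 + (\<delta> j)\<^sup>2"
          using uv by (intro add_mono; subst abs_le_square_iff[symmetric]) auto
        finally show ?thesis using 3 by simp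
      qed
    qed
    then have "(\<Sum>j\<le>N. (\<epsilon> j)\<^sup>2) \<le> (\<Sum>j\<le>N. (if 0 < j then (\<delta> (j - 1))\<^sup>2 else 0) + (if j < N then (\<delta> j)\<^sup>2 else 0))"
      by (intro sum_mono) auto
    also have "\<dots> = (\<Sum>q<N. (\<delta> q)\<^sup>2) + (\<Sum>q<N. (\<delta> q)\<^sup>2)"
      unfolding sum.distrib by (subst sum.atMost_shift) (simp flip: lessThan_Suc_atMost)
    also have "\<dots> \<le> 2 * (\<Sum>q<N. pint (f q * f q) / (4 * real k))"
      using sum_mono[of "{..<N}" "\<lambda>q. (\<delta> q)\<^sup>2", OF d2] by simp
    also have "\<dots> = mass N f f / real k" by (simp add: mass_def sum_divide_distrib[symmetric])
    finally show "(\<Sum>j\<le>N. (\<epsilon> j)\<^sup>2) \<le> mass N f f / real k" .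
  qed
qed

lemma mass_add_left: "mass N (\<lambda>q. x q + z q) y = mass N x y + mass N z y"
  using mass_diff_left[of N "\<lambda>q. x q + z q" z y] by simp

lemma ip_add_left: "ip N \<alpha> k (\<lambda>q. x q + z q) y = ip N \<alpha> k x y + ip N \<alpha> k z y"
  using ip_diff_left[of N \<alpha> k "\<lambda>q. x q + z q" z y] by simp

lemma mass_square_diff: "mass N (\<lambda>q. x q - y q) (\<lambda>q. x q - y q) = mass N x x - 2 * mass N x y + mass N y y"
proof -
  have "mass N (\<lambda>q. x q - y q) z = mass N x z - mass N y z" "mass N z (\<lambda>q. x q - y q) = mass N z x - mass N z y" for z
    using mass_diff_left[of N x y z] by (simp_all only: mass_sym[of N z])
  then show ?thesis using mass_sym[of N x y] by simp
qed

lemma mass_square_add: "mass N (\<lambda>q. x q + y q) (\<lambda>q. x q + y q) = mass N x x + 2 * mass N x y + mass N y y"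
proof -
  have "mass N (\<lambda>q. x q + y q) z = mass N x z + mass N y z" "mass N z (\<lambda>q. x q + y q) = mass N z x + mass N z y" for z
    using mass_add_left[of N x y z] by (simp_all only: mass_sym[of N z])
  then show ?thesis using mass_sym[of N x y] by simp
qed

lemma ip_square_diff: "ip N \<alpha> k (\<lambda>q. x q - y q) (\<lambda>q. x q - y q) = ip N \<alpha> k x x - 2 * ip N \<alpha> k x y + ip N \<alpha> k y y"
  using ip_sym[of N \<alpha> k x y] by (simp add: ip_diff_left ip_diff_right)

lemma ip_square_add: "ip N \<alpha> k (\<lambda>q. x q + y q) (\<lambda>q. x q + y q) = ip N \<alpha> k x x + 2 * ip N \<alpha> k x y + ip N \<alpha> k y y"
proof -
  have "ip N \<alpha> k z (\<lambda>q. x q + y q) = ip N \<alpha> k z x + ip N \<alpha> k z y" for z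
    using ip_add_left[of N \<alpha> k x y z] by (simp only: ip_sym[of N \<alpha> k z])
  then show ?thesis using ip_sym[of N \<alpha> k x y] by (simp add: ip_add_left)
qed

lemma bpoly_add: "x \<in> bpoly N k \<Longrightarrow> y \<in> bpoly N k \<Longrightarrow> (\<lambda>q. x q + y q) \<in> bpoly N k"
  by (auto simp: bpoly_def intro!: degree_add_le)

lemma flux_conforming: "(\<And>j. j \<le> N \<Longrightarrow> jmp N j z = 0) \<Longrightarrow> flux N y z = 0"
  by (simp add: flux_def)

lemma jmps_conforming: "(\<And>j. j \<le> N \<Longrightarrow> jmp N j z = 0) \<Longrightarrow> jmps N z y = 0"
  by (simp add: jmps_def)

lemma ip_conforming: "(\<And>j. j \<le> N \<Longrightarrow> jmp N j z = 0) \<Longrightarrow> ip N \<alpha> k z y = dir N z y - flux N z y"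
  using flux_conforming[of N z y] jmps_conforming[of N z y] by (simp add: ip_def)

lemma sum_jmp_CS: "(\<Sum>j\<le>N. \<epsilon> j * jmp N j y)\<^sup>2 \<le> (\<Sum>j\<le>N. (\<epsilon> j)\<^sup>2) * jmps N y y"
  using Cauchy_Schwarz_ineq_sum[of \<epsilon> "\<lambda>j. jmp N j y" "{..N}"] by (simp add: jmps_def power2_eq_square)

lemma en_diff_le: "en N k x x \<le> 2 * en N k y y + 2 * en N k (\<lambda>q. x q - y q) (\<lambda>q. x q - y q)"
proof -
  have "pint (p * p) \<le> 2 * pint (r * r) + 2 * pint ((p - r) * (p - r))" for p r
  proof -
    have "2 * pint (r * r) + 2 * pint ((p - r) * (p - r)) - pint (p * p) = pint ((p - r - r) * (p - r - r))"
      unfolding pint_diff_square[of "p - r" r] pint_diff_square[of p r] left_diff_distrib[of p r r] pint_diff by simp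
    then show ?thesis using pint_sq_nonneg[of "p - r - r"] by linarith
  qed
  then have "(\<Sum>q<N. pint (pderiv (x q) * pderiv (x q))) \<le> (\<Sum>q<N. 2 * pint (pderiv (y q) * pderiv (y q))
      + 2 * pint ((pderiv (x q) - pderiv (y q)) * (pderiv (x q) - pderiv (y q))))"
    by (intro sum_mono) blast
  then have "dir N x x \<le> 2 * dir N y y + 2 * dir N (\<lambda>q. x q - y q) (\<lambda>q. x q - y q)"
    unfolding dir_def pderiv_diff by (simp only: sum.distrib sum_distrib_left[symmetric])
  moreover have "jmps N x x \<le> 2 * jmps N y y + 2 * jmps N (\<lambda>q. x q - y q) (\<lambda>q. x q - y q)"
  proof -
    have "a * a \<le> 2 * (b * b) + 2 * ((a - b) * (a - b))" for a b :: real
      using zero_le_square[of "a - 2 * b"] by (simp add: algebra_simps)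
    then have "(\<Sum>j\<le>N. jmp N j x * jmp N j x) \<le> (\<Sum>j\<le>N. 2 * (jmp N j y * jmp N j y)
        + 2 * ((jmp N j x - jmp N j y) * (jmp N j x - jmp N j y)))"
      by (intro sum_mono) blast
    then show ?thesis unfolding jmps_def jmp_diff by (simp only: sum.distrib sum_distrib_left[symmetric])
  qed
  then have "(real k)\<^sup>2 * jmps N x x \<le> (real k)\<^sup>2 * (2 * jmps N y y + 2 * jmps N (\<lambda>q. x q - y q) (\<lambda>q. x q - y q))"
    by (intro mult_left_mono) auto
  ultimately show ?thesis by (simp add: en_def algebra_simps)
qed

text \<open>The quadratic form a M^-1 a in Legendre coordinates: the squared mass norm of the
  representative of the residual of \<open>x\<close> from \<open>Riesz_1d\<close>. It plays the part
  of a broken second-order norm.\<close>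

definition sqf :: "nat \<Rightarrow> real \<Rightarrow> nat \<Rightarrow> (nat \<Rightarrow> real poly) \<Rightarrow> real" where
  "sqf N \<alpha> k x = (\<Sum>u\<in>idx N k. (2 * real (snd u) + 1) * (ip N \<alpha> k x (bas u))\<^sup>2)"

text \<open>The conforming splitting is applied to the representative of the residual of
  \<open>x\<close>. The defect \<open>x - z\<close> then sees test functions only through their
  jumps: it is orthogonal to all conforming functions and driven by nodal data that the residual
  controls.\<close>

lemma defect_split:
  assumes "0 < N" "0 < k" "x \<in> bpoly N k"
  obtains z \<epsilon> where "z \<in> bpoly N k" "\<And>j. j \<le> N \<Longrightarrow> jmp N j z = 0"
    "\<And>y. y \<in> bpoly N k \<Longrightarrow> ip N \<alpha> k (\<lambda>q. x q - z q) y = 2 * (\<Sum>j\<le>N. \<epsilon> j * jmp N j y)"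
    "(\<Sum>j\<le>N. (\<epsilon> j)\<^sup>2) \<le> sqf N \<alpha> k x / real k"
proof -
  define f where "f x = rep N k (\<lambda>u. (2 * real (snd u) + 1) * ip N \<alpha> k x (bas u))" for x
  note R = Riesz_1d[OF assms(1) f_def]
  have fx: "f x \<in> bpoly N k" by (simp add: f_def)
  obtain z \<epsilon> where
    z: "z \<in> bpoly N k" "\<And>j. j \<le> N \<Longrightarrow> jmp N j z = 0"
    "\<And>y. y \<in> bpoly N k \<Longrightarrow> mass N (f x) y = dir N z y - flux N z y + 2 * (\<Sum>j\<le>N. \<epsilon> j * jmp N j y)"
    "(\<Sum>j\<le>N. (\<epsilon> j)\<^sup>2) \<le> mass N (f x) (f x) / real k" using conforming_split[OF assms(1,2) fx] by blast
  show ?thesis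
  proof (rule that[of z \<epsilon>])
    show "ip N \<alpha> k (\<lambda>q. x q - z q) y = 2 * (\<Sum>j\<le>N. \<epsilon> j * jmp N j y)" if "y \<in> bpoly N k" for y
    proof -
      have "ip N \<alpha> k z y = dir N z y - flux N z y" by (rule ip_conforming) (rule z(2))
      then show ?thesis using R(1)[OF that, of x] z(3)[OF that] by (simp add: ip_diff_left)
    qed
    show "(\<Sum>j\<le>N. (\<epsilon> j)\<^sup>2) \<le> sqf N \<alpha> k x / real k"
      using z(4) unfolding R(2) sqf_def .
  qed (use z in auto)
qed

text \<open>The Garding inequality improves to coercivity since the defect \<open>x - z\<close> of the conforming
  approximation is controlled in the mean by its jumps alone.\<close>

lemma coercive_1d:
  assumes "0 < N" "0 < k" "0 < \<beta>"
    and garding: "\<And>x. x \<in> bpoly N k \<Longrightarrow> \<beta> * en N k x x - K * mass N x x \<le> ip N \<alpha> k x x"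
    and K: "0 \<le> K" "8 * K \<le> \<beta> * (real k) ^ 3"
    and x: "x \<in> bpoly N k"
  shows "min (\<beta> / 2) 1 / 2 * en N k x x \<le> ip N \<alpha> k x x"
proof -
  obtain z \<epsilon> where
    z: "z \<in> bpoly N k" "\<And>j. j \<le> N \<Longrightarrow> jmp N j z = 0"
    "\<And>y. y \<in> bpoly N k \<Longrightarrow> ip N \<alpha> k (\<lambda>q. x q - z q) y = 2 * (\<Sum>j\<le>N. \<epsilon> j * jmp N j y)"
    "(\<Sum>j\<le>N. (\<epsilon> j)\<^sup>2) \<le> sqf N \<alpha> k x / real k" using defect_split[OF assms(1,2) x, of \<alpha>] by blast
  define y where "y = (\<lambda>q. x q - z q)"
  have y: "y \<in> bpoly N k" unfolding y_def by (rule bpoly_diff[OF x z(1)])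
  have orth: "ip N \<alpha> k y w = 0" if "w \<in> bpoly N k" "\<And>j. j \<le> N \<Longrightarrow> jmp N j w = 0" for w
    unfolding y_def z(3)[OF that(1)] using that(2) by simp
  \<comment> \<open>Duality: the splitting is applied to the defect y itself. Its conforming part w
    is orthogonal to y, so only the nodal term is left; Cauchy-Schwarz and cancelling one factor
    bound the mass of y by 4 / k times its squared jumps.\<close>
  have my: "mass N y y \<le> 4 / real k * jmps N y y"
  proof -
    obtain w \<eta> where
      w: "w \<in> bpoly N k" "\<And>j. j \<le> N \<Longrightarrow> jmp N j w = 0"
      "\<And>v. v \<in> bpoly N k \<Longrightarrow> mass N y v = dir N w v - flux N w v + 2 * (\<Sum>j\<le>N. \<eta> j * jmp N j v)"
      "(\<Sum>j\<le>N. (\<eta> j)\<^sup>2) \<le> mass N y y / real k" using conforming_split[OF assms(1,2) y] by blast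
    have "mass N y y = ip N \<alpha> k w y + 2 * (\<Sum>j\<le>N. \<eta> j * jmp N j y)"
    proof -
      have "ip N \<alpha> k w y = dir N w y - flux N w y" by (rule ip_conforming) (rule w(2))
      then show ?thesis using w(3)[OF y] by simp
    qed
    also have "ip N \<alpha> k w y = 0" by (subst ip_sym) (rule orth[OF w(1,2)])
    finally have "(mass N y y)\<^sup>2 = 4 * (\<Sum>j\<le>N. \<eta> j * jmp N j y)\<^sup>2" by (simp add: power2_eq_square)
    also have "\<dots> \<le> 4 * ((\<Sum>j\<le>N. (\<eta> j)\<^sup>2) * jmps N y y)"
      using sum_jmp_CS[of \<eta> N y] by simp
    also have "\<dots> \<le> 4 * (mass N y y / real k * jmps N y y)"
      using w(4) by (intro mult_left_mono mult_right_mono jmps_nonneg) auto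
    finally have "mass N y y * mass N y y \<le> mass N y y * (4 / real k * jmps N y y)"
      by (simp add: power2_eq_square mult_ac)
    then have "mass N y y \<le> 4 / real k * jmps N y y" if "0 < mass N y y"
      using that by (simp only: mult_le_cancel_left_pos)
    then show ?thesis using mass_nonneg[of N y] jmps_nonneg[of N y] by (cases "mass N y y = 0") auto
  qed
  \<comment> \<open>By the hypothesis on \<open>K\<close>, 4 K / k is at most \<beta> k^2 / 2, so
    half of the penalty part of the energy absorbs the Garding term.\<close>
  have "K * mass N y y \<le> K * (4 / real k * jmps N y y)" using my K by (intro mult_left_mono) auto
  also have "\<dots> = 8 * K * (jmps N y y / (2 * real k))" by simp
  also have "\<dots> \<le> \<beta> * (real k) ^ 3 * (jmps N y y / (2 * real k))"
    using K jmps_nonneg[of N y] by (intro mult_right_mono) auto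
  also have "\<dots> = \<beta> / 2 * ((real k)\<^sup>2 * jmps N y y)"
    using assms(2) by (simp add: field_simps power2_eq_square power3_eq_cube)
  also have "\<dots> \<le> \<beta> / 2 * en N k y y"
    using assms(3) by (intro mult_left_mono) (auto simp: en_def dir_nonneg)
  finally have 1: "\<beta> / 2 * en N k y y \<le> ip N \<alpha> k y y" using garding[OF y] by simp
  have enz: "en N k z z = dir N z z" using jmps_conforming[of N z z] z(2) by (simp add: en_def)
  have ipz: "ip N \<alpha> k z z = dir N z z" using ip_conforming[of N z \<alpha> k z] flux_conforming[of N z z] z(2) by simp
  have "ip N \<alpha> k x x = ip N \<alpha> k (\<lambda>q. y q + z q) (\<lambda>q. y q + z q)" by (simp add: y_def)
  also have "\<dots> = ip N \<alpha> k y y + ip N \<alpha> k z z + 2 * ip N \<alpha> k y z"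
    by (simp add: ip_square_add)
  also have "ip N \<alpha> k y z = 0" by (rule orth[OF z(1,2)])
  finally have 2: "ip N \<alpha> k x x = ip N \<alpha> k y y + en N k z z" by (simp add: ipz enz)
  \<comment> \<open>The defect is coercive with \<beta> / 2, the conforming part with 1. The further
    factor 1/2 in the claim pays for recombining the two energies.\<close>
  define \<gamma> where "\<gamma> = min (\<beta> / 2) 1"
  have "\<gamma> * en N k y y \<le> \<beta> / 2 * en N k y y" "\<gamma> * en N k z z \<le> 1 * en N k z z"
    by (intro mult_right_mono en_nonneg; simp add: \<gamma>_def)+
  then have "\<gamma> * (en N k z z + en N k y y) \<le> ip N \<alpha> k x x" using 1 2 by (simp add: algebra_simps)
  moreover have "\<gamma> / 2 * en N k x x \<le> \<gamma> / 2 * (2 * en N k z z + 2 * en N k y y)"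
    unfolding y_def using assms(3) by (intro mult_left_mono en_diff_le) (simp add: \<gamma>_def)
  ultimately show ?thesis by (simp add: \<gamma>_def algebra_simps)
qed

text \<open>The defect has the jumps of \<open>x\<close>. With J the squared jumps and R the
  residual, coercivity gives \<gamma> k^2 J \<le> 2 (R / k)^(1/2) J^(1/2); solving for J produces
  the fifth power of k.\<close>

lemma jmps_bound:
  assumes "0 < N" "0 < k" "0 < \<gamma>"
    and coer: "\<And>x. x \<in> bpoly N k \<Longrightarrow> \<gamma> * en N k x x \<le> ip N \<alpha> k x x"
    and x: "x \<in> bpoly N k"
  shows "jmps N x x \<le> 4 / (\<gamma>\<^sup>2 * real k ^ 5) * sqf N \<alpha> k x"
proof -
  obtain z \<epsilon> where
    z: "z \<in> bpoly N k" "\<And>j. j \<le> N \<Longrightarrow> jmp N j z = 0"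
    "\<And>y. y \<in> bpoly N k \<Longrightarrow> ip N \<alpha> k (\<lambda>q. x q - z q) y = 2 * (\<Sum>j\<le>N. \<epsilon> j * jmp N j y)"
    "(\<Sum>j\<le>N. (\<epsilon> j)\<^sup>2) \<le> sqf N \<alpha> k x / real k" using defect_split[OF assms(1,2) x, of \<alpha>] by blast
  define y where "y = (\<lambda>q. x q - z q)"
  have y: "y \<in> bpoly N k" unfolding y_def by (rule bpoly_diff[OF x z(1)])
  have J: "jmps N y y = jmps N x x" unfolding y_def jmps_def jmp_diff using z(2) by simp
  define J where "J = jmps N x x"
  have J0: "0 \<le> J" by (simp add: J_def jmps_nonneg)
  have "\<gamma> * (real k)\<^sup>2 * J \<le> \<gamma> * en N k y y"
    using assms(3) by (simp add: en_def dir_nonneg J[symmetric] J_def)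
  also have "\<dots> \<le> 2 * (\<Sum>j\<le>N. \<epsilon> j * jmp N j y)" using coer[OF y] z(3)[OF y] by (simp add: y_def)
  finally have "(\<gamma> * (real k)\<^sup>2 * J)\<^sup>2 \<le> (2 * (\<Sum>j\<le>N. \<epsilon> j * jmp N j y))\<^sup>2"
    using assms(3) J0 by (intro power_mono) auto
  also have "\<dots> \<le> 4 * ((\<Sum>j\<le>N. (\<epsilon> j)\<^sup>2) * J)"
    using sum_jmp_CS[of \<epsilon> N y] by (simp add: J J_def power2_eq_square)
  also have "\<dots> \<le> 4 * (sqf N \<alpha> k x / real k * J)"
    using z(4) J0 by (intro mult_left_mono mult_right_mono) auto
  finally have "J * (\<gamma>\<^sup>2 * (real k)^4 * J) \<le> J * (4 * (sqf N \<alpha> k x / real k))"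
    by (simp add: power2_eq_square mult_ac power4_eq_xxxx)
  moreover have "0 \<le> sqf N \<alpha> k x" by (auto simp: sqf_def intro!: sum_nonneg)
  ultimately have "\<gamma>\<^sup>2 * (real k)^4 * J \<le> 4 * (sqf N \<alpha> k x / real k)"
  proof (cases "J = 0")
    case False
    then have "0 < J" using J0 by simp
    from \<open>J * (\<gamma>\<^sup>2 * (real k)^4 * J) \<le> J * (4 * (sqf N \<alpha> k x / real k))\<close> this show ?thesis
      by (simp only: mult_le_cancel_left_pos)
  qed simp
  then have "\<gamma>\<^sup>2 * (real k)^4 * real k * J \<le> 4 * sqf N \<alpha> k x"
    using assms(2) by (simp add: field_simps)
  moreover have "\<gamma>\<^sup>2 * (real k)^4 * real k = \<gamma>\<^sup>2 * real k ^ 5" by (simp add: eval_nat_numeral)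
  ultimately have "\<gamma>\<^sup>2 * real k ^ 5 * J \<le> 4 * sqf N \<alpha> k x" by simp
  then show ?thesis using assms(2,3) by (simp add: J_def field_simps)
qed

subsection \<open>Removing the highest mode\<close>

definition bub :: "nat \<Rightarrow> (nat \<Rightarrow> real poly) \<Rightarrow> nat \<Rightarrow> real poly" where
  "bub k x q = Polynomial.smult (lcoef (x q) k) (legendre k - legendre (k - 2))"

definition top2 :: "nat \<Rightarrow> nat \<Rightarrow> (nat \<Rightarrow> real poly) \<Rightarrow> real" where
  "top2 N k x = (\<Sum>q<N. (lcoef (x q) k)\<^sup>2)"

text \<open>The derivative is a multiple of a single Legendre polynomial, so all norms are explicit:
  squared mass of order 1 / k against a squared derivative of order k. These two powers are behind
  the gain of k^-2 in the cut.\<close>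

lemma bubble_facts:
  assumes "2 \<le> k"
  defines "D \<equiv> legendre k - legendre (k - 2)"
  shows "pderiv D = Polynomial.smult (2 * real k - 1) (legendre (k - 1))"
    "poly D 1 = 0" "poly D (-1) = 0" "pint (D * D) \<le> 8 / real k"
    "pint (pderiv D * pderiv D) = 2 * (2 * real k - 1)" "degree D \<le> k"
proof -
  obtain l where k: "k = Suc (Suc l)" using assms(1) by (metis add_2_eq_Suc le_Suc_ex)
  show D': "pderiv D = Polynomial.smult (2 * real k - 1) (legendre (k - 1))"
    using pderiv_legendre_diff[of l] by (simp add: D_def k add.commute del: legendre.simps)
  show "poly D 1 = 0" by (simp add: D_def poly_legendre_1)
  show "poly D (-1) = 0" by (simp add: D_def poly_legendre_minus_1 k del: legendre.simps)
  have "pint (D * D) = 2 / (2 * real k + 1) + 2 / (2 * real l + 1)"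
    unfolding D_def k
    by (simp add: pint_diff_square legendre_orthogonal del: legendre.simps)
  also have "\<dots> \<le> 4 / real k + 4 / real k"
    by (intro add_mono) (auto simp: k field_simps)
  finally show "pint (D * D) \<le> 8 / real k" by simp
  show "pint (pderiv D * pderiv D) = 2 * (2 * real k - 1)"
    unfolding D' by (simp add: pint_smult legendre_orthogonal k del: legendre.simps)
  show "degree D \<le> k" unfolding D_def
    by (intro degree_diff_le order.trans[OF degree_legendre_le]) auto
qed

lemma bub_bpoly: "2 \<le> k \<Longrightarrow> bub k x \<in> bpoly N k"
  using bubble_facts(6)[of k] by (auto simp: bpoly_def bub_def)

lemma jmp_bub: "2 \<le> k \<Longrightarrow> jmp N j (bub k x) = 0"
  using bubble_facts(2,3)[of k] by (simp add: jmp_def bub_def)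

lemma ip_bub: "2 \<le> k \<Longrightarrow> ip N \<alpha> k (bub k x) (bub k x) = 4 * (2 * real k - 1) * top2 N k x"
proof -
  assume k: "2 \<le> k"
  have "ip N \<alpha> k (bub k x) (bub k x) = dir N (bub k x) (bub k x)"
    using ip_conforming[of N "bub k x"] flux_conforming[of N "bub k x"] jmp_bub[OF k] by simp
  also have "\<dots> = 4 * (2 * real k - 1) * top2 N k x"
    unfolding dir_def bub_def top2_def pderiv_smult sum_distrib_left
    by (intro sum.cong) (simp_all add: pint_smult bubble_facts(5)[OF k] power2_eq_square)
  finally show ?thesis .
qed

lemma mass_bub: "2 \<le> k \<Longrightarrow> mass N (bub k x) (bub k x) \<le> 4 / real k * top2 N k x"
proof -
  assume k: "2 \<le> k"
  have "mass N (bub k x) (bub k x) = top2 N k x * pint ((legendre k - legendre (k - 2)) * (legendre k - legendre (k - 2))) / 2"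
    unfolding mass_def bub_def top2_def sum_distrib_right
    by (simp add: pint_smult power2_eq_square)
  also have "\<dots> \<le> top2 N k x * (8 / real k) / 2"
    by (intro divide_right_mono mult_left_mono bubble_facts(4)[OF k]) (auto simp: top2_def intro: sum_nonneg)
  finally show ?thesis by simp
qed

lemma top2_mass: "top2 N k x \<le> (2 * real k + 1) * mass N x x"
proof -
  have "(lcoef p k)\<^sup>2 \<le> (2 * real k + 1) * (pint (p * p) / 2)" for p
  proof -
    have "(lcoef p k)\<^sup>2 = ((2 * real k + 1) / 2)\<^sup>2 * (pint (p * legendre k))\<^sup>2" unfolding lcoef_def power_mult_distrib ..
    also have "\<dots> \<le> ((2 * real k + 1) / 2)\<^sup>2 * (pint (p * p) * (2 / (2 * real k + 1)))"
      using pint_Cauchy_Schwarz[of p "legendre k"] by (intro mult_left_mono) (auto simp: legendre_norm)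
    also have "\<dots> = (2 * real k + 1) * (pint (p * p) / 2)" by (simp add: power2_eq_square field_simps)
    finally show ?thesis .
  qed
  then show ?thesis unfolding top2_def mass_def
    by (simp add: sum_divide_distrib sum_distrib_left) (intro sum_mono, simp)
qed

text \<open>In degree at most \<open>k\<close> only the top mode has a derivative that meets
  \<open>legendre (k - 1)\<close>. So the top coefficient can be read off the derivative, which
  bounds it by the Dirichlet form with an extra power of k.\<close>

lemma lcoef_pderiv:
  assumes "2 \<le> k" "degree p \<le> k"
  shows "pint (pderiv p * legendre (k - 1)) = 2 * lcoef p k"
proof -
  obtain l where k: "k = Suc (Suc l)" using assms(1) by (metis add_2_eq_Suc le_Suc_ex)
  have d: "pint (legendre m * legendre (Suc l)) = (if m = Suc l then 2 / (2 * real l + 3) else 0)" for m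
    by (simp add: legendre_orthogonal add.commute del: legendre.simps)
  have low: "pint (pderiv (legendre m) * legendre (Suc l)) = 0" if "m \<le> Suc l" for m
  proof -
    have "degree (pderiv (legendre m)) < Suc l" using degree_legendre_le[of m] that by (simp add: degree_pderiv del: legendre.simps)
    then show ?thesis by (subst mult.commute) (rule legendre_orthogonal_poly)
  qed
  have top: "pint (pderiv (legendre (Suc (Suc l))) * legendre (Suc l)) = 2"
  proof -
    have "pderiv (legendre (Suc (Suc l))) = Polynomial.smult (2 * real l + 3) (legendre (Suc l)) + pderiv (legendre l)"
      using pderiv_legendre_diff[of l] by (simp add: pderiv_diff diff_eq_eq del: legendre.simps)
    then show ?thesis using low[of l] by (simp add: distrib_right pint_add pint_smult d del: legendre.simps) (simp add: field_simps)
  qed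
  have "pderiv p = (\<Sum>m\<le>k. Polynomial.smult (lcoef p m) (pderiv (legendre m)))"
    by (subst legendre_expansion[OF assms(2)]) (rule pderiv_sum_smult)
  then have "pint (pderiv p * legendre (k - 1)) = (\<Sum>m\<le>k. lcoef p m * pint (pderiv (legendre m) * legendre (Suc l)))"
    unfolding k
    by (simp only: sum_distrib_right pint_sum pint_smult mult_smult_left diff_Suc_1)
  also have "\<dots> = (\<Sum>m\<le>Suc l. lcoef p m * pint (pderiv (legendre m) * legendre (Suc l))) + lcoef p k * 2"
    by (simp add: k top del: legendre.simps)
  also have "(\<Sum>m\<le>Suc l. lcoef p m * pint (pderiv (legendre m) * legendre (Suc l))) = 0"
    using low by (intro sum.neutral) (auto simp del: legendre.simps)
  finally show ?thesis by simp
qed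

lemma top2_dir:
  assumes "2 \<le> k" "x \<in> bpoly N k"
  shows "4 * real k * top2 N k x \<le> dir N x x"
proof -
  have "4 * real k * (lcoef p k)\<^sup>2 \<le> 2 * pint (pderiv p * pderiv p)" if "degree p \<le> k" for p
  proof -
    have k: "real (k - 1) = real k - 1" "2 * real k - 1 \<ge> real k" using assms(1) by auto
    have "4 * (lcoef p k)\<^sup>2 = (pint (pderiv p * legendre (k - 1)))\<^sup>2"
      unfolding lcoef_pderiv[OF assms(1) that] by (simp add: power2_eq_square)
    also have "\<dots> \<le> pint (pderiv p * pderiv p) * (2 / (2 * real k - 1))"
      using pint_Cauchy_Schwarz[of "pderiv p" "legendre (k - 1)"] k by (simp add: legendre_norm)
    also have "\<dots> \<le> pint (pderiv p * pderiv p) * (2 / real k)"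
      using k assms(1) by (intro mult_left_mono divide_left_mono) auto
    finally show ?thesis using assms(1) by (simp add: field_simps)
  qed
  then show ?thesis using assms(2) unfolding top2_def dir_def sum_distrib_left bpoly_def
    by (intro sum_mono) auto
qed

lemma sum_square3: "(a + b + c)\<^sup>2 \<le> 3 * (a\<^sup>2 + b\<^sup>2 + c\<^sup>2)" for a b c :: real
  using zero_le_power2[of "a - b"] zero_le_power2[of "b - c"] zero_le_power2[of "a - c"]
  by (simp add: power2_eq_square algebra_simps)

text \<open>A bound of second order, in contrast to \<open>top2_dir\<close>: testing the residual
  with the bubble of one cell yields 4 (2 k - 1) times the top coefficient, up to the jumps at the
  two nodes of the cell, and the residual meets the bubble only with its small mass.\<close>

lemma top2_jump:
  assumes k: "2 \<le> k" and N: "0 < N" and x: "x \<in> bpoly N k"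
  shows "top2 N k x \<le> sqf N \<alpha> k x / real k ^ 3 + 2 * jmps N x x"
proof -
  define f where "f x = rep N k (\<lambda>u. (2 * real (snd u) + 1) * ip N \<alpha> k x (bas u))" for x
  note R = Riesz_1d[OF N f_def]
  define D where "D = legendre k - legendre (k - 2)"
  note D = bubble_facts[OF k, folded D_def]
  have kr: "2 * real k - 1 \<ge> real k" "real k \<ge> 2" using k by auto
  have main: "16 * (lcoef (x q) k)\<^sup>2 \<le> 3 * (2 * pint (f x q * f x q) / real k ^ 3 + 4 * (jmp N q x)\<^sup>2 + 4 * (jmp N (Suc q) x)\<^sup>2)"
    if q: "q < N" for q
  proof -
    \<comment> \<open>Supported on one cell and free of jumps: the penalty and the flux of x drop
      out, and only the slopes of the bubble against the jumps of x remain.\<close>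
    define y where "y p = (if p = q then D else 0)" for p
    have y: "y \<in> bpoly N k" using D(6) by (auto simp: bpoly_def y_def)
    have "poly (y p) 1 = 0" "poly (y p) (-1) = 0" for p using D(2,3) by (auto simp: y_def)
    then have jy: "jmp N j y = 0" for j by (simp add: jmp_def)
    have y': "pderiv (y p) = (if p = q then pderiv D else 0)" for p by (simp add: y_def)
    have "ip N \<alpha> k x y = dir N x y - flux N y x"
      using flux_conforming[of N y x] jmps_conforming[of N y x] jy by (simp add: ip_def jmps_sym[of N x])
    moreover have "dir N x y = 2 * pint (pderiv (x q) * pderiv D)"
    proof -
      have "(\<Sum>p<N. pint (pderiv (x p) * pderiv (y p))) = (\<Sum>p<N. if p = q then pint (pderiv (x p) * pderiv D) else 0)"
        by (intro sum.cong) (auto simp: y')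
      then show ?thesis using q by (simp add: dir_def)
    qed
    moreover have "pint (pderiv (x q) * pderiv D) = (2 * real k - 1) * (2 * lcoef (x q) k)"
      unfolding D(1) using lcoef_pderiv[OF k, of "x q"] x q by (simp add: pint_smult bpoly_def)
    moreover have "\<bar>flux N y x\<bar> \<le> (2 * real k - 1) * (2 * \<bar>jmp N q x\<bar> + 2 * \<bar>jmp N (Suc q) x\<bar>)"
    proof -
      define a where "a j = avg N j (\<lambda>p. pderiv (y p))" for j
      have a0: "a j = 0" if "j \<noteq> q" "j \<noteq> Suc q" "j \<le> N" for j
        using that q unfolding a_def avg_def y' by auto
      have pD: "\<bar>poly (pderiv D) s\<bar> = 2 * real k - 1" if "s = 1 \<or> s = -1" for s
        unfolding D(1) using that kr by (auto simp: abs_mult poly_legendre_1 poly_legendre_minus_1)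
      \<comment> \<open>The end slopes of the bubble have modulus 2 k - 1, the factor of the volume
        term. It cancels, so the jumps enter without a power of k.\<close>
      have aq: "\<bar>a j\<bar> \<le> 2 * real k - 1" if "j = q \<or> j = Suc q" for j
        using that q pD[of 1] pD[of "-1"] kr unfolding a_def avg_def y' by (auto simp: abs_if split: if_splits)
      have "flux N y x = 2 * (\<Sum>j\<in>{q, Suc q}. a j * jmp N j x)"
        unfolding flux_def a_def[symmetric] using q a0 by (intro arg_cong[of _ _ "\<lambda>t. 2 * t"] sum.mono_neutral_right) auto
      then have "\<bar>flux N y x\<bar> = 2 * \<bar>a q * jmp N q x + a (Suc q) * jmp N (Suc q) x\<bar>"
        by (simp del: distrib_left_numeral add: abs_mult)
      also have "\<dots> \<le> 2 * (\<bar>a q\<bar> * \<bar>jmp N q x\<bar> + \<bar>a (Suc q)\<bar> * \<bar>jmp N (Suc q) x\<bar>)"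
        using abs_triangle_ineq[of "a q * jmp N q x" "a (Suc q) * jmp N (Suc q) x"] by (simp add: abs_mult)
      also have "\<dots> \<le> 2 * ((2 * real k - 1) * \<bar>jmp N q x\<bar> + (2 * real k - 1) * \<bar>jmp N (Suc q) x\<bar>)"
        using aq by (intro mult_left_mono add_mono mult_right_mono) auto
      finally show ?thesis by (simp add: algebra_simps)
    qed
    ultimately have "(2 * real k - 1) * \<bar>4 * lcoef (x q) k\<bar> \<le> \<bar>ip N \<alpha> k x y\<bar> + (2 * real k - 1) * (2 * \<bar>jmp N q x\<bar> + 2 * \<bar>jmp N (Suc q) x\<bar>)"
    proof -
      assume a: "ip N \<alpha> k x y = dir N x y - flux N y x" "dir N x y = 2 * pint (pderiv (x q) * pderiv D)"
        "pint (pderiv (x q) * pderiv D) = (2 * real k - 1) * (2 * lcoef (x q) k)"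
        "\<bar>flux N y x\<bar> \<le> (2 * real k - 1) * (2 * \<bar>jmp N q x\<bar> + 2 * \<bar>jmp N (Suc q) x\<bar>)"
      have "\<bar>(2 * real k - 1) * (4 * lcoef (x q) k)\<bar> = \<bar>ip N \<alpha> k x y + flux N y x\<bar>" unfolding a(1-3) by (simp add: algebra_simps)
      also have "\<dots> \<le> \<bar>ip N \<alpha> k x y\<bar> + \<bar>flux N y x\<bar>" by (rule abs_triangle_ineq)
      finally show ?thesis using a(4) kr by (simp add: abs_mult)
    qed
    then have "\<bar>4 * lcoef (x q) k\<bar> \<le> \<bar>ip N \<alpha> k x y\<bar> / (2 * real k - 1) + (2 * \<bar>jmp N q x\<bar> + 2 * \<bar>jmp N (Suc q) x\<bar>)"
      using kr by (simp add: field_simps)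
    then have "(4 * lcoef (x q) k)\<^sup>2 \<le> (\<bar>ip N \<alpha> k x y\<bar> / (2 * real k - 1) + 2 * \<bar>jmp N q x\<bar> + 2 * \<bar>jmp N (Suc q) x\<bar>)\<^sup>2"
      by (subst abs_le_square_iff[symmetric]) simp
    also have "\<dots> \<le> 3 * ((\<bar>ip N \<alpha> k x y\<bar> / (2 * real k - 1))\<^sup>2 + (2 * \<bar>jmp N q x\<bar>)\<^sup>2 + (2 * \<bar>jmp N (Suc q) x\<bar>)\<^sup>2)"
      by (rule sum_square3)
    also have "\<dots> = 3 * ((ip N \<alpha> k x y)\<^sup>2 / (2 * real k - 1)\<^sup>2 + 4 * (jmp N q x)\<^sup>2 + 4 * (jmp N (Suc q) x)\<^sup>2)"
      by (simp add: power_divide power_mult_distrib)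
    also have "(ip N \<alpha> k x y)\<^sup>2 / (2 * real k - 1)\<^sup>2 \<le> (ip N \<alpha> k x y)\<^sup>2 / (real k)\<^sup>2"
      using kr by (intro divide_left_mono power_mono) auto
    also have "ip N \<alpha> k x y = pint (f x q * D) / 2"
    proof -
      have "(\<Sum>p<N. pint (f x p * y p)) = (\<Sum>p<N. if p = q then pint (f x p * D) else 0)"
        by (intro sum.cong) (auto simp: y_def)
      then show ?thesis using q unfolding R(1)[OF y] mass_def by simp
    qed
    also have "(pint (f x q * D) / 2)\<^sup>2 / (real k)\<^sup>2 \<le> (pint (f x q * f x q) * (8 / real k) / 4) / (real k)\<^sup>2"
    proof (rule divide_right_mono)
      have "(pint (f x q * D))\<^sup>2 \<le> pint (f x q * f x q) * pint (D * D)" by (rule pint_Cauchy_Schwarz)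
      also have "\<dots> \<le> pint (f x q * f x q) * (8 / real k)" using D(4) by (intro mult_left_mono) auto
      finally show "(pint (f x q * D) / 2)\<^sup>2 \<le> pint (f x q * f x q) * (8 / real k) / 4"
        by (simp add: power_divide mult.commute)
    qed simp
    also have "(pint (f x q * f x q) * (8 / real k) / 4) / (real k)\<^sup>2 = 2 * pint (f x q * f x q) / real k ^ 3"
      by (simp add: power2_eq_square power3_eq_cube)
    finally show ?thesis by (simp add: power_mult_distrib)
  qed
  have "16 * top2 N k x \<le> (\<Sum>q<N. 3 * (2 * pint (f x q * f x q) / real k ^ 3 + 4 * (jmp N q x)\<^sup>2 + 4 * (jmp N (Suc q) x)\<^sup>2))"
    unfolding top2_def sum_distrib_left using main by (intro sum_mono) auto
  also have "\<dots> = 12 * (mass N (f x) (f x) / real k ^ 3) + 12 * (\<Sum>q<N. (jmp N q x)\<^sup>2) + 12 * (\<Sum>q<N. (jmp N (Suc q) x)\<^sup>2)"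
    by (simp add: mass_def sum.distrib sum_distrib_left sum_divide_distrib algebra_simps)
  also have "(\<Sum>q<N. (jmp N q x)\<^sup>2) \<le> jmps N x x"
    unfolding jmps_def power2_eq_square by (intro sum_mono2) auto
  also have "(\<Sum>q<N. (jmp N (Suc q) x)\<^sup>2) \<le> jmps N x x"
    unfolding jmps_def power2_eq_square by (subst sum.atMost_shift) simp
  finally have "16 * top2 N k x \<le> 12 * (sqf N \<alpha> k x / real k ^ 3) + 24 * jmps N x x"
    unfolding R(2) sqf_def by simp
  moreover have "0 \<le> sqf N \<alpha> k x / real k ^ 3" by (auto simp: sqf_def intro!: sum_nonneg divide_nonneg_nonneg)
  ultimately show ?thesis using jmps_nonneg[of N x] by simp
qed

text \<open>These are the demands of the tensor argument on one direction: the cut is stable in mass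
  and energy, and the removed bubble gains k^-2 whenever one order is spent, from energy to mass or
  from residual to energy.\<close>

lemma cut_bounds:
  assumes k: "2 \<le> k" and N: "0 < N" and \<gamma>: "0 < \<gamma>"
    and coer: "\<And>x. x \<in> bpoly N k \<Longrightarrow> \<gamma> * en N k x x \<le> ip N \<alpha> k x x"
    and x: "x \<in> bpoly N k"
  defines "x' \<equiv> \<lambda>q. x q - bub k x q"
  shows "mass N x' x' \<le> 26 * mass N x x"
    and "ip N \<alpha> k x' x' \<le> (2 + 4 / \<gamma>) * ip N \<alpha> k x x"
    and "mass N (bub k x) (bub k x) \<le> 1 / \<gamma> / (real k)\<^sup>2 * ip N \<alpha> k x x"
    and "ip N \<alpha> k (bub k x) (bub k x) \<le> 8 * (1 + 8 / \<gamma>\<^sup>2) / (real k)\<^sup>2 * sqf N \<alpha> k x"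
proof -
  define b where "b = bub k x"
  define T where "T = top2 N k x"
  have kr: "real k \<ge> 2" using k by simp
  have T0: "0 \<le> T" by (auto simp: T_def top2_def intro: sum_nonneg)
  have b: "b \<in> bpoly N k" by (simp add: b_def bub_bpoly[OF k])
  have pos: "0 \<le> ip N \<alpha> k y y" if "y \<in> bpoly N k" for y
    using coer[OF that] mult_nonneg_nonneg[OF less_imp_le[OF \<gamma>] en_nonneg[of N k y]] by simp
  have T1: "T \<le> (2 * real k + 1) * mass N x x" unfolding T_def by (rule top2_mass)
  have dirip: "dir N x x \<le> ip N \<alpha> k x x / \<gamma>"
  proof -
    have "\<gamma> * dir N x x \<le> \<gamma> * en N k x x" using \<gamma> by (simp add: en_def jmps_nonneg)
    then have "\<gamma> * dir N x x \<le> ip N \<alpha> k x x" using coer[OF x] by (rule order.trans)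
    then show ?thesis using \<gamma> by (simp add: field_simps)
  qed
  have T2: "4 * real k * T \<le> ip N \<alpha> k x x / \<gamma>" using top2_dir[OF k x] dirip by (simp add: T_def)
  have Mb: "mass N b b \<le> 4 / real k * T" unfolding b_def T_def by (rule mass_bub[OF k])
  have Ib: "ip N \<alpha> k b b \<le> 8 * real k * T"
    unfolding b_def ip_bub[OF k] T_def[symmetric] using T0 by (intro mult_right_mono) auto
  have "mass N b b \<le> 12 * mass N x x"
  proof -
    have "4 / real k * T \<le> 4 / real k * ((2 * real k + 1) * mass N x x)" using T1 by (intro mult_left_mono) auto
    also have "\<dots> \<le> 12 * mass N x x"
    proof -
      have "4 / real k * (2 * real k + 1) \<le> 12" using kr by (simp add: field_simps)
      then have "4 / real k * (2 * real k + 1) * mass N x x \<le> 12 * mass N x x" by (intro mult_right_mono mass_nonneg)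
      then show ?thesis by (simp only: mult.assoc)
    qed
    finally show ?thesis using Mb by simp
  qed
  moreover have "mass N x' x' \<le> 2 * mass N x x + 2 * mass N b b"
  proof -
    have "mass N x' x' = mass N x x - 2 * mass N x b + mass N b b"
      unfolding x'_def b_def[symmetric] by (simp add: mass_square_diff)
    moreover have "mass N (\<lambda>q. x q + b q) (\<lambda>q. x q + b q) = mass N x x + 2 * mass N x b + mass N b b"
      by (simp add: mass_square_add)
    ultimately show ?thesis using mass_nonneg[of N "\<lambda>q. x q + b q"] by simp
  qed
  ultimately show "mass N x' x' \<le> 26 * mass N x x" by simp
  have "8 * real k * T \<le> 2 / \<gamma> * ip N \<alpha> k x x" using T2 by simp
  then have "ip N \<alpha> k b b \<le> 2 / \<gamma> * ip N \<alpha> k x x" using Ib by simp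
  moreover have "ip N \<alpha> k x' x' \<le> 2 * ip N \<alpha> k x x + 2 * ip N \<alpha> k b b"
  proof -
    have "ip N \<alpha> k x' x' = ip N \<alpha> k x x - 2 * ip N \<alpha> k x b + ip N \<alpha> k b b"
      unfolding x'_def b_def[symmetric] by (simp add: ip_square_diff)
    moreover have "ip N \<alpha> k (\<lambda>q. x q + b q) (\<lambda>q. x q + b q) = ip N \<alpha> k x x + 2 * ip N \<alpha> k x b + ip N \<alpha> k b b"
      by (simp add: ip_square_add)
    ultimately show ?thesis using pos[OF bpoly_add[OF x b]] by simp
  qed
  ultimately show "ip N \<alpha> k x' x' \<le> (2 + 4 / \<gamma>) * ip N \<alpha> k x x" by (simp add: algebra_simps)
  have "4 / real k * T = (4 * real k * T) / (real k)\<^sup>2" using kr by (simp add: power2_eq_square)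
  also have "\<dots> \<le> (ip N \<alpha> k x x / \<gamma>) / (real k)\<^sup>2" by (intro divide_right_mono T2) simp
  finally show "mass N (bub k x) (bub k x) \<le> 1 / \<gamma> / (real k)\<^sup>2 * ip N \<alpha> k x x"
    using Mb by (simp add: b_def mult_ac)
  define S where "S = sqf N \<alpha> k x"
  have S0: "0 \<le> S" by (auto simp: S_def sqf_def intro!: sum_nonneg)
  have "T \<le> S / real k ^ 3 + 2 * jmps N x x" unfolding T_def S_def by (rule top2_jump[OF k N x])
  also have "jmps N x x \<le> 4 / (\<gamma>\<^sup>2 * real k ^ 5) * S"
    unfolding S_def by (rule jmps_bound[OF N _ \<gamma> coer x]) (use k in auto)
  \<comment> \<open>The jump contribution is better than required; the bubble test contributes k^-3
    in any case.\<close>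
  also have "4 / (\<gamma>\<^sup>2 * real k ^ 5) * S \<le> 4 / (\<gamma>\<^sup>2 * real k ^ 3) * S"
    using kr \<gamma> S0 by (intro mult_right_mono divide_left_mono mult_left_mono power_increasing) auto
  finally have "T \<le> (1 + 8 / \<gamma>\<^sup>2) * (S / real k ^ 3)" using \<gamma> by (simp add: algebra_simps)
  then have "8 * real k * T \<le> 8 * real k * ((1 + 8 / \<gamma>\<^sup>2) * (S / real k ^ 3))" using kr by (intro mult_left_mono) auto
  also have "\<dots> = 8 * (1 + 8 / \<gamma>\<^sup>2) / (real k)\<^sup>2 * S" using kr by (simp add: power2_eq_square power3_eq_cube)
  finally show "ip N \<alpha> k (bub k x) (bub k x) \<le> 8 * (1 + 8 / \<gamma>\<^sup>2) / (real k)\<^sup>2 * sqf N \<alpha> k x"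
    using Ib by (simp add: b_def S_def)
qed

subsection \<open>Poincare inequality\<close>

text \<open>Values are reached by walking from the left boundary, where the jump at node 0 is minus
  the boundary value. The growth with \<open>N\<close> is harmless: the bound serves directions with
  boundedly many cells and the proof of definiteness.\<close>

lemma mass_le_en:
  assumes "0 < k"
  shows "mass N x x \<le> 8 * (real N + 1)\<^sup>2 * en N k x x"
proof -
  define E where "E = dir N x x + jmps N x x"
  have E0: "0 \<le> E" by (simp add: E_def dir_nonneg jmps_nonneg)
  have EI: "(pint (pderiv p))\<^sup>2 \<le> 2 * pint (pderiv p * pderiv p)" for p
    using pint_Cauchy_Schwarz[of "pderiv p" 1] by simp
  have path: "poly (x q) 1 = (\<Sum>p\<le>q. pint (pderiv (x p)) - jmp N p x)" if "q < N" for q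
    using that
  proof (induction q)
    case 0
    then show ?case by (simp add: pint_pderiv jmp_def)
  next
    case (Suc q)
    then show ?case by (simp add: pint_pderiv jmp_def)
  qed
  have val: "(poly (x q) 1)\<^sup>2 \<le> 2 * (real N + 1) * E" if q: "q < N" for q
  proof -
    have "(poly (x q) 1)\<^sup>2 = (\<Sum>p\<le>q. 1 * (pint (pderiv (x p)) - jmp N p x))\<^sup>2" unfolding path[OF q] by simp
    also have "\<dots> \<le> (\<Sum>p\<le>q. 1\<^sup>2) * (\<Sum>p\<le>q. (pint (pderiv (x p)) - jmp N p x)\<^sup>2)"
      by (rule Cauchy_Schwarz_ineq_sum)
    also have "\<dots> \<le> (real N + 1) * (\<Sum>p\<le>q. (pint (pderiv (x p)) - jmp N p x)\<^sup>2)"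
      using q by (intro mult_right_mono sum_nonneg) auto
    also have "(\<Sum>p\<le>q. (pint (pderiv (x p)) - jmp N p x)\<^sup>2) \<le> (\<Sum>p<N. 4 * pint (pderiv (x p) * pderiv (x p)) + 2 * (jmp N p x)\<^sup>2)"
    proof -
      have "(\<Sum>p\<le>q. (pint (pderiv (x p)) - jmp N p x)\<^sup>2) \<le> (\<Sum>p<N. (pint (pderiv (x p)) - jmp N p x)\<^sup>2)"
        using q by (intro sum_mono2) auto
      also have "\<dots> \<le> (\<Sum>p<N. 4 * pint (pderiv (x p) * pderiv (x p)) + 2 * (jmp N p x)\<^sup>2)"
      proof (rule sum_mono)
        fix p
        have "(u - v)\<^sup>2 \<le> 2 * u\<^sup>2 + 2 * v\<^sup>2" for u v :: real
          using zero_le_power2[of "u + v"] by (simp add: power2_eq_square algebra_simps)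
        from this[of "pint (pderiv (x p))" "jmp N p x"] EI[of "x p"]
        show "(pint (pderiv (x p)) - jmp N p x)\<^sup>2 \<le> 4 * pint (pderiv (x p) * pderiv (x p)) + 2 * (jmp N p x)\<^sup>2" by simp
      qed
      finally show ?thesis .
    qed
    also have "\<dots> = 2 * dir N x x + 2 * (\<Sum>p<N. (jmp N p x)\<^sup>2)"
      by (simp add: dir_def sum.distrib sum_distrib_left)
    also have "2 * dir N x x + 2 * (\<Sum>p<N. (jmp N p x)\<^sup>2) \<le> 2 * E"
    proof -
      have "(\<Sum>p<N. (jmp N p x)\<^sup>2) \<le> jmps N x x"
        unfolding jmps_def power2_eq_square by (intro sum_mono2) auto
      then show ?thesis by (simp add: E_def)
    qed
    finally show ?thesis by (simp add: mult_left_mono mult_ac)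
  qed
  have cell: "pint (x q * x q) \<le> 8 * (real N + 1) * E + 16 * E" if q: "q < N" for q
  proof -
    let ?p = "x q"
    \<comment> \<open>The weight 1 + s has derivative 1 and vanishes at -1, so integration by parts
      leaves only the value at the right end, which \<open>val\<close> controls.\<close>
    define Y :: "real poly" where "Y = [:1, 1:]"
    have Y: "pderiv Y = 1" "poly Y s = 1 + s" for s by (simp_all add: Y_def pderiv_pCons one_pCons)
    have "pint (?p * ?p) = pint (pderiv Y * (?p * ?p))" unfolding Y by simp
    also have "\<dots> = 2 * (poly ?p 1)\<^sup>2 - 2 * pint (Y * ?p * pderiv ?p)"
    proof -
      have "pint (Y * pderiv (?p * ?p)) = 2 * pint (Y * ?p * pderiv ?p)"
        unfolding pderiv_mult distrib_left pint_add by (simp only: mult_ac mult_2)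
      then show ?thesis unfolding pint_by_parts by (simp add: power2_eq_square Y)
    qed
    also have "\<dots> \<le> 2 * (poly ?p 1)\<^sup>2 + pint (?p * ?p) / 2 + 8 * pint (pderiv ?p * pderiv ?p)"
    proof -
      have "0 \<le> pint (?p * ?p) / 2 + 2 * pint (Y * ?p * pderiv ?p) + 8 * pint (pderiv ?p * pderiv ?p)"
      proof -
        have "pint (Y * ?p * pderiv ?p) = pint (?p * (Y * pderiv ?p))" by (simp add: mult_ac)
        have "0 \<le> pint (Polynomial.smult (1/2) (?p * ?p) + Polynomial.smult 2 (Y * ?p * pderiv ?p) + Polynomial.smult 8 (pderiv ?p * pderiv ?p))"
          unfolding pint_def
        proof (rule Henstock_Kurzweil_Integration.integral_nonneg)
          fix s :: real assume s: "s \<in> {-1..1}"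
          define a b where "a = poly ?p s" and "b = poly (pderiv ?p) s"
          \<comment> \<open>Young's inequality written as a square. Half of the mass will be
            absorbed; the 8 is 2 * 2^2 from 1 + s \<le> 2.\<close>
          have "0 \<le> (a / 2 + (1 + s) * b)\<^sup>2 * 2" by simp
          also have "\<dots> = a\<^sup>2 / 2 + 2 * (1 + s) * a * b + 2 * (1 + s)\<^sup>2 * b\<^sup>2"
            by (simp add: power2_eq_square algebra_simps add_divide_distrib)
          also have "2 * (1 + s)\<^sup>2 * b\<^sup>2 \<le> 2 * 2\<^sup>2 * b\<^sup>2"
            using s by (intro mult_right_mono mult_left_mono power_mono) auto
          finally show "0 \<le> poly (Polynomial.smult (1/2) (?p * ?p) + Polynomial.smult 2 (Y * ?p * pderiv ?p) + Polynomial.smult 8 (pderiv ?p * pderiv ?p)) s"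
            by (simp add: a_def b_def power2_eq_square algebra_simps Y)
        qed simp
        then show ?thesis by (simp add: pint_add pint_smult)
      qed
      then show ?thesis by simp
    qed
    finally have "pint (?p * ?p) \<le> 4 * (poly ?p 1)\<^sup>2 + 16 * pint (pderiv ?p * pderiv ?p)" by simp
    also have "\<dots> \<le> 4 * (2 * (real N + 1) * E) + 16 * (E / 2)"
    proof (intro add_mono mult_left_mono val[OF q])
      have "pint (pderiv ?p * pderiv ?p) \<le> (\<Sum>q<N. pint (pderiv (x q) * pderiv (x q)))"
        using q by (intro member_le_sum) auto
      then show "pint (pderiv ?p * pderiv ?p) \<le> E / 2" using jmps_nonneg[of N x] by (simp add: E_def dir_def)
    qed auto
    finally show ?thesis using E0 by (simp add: algebra_simps)
  qed
  have "mass N x x \<le> (\<Sum>q<N. 8 * (real N + 1) * E + 16 * E) / 2"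
    unfolding mass_def using cell by (intro divide_right_mono sum_mono) auto
  also have "\<dots> = real N * (4 * (real N + 1) + 8) * E" by (simp add: algebra_simps)
  also have "\<dots> \<le> 8 * (real N + 1)\<^sup>2 * E"
    using E0 by (intro mult_right_mono) (auto simp: power2_eq_square algebra_simps)
  also have "E \<le> en N k x x"
  proof -
    have "1 * jmps N x x \<le> (real k)\<^sup>2 * jmps N x x" using assms by (intro mult_right_mono jmps_nonneg) (simp add: Suc_le_eq)
    then show ?thesis by (simp add: E_def en_def)
  qed
  finally show ?thesis by (simp add: mult_left_mono)
qed

section \<open>Tensor products of quadratic forms\<close>

definition qf :: "'s set \<Rightarrow> ('s \<Rightarrow> 's \<Rightarrow> real) \<Rightarrow> ('s \<Rightarrow> real) \<Rightarrow> real" where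
  "qf X B c = (\<Sum>s\<in>X. \<Sum>t\<in>X. B s t * c s * c t)"

definition psd :: "'s set \<Rightarrow> ('s \<Rightarrow> 's \<Rightarrow> real) \<Rightarrow> bool" where
  "psd X B \<longleftrightarrow> (\<forall>s\<in>X. \<forall>t\<in>X. B s t = B t s) \<and> (\<forall>c. 0 \<le> qf X B c)"

lemma psd_sym: "psd X B \<Longrightarrow> s \<in> X \<Longrightarrow> t \<in> X \<Longrightarrow> B s t = B t s"
  unfolding psd_def by blast

lemma psd_nonneg: "psd X B \<Longrightarrow> 0 \<le> qf X B c"
  unfolding psd_def by blast

lemma qf_insert:
  assumes "finite X" "a \<notin> X" "\<And>s. s \<in> X \<Longrightarrow> B s a = B a s"
  shows "qf (insert a X) B c = B a a * (c a)\<^sup>2 + 2 * c a * (\<Sum>s\<in>X. B a s * c s) + qf X B c"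
proof -
  have "qf (insert a X) B c = (B a a * c a * c a + (\<Sum>t\<in>X. B a t * c a * c t))
      + (\<Sum>s\<in>X. B s a * c s * c a + (\<Sum>t\<in>X. B s t * c s * c t))"
    unfolding qf_def using assms(1,2) by simp
  also have "(\<Sum>s\<in>X. B s a * c s * c a + (\<Sum>t\<in>X. B s t * c s * c t)) = c a * (\<Sum>s\<in>X. B a s * c s) + qf X B c"
    by (simp add: sum.distrib qf_def sum_distrib_left assms(3) mult_ac)
  finally show ?thesis by (simp add: power2_eq_square sum_distrib_left mult_ac)
qed

lemma qf_cong: "(\<And>s. s \<in> X \<Longrightarrow> c s = d s) \<Longrightarrow> qf X B c = qf X B d"
  unfolding qf_def by (intro sum.cong) auto

text \<open>Otherwise the form would be affine, and not constant, in the value at \<open>a\<close>,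
  hence unbounded below.\<close>

lemma psd_insert_zero:
  assumes X: "finite X" "a \<notin> X" and B: "psd (insert a X) B" and z: "B a a = 0" and t: "t \<in> X"
  shows "B a t = 0"
proof (rule ccontr)
  assume nz: "B a t \<noteq> 0"
  have sym: "s \<in> X \<Longrightarrow> B s a = B a s" for s using psd_sym[OF B] by blast
  define u where "u = - (B t t + 1) / (2 * B a t)"
  define c where "c s = (if s = a then u else if s = t then 1 else 0)" for s
  have "0 \<le> qf (insert a X) B c" by (rule psd_nonneg[OF B])
  also have "\<dots> = 2 * u * (\<Sum>s\<in>X. B a s * c s) + qf X B c" using qf_insert[where B = B, OF X sym] z by (simp add: c_def)
  also have "(\<Sum>s\<in>X. B a s * c s) = (\<Sum>s\<in>X. if s = t then B a t else 0)" using X by (intro sum.cong) (auto simp: c_def)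
  also have "\<dots> = B a t" using X t by simp
  also have "qf X B c = (\<Sum>s\<in>X. if s = t then B t t else 0)"
  proof -
    have "(\<Sum>r\<in>X. B s r * c s * c r) = (if s = t then B t t else 0)" if "s \<in> X" for s
    proof -
      have "(\<Sum>r\<in>X. B s r * c s * c r) = (\<Sum>r\<in>X. if r = t then (if s = t then B t t else 0) else 0)"
        using X that by (intro sum.cong) (auto simp: c_def)
      then show ?thesis using X t by simp
    qed
    then show ?thesis unfolding qf_def by (intro sum.cong) auto
  qed
  also have "\<dots> = B t t" using X t by simp
  finally have "0 \<le> 2 * u * B a t + B t t" .
  moreover have "2 * u * B a t = - (B t t + 1)" using nz by (simp add: u_def)
  ultimately show False by simp
qed

text \<open>Cholesky elimination, one index at a time; a vanishing pivot has a vanishing row.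
  Positivity becomes a sum of squares, and such sums multiply. The factors are indexed by
  \<open>X\<close> itself, so that products over directions range over the same tuples as the
  coordinates.\<close>

lemma psd_gram:
  assumes "finite X" "psd X B"
  shows "\<exists>g. \<forall>s\<in>X. \<forall>t\<in>X. B s t = (\<Sum>p\<in>X. g p s * g p t :: real)"
  using assms
proof (induction X arbitrary: B rule: finite_induct)
  case (insert a X)
  have sym: "s \<in> X \<Longrightarrow> B s a = B a s" for s using psd_sym[OF insert.prems] by blast
  have qi: "qf (insert a X) B c = B a a * (c a)\<^sup>2 + 2 * c a * (\<Sum>s\<in>X. B a s * c s) + qf X B c" for c
    using qf_insert[where B = B, OF insert.hyps] sym by blast
  have pos: "0 \<le> qf (insert a X) B c" for c by (rule psd_nonneg[OF insert.prems])
  show ?case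
  proof (cases "B a a = 0")
    case True
    have z: "B a t = 0" if "t \<in> X" for t
      by (rule psd_insert_zero[OF insert.hyps insert.prems True that])
    have "psd X B" unfolding psd_def
    proof (intro conjI allI ballI)
      show "B s t = B t s" if "s \<in> X" "t \<in> X" for s t using psd_sym[OF insert.prems] that by blast
      show "0 \<le> qf X B c" for c using pos[of c] unfolding qi by (simp add: z True)
    qed
    then obtain g where g: "\<forall>s\<in>X. \<forall>t\<in>X. B s t = (\<Sum>p\<in>X. g p s * g p t)" using insert.IH by blast
    define h where "h p s = (if p = a \<or> s = a then 0 else g p s)" for p s
    have "B s t = (\<Sum>p\<in>insert a X. h p s * h p t)" if st: "s \<in> insert a X" "t \<in> insert a X" for s t
    proof -
      have e: "(\<Sum>p\<in>insert a X. h p s * h p t) = (\<Sum>p\<in>X. h p s * h p t)" using insert.hyps by (simp add: h_def)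
      show ?thesis
      proof (cases "s = a \<or> t = a")
        case True
        then have "B s t = 0" using st z sym[of s] \<open>B a a = 0\<close> insert.hyps(2) by (cases "s = a") auto
        then show ?thesis unfolding e using True by (auto simp: h_def)
      next
        case False
        then have "B s t = (\<Sum>p\<in>X. g p s * g p t)" using g st by auto
        also have "\<dots> = (\<Sum>p\<in>X. h p s * h p t)" using False insert.hyps by (intro sum.cong) (auto simp: h_def)
        finally show ?thesis unfolding e .
      qed
    qed
    then show ?thesis by blast
  next
    case False
    have "0 \<le> B a a"
      using pos[of "\<lambda>s. if s = a then 1 else 0"] insert.hyps unfolding qi
      by (simp add: qf_def if_distrib cong: if_cong sum.cong)
    with False have Ba: "0 < B a a" by simp
    \<comment> \<open>The Schur complement of the pivot. Its form is the minimum of the given one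
      over the value at \<open>a\<close>, attained at the \<open>d\<close> below, so it inherits
      positivity.\<close>
    define B' where "B' s t = B s t - B a s * B a t / B a a" for s t
    have "psd X B'" unfolding psd_def
    proof (intro conjI allI ballI)
      show "B' s t = B' t s" if "s \<in> X" "t \<in> X" for s t
        using psd_sym[OF insert.prems, of s t] that by (simp add: B'_def)
      show "0 \<le> qf X B' c" for c
      proof -
        define L where "L = (\<Sum>s\<in>X. B a s * c s)"
        define d where "d = c(a := - L / B a a)"
        have "(\<Sum>s\<in>X. B a s * d s) = L" unfolding L_def d_def using insert.hyps by (intro sum.cong) auto
        moreover have "qf X B d = qf X B c" using insert.hyps by (intro qf_cong) (auto simp: d_def)
        ultimately have "0 \<le> B a a * (L / B a a)\<^sup>2 - 2 * (L / B a a) * L + qf X B c"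
          using pos[of d] unfolding qi by (simp add: d_def)
        also have "\<dots> = qf X B c - L * L / B a a" using Ba by (simp add: power2_eq_square field_simps)
        also have "L * L / B a a = (\<Sum>s\<in>X. \<Sum>t\<in>X. (B a s * B a t / B a a) * c s * c t)"
          unfolding L_def sum_product sum_divide_distrib by (intro sum.cong) auto
        also have "qf X B c - \<dots> = qf X B' c"
          unfolding qf_def B'_def by (simp add: sum_subtractf left_diff_distrib)
        finally show ?thesis .
      qed
    qed
    then obtain g where g: "\<forall>s\<in>X. \<forall>t\<in>X. B' s t = (\<Sum>p\<in>X. g p s * g p t)" using insert.IH by blast
    define h where "h p s = (if p = a then B a s / sqrt (B a a) else if s = a then 0 else g p s)" for p s
    have "B s t = (\<Sum>p\<in>insert a X. h p s * h p t)" if st: "s \<in> insert a X" "t \<in> insert a X" for s t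
    proof -
      have e: "(\<Sum>p\<in>insert a X. h p s * h p t) = B a s * B a t / B a a + (\<Sum>p\<in>X. h p s * h p t)"
        using insert.hyps Ba by (simp add: h_def)
      show ?thesis
      proof (cases "s = a \<or> t = a")
        case True
        then have "(\<Sum>p\<in>X. h p s * h p t) = 0" using insert.hyps by (intro sum.neutral) (auto simp: h_def)
        moreover have "B s t = B a s * B a t / B a a" using True st sym[of s] Ba insert.hyps(2) by (cases "s = a") auto
        ultimately show ?thesis unfolding e by simp
      next
        case False
        then have "B' s t = (\<Sum>p\<in>X. g p s * g p t)" using g st by auto
        also have "\<dots> = (\<Sum>p\<in>X. h p s * h p t)" using False insert.hyps by (intro sum.cong) (auto simp: h_def)
        finally show ?thesis unfolding e by (simp add: B'_def)
      qed
    qed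
    then show ?thesis by blast
  qed
qed simp

section \<open>Tensor products: positivity and comparison factor by factor\<close>

definition tform :: "('d::finite \<Rightarrow> 's set) \<Rightarrow> ('d \<Rightarrow> 's \<Rightarrow> 's \<Rightarrow> real) \<Rightarrow> (('d \<Rightarrow> 's) \<Rightarrow> real) \<Rightarrow> (('d \<Rightarrow> 's) \<Rightarrow> real) \<Rightarrow> real" where
  "tform X B v w = (\<Sum>I\<in>PiE UNIV X. \<Sum>J\<in>PiE UNIV X. (\<Prod>i\<in>UNIV. B i (I i) (J i)) * v I * w J)"

definition tapp :: "('d::finite \<Rightarrow> 's set) \<Rightarrow> ('d \<Rightarrow> 's \<Rightarrow> 's \<Rightarrow> real) \<Rightarrow> (('d \<Rightarrow> 's) \<Rightarrow> real) \<Rightarrow> ('d \<Rightarrow> 's) \<Rightarrow> real" where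
  "tapp X K v I = (\<Sum>J\<in>PiE UNIV X. (\<Prod>i\<in>UNIV. K i (I i) (J i)) * v J)"

text \<open>The matrix K^T B K.\<close>

definition pull :: "'s set \<Rightarrow> ('s \<Rightarrow> 's \<Rightarrow> real) \<Rightarrow> ('s \<Rightarrow> 's \<Rightarrow> real) \<Rightarrow> 's \<Rightarrow> 's \<Rightarrow> real" where
  "pull X B K s t = (\<Sum>p\<in>X. \<Sum>q\<in>X. B p q * K p s * K q t)"

lemma finite_PiE_UNIV: "(\<And>i. finite (X i)) \<Longrightarrow> finite (PiE UNIV X)" for X :: "'d::finite \<Rightarrow> 's set"
  by (intro finite_PiE) auto

lemma prod_sum_PiE_UNIV:
  fixes f :: "'d::finite \<Rightarrow> 's \<Rightarrow> real"
  assumes "\<And>i. finite (X i)"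
  shows "(\<Prod>i\<in>UNIV. \<Sum>s\<in>X i. f i s) = (\<Sum>I\<in>PiE UNIV X. \<Prod>i\<in>UNIV. f i (I i))"
  by (rule prod_sum_PiE) (auto simp: assms)

text \<open>Gram factors of the single directions multiply to Gram factors of the tensor product, so
  the form is a sum of squares over the tuples \<open>P\<close>.\<close>

lemma tform_psd:
  assumes fin: "\<And>i. finite (X i)" and B: "\<And>i. psd (X i) (B i)"
  shows "0 \<le> tform X B v v"
proof -
  have "\<forall>i. \<exists>g. \<forall>s\<in>X i. \<forall>t\<in>X i. B i s t = (\<Sum>p\<in>X i. g p s * g p t)"
    using psd_gram[OF fin B] by blast
  then obtain g where g: "\<And>i s t. s \<in> X i \<Longrightarrow> t \<in> X i \<Longrightarrow> B i s t = (\<Sum>p\<in>X i. g i p s * g i p t)" by metis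
  let ?U = "PiE UNIV X"
  have "tform X B v v = (\<Sum>I\<in>?U. \<Sum>J\<in>?U. (\<Sum>P\<in>?U. \<Prod>i\<in>UNIV. g i (P i) (I i) * g i (P i) (J i)) * v I * v J)"
    unfolding tform_def
  proof (intro sum.cong refl)
    fix I J assume "I \<in> ?U" "J \<in> ?U"
    then have "(\<Prod>i\<in>UNIV. B i (I i) (J i)) = (\<Prod>i\<in>UNIV. \<Sum>p\<in>X i. g i p (I i) * g i p (J i))"
      by (intro prod.cong refl g) auto
    then show "(\<Prod>i\<in>UNIV. B i (I i) (J i)) * v I * v J = (\<Sum>P\<in>?U. \<Prod>i\<in>UNIV. g i (P i) (I i) * g i (P i) (J i)) * v I * v J"
      by (simp add: prod_sum_PiE_UNIV[OF fin])
  qed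
  also have "\<dots> = (\<Sum>I\<in>?U. \<Sum>J\<in>?U. \<Sum>P\<in>?U. ((\<Prod>i\<in>UNIV. g i (P i) (I i)) * v I) * ((\<Prod>i\<in>UNIV. g i (P i) (J i)) * v J))"
    by (simp add: sum_distrib_left sum_distrib_right prod.distrib mult_ac)
  also have "\<dots> = (\<Sum>I\<in>?U. \<Sum>P\<in>?U. \<Sum>J\<in>?U. ((\<Prod>i\<in>UNIV. g i (P i) (I i)) * v I) * ((\<Prod>i\<in>UNIV. g i (P i) (J i)) * v J))"
    by (intro sum.cong refl sum.swap)
  also have "\<dots> = (\<Sum>P\<in>?U. \<Sum>I\<in>?U. \<Sum>J\<in>?U. ((\<Prod>i\<in>UNIV. g i (P i) (I i)) * v I) * ((\<Prod>i\<in>UNIV. g i (P i) (J i)) * v J))"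
    by (rule sum.swap)
  also have "\<dots> = (\<Sum>P\<in>?U. (\<Sum>I\<in>?U. (\<Prod>i\<in>UNIV. g i (P i) (I i)) * v I)\<^sup>2)"
    by (simp add: power2_eq_square sum_product)
  also have "\<dots> \<ge> 0" by (intro sum_nonneg) auto
  finally show ?thesis .
qed

lemma prod_split: "(\<Prod>i\<in>UNIV. f i) = f j * (\<Prod>i\<in>UNIV - {j}. f i)" for f :: "'d::finite \<Rightarrow> real"
  by (rule prod.remove) auto

lemma tform_upd_diff:
  "tform X (B(j := B1)) v w - tform X (B(j := B2)) v w = tform X (B(j := \<lambda>s t. B1 s t - B2 s t)) v w"
proof -
  have "(\<Prod>i\<in>UNIV. (B(j := B1)) i (I i) (J i)) - (\<Prod>i\<in>UNIV. (B(j := B2)) i (I i) (J i))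
     = (\<Prod>i\<in>UNIV. (B(j := \<lambda>s t. B1 s t - B2 s t)) i (I i) (J i))" for I J
    by (simp add: prod_split[where j = j] left_diff_distrib)
  note e = this[symmetric]
  show ?thesis unfolding tform_def e left_diff_distrib sum_subtractf ..
qed

lemma tapp_upd_diff:
  "tapp X (K(j := K1)) v I - tapp X (K(j := K2)) v I = tapp X (K(j := \<lambda>s t. K1 s t - K2 s t)) v I"
proof -
  have "(\<Prod>i\<in>UNIV. (K(j := K1)) i (I i) (J i)) - (\<Prod>i\<in>UNIV. (K(j := K2)) i (I i) (J i))
     = (\<Prod>i\<in>UNIV. (K(j := \<lambda>s t. K1 s t - K2 s t)) i (I i) (J i))" for I J
    by (simp add: prod_split[where j = j] left_diff_distrib)
  note e = this[symmetric]
  show ?thesis unfolding tapp_def e left_diff_distrib sum_subtractf ..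
qed

text \<open>The factors are exchanged one at a time. In each step the difference is a tensor form
  with a semidefinite factor in every slot, so only comparisons in one dimension enter.\<close>

lemma tform_mono:
  fixes X :: "'d::finite \<Rightarrow> 's set"
  assumes fin: "\<And>i. finite (X i)" and B: "\<And>i. psd (X i) (B i)" and B': "\<And>i. psd (X i) (B' i)"
    and le: "\<And>i. psd (X i) (\<lambda>s t. B' i s t - B i s t)"
  shows "tform X B v v \<le> tform X B' v v"
proof -
  have "finite S \<Longrightarrow> tform X B v v \<le> tform X (\<lambda>i. if i \<in> S then B' i else B i) v v" for S
  proof (induction S rule: finite_induct)
    case (insert j S)
    define H where "H i = (if i \<in> S then B' i else B i)" for i
    have 1: "(\<lambda>i. if i \<in> insert j S then B' i else B i) = H(j := B' j)" by (auto simp: H_def)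
    have 2: "(\<lambda>i. if i \<in> S then B' i else B i) = H(j := B j)" using insert.hyps by (auto simp: H_def fun_eq_iff)
    have "0 \<le> tform X (H(j := \<lambda>s t. B' j s t - B j s t)) v v"
      by (rule tform_psd[OF fin]) (auto simp: H_def B B' le)
    then show ?case using insert.IH unfolding 1 2 tform_upd_diff[symmetric] by simp
  qed simp
  from this[of UNIV] show ?thesis by simp
qed

lemma tform_scale: "tform X (\<lambda>i s t. c i * B i s t) v w = (\<Prod>i\<in>UNIV. c i) * tform X B v w"
  unfolding tform_def by (simp add: prod.distrib sum_distrib_left mult_ac)

lemma psd_scale: "0 \<le> c \<Longrightarrow> psd X B \<Longrightarrow> psd X (\<lambda>s t. c * B s t)"
  unfolding psd_def qf_def by (auto simp: mult.assoc sum_distrib_left[symmetric])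

lemma tform_mono_scale:
  fixes X :: "'d::finite \<Rightarrow> 's set"
  assumes "\<And>i. finite (X i)" "\<And>i. psd (X i) (B i)" "\<And>i. psd (X i) (B' i)" "\<And>i. 0 \<le> c i"
    and "\<And>i. psd (X i) (\<lambda>s t. c i * B' i s t - B i s t)"
  shows "tform X B v v \<le> (\<Prod>i\<in>UNIV. c i) * tform X B' v v"
  using tform_mono[of X B "\<lambda>i s t. c i * B' i s t" v] assms by (simp add: tform_scale psd_scale)

lemma tform_sym:
  assumes "\<And>i s t. s \<in> X i \<Longrightarrow> t \<in> X i \<Longrightarrow> B i s t = B i t s"
  shows "tform X B v w = tform X B w v"
proof -
  have "tform X B v w = (\<Sum>I\<in>PiE UNIV X. \<Sum>J\<in>PiE UNIV X. (\<Prod>i\<in>UNIV. B i (J i) (I i)) * w J * v I)"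
    unfolding tform_def
  proof (intro sum.cong refl)
    fix I J assume "I \<in> PiE UNIV X" "J \<in> PiE UNIV X"
    then have "(\<Prod>i\<in>UNIV. B i (I i) (J i)) = (\<Prod>i\<in>UNIV. B i (J i) (I i))" by (intro prod.cong refl assms) auto
    then show "(\<Prod>i\<in>UNIV. B i (I i) (J i)) * v I * w J = (\<Prod>i\<in>UNIV. B i (J i) (I i)) * w J * v I" by simp
  qed
  also have "\<dots> = tform X B w v" unfolding tform_def by (rule sum.swap)
  finally show ?thesis .
qed

lemma tform_add_left: "tform X B (\<lambda>I. v I + w I) u = tform X B v u + tform X B w u"
  unfolding tform_def by (simp add: distrib_left distrib_right sum.distrib)

lemma tform_add_right: "tform X B u (\<lambda>I. v I + w I) = tform X B u v + tform X B u w"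
  unfolding tform_def by (simp add: distrib_left distrib_right sum.distrib)

lemma tform_diff_left: "tform X B (\<lambda>I. v I - w I) u = tform X B v u - tform X B w u"
  unfolding tform_def by (simp add: right_diff_distrib left_diff_distrib sum_subtractf)

lemma tform_diff_right: "tform X B u (\<lambda>I. v I - w I) = tform X B u v - tform X B u w"
  unfolding tform_def by (simp add: right_diff_distrib left_diff_distrib sum_subtractf)

lemma tform_parallelogram:
  assumes "\<And>i. finite (X i)" "\<And>i. psd (X i) (B i)"
  shows "tform X B (\<lambda>I. v I + w I) (\<lambda>I. v I + w I) \<le> 2 * tform X B v v + 2 * tform X B w w"
proof -
  have "0 \<le> tform X B (\<lambda>I. v I - w I) (\<lambda>I. v I - w I)" by (rule tform_psd) (fact assms)+
  then show ?thesis by (simp add: tform_add_left tform_add_right tform_diff_left tform_diff_right)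
qed

lemma tform_cong: "(\<And>I. I \<in> PiE UNIV X \<Longrightarrow> v I = v' I) \<Longrightarrow> (\<And>I. I \<in> PiE UNIV X \<Longrightarrow> w I = w' I) \<Longrightarrow> tform X B v w = tform X B v' w'"
  unfolding tform_def by (intro sum.cong) auto

lemma tform_tapp:
  fixes X :: "'d::finite \<Rightarrow> 's set"
  assumes fin: "\<And>i. finite (X i)"
  shows "tform X B (tapp X K v) (tapp X K v) = tform X (\<lambda>i. pull (X i) (B i) (K i)) v v"
proof -
  let ?U = "PiE UNIV X"
  let ?b = "\<lambda>P Q. \<Prod>i\<in>UNIV. B i (P i) (Q i)" and ?k = "\<lambda>P I. \<Prod>i\<in>UNIV. K i (P i) (I i)"
  have pl: "(\<Prod>i\<in>UNIV. pull (X i) (B i) (K i) (I i) (J i)) = (\<Sum>P\<in>?U. \<Sum>Q\<in>?U. ?b P Q * ?k P I * ?k Q J)" for I J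
  proof -
    have "(\<Prod>i\<in>UNIV. pull (X i) (B i) (K i) (I i) (J i))
       = (\<Sum>P\<in>?U. \<Prod>i\<in>UNIV. \<Sum>q\<in>X i. B i (P i) q * K i (P i) (I i) * K i q (J i))"
      unfolding pull_def by (rule prod_sum_PiE_UNIV[OF fin])
    also have "\<dots> = (\<Sum>P\<in>?U. \<Sum>Q\<in>?U. \<Prod>i\<in>UNIV. B i (P i) (Q i) * K i (P i) (I i) * K i (Q i) (J i))"
      by (intro sum.cong refl prod_sum_PiE_UNIV[OF fin])
    finally show ?thesis by (simp add: prod.distrib)
  qed
  have "tform X (\<lambda>i. pull (X i) (B i) (K i)) v v
      = (\<Sum>I\<in>?U. \<Sum>J\<in>?U. \<Sum>P\<in>?U. \<Sum>Q\<in>?U. ?b P Q * (?k P I * v I) * (?k Q J * v J))"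
    unfolding tform_def pl by (simp add: sum_distrib_left sum_distrib_right mult_ac)
  also have "\<dots> = (\<Sum>I\<in>?U. \<Sum>P\<in>?U. \<Sum>J\<in>?U. \<Sum>Q\<in>?U. ?b P Q * (?k P I * v I) * (?k Q J * v J))"
    by (intro sum.cong refl sum.swap)
  also have "\<dots> = (\<Sum>P\<in>?U. \<Sum>I\<in>?U. \<Sum>J\<in>?U. \<Sum>Q\<in>?U. ?b P Q * (?k P I * v I) * (?k Q J * v J))"
    by (rule sum.swap)
  also have "\<dots> = (\<Sum>P\<in>?U. \<Sum>I\<in>?U. \<Sum>Q\<in>?U. \<Sum>J\<in>?U. ?b P Q * (?k P I * v I) * (?k Q J * v J))"
    by (intro sum.cong refl sum.swap)
  also have "\<dots> = (\<Sum>P\<in>?U. \<Sum>Q\<in>?U. \<Sum>I\<in>?U. \<Sum>J\<in>?U. ?b P Q * (?k P I * v I) * (?k Q J * v J))"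
    by (intro sum.cong refl sum.swap)
  also have "\<dots> = (\<Sum>P\<in>?U. \<Sum>Q\<in>?U. ?b P Q * tapp X K v P * tapp X K v Q)"
  proof (intro sum.cong refl)
    fix P Q
    have "?b P Q * tapp X K v P * tapp X K v Q = ?b P Q * (\<Sum>I\<in>?U. \<Sum>J\<in>?U. (?k P I * v I) * (?k Q J * v J))"
      unfolding tapp_def mult.assoc sum_product by simp
    then show "(\<Sum>I\<in>?U. \<Sum>J\<in>?U. ?b P Q * (?k P I * v I) * (?k Q J * v J)) = ?b P Q * tapp X K v P * tapp X K v Q"
      by (simp add: sum_distrib_left mult_ac)
  qed
  finally show ?thesis unfolding tform_def by simp
qed

lemma tform_product:
  assumes fin: "\<And>i. finite (X i)"
  shows "tform X B (\<lambda>I. \<Prod>i\<in>UNIV. c i (I i)) (\<lambda>I. \<Prod>i\<in>UNIV. c i (I i)) = (\<Prod>i\<in>UNIV. qf (X i) (B i) (c i))"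
  unfolding tform_def qf_def prod_sum_PiE_UNIV[OF fin] by (simp add: prod.distrib)

lemma tform_subset:
  fixes X :: "'d::finite \<Rightarrow> 's set"
  assumes "\<And>i. finite (X i)" "\<And>i. Y i \<subseteq> X i"
    and "\<And>I. I \<in> PiE UNIV X \<Longrightarrow> I \<notin> PiE UNIV Y \<Longrightarrow> v I = 0" "\<And>I. I \<in> PiE UNIV X \<Longrightarrow> I \<notin> PiE UNIV Y \<Longrightarrow> w I = 0"
  shows "tform X B v w = tform Y B v w"
proof -
  have sub: "PiE UNIV Y \<subseteq> PiE UNIV X" using assms(2) by (intro PiE_mono) auto
  note mn = sum.mono_neutral_right[OF finite_PiE_UNIV[of X, OF assms(1)] sub]
  have "tform X B v w = (\<Sum>I\<in>PiE UNIV Y. \<Sum>J\<in>PiE UNIV X. (\<Prod>i\<in>UNIV. B i (I i) (J i)) * v I * w J)"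
    unfolding tform_def by (rule mn) (use assms(3) in \<open>intro ballI sum.neutral, simp\<close>)
  also have "\<dots> = tform Y B v w"
    unfolding tform_def by (intro sum.cong refl mn) (use assms(4) in simp)
  finally show ?thesis .
qed

subsection \<open>Kronecker sums\<close>

definition slot :: "'d \<Rightarrow> ('d \<Rightarrow> 'b) \<Rightarrow> ('d \<Rightarrow> 'b) \<Rightarrow> 'd \<Rightarrow> 'b" where
  "slot i a m l = (if l = i then a l else m l)"

text \<open>The structure of a Laplacian on a box: one summand per direction, with the second-order
  form in that direction and masses in the others.\<close>

definition ksum :: "('d::finite \<Rightarrow> 's set) \<Rightarrow> ('d \<Rightarrow> 's \<Rightarrow> 's \<Rightarrow> real) \<Rightarrow> ('d \<Rightarrow> 's \<Rightarrow> 's \<Rightarrow> real) \<Rightarrow> (('d \<Rightarrow> 's) \<Rightarrow> real) \<Rightarrow> (('d \<Rightarrow> 's) \<Rightarrow> real) \<Rightarrow> real" where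
  "ksum X a m v w = (\<Sum>i\<in>UNIV. tform X (slot i a m) v w)"

text \<open>The form a M^-1 a with M = diag \<mu>, of twice the order of \<open>a\<close> (for
  symmetric \<open>a\<close>).\<close>

definition sqform :: "'s set \<Rightarrow> ('s \<Rightarrow> real) \<Rightarrow> ('s \<Rightarrow> 's \<Rightarrow> real) \<Rightarrow> 's \<Rightarrow> 's \<Rightarrow> real" where
  "sqform X \<mu> a s t = (\<Sum>u\<in>X. a u s * a u t / \<mu> u)"

definition resid :: "('d::finite \<Rightarrow> 's set) \<Rightarrow> ('d \<Rightarrow> 's \<Rightarrow> 's \<Rightarrow> real) \<Rightarrow> ('d \<Rightarrow> 's \<Rightarrow> 's \<Rightarrow> real) \<Rightarrow> (('d \<Rightarrow> 's) \<Rightarrow> real) \<Rightarrow> ('d \<Rightarrow> 's) \<Rightarrow> real" where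
  "resid X a m v I = (\<Sum>i\<in>UNIV. tapp X (slot i a m) v I)"

text \<open>The (i, j) summand of A M^-1 A for the Kronecker sum A. In every slot M^-1 cancels one
  factor \<open>m\<close>; this leaves \<open>a\<close> in two slots, or \<open>sqform\<close> in
  one when the two coincide.\<close>

definition mixed :: "('d::finite \<Rightarrow> 's set) \<Rightarrow> ('d \<Rightarrow> 's \<Rightarrow> real) \<Rightarrow> ('d \<Rightarrow> 's \<Rightarrow> 's \<Rightarrow> real) \<Rightarrow> ('d \<Rightarrow> 's \<Rightarrow> 's \<Rightarrow> real) \<Rightarrow> 'd \<Rightarrow> 'd \<Rightarrow> 'd \<Rightarrow> 's \<Rightarrow> 's \<Rightarrow> real" where
  "mixed X \<mu> a m i j l = (if l = i \<and> l = j then sqform (X l) (\<mu> l) (a l) else if l = i \<or> l = j then a l else m l)"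

lemma qf_sqform: "qf X (sqform X \<mu> a) c = (\<Sum>u\<in>X. (\<Sum>s\<in>X. a u s * c s)\<^sup>2 / \<mu> u)"
proof -
  have "qf X (sqform X \<mu> a) c = (\<Sum>s\<in>X. \<Sum>t\<in>X. \<Sum>u\<in>X. (a u s * c s) * (a u t * c t) / \<mu> u)"
    unfolding qf_def sqform_def by (simp add: sum_distrib_left sum_distrib_right mult_ac)
  also have "\<dots> = (\<Sum>s\<in>X. \<Sum>u\<in>X. \<Sum>t\<in>X. (a u s * c s) * (a u t * c t) / \<mu> u)"
    by (intro sum.cong refl sum.swap)
  also have "\<dots> = (\<Sum>u\<in>X. \<Sum>s\<in>X. \<Sum>t\<in>X. (a u s * c s) * (a u t * c t) / \<mu> u)" by (rule sum.swap)
  also have "\<dots> = (\<Sum>u\<in>X. (\<Sum>s\<in>X. a u s * c s)\<^sup>2 / \<mu> u)"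
    by (simp add: power2_eq_square sum_product sum_divide_distrib)
  finally show ?thesis .
qed

lemma psd_sqform: "(\<And>u. u \<in> X \<Longrightarrow> 0 < \<mu> u) \<Longrightarrow> psd X (sqform X \<mu> a)"
  unfolding psd_def qf_sqform
  by (auto simp: sqform_def mult.commute less_imp_le intro!: sum_nonneg divide_nonneg_nonneg)

lemma qf_pull: "qf X (pull X B K) c = qf X B (\<lambda>p. \<Sum>s\<in>X. K p s * c s)"
proof -
  have "qf X (pull X B K) c = (\<Sum>s\<in>X. \<Sum>t\<in>X. \<Sum>p\<in>X. \<Sum>q\<in>X. B p q * (K p s * c s) * (K q t * c t))"
    unfolding qf_def pull_def by (simp add: sum_distrib_left sum_distrib_right mult_ac)
  also have "\<dots> = (\<Sum>s\<in>X. \<Sum>p\<in>X. \<Sum>t\<in>X. \<Sum>q\<in>X. B p q * (K p s * c s) * (K q t * c t))"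
    by (intro sum.cong refl sum.swap)
  also have "\<dots> = (\<Sum>p\<in>X. \<Sum>s\<in>X. \<Sum>t\<in>X. \<Sum>q\<in>X. B p q * (K p s * c s) * (K q t * c t))"
    by (rule sum.swap)
  also have "\<dots> = (\<Sum>p\<in>X. \<Sum>s\<in>X. \<Sum>q\<in>X. \<Sum>t\<in>X. B p q * (K p s * c s) * (K q t * c t))"
    by (intro sum.cong refl sum.swap)
  also have "\<dots> = (\<Sum>p\<in>X. \<Sum>q\<in>X. \<Sum>s\<in>X. \<Sum>t\<in>X. B p q * (K p s * c s) * (K q t * c t))"
    by (intro sum.cong refl sum.swap)
  also have "\<dots> = qf X B (\<lambda>p. \<Sum>s\<in>X. K p s * c s)"
    unfolding qf_def mult.assoc sum_product by (simp add: sum_distrib_left sum_distrib_right mult_ac)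
  finally show ?thesis .
qed

lemma pull_sym: "(\<And>s t. s \<in> X \<Longrightarrow> t \<in> X \<Longrightarrow> B s t = B t s) \<Longrightarrow> pull X B K s t = pull X B K t s"
proof -
  assume B: "\<And>s t. s \<in> X \<Longrightarrow> t \<in> X \<Longrightarrow> B s t = B t s"
  have "pull X B K s t = (\<Sum>q\<in>X. \<Sum>p\<in>X. B p q * K p s * K q t)" unfolding pull_def by (rule sum.swap)
  also have "\<dots> = pull X B K t s" unfolding pull_def
  proof (intro sum.cong refl)
    fix p q assume "p \<in> X" "q \<in> X"
    then show "B q p * K q s * K p t = B p q * K p t * K q s" using B[of q p] by simp
  qed
  finally show ?thesis .
qed

lemma psd_pull: "psd X B \<Longrightarrow> psd X (pull X B K)"
  unfolding psd_def qf_pull using pull_sym[of X B K] by blast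

lemma psd_diag: "finite X \<Longrightarrow> (\<And>u. u \<in> X \<Longrightarrow> 0 < \<mu> u) \<Longrightarrow> psd X (\<lambda>s t. if s = t then \<mu> s else (0::real))"
proof -
  assume a: "finite X" "\<And>u. u \<in> X \<Longrightarrow> 0 < \<mu> u"
  have "qf X (\<lambda>s t. if s = t then \<mu> s else 0) c = (\<Sum>s\<in>X. \<mu> s * (c s)\<^sup>2)" for c
    unfolding qf_def
  proof (intro sum.cong refl)
    fix s assume "s \<in> X"
    have "(\<Sum>t\<in>X. (if s = t then \<mu> s else 0) * c s * c t) = (\<Sum>t\<in>X. if t = s then \<mu> s * (c s)\<^sup>2 else 0)"
      by (intro sum.cong) (auto simp: power2_eq_square)
    then show "(\<Sum>t\<in>X. (if s = t then \<mu> s else 0) * c s * c t) = \<mu> s * (c s)\<^sup>2" using a \<open>s \<in> X\<close> by simp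
  qed
  then show ?thesis using a by (auto simp: psd_def less_imp_le intro!: sum_nonneg)
qed

lemma ksum_resid_sym:
  assumes "\<And>i s t. s \<in> X i \<Longrightarrow> t \<in> X i \<Longrightarrow> a i s t = a i t s"
    and "\<And>i s t. s \<in> X i \<Longrightarrow> t \<in> X i \<Longrightarrow> m i s t = m i t s"
  shows "ksum X a m v w = (\<Sum>I\<in>PiE UNIV X. w I * resid X a m v I)"
proof -
  have "tform X (slot i a m) v w = (\<Sum>I\<in>PiE UNIV X. w I * tapp X (slot i a m) v I)" for i
  proof -
    have "tform X (slot i a m) v w = tform X (slot i a m) w v"
    proof (rule tform_sym)
      fix l s t assume "s \<in> X l" "t \<in> X l"
      then show "slot i a m l s t = slot i a m l t s" using assms[of s l t] by (cases "l = i") (simp_all add: slot_def)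
    qed
    then show ?thesis unfolding tform_def tapp_def by (simp add: sum_distrib_left mult_ac)
  qed
  then show ?thesis unfolding ksum_def resid_def by (simp add: sum_distrib_left) (rule sum.swap)
qed

section \<open>Residuals of Kronecker sums with diagonal mass\<close>

locale kron =
  fixes X :: "'d::finite \<Rightarrow> 's set" and \<mu> :: "'d \<Rightarrow> 's \<Rightarrow> real" and a m :: "'d \<Rightarrow> 's \<Rightarrow> 's \<Rightarrow> real"
  assumes fin: "\<And>i. finite (X i)"
    and mu: "\<And>i s. s \<in> X i \<Longrightarrow> 0 < \<mu> i s"
    and m_eq: "\<And>i s t. s \<in> X i \<Longrightarrow> t \<in> X i \<Longrightarrow> m i s t = (if s = t then \<mu> i s else 0)"
    and a_psd: "\<And>i. psd (X i) (a i)"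
begin

lemma m_psd: "psd (X i) (m i)"
proof -
  have "qf (X i) (m i) c = qf (X i) (\<lambda>s t. if s = t then \<mu> i s else 0) c" for c
    unfolding qf_def by (intro sum.cong) (auto simp: m_eq)
  moreover have "psd (X i) (\<lambda>s t. if s = t then \<mu> i s else 0)" by (rule psd_diag[OF fin mu])
  ultimately show ?thesis unfolding psd_def by (simp add: m_eq)
qed

lemma mixed_psd: "psd (X l) (mixed X \<mu> a m i j l)"
  by (auto simp: mixed_def m_psd a_psd psd_sqform mu)

lemma slot_psd: "psd (X l) (slot i a m l)"
  by (simp add: slot_def m_psd a_psd)

abbreviation "wt I \<equiv> \<Prod>l\<in>UNIV. \<mu> l (I l)"

text \<open>M^-1 is diagonal and a tensor product, so it acts slot by slot: two factors
  \<open>m\<close> combine to \<open>m\<close>, one \<open>m\<close> and one \<open>a\<close> to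
  \<open>a\<close>, two factors \<open>a\<close> to \<open>sqform\<close>.\<close>

lemma resid_square:
  "(\<Sum>I\<in>PiE UNIV X. (resid X a m v I)\<^sup>2 / wt I) = (\<Sum>i\<in>UNIV. \<Sum>j\<in>UNIV. tform X (mixed X \<mu> a m i j) v v)"
proof -
  let ?U = "PiE UNIV X"
  have one: "(\<Sum>I\<in>?U. tapp X (slot i a m) v I * tapp X (slot j a m) v I / wt I) = tform X (mixed X \<mu> a m i j) v v" for i j
  proof -
    let ?p = "\<lambda>i I J. \<Prod>l\<in>UNIV. slot i a m l (I l) (J l)"
    have "(\<Sum>I\<in>?U. tapp X (slot i a m) v I * tapp X (slot j a m) v I / wt I)
      = (\<Sum>I\<in>?U. \<Sum>J\<in>?U. \<Sum>J'\<in>?U. (?p i I J * ?p j I J' / wt I) * v J * v J')"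
      unfolding tapp_def sum_product sum_divide_distrib by (simp add: mult_ac)
    also have "\<dots> = (\<Sum>J\<in>?U. \<Sum>I\<in>?U. \<Sum>J'\<in>?U. (?p i I J * ?p j I J' / wt I) * v J * v J')"
      by (rule sum.swap)
    also have "\<dots> = (\<Sum>J\<in>?U. \<Sum>J'\<in>?U. \<Sum>I\<in>?U. (?p i I J * ?p j I J' / wt I) * v J * v J')"
      by (intro sum.cong refl sum.swap)
    also have "\<dots> = tform X (mixed X \<mu> a m i j) v v"
      unfolding tform_def
    proof (intro sum.cong refl)
      fix J J' assume J: "J \<in> ?U" "J' \<in> ?U"
      have "(\<Sum>I\<in>?U. ?p i I J * ?p j I J' / wt I) = (\<Prod>l\<in>UNIV. \<Sum>s\<in>X l. slot i a m l s (J l) * slot j a m l s (J' l) / \<mu> l s)"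
        unfolding prod_sum_PiE_UNIV[OF fin] by (simp add: prod.distrib prod_dividef)
      also have "\<dots> = (\<Prod>l\<in>UNIV. mixed X \<mu> a m i j l (J l) (J' l))"
      proof (intro prod.cong refl)
        fix l
        have Jl: "J l \<in> X l" "J' l \<in> X l" using J by auto
        have mm: "(\<Sum>s\<in>X l. m l s t * f s / \<mu> l s) = f t" if "t \<in> X l" for t f
        proof -
          have "(\<Sum>s\<in>X l. m l s t * f s / \<mu> l s) = (\<Sum>s\<in>X l. if s = t then f s else 0)"
            using that mu[of _ l] by (intro sum.cong) (auto simp: m_eq less_imp_neq[symmetric])
          then show ?thesis using that fin by simp
        qed
        have mm': "(\<Sum>s\<in>X l. f s * m l s t / \<mu> l s) = f t" if "t \<in> X l" for t f
          using mm[OF that, of f] by (simp add: mult.commute)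
        have sym: "a l s t = a l t s" if "s \<in> X l" "t \<in> X l" for s t by (rule psd_sym[OF a_psd that])
        have msym: "m l s t = m l t s" if "s \<in> X l" "t \<in> X l" for s t using that by (auto simp: m_eq)
        show "(\<Sum>s\<in>X l. slot i a m l s (J l) * slot j a m l s (J' l) / \<mu> l s) = mixed X \<mu> a m i j l (J l) (J' l)"
          using Jl mm[OF Jl(1)] mm'[OF Jl(2)] sym[OF Jl] msym[OF Jl] by (auto simp: slot_def mixed_def sqform_def)
      qed
      finally show "(\<Sum>I\<in>?U. ?p i I J * ?p j I J' / wt I * v J * v J') = (\<Prod>l\<in>UNIV. mixed X \<mu> a m i j l (J l) (J' l)) * v J * v J'"
        by (simp only: sum_distrib_right[symmetric])
    qed
    finally show ?thesis .
  qed
  have "(\<Sum>I\<in>?U. (resid X a m v I)\<^sup>2 / wt I)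
      = (\<Sum>I\<in>?U. \<Sum>i\<in>UNIV. \<Sum>j\<in>UNIV. tapp X (slot i a m) v I * tapp X (slot j a m) v I / wt I)"
    unfolding resid_def power2_eq_square sum_product sum_divide_distrib ..
  also have "\<dots> = (\<Sum>i\<in>UNIV. \<Sum>I\<in>?U. \<Sum>j\<in>UNIV. tapp X (slot i a m) v I * tapp X (slot j a m) v I / wt I)"
    by (rule sum.swap)
  also have "\<dots> = (\<Sum>i\<in>UNIV. \<Sum>j\<in>UNIV. \<Sum>I\<in>?U. tapp X (slot i a m) v I * tapp X (slot j a m) v I / wt I)"
    by (intro sum.cong refl sum.swap)
  finally show ?thesis unfolding one .
qed

text \<open>The substitute for elliptic regularity: all second derivatives, mixed ones included, are
  controlled by the discrete Laplacian because every summand of \<open>resid_square\<close> is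
  nonnegative.\<close>

lemma mixed_le_resid: "tform X (mixed X \<mu> a m i j) v v \<le> (\<Sum>I\<in>PiE UNIV X. (resid X a m v I)\<^sup>2 / wt I)"
proof -
  have nn: "0 \<le> tform X (mixed X \<mu> a m i j) v v" for i j by (rule tform_psd[OF fin mixed_psd])
  have "tform X (mixed X \<mu> a m i j) v v \<le> (\<Sum>j\<in>UNIV. tform X (mixed X \<mu> a m i j) v v)"
    using nn by (intro member_le_sum) auto
  also have "\<dots> \<le> (\<Sum>i\<in>UNIV. \<Sum>j\<in>UNIV. tform X (mixed X \<mu> a m i j) v v)"
    using nn by (intro member_le_sum[where f = "\<lambda>i. \<Sum>j\<in>UNIV. tform X (mixed X \<mu> a m i j) v v"] sum_nonneg) auto
  finally show ?thesis unfolding resid_square .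
qed

text \<open>The identity minus the tensor cut telescopes into terms with \<open>Q\<close> in one
  slot, \<open>Pm\<close> in the slots treated before and the identity in the rest. In the summand
  of \<open>ksum\<close> for direction i, the term with \<open>Q\<close> in slot j is bounded by
  \<kappa> times \<open>mixed i j\<close> up to powers of \<open>C\<close>: slot j rises by one
  order, from \<open>m\<close> to \<open>a\<close> or, for i = j, from \<open>a\<close> to
  \<open>sqform\<close>.\<close>

lemma tensor_cut_error:
  fixes Pm Q :: "'d \<Rightarrow> 's \<Rightarrow> 's \<Rightarrow> real" and v :: "('d \<Rightarrow> 's) \<Rightarrow> real"
  assumes C: "1 \<le> C" and \<kappa>: "0 \<le> \<kappa>"
    and Q: "\<And>l s t. Q l s t = (if s = t then 1 else 0) - Pm l s t"
    and H1: "\<And>l. psd (X l) (\<lambda>s t. C * m l s t - pull (X l) (m l) (Pm l) s t)"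
    and H2: "\<And>l. psd (X l) (\<lambda>s t. C * a l s t - pull (X l) (a l) (Pm l) s t)"
    and H3: "\<And>l. psd (X l) (\<lambda>s t. \<kappa> * C * a l s t - pull (X l) (m l) (Q l) s t)"
    and H4: "\<And>l. psd (X l) (\<lambda>s t. \<kappa> * C * sqform (X l) (\<mu> l) (a l) s t - pull (X l) (a l) (Q l) s t)"
  defines "e \<equiv> \<lambda>I. v I - tapp X Pm v I"
  shows "ksum X a m e e \<le> real CARD('d) * (2 ^ (CARD('d) + 1) * \<kappa> * C ^ CARD('d)) * (\<Sum>I\<in>PiE UNIV X. (resid X a m v I)\<^sup>2 / wt I)"
proof -
  define \<rho> where "\<rho> = (\<Sum>I\<in>PiE UNIV X. (resid X a m v I)\<^sup>2 / wt I)"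
  have \<rho>0: "0 \<le> \<rho>" unfolding \<rho>_def
    by (intro sum_nonneg divide_nonneg_nonneg prod_nonneg less_imp_le[OF mu] ballI) auto
  define D :: "'s \<Rightarrow> 's \<Rightarrow> real" where "D s t = (if s = t then 1 else 0)" for s t
  have pullD: "pull (X l) B D s t = B s t" if "s \<in> X l" "t \<in> X l" for l B s t
  proof -
    have "pull (X l) B D s t = (\<Sum>p\<in>X l. if p = s then (\<Sum>q\<in>X l. if q = t then B p q else 0) else 0)"
      unfolding pull_def D_def by (intro sum.cong refl) (auto intro!: sum.cong)
    then show ?thesis using that fin by simp
  qed
  have psd_cong: "psd Y B \<Longrightarrow> (\<And>s t. s \<in> Y \<Longrightarrow> t \<in> Y \<Longrightarrow> B' s t = B s t) \<Longrightarrow> psd Y B'" for Y :: "'s set" and B B'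
    unfolding psd_def qf_def by simp
  \<comment> \<open>\<open>S\<close> collects the slots already cut; \<open>KQ j S\<close> is the
    change made by cutting slot j as well.\<close>
  define K where "K S l = (if l \<in> S then Pm l else D)" for S l
  define KQ where "KQ j S l = (if l = j then Q j else K S l)" for j S l
  define E where "E S I = v I - tapp X (K S) v I" for S I
  have step: "tform X (slot i a m) (tapp X (KQ j S) v) (tapp X (KQ j S) v) \<le> \<kappa> * C ^ CARD('d) * \<rho>" for i j S
  proof -
    define c where "c l = (if l = j then \<kappa> * C else C)" for l
    have "tform X (slot i a m) (tapp X (KQ j S) v) (tapp X (KQ j S) v)
       = tform X (\<lambda>l. pull (X l) (slot i a m l) (KQ j S l)) v v" by (rule tform_tapp[OF fin])
    also have "\<dots> \<le> (\<Prod>l\<in>UNIV. c l) * tform X (mixed X \<mu> a m i j) v v"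
    proof (rule tform_mono_scale[OF fin])
      show "psd (X l) (pull (X l) (slot i a m l) (KQ j S l))" for l by (rule psd_pull[OF slot_psd])
      show "psd (X l) (mixed X \<mu> a m i j l)" for l by (rule mixed_psd)
      show "0 \<le> c l" for l using C \<kappa> by (simp add: c_def)
      show "psd (X l) (\<lambda>s t. c l * mixed X \<mu> a m i j l s t - pull (X l) (slot i a m l) (KQ j S l) s t)" for l
      proof -
        consider "l = j" "l = i" | "l = j" "l \<noteq> i" | "l \<noteq> j" "l \<in> S" | "l \<noteq> j" "l \<notin> S" by blast
        then show ?thesis
        proof cases
          case 1 then show ?thesis using H4[of l] by (simp add: c_def mixed_def slot_def KQ_def)
        next
          case 2 then show ?thesis using H3[of l] by (simp add: c_def mixed_def slot_def KQ_def)
        next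
          case 3 then show ?thesis using H1[of l] H2[of l] by (auto simp: c_def mixed_def slot_def KQ_def K_def)
        next
          case 4
          \<comment> \<open>An untouched slot: the identity is pulled back to the same form, and 1
            \<le> \<open>C\<close> is enough.\<close>
          have "psd (X l) (\<lambda>s t. (C - 1) * slot i a m l s t)" using C by (intro psd_scale slot_psd) auto
          then show ?thesis
            by (rule psd_cong) (use 4 in \<open>auto simp: c_def mixed_def slot_def KQ_def K_def pullD left_diff_distrib\<close>)
        qed
      qed
    qed
    also have "(\<Prod>l\<in>UNIV. c l) = \<kappa> * C ^ CARD('d)"
    proof -
      have "(\<Prod>l\<in>UNIV. c l) = c j * (\<Prod>l\<in>UNIV - {j}. C)" unfolding prod_split[of c j] by (simp add: c_def)
      also have "\<dots> = \<kappa> * (C * C ^ (CARD('d) - 1))" by (simp add: c_def)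
      also have "C * C ^ (CARD('d) - 1) = C ^ CARD('d)" by (simp flip: power_Suc)
      finally show ?thesis .
    qed
    also have "\<kappa> * C ^ CARD('d) * tform X (mixed X \<mu> a m i j) v v \<le> \<kappa> * C ^ CARD('d) * \<rho>"
      unfolding \<rho>_def using C \<kappa> by (intro mult_left_mono mixed_le_resid) auto
    finally show ?thesis .
  qed
  define R where "R = \<kappa> * C ^ CARD('d) * \<rho>"
  have R0: "0 \<le> R" using C \<kappa> \<rho>0 by (simp add: R_def)
  \<comment> \<open>The parallelogram inequality gives the recursion t to 2 t + 2 R. Started at 0 it
    reaches (2^(s + 1) - 2) R after s slots.\<close>
  have bound: "finite S \<Longrightarrow> tform X (slot i a m) (E S) (E S) \<le> (2 ^ (card S + 1) - 2) * R" for i S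
  proof (induction S rule: finite_induct)
    case empty
    have "E {} I = 0" if "I \<in> PiE UNIV X" for I
    proof -
      have pD: "(\<Prod>l\<in>UNIV. D (I l) (J l)) = (if J = I then 1 else 0)" for J :: "'d \<Rightarrow> 's"
      proof (cases "J = I")
        case False
        then obtain l where "J l \<noteq> I l" by auto
        then have "D (I l) (J l) = 0" by (simp add: D_def)
        then have "(\<Prod>l\<in>UNIV. D (I l) (J l)) = 0" by (intro prod_zero) auto
        then show ?thesis using False by simp
      qed (simp add: D_def)
      have "tapp X (K {}) v I = (\<Sum>J\<in>PiE UNIV X. if J = I then v J else 0)"
        unfolding tapp_def K_def by (simp add: pD if_distrib[of "\<lambda>x. x * _"] cong: if_cong)
      then show ?thesis using that finite_PiE_UNIV[of X, OF fin] by (simp add: E_def)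
    qed
    then have "tform X (slot i a m) (E {}) (E {}) = 0" unfolding tform_def by (simp cong: sum.cong)
    then show ?case by simp
  next
    case (insert j S)
    have e: "E (insert j S) I = E S I + tapp X (KQ j S) v I" for I
    proof -
      have a1: "K S = (K S)(j := D)" and a2: "K (insert j S) = (K S)(j := Pm j)" and a3: "KQ j S = (K S)(j := \<lambda>s t. D s t - Pm j s t)"
        using insert.hyps by (auto simp: K_def KQ_def fun_eq_iff Q D_def)
      have "tapp X (K S) v I - tapp X (K (insert j S)) v I = tapp X (KQ j S) v I"
        unfolding a2 a3 by (subst a1) (rule tapp_upd_diff)
      then show ?thesis by (simp add: E_def)
    qed
    have "tform X (slot i a m) (E (insert j S)) (E (insert j S))
        \<le> 2 * tform X (slot i a m) (E S) (E S) + 2 * tform X (slot i a m) (tapp X (KQ j S) v) (tapp X (KQ j S) v)"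
      unfolding e by (rule tform_parallelogram[OF fin slot_psd])
    also have "\<dots> \<le> 2 * ((2 ^ (card S + 1) - 2) * R) + 2 * R"
      using insert.IH step[of i j S] by (simp add: R_def)
    also have "\<dots> = (2 ^ (card (insert j S) + 1) - 2) * R" using insert.hyps by (simp add: algebra_simps)
    finally show ?case .
  qed
  have "K UNIV = Pm" by (simp add: K_def fun_eq_iff)
  then have eE: "e = E UNIV" unfolding e_def E_def by simp
  have "tform X (slot i a m) e e \<le> 2 ^ (CARD('d) + 1) * R" for i
    using bound[where S = UNIV and i = i] R0 by (simp add: eE left_diff_distrib)
  then have "ksum X a m e e \<le> (\<Sum>i\<in>(UNIV::'d set). 2 ^ (CARD('d) + 1) * R)"
    unfolding ksum_def by (intro sum_mono) auto
  then show ?thesis by (simp add: R_def \<rho>_def mult_ac)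
qed

lemma ksum_resid: "ksum X a m v w = (\<Sum>I\<in>PiE UNIV X. w I * resid X a m v I)"
  by (rule ksum_resid_sym) (use a_psd m_psd in \<open>auto intro: psd_sym\<close>)

end

section \<open>Approximation property\<close>

definition ipm :: "nat \<Rightarrow> real \<Rightarrow> nat \<Rightarrow> nat \<times> nat \<Rightarrow> nat \<times> nat \<Rightarrow> real" where
  "ipm N \<alpha> k s t = ip N \<alpha> k (bas s) (bas t)"
definition mm :: "nat \<Rightarrow> nat \<times> nat \<Rightarrow> nat \<times> nat \<Rightarrow> real" where
  "mm N s t = mass N (bas s) (bas t)"
definition enm :: "nat \<Rightarrow> nat \<Rightarrow> nat \<times> nat \<Rightarrow> nat \<times> nat \<Rightarrow> real" where
  "enm N k s t = en N k (bas s) (bas t)"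
definition jm :: "nat \<Rightarrow> nat \<times> nat \<Rightarrow> nat \<times> nat \<Rightarrow> real" where
  "jm N s t = jmps N (bas s) (bas t)"
text \<open>The diagonal of \<open>mm\<close>. Diagonal masses in each direction are what makes the
  inverse of the full mass matrix explicit.\<close>

definition leg_weight :: "nat \<times> nat \<Rightarrow> real" where
  "leg_weight s = 1 / (2 * real (snd s) + 1)"

lemma qf_bilinear:
  assumes "\<And>y. F (rep N k c) y = (\<Sum>s\<in>idx N k. c s * F (bas s) y)" "\<And>x y. F x y = F y x"
  shows "qf (idx N k) (\<lambda>s t. F (bas s) (bas t)) c = F (rep N k c) (rep N k c)"
proof -
  have "F (bas s) (rep N k c) = (\<Sum>t\<in>idx N k. c t * F (bas s) (bas t))" for s
    using assms(1)[of "bas s"] by (simp only: assms(2)[of "bas s"])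
  then show ?thesis unfolding assms(1)[of "rep N k c"] qf_def by (simp add: sum_distrib_left mult_ac)
qed

lemma qf_ipm: "qf (idx N l) (ipm N \<alpha> k) c = ip N \<alpha> k (rep N l c) (rep N l c)"
  unfolding ipm_def by (rule qf_bilinear) (simp_all only: rep_def ip_sum_left, rule ip_sym)

lemma qf_mm: "qf (idx N k) (mm N) c = mass N (rep N k c) (rep N k c)"
  unfolding mm_def by (rule qf_bilinear) (simp_all only: rep_def mass_sum_left, rule mass_sym)

lemma qf_enm: "qf (idx N l) (enm N k) c = en N k (rep N l c) (rep N l c)"
  unfolding enm_def by (rule qf_bilinear) (simp_all only: rep_def en_sum_left, rule en_sym)

lemma qf_jm: "qf (idx N k) (jm N) c = jmps N (rep N k c) (rep N k c)"
  unfolding jm_def by (rule qf_bilinear) (simp_all only: rep_def jmps_sum_left, rule jmps_sym)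

lemma qf_sqform_ipm: "qf (idx N k) (sqform (idx N k) leg_weight (ipm N \<alpha> k)) c = sqf N \<alpha> k (rep N k c)"
proof -
  have "(\<Sum>s\<in>idx N k. ipm N \<alpha> k u s * c s) = ip N \<alpha> k (rep N k c) (bas u)" for u
    unfolding rep_def ip_sum_left ipm_def by (simp add: ip_sym[of N \<alpha> k "bas u"] mult.commute)
  then show ?thesis unfolding qf_sqform sqf_def by (simp add: leg_weight_def mult.commute)
qed

lemma psdI:
  assumes "\<And>s t. s \<in> X \<Longrightarrow> t \<in> X \<Longrightarrow> B s t = B t s" "\<And>c. 0 \<le> qf X B c"
  shows "psd X B"
  using assms unfolding psd_def by blast

lemma qf_diff: "qf X (\<lambda>s t. C * A s t - B s t) c = C * qf X A c - qf X B c"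
  unfolding qf_def by (simp add: left_diff_distrib sum_subtractf sum_distrib_left mult.assoc)

lemma sym_forms: "ipm N \<alpha> k s t = ipm N \<alpha> k t s" "mm N s t = mm N t s" "enm N k s t = enm N k t s"
  "jm N s t = jm N t s" "sqform X \<mu> a s t = sqform X \<mu> a t s"
  by (auto simp: ipm_def mm_def enm_def jm_def ip_sym mass_sym en_sym jmps_sym sqform_def mult.commute)

lemma psd_mm: "psd (idx N k) (mm N)"
  by (rule psdI) (rule sym_forms, simp add: qf_mm mass_nonneg)

lemma psd_enm: "psd (idx N l) (enm N k)"
  by (rule psdI) (rule sym_forms, simp add: qf_enm en_nonneg)

lemma psd_jm: "psd (idx N l) (jm N)"
  by (rule psdI) (rule sym_forms, simp add: qf_jm jmps_nonneg)

lemma psd_ipm: "(\<And>x. x \<in> bpoly N l \<Longrightarrow> 0 \<le> ip N \<alpha> k x x) \<Longrightarrow> psd (idx N l) (ipm N \<alpha> k)"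
  by (rule psdI) (rule sym_forms, simp add: qf_ipm)

text \<open>The matrix of \<open>bub k\<close> in Legendre coordinates: the column of a mode of
  degree k has 1 in its own row and -1 in the row of degree k - 2 of the same cell, all other
  columns vanish.\<close>

definition cutm :: "nat \<Rightarrow> nat \<times> nat \<Rightarrow> nat \<times> nat \<Rightarrow> real" where
  "cutm k s t = (if snd t = k then (if s = t then 1 else 0) - (if s = (fst t, k - 2) then 1 else 0) else 0)"

lemma cutm_apply:
  assumes "2 \<le> k" "s \<in> idx N k"
  shows "(\<Sum>t\<in>idx N k. cutm k s t * c t) = (if snd s = k then c s else 0) - (if snd s = k - 2 then c (fst s, k) else 0)"
proof -
  have "(\<Sum>t\<in>idx N k. cutm k s t * c t) = (\<Sum>t\<in>idx N k. (if t = s then (if snd s = k then c s else 0) else 0)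
      - (if t = (fst s, k) then (if snd s = k - 2 then c (fst s, k) else 0) else 0))"
    by (intro sum.cong refl) (auto simp: cutm_def prod_eq_iff)
  also have "\<dots> = (if snd s = k then c s else 0) - (if snd s = k - 2 then c (fst s, k) else 0)"
    unfolding sum_subtractf using assms by (auto simp: idx_def sum.delta)
  finally show ?thesis .
qed

lemma rep_cutm:
  assumes "2 \<le> k" "q < N"
  shows "rep N k (\<lambda>s. \<Sum>t\<in>idx N k. cutm k s t * c t) q = bub k (rep N k c) q"
proof -
  have "rep N k (\<lambda>s. \<Sum>t\<in>idx N k. cutm k s t * c t) q
      = (\<Sum>n\<le>k. Polynomial.smult ((if n = k then c (q, k) else 0) - (if n = k - 2 then c (q, k) else 0)) (legendre n))"
    unfolding rep_eq[OF assms(2)] using assms(2)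
    by (intro sum.cong refl) (subst cutm_apply[OF assms(1)], auto simp: idx_def)
  also have "\<dots> = (\<Sum>n\<le>k. (if n = k then Polynomial.smult (c (q, k)) (legendre k) else 0)
      - (if n = k - 2 then Polynomial.smult (c (q, k)) (legendre (k - 2)) else 0))"
    by (intro sum.cong refl) (auto simp: smult_diff_left)
  also have "\<dots> = Polynomial.smult (c (q, k)) (legendre k) - Polynomial.smult (c (q, k)) (legendre (k - 2))"
    unfolding sum_subtractf by (simp add: sum.delta)
  also have "\<dots> = bub k (rep N k c) q"
    unfolding bub_def lcoef_rep[OF assms(2) order.refl] by (simp add: smult_diff_right)
  finally show ?thesis .
qed

lemma rep_diff: "rep N k (\<lambda>s. c s - d s) q = rep N k c q - rep N k d q"
  by (simp add: rep_def smult_diff_left sum_subtractf)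

lemma rep_cong: "(\<And>s. s \<in> idx N k \<Longrightarrow> c s = d s) \<Longrightarrow> rep N k c = rep N k d"
  unfolding rep_def by (intro ext sum.cong) auto

lemma kron_level:
  assumes "\<And>i x. x \<in> bpoly (N i) k \<Longrightarrow> 0 \<le> ip (N i) \<alpha> k x x"
  shows "kron (\<lambda>i. idx (N i) k) (\<lambda>i. leg_weight) (\<lambda>i. ipm (N i) \<alpha> k) (\<lambda>i. mm (N i))"
proof
  show "mm (N i) s t = (if s = t then leg_weight s else 0)" if "s \<in> idx (N i) k" "t \<in> idx (N i) k" for i s t
    unfolding mm_def leg_weight_def by (rule mass_bas[OF that])
  show "psd (idx (N i) k) (ipm (N i) \<alpha> k)" for i by (rule psd_ipm) (rule assms)
qed (auto simp: leg_weight_def add_nonneg_pos)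

text \<open>The tensor product of the one-dimensional cuts has its values in degree \<open>k - 1\<close>.\<close>

lemma level_cut:
  fixes N :: "'d::finite \<Rightarrow> nat" and v :: "('d \<Rightarrow> nat \<times> nat) \<Rightarrow> real"
  assumes k: "2 \<le> k" and N: "\<And>i. 0 < N i" and \<gamma>: "0 < \<gamma>"
    and coer: "\<And>i x. x \<in> bpoly (N i) k \<Longrightarrow> \<gamma> * en (N i) k x x \<le> ip (N i) \<alpha> k x x"
  defines "X \<equiv> \<lambda>i. idx (N i) k" and "a \<equiv> \<lambda>i. ipm (N i) \<alpha> k" and "m \<equiv> \<lambda>i. mm (N i)"
    and "C \<equiv> 26 + 4 / \<gamma> + 1 / \<gamma> + 8 * (1 + 8 / \<gamma>\<^sup>2)"
  shows "\<exists>\<phi>. (\<forall>I\<in>PiE UNIV X. \<forall>i. snd (I i) = k \<longrightarrow> \<phi> I = 0) \<and>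
    ksum X a m (\<lambda>I. v I - \<phi> I) (\<lambda>I. v I - \<phi> I)
      \<le> real CARD('d) * (2 ^ (CARD('d) + 1) * (1 / (real k)\<^sup>2) * C ^ CARD('d)) * (\<Sum>I\<in>PiE UNIV X. (resid X a m v I)\<^sup>2 / (\<Prod>l\<in>UNIV. leg_weight (I l)))"
proof -
  have pos: "0 \<le> ip (N i) \<alpha> k x x" if "x \<in> bpoly (N i) k" for i x
    using coer[OF that] mult_nonneg_nonneg[OF less_imp_le[OF \<gamma>] en_nonneg[of "N i" k x]] by simp
  interpret kron X "\<lambda>i. leg_weight" a m
    unfolding X_def a_def m_def by (rule kron_level) (rule pos)
  define Pm where "Pm (l::'d) s t = (if s = t then 1 else 0) - cutm k s t" for l s t
  have Cs: "26 \<le> C" "2 + 4 / \<gamma> \<le> C" "1 / \<gamma> \<le> C" "8 * (1 + 8 / \<gamma>\<^sup>2) \<le> C"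
  proof -
    have "0 \<le> 1 / \<gamma>" "0 \<le> 1 / \<gamma>\<^sup>2" using \<gamma> by auto
    moreover have "C = 34 + 5 * (1 / \<gamma>) + 64 * (1 / \<gamma>\<^sup>2)" by (simp add: C_def)
    ultimately show "26 \<le> C" "2 + 4 / \<gamma> \<le> C" "1 / \<gamma> \<le> C" "8 * (1 + 8 / \<gamma>\<^sup>2) \<le> C"
      by (simp_all only: times_divide_eq_right[symmetric]) (simp_all add: C_def)
  qed
  have C1: "1 \<le> C" using Cs(1) by simp
  have PmX: "(\<Sum>t\<in>X l. Pm l s t * c t) = c s - (\<Sum>t\<in>X l. cutm k s t * c t)" if "s \<in> X l" for s l c
  proof -
    have "(\<Sum>t\<in>X l. Pm l s t * c t) = (\<Sum>t\<in>X l. (if t = s then c s else 0) - cutm k s t * c t)"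
      unfolding Pm_def by (intro sum.cong refl) (auto simp: left_diff_distrib)
    then show ?thesis using that fin by (simp add: sum_subtractf)
  qed
  have repP: "rep (N l) k (\<lambda>p. \<Sum>s\<in>X l. Pm l p s * c s) q = rep (N l) k c q - bub k (rep (N l) k c) q"
    if "q < N l" for l c q
  proof -
    have "rep (N l) k (\<lambda>p. \<Sum>s\<in>X l. Pm l p s * c s) = rep (N l) k (\<lambda>p. c p - (\<Sum>s\<in>X l. cutm k p s * c s))"
      by (rule rep_cong) (simp add: PmX[unfolded X_def] X_def)
    then show ?thesis using that by (simp add: rep_diff X_def rep_cutm[OF k])
  qed
  have massP: "mass (N l) (rep (N l) k (\<lambda>p. \<Sum>s\<in>X l. Pm l p s * c s)) (rep (N l) k (\<lambda>p. \<Sum>s\<in>X l. Pm l p s * c s))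
      = mass (N l) (\<lambda>q. rep (N l) k c q - bub k (rep (N l) k c) q) (\<lambda>q. rep (N l) k c q - bub k (rep (N l) k c) q)" for l c
    by (rule mass_cong) (simp_all only: repP)
  have ipP: "ip (N l) \<alpha> k (rep (N l) k (\<lambda>p. \<Sum>s\<in>X l. Pm l p s * c s)) (rep (N l) k (\<lambda>p. \<Sum>s\<in>X l. Pm l p s * c s))
      = ip (N l) \<alpha> k (\<lambda>q. rep (N l) k c q - bub k (rep (N l) k c) q) (\<lambda>q. rep (N l) k c q - bub k (rep (N l) k c) q)" for l c
    by (rule ip_cong) (simp_all only: repP N)
  have massQ: "mass (N l) (rep (N l) k (\<lambda>p. \<Sum>s\<in>X l. cutm k p s * c s)) (rep (N l) k (\<lambda>p. \<Sum>s\<in>X l. cutm k p s * c s))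
      = mass (N l) (bub k (rep (N l) k c)) (bub k (rep (N l) k c))" for l c
    unfolding X_def by (rule mass_cong) (simp_all only: rep_cutm[OF k])
  have ipQ: "ip (N l) \<alpha> k (rep (N l) k (\<lambda>p. \<Sum>s\<in>X l. cutm k p s * c s)) (rep (N l) k (\<lambda>p. \<Sum>s\<in>X l. cutm k p s * c s))
      = ip (N l) \<alpha> k (bub k (rep (N l) k c)) (bub k (rep (N l) k c))" for l c
    unfolding X_def by (rule ip_cong) (simp_all only: rep_cutm[OF k] N)
  note cb = cut_bounds[OF k N \<gamma> coer rep_bpoly]
  have qm: "qf (X l) (m l) c = mass (N l) (rep (N l) k c) (rep (N l) k c)" for l c
    by (simp add: X_def m_def qf_mm)
  have qa: "qf (X l) (a l) c = ip (N l) \<alpha> k (rep (N l) k c) (rep (N l) k c)" for l c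
    by (simp add: X_def a_def qf_ipm)
  have qs: "qf (X l) (sqform (X l) leg_weight (a l)) c = sqf (N l) \<alpha> k (rep (N l) k c)" for l c
    by (simp add: X_def a_def qf_sqform_ipm)
  have ipos: "0 \<le> ip (N l) \<alpha> k (rep (N l) k c) (rep (N l) k c)" for l c by (rule pos) simp
  have sqpos: "0 \<le> sqf (N l) \<alpha> k (rep (N l) k c)" for l c by (auto simp: sqf_def intro!: sum_nonneg)
  have psym: "pull (X l) (m l) K s t = pull (X l) (m l) K t s" "pull (X l) (a l) K s t = pull (X l) (a l) K t s" for l K s t
    by (rule pull_sym, simp only: m_def a_def sym_forms(1)[of _ _ _ s] sym_forms(2)[of _ s], metis sym_forms)+
  have msym: "m l s t = m l t s" "a l s t = a l t s" for l s t
    unfolding m_def a_def by (metis sym_forms)+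
  have H1: "psd (X l) (\<lambda>s t. C * m l s t - pull (X l) (m l) (Pm l) s t)" for l
  proof (rule psdI)
    show "0 \<le> qf (X l) (\<lambda>s t. C * m l s t - pull (X l) (m l) (Pm l) s t) c" for c
    proof -
      have "mass (N l) (rep (N l) k (\<lambda>p. \<Sum>s\<in>X l. Pm l p s * c s)) (rep (N l) k (\<lambda>p. \<Sum>s\<in>X l. Pm l p s * c s))
        \<le> 26 * mass (N l) (rep (N l) k c) (rep (N l) k c)" unfolding massP by (rule cb(1))
      also have "\<dots> \<le> C * mass (N l) (rep (N l) k c) (rep (N l) k c)" by (intro mult_right_mono Cs mass_nonneg)
      finally show ?thesis by (simp add: qf_diff qf_pull qm)
    qed
  qed (metis msym psym)
  have H2: "psd (X l) (\<lambda>s t. C * a l s t - pull (X l) (a l) (Pm l) s t)" for l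
  proof (rule psdI)
    show "0 \<le> qf (X l) (\<lambda>s t. C * a l s t - pull (X l) (a l) (Pm l) s t) c" for c
    proof -
      have "ip (N l) \<alpha> k (rep (N l) k (\<lambda>p. \<Sum>s\<in>X l. Pm l p s * c s)) (rep (N l) k (\<lambda>p. \<Sum>s\<in>X l. Pm l p s * c s))
        \<le> (2 + 4 / \<gamma>) * ip (N l) \<alpha> k (rep (N l) k c) (rep (N l) k c)" unfolding ipP by (rule cb(2))
      also have "\<dots> \<le> C * ip (N l) \<alpha> k (rep (N l) k c) (rep (N l) k c)" by (intro mult_right_mono Cs ipos)
      finally show ?thesis by (simp add: qf_diff qf_pull qa)
    qed
  qed (metis msym psym)
  have H3: "psd (X l) (\<lambda>s t. 1 / (real k)\<^sup>2 * C * a l s t - pull (X l) (m l) (cutm k) s t)" for l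
  proof (rule psdI)
    show "0 \<le> qf (X l) (\<lambda>s t. 1 / (real k)\<^sup>2 * C * a l s t - pull (X l) (m l) (cutm k) s t) c" for c
    proof -
      have "mass (N l) (rep (N l) k (\<lambda>p. \<Sum>s\<in>X l. cutm k p s * c s)) (rep (N l) k (\<lambda>p. \<Sum>s\<in>X l. cutm k p s * c s))
        \<le> 1 / \<gamma> / (real k)\<^sup>2 * ip (N l) \<alpha> k (rep (N l) k c) (rep (N l) k c)" unfolding massQ by (rule cb(3))
      also have "\<dots> \<le> C / (real k)\<^sup>2 * ip (N l) \<alpha> k (rep (N l) k c) (rep (N l) k c)" by (intro mult_right_mono divide_right_mono Cs ipos) auto
      finally show ?thesis by (simp only: qf_diff qf_pull qm qa) simp
    qed
  qed (metis msym psym)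
  have H4: "psd (X l) (\<lambda>s t. 1 / (real k)\<^sup>2 * C * sqform (X l) leg_weight (a l) s t - pull (X l) (a l) (cutm k) s t)" for l
  proof (rule psdI)
    show "0 \<le> qf (X l) (\<lambda>s t. 1 / (real k)\<^sup>2 * C * sqform (X l) leg_weight (a l) s t - pull (X l) (a l) (cutm k) s t) c" for c
    proof -
      have "ip (N l) \<alpha> k (rep (N l) k (\<lambda>p. \<Sum>s\<in>X l. cutm k p s * c s)) (rep (N l) k (\<lambda>p. \<Sum>s\<in>X l. cutm k p s * c s))
        \<le> 8 * (1 + 8 / \<gamma>\<^sup>2) / (real k)\<^sup>2 * sqf (N l) \<alpha> k (rep (N l) k c)" unfolding ipQ by (rule cb(4))
      also have "\<dots> \<le> C / (real k)\<^sup>2 * sqf (N l) \<alpha> k (rep (N l) k c)" by (intro mult_right_mono divide_right_mono Cs sqpos) auto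
      finally show ?thesis by (simp only: qf_diff qf_pull qs qa) simp
    qed
  qed (metis psym sym_forms(5))
  \<comment> \<open>The row of \<open>Pm\<close> at a mode of degree k is zero: its diagonal 1 is
    cancelled by the 1 in \<open>cutm\<close>, and the -1 of \<open>cutm\<close> sits in degree k -
    2, which differs from k.\<close>
  have "tapp X Pm v I = 0" if "snd (I i) = k" for I i
  proof -
    have "Pm i (I i) t = 0" for t using that k by (auto simp: Pm_def cutm_def prod_eq_iff)
    then have "(\<Prod>i\<in>UNIV. Pm i (I i) (J i)) = 0" for J
      using prod_zero[OF finite, of UNIV "\<lambda>i. Pm i (I i) (J i)"] by blast
    then show ?thesis by (simp add: tapp_def)
  qed
  moreover have "ksum X a m (\<lambda>I. v I - tapp X Pm v I) (\<lambda>I. v I - tapp X Pm v I)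
      \<le> real CARD('d) * (2 ^ (CARD('d) + 1) * (1 / (real k)\<^sup>2) * C ^ CARD('d)) * (\<Sum>I\<in>PiE UNIV X. (resid X a m v I)\<^sup>2 / (\<Prod>l\<in>UNIV. leg_weight (I l)))"
    by (rule tensor_cut_error[OF C1 _ _ H1 H2 H3 H4]) (auto simp: Pm_def)
  ultimately show ?thesis by blast
qed

section \<open>Comparison of consecutive levels\<close>

lemma slot_eq: "slot i a m = m(i := a i)"
  by (auto simp: slot_def)

text \<open>The level enters the form through the penalty alone. This difference is all that
  separates the non-inherited forms from inherited ones.\<close>

lemma ksum_level_diff:
  "ksum X (\<lambda>i. ipm (N i) \<alpha> k) m v w - ksum X (\<lambda>i. ipm (N i) \<alpha> l) m v w
    = \<alpha> * ((real k)\<^sup>2 - (real l)\<^sup>2) * ksum X (\<lambda>i. jm (N i)) m v w"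
proof -
  have e: "ipm n \<alpha> k s t - ipm n \<alpha> l s t = \<alpha> * ((real k)\<^sup>2 - (real l)\<^sup>2) * jm n s t" for n s t
    by (simp add: ipm_def jm_def ip_def algebra_simps)
  have "tform X (slot i (\<lambda>i. ipm (N i) \<alpha> k) m) v w - tform X (slot i (\<lambda>i. ipm (N i) \<alpha> l) m) v w
      = \<alpha> * ((real k)\<^sup>2 - (real l)\<^sup>2) * tform X (slot i (\<lambda>i. jm (N i)) m) v w" for i
  proof -
    have "(\<Prod>l'\<in>UNIV. (m(i := \<lambda>s t. c * jm (N i) s t)) l' (I l') (J l')) = c * (\<Prod>l'\<in>UNIV. (m(i := jm (N i))) l' (I l') (J l'))" for c I J
      by (simp add: prod_split[where j = i])
    then have "tform X (m(i := \<lambda>s t. c * jm (N i) s t)) v w = c * tform X (m(i := jm (N i))) v w" for c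
      unfolding tform_def by (simp add: sum_distrib_left mult_ac del: fun_upd_apply)
    moreover have "tform X (slot i (\<lambda>i. ipm (N i) \<alpha> k) m) v w - tform X (slot i (\<lambda>i. ipm (N i) \<alpha> l) m) v w
        = tform X (m(i := \<lambda>s t. \<alpha> * ((real k)\<^sup>2 - (real l)\<^sup>2) * jm (N i) s t)) v w"
      unfolding slot_eq tform_upd_diff e ..
    ultimately show ?thesis unfolding slot_eq by simp
  qed
  then show ?thesis unfolding ksum_def by (simp add: sum_subtractf[symmetric] sum_distrib_left)
qed

lemma ksum_diff_square:
  assumes "\<And>v w. ksum X a m v w = ksum X a m w v"
  shows "ksum X a m (\<lambda>I. v I - w I) (\<lambda>I. v I - w I) = ksum X a m v v - 2 * ksum X a m v w + ksum X a m w w"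
proof -
  have "ksum X a m (\<lambda>I. v I - w I) u = ksum X a m v u - ksum X a m w u"
    "ksum X a m u (\<lambda>I. v I - w I) = ksum X a m u v - ksum X a m u w" for u
    unfolding ksum_def tform_diff_left tform_diff_right sum_subtractf by auto
  then show ?thesis using assms[of v w] by simp
qed

lemma (in kron) ksum_sym: "ksum X a m v w = ksum X a m w v"
  unfolding ksum_def by (intro sum.cong refl tform_sym psd_sym[OF slot_psd])

lemma (in kron) ksum_nonneg: "0 \<le> ksum X a m v v"
  unfolding ksum_def by (intro sum_nonneg tform_psd fin slot_psd)

text \<open>A jump form in slot i is dominated by \<open>sqform\<close> in slot i, by
  \<open>jmps_bound\<close>, so a diagonal summand \<open>mixed i i\<close> of the squared residual
  suffices. The power k^-5 more than compensates the difference of penalties, which is of order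
  k.\<close>

lemma jump_energy_bound:
  fixes N :: "'d::finite \<Rightarrow> nat"
  assumes k: "0 < k" and N: "\<And>i. 0 < N i" and \<gamma>: "0 < \<gamma>"
    and coer: "\<And>i x. x \<in> bpoly (N i) k \<Longrightarrow> \<gamma> * en (N i) k x x \<le> ip (N i) \<alpha> k x x"
  defines "X \<equiv> \<lambda>i. idx (N i) k" and "a \<equiv> \<lambda>i. ipm (N i) \<alpha> k" and "m \<equiv> \<lambda>i. mm (N i)"
  shows "ksum X (\<lambda>i. jm (N i)) m w w \<le> real CARD('d) * (4 / (\<gamma>\<^sup>2 * real k ^ 5)) *
    (\<Sum>I\<in>PiE UNIV X. (resid X a m w I)\<^sup>2 / (\<Prod>l\<in>UNIV. leg_weight (I l)))"
proof -
  have pos: "0 \<le> ip (N i) \<alpha> k x x" if "x \<in> bpoly (N i) k" for i x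
    using coer[OF that] mult_nonneg_nonneg[OF less_imp_le[OF \<gamma>] en_nonneg[of "N i" k x]] by simp
  interpret kron X "\<lambda>i. leg_weight" a m
    unfolding X_def a_def m_def by (rule kron_level) (rule pos)
  define c where "c = 4 / (\<gamma>\<^sup>2 * real k ^ 5)"
  have c: "0 \<le> c" by (simp add: c_def)
  have one: "tform X (slot i (\<lambda>i. jm (N i)) m) w w \<le> c * (\<Sum>I\<in>PiE UNIV X. (resid X a m w I)\<^sup>2 / wt I)" for i
  proof -
    have "tform X (slot i (\<lambda>i. jm (N i)) m) w w \<le> (\<Prod>l\<in>UNIV. if l = i then c else 1) * tform X (mixed X (\<lambda>i. leg_weight) a m i i) w w"
    proof (rule tform_mono_scale[OF fin])
      show "psd (X l) (slot i (\<lambda>i. jm (N i)) m l)" for l using m_psd by (auto simp: slot_def X_def psd_jm)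
      show "psd (X l) (mixed X (\<lambda>i. leg_weight) a m i i l)" for l by (rule mixed_psd)
      show "0 \<le> (if l = i then c else 1)" for l using c by simp
      show "psd (X l) (\<lambda>s t. (if l = i then c else 1) * mixed X (\<lambda>i. leg_weight) a m i i l s t - slot i (\<lambda>i. jm (N i)) m l s t)" for l
      proof (cases "l = i")
        case True
        have "psd (X i) (\<lambda>s t. c * sqform (X i) leg_weight (a i) s t - jm (N i) s t)"
        proof (rule psdI)
          show "0 \<le> qf (X i) (\<lambda>s t. c * sqform (X i) leg_weight (a i) s t - jm (N i) s t) d" for d
            using jmps_bound[OF N k \<gamma> coer rep_bpoly, of i d]
            unfolding qf_diff X_def a_def qf_jm qf_sqform_ipm c_def by simp
        qed (metis sym_forms)
        then show ?thesis using True by (simp add: mixed_def slot_def)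
      next
        case False
        then show ?thesis by (simp add: mixed_def slot_def psd_def qf_def)
      qed
    qed
    also have "(\<Prod>l\<in>UNIV. if l = i then c else 1) = c" by (simp add: prod_split[where j = i])
    also have "c * tform X (mixed X (\<lambda>i. leg_weight) a m i i) w w \<le> c * (\<Sum>I\<in>PiE UNIV X. (resid X a m w I)\<^sup>2 / wt I)"
      by (intro mult_left_mono mixed_le_resid c)
    finally show ?thesis .
  qed
  have "ksum X (\<lambda>i. jm (N i)) m w w \<le> (\<Sum>i\<in>(UNIV::'d set). c * (\<Sum>I\<in>PiE UNIV X. (resid X a m w I)\<^sup>2 / wt I))"
    unfolding ksum_def by (intro sum_mono one)
  then show ?thesis by (simp add: c_def mult_ac)
qed

lemma idx_mono: "k \<le> l \<Longrightarrow> idx N k \<subseteq> idx N l"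
  by (auto simp: idx_def)

text \<open>Both sums are energies of discrete solutions. Upper bound: the cut \<open>\<phi>\<close>
  of the fine solution is compared with the coarse solution by completing the square in the coarse
  energy, which lies below the fine one. Lower bound: the coarse solution is a competitor on the
  fine level, and its excess of fine over coarse energy is a multiple of its squared jumps.\<close>

lemma approximation_fine:
  fixes N :: "'d::finite \<Rightarrow> nat"
  assumes k: "2 \<le> k" and N: "\<And>i. 0 < N i" and \<gamma>: "0 < \<gamma>" and \<alpha>: "0 \<le> \<alpha>"
    and coer: "\<And>i x. x \<in> bpoly (N i) k \<Longrightarrow> \<gamma> * en (N i) k x x \<le> ip (N i) \<alpha> k x x"
    and coer': "\<And>i x. x \<in> bpoly (N i) (k - 1) \<Longrightarrow> \<gamma> * en (N i) (k - 1) x x \<le> ip (N i) \<alpha> (k - 1) x x"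
  defines "X \<equiv> \<lambda>l i. idx (N i) l" and "a \<equiv> \<lambda>l i. ipm (N i) \<alpha> l" and "m \<equiv> \<lambda>i. mm (N i)"
    and "C \<equiv> real CARD('d) * (2 ^ (CARD('d) + 1) * (26 + 4 / \<gamma> + 1 / \<gamma> + 8 * (1 + 8 / \<gamma>\<^sup>2)) ^ CARD('d)) + 48 * \<alpha> * real CARD('d) / \<gamma>\<^sup>2"
  assumes v: "\<And>I. I \<in> PiE UNIV (X k) \<Longrightarrow> resid (X k) (a k) m v I = r I"
    and w: "\<And>I. I \<in> PiE UNIV (X (k - 1)) \<Longrightarrow> resid (X (k - 1)) (a (k - 1)) m w I = r I"
  shows "\<bar>(\<Sum>I\<in>PiE UNIV (X k). v I * r I) - (\<Sum>I\<in>PiE UNIV (X (k - 1)). w I * r I)\<bar>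
    \<le> C / (real k)\<^sup>2 * (\<Sum>I\<in>PiE UNIV (X k). (r I)\<^sup>2 / (\<Prod>l\<in>UNIV. leg_weight (I l)))"
proof -
  define K where "K = k - 1"
  have K: "0 < K" "K < k" "real k = real K + 1" using k by (auto simp: K_def)
  let ?U = "PiE UNIV (X k)" and ?V = "PiE UNIV (X K)"
  let ?A = "ksum (X k) (a k) m" and ?B = "ksum (X K) (a K) m"
  let ?wt = "\<lambda>I :: 'd \<Rightarrow> nat \<times> nat. \<Prod>l\<in>UNIV. leg_weight (I l)"
  have finX: "finite (X l i)" for l i by (simp add: X_def)
  have sub: "X K i \<subseteq> X k i" for i unfolding X_def by (rule idx_mono) (use K in simp)
  have subU: "?V \<subseteq> ?U" using sub by (intro PiE_mono) auto
  define \<rho> where "\<rho> = (\<Sum>I\<in>?U. (r I)\<^sup>2 / ?wt I)"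
  define \<rho>' where "\<rho>' = (\<Sum>I\<in>?V. (r I)\<^sup>2 / ?wt I)"
  have \<rho>: "0 \<le> \<rho>'" "\<rho>' \<le> \<rho>" unfolding \<rho>_def \<rho>'_def
    by (intro sum_nonneg sum_mono2 divide_nonneg_nonneg prod_nonneg finite_PiE_UNIV finX subU; simp add: leg_weight_def)+
  have pos: "0 \<le> ip (N i) \<alpha> k x x" if "x \<in> bpoly (N i) k" for i x
    using coer[OF that] mult_nonneg_nonneg[OF less_imp_le[OF \<gamma>] en_nonneg[of "N i" k x]] by simp
  have pos': "0 \<le> ip (N i) \<alpha> K x x" if "x \<in> bpoly (N i) K" for i x
    using coer'[folded K_def, OF that] mult_nonneg_nonneg[OF less_imp_le[OF \<gamma>] en_nonneg[of "N i" K x]] by simp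
  interpret k1: kron "X k" "\<lambda>i. leg_weight" "a k" m
    unfolding X_def a_def m_def by (rule kron_level) (rule pos)
  interpret k2: kron "X K" "\<lambda>i. leg_weight" "a K" m
    unfolding X_def a_def m_def by (rule kron_level) (rule pos')
  have rA: "?A v u = (\<Sum>I\<in>?U. u I * r I)" for u
    unfolding k1.ksum_resid by (intro sum.cong refl) (simp add: v)
  have rB: "?B w u = (\<Sum>I\<in>?V. u I * r I)" for u
    unfolding k2.ksum_resid by (intro sum.cong refl) (simp add: w[folded K_def])
  have restrict: "ksum (X k) aa m u u = ksum (X K) aa m u u" if "\<And>I. I \<in> ?U \<Longrightarrow> I \<notin> ?V \<Longrightarrow> u I = 0" for u aa
    unfolding ksum_def by (intro sum.cong refl tform_subset finX sub that)
  have jpos: "0 \<le> ksum (X K) (\<lambda>i. jm (N i)) m u u" for u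
    unfolding ksum_def
  proof (intro sum_nonneg tform_psd finX)
    show "psd (X K l) (slot i (\<lambda>i. jm (N i)) m l)" for i l
      unfolding slot_def X_def m_def using psd_mm psd_jm by simp
  qed
  have kk: "(real k)\<^sup>2 - (real K)\<^sup>2 = 2 * real K + 1" unfolding K(3) by (simp add: power2_eq_square algebra_simps)
  have lev: "ksum (X K) (a k) m u u = ?B u u + \<alpha> * (2 * real K + 1) * ksum (X K) (\<lambda>i. jm (N i)) m u u" for u
    using ksum_level_diff[of "X K" N \<alpha> k m u u K] unfolding kk a_def by simp
  define C1 where "C1 = real CARD('d) * (2 ^ (CARD('d) + 1) * (26 + 4 / \<gamma> + 1 / \<gamma> + 8 * (1 + 8 / \<gamma>\<^sup>2)) ^ CARD('d))"
  define C2 where "C2 = 48 * \<alpha> * real CARD('d) / \<gamma>\<^sup>2"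
  have C: "C = C1 + C2" "0 \<le> C1" "0 \<le> C2" using \<alpha> \<gamma> by (simp_all add: C_def C1_def C2_def add_nonneg_nonneg)
  obtain \<phi> where \<phi>': "(\<forall>I\<in>?U. \<forall>i. snd (I i) = k \<longrightarrow> \<phi> I = 0) \<and>
      ?A (\<lambda>I. v I - \<phi> I) (\<lambda>I. v I - \<phi> I)
      \<le> real CARD('d) * (2 ^ (CARD('d) + 1) * (1 / (real k)\<^sup>2) * (26 + 4 / \<gamma> + 1 / \<gamma> + 8 * (1 + 8 / \<gamma>\<^sup>2)) ^ CARD('d))
        * (\<Sum>I\<in>?U. (resid (X k) (a k) m v I)\<^sup>2 / ?wt I)"
    unfolding X_def a_def m_def
    using level_cut[where N = N and v = v and \<alpha> = \<alpha> and \<gamma> = \<gamma> and k = k, OF k N \<gamma> coer] ..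
  then have \<phi>0: "\<And>I i. snd (I i) = k \<Longrightarrow> I \<in> ?U \<Longrightarrow> \<phi> I = 0"
    and \<phi>: "?A (\<lambda>I. v I - \<phi> I) (\<lambda>I. v I - \<phi> I)
      \<le> real CARD('d) * (2 ^ (CARD('d) + 1) * (1 / (real k)\<^sup>2) * (26 + 4 / \<gamma> + 1 / \<gamma> + 8 * (1 + 8 / \<gamma>\<^sup>2)) ^ CARD('d))
        * (\<Sum>I\<in>?U. (resid (X k) (a k) m v I)\<^sup>2 / ?wt I)"
    by blast+
  have "(\<Sum>I\<in>?U. (resid (X k) (a k) m v I)\<^sup>2 / ?wt I) = \<rho>"
    unfolding \<rho>_def by (intro sum.cong refl) (simp add: v)
  with \<phi> have \<phi>b: "?A (\<lambda>I. v I - \<phi> I) (\<lambda>I. v I - \<phi> I) \<le> C1 / (real k)\<^sup>2 * \<rho>"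
    by (simp add: C1_def)
  have \<phi>z: "\<phi> I = 0" if I: "I \<in> ?U" "I \<notin> ?V" for I
  proof -
    obtain i where "I i \<notin> X K i" using I(2) by (auto simp: PiE_iff)
    moreover have "I i \<in> X k i" using I(1) by auto
    ultimately have "snd (I i) = k" using K by (auto simp: X_def idx_def)
    then show ?thesis using \<phi>0 I(1) by blast
  qed
  have r\<phi>: "(\<Sum>I\<in>?U. \<phi> I * r I) = (\<Sum>I\<in>?V. \<phi> I * r I)"
    by (rule sum.mono_neutral_right[OF finite_PiE_UNIV[OF finX] subU]) (use \<phi>z in auto)
  have "?A (\<lambda>I. v I - \<phi> I) (\<lambda>I. v I - \<phi> I) = ?A v v - 2 * ?A v \<phi> + ?A \<phi> \<phi>"
    by (rule ksum_diff_square[OF k1.ksum_sym])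
  moreover have "0 \<le> ?B w w - 2 * ?B w \<phi> + ?B \<phi> \<phi>"
    using ksum_diff_square[OF k2.ksum_sym, of w \<phi>] k2.ksum_nonneg[of "\<lambda>I. w I - \<phi> I"] by simp
  moreover have "?B \<phi> \<phi> \<le> ?A \<phi> \<phi>"
    using lev[of \<phi>] restrict[of \<phi> "a k"] \<phi>z jpos[of \<phi>] \<alpha> by simp
  moreover have "?A v \<phi> = ?B w \<phi>" unfolding rA rB r\<phi> ..
  ultimately have up: "?A v v - ?B w w \<le> C1 / (real k)\<^sup>2 * \<rho>" using \<phi>b by simp
  \<comment> \<open>\<open>w\<close> is specified on the coarse indices only; extended by zero it
    may be tested on the fine level.\<close>
  define w0 where "w0 I = (if I \<in> ?V then w I else 0)" for I
  have w0B: "ksum (X K) aa m w0 w0 = ksum (X K) aa m w w" for aa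
    unfolding ksum_def by (intro sum.cong refl tform_cong) (auto simp: w0_def)
  have rw0: "?A v w0 = ?B w w"
    unfolding rA rB using sum.mono_neutral_right[OF finite_PiE_UNIV[OF finX] subU, of "\<lambda>I. w0 I * r I"]
    by (simp add: w0_def)
  have "0 \<le> ?A v v - 2 * ?A v w0 + ?A w0 w0"
    using ksum_diff_square[OF k1.ksum_sym, of v w0] k1.ksum_nonneg[of "\<lambda>I. v I - w0 I"] by simp
  moreover have "?A w0 w0 = ?B w w + \<alpha> * (2 * real K + 1) * ksum (X K) (\<lambda>i. jm (N i)) m w w"
    using restrict[of w0 "a k"] lev[of w0] by (simp add: w0B) (simp add: w0_def)
  ultimately have "?B w w - ?A v v \<le> \<alpha> * (2 * real K + 1) * ksum (X K) (\<lambda>i. jm (N i)) m w w"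
    unfolding rw0 by simp
  also have "\<dots> \<le> \<alpha> * (2 * real K + 1) * (real CARD('d) * (4 / (\<gamma>\<^sup>2 * real K ^ 5)) * \<rho>')"
  proof (rule mult_left_mono)
    have "(\<Sum>I\<in>?V. (resid (X K) (a K) m w I)\<^sup>2 / ?wt I) = \<rho>'"
      unfolding \<rho>'_def by (intro sum.cong refl) (simp add: w[folded K_def])
    then show "ksum (X K) (\<lambda>i. jm (N i)) m w w \<le> real CARD('d) * (4 / (\<gamma>\<^sup>2 * real K ^ 5)) * \<rho>'"
      using jump_energy_bound[where N = N and w = w and k = K and \<gamma> = \<gamma> and \<alpha> = \<alpha>, OF K(1) N \<gamma> coer'[folded K_def]] unfolding X_def a_def m_def by simp
  qed (use \<alpha> in simp)
  also have "\<dots> = 4 * \<alpha> * real CARD('d) / \<gamma>\<^sup>2 * ((2 * real K + 1) / real K ^ 5) * \<rho>'" by simp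
  also have "\<dots> \<le> 4 * \<alpha> * real CARD('d) / \<gamma>\<^sup>2 * (12 / (real k)\<^sup>2) * \<rho>'"
  proof (intro mult_right_mono mult_left_mono \<rho>(1))
    have K1: "1 \<le> real K" using K by simp
    have "(2 * real K + 1) / real K ^ 5 \<le> 3 * real K / real K ^ 5" using K1 by (intro divide_right_mono) auto
    also have "\<dots> = 3 / real K ^ 4" using K1 by (simp add: eval_nat_numeral)
    also have "\<dots> \<le> 3 / (real K)\<^sup>2" using K1 by (intro divide_left_mono power_increasing) auto
    \<comment> \<open>From k = K + 1 \<le> 2 K the bound returns to the fine degree.\<close>
    also have "\<dots> = 12 / (2 * real K)\<^sup>2" by (simp add: power_mult_distrib)
    also have "\<dots> \<le> 12 / (real k)\<^sup>2" using K1 unfolding K(3) by (intro divide_left_mono power_mono) auto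
    finally show "(2 * real K + 1) / real K ^ 5 \<le> 12 / (real k)\<^sup>2" .
  qed (use \<alpha> in simp)
  also have "\<dots> = C2 / (real k)\<^sup>2 * \<rho>'" by (simp add: C2_def)
  also have "\<dots> \<le> C2 / (real k)\<^sup>2 * \<rho>" using \<rho> C by (intro mult_left_mono) auto
  finally have lo: "?B w w - ?A v v \<le> C2 / (real k)\<^sup>2 * \<rho>" .
  have "C1 / (real k)\<^sup>2 * \<rho> \<le> C / (real k)\<^sup>2 * \<rho>" "C2 / (real k)\<^sup>2 * \<rho> \<le> C / (real k)\<^sup>2 * \<rho>"
    using C \<rho> by (intro mult_right_mono divide_right_mono; simp)+
  then have "\<bar>?A v v - ?B w w\<bar> \<le> C / (real k)\<^sup>2 * \<rho>" using up lo by (simp add: abs_le_iff)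
  then show ?thesis unfolding rA rB unfolding \<rho>_def K_def .
qed

section \<open>One-dimensional coercivity from stability of the full form\<close>

definition tensor_coercive :: "('d::finite \<Rightarrow> nat) \<Rightarrow> real \<Rightarrow> real \<Rightarrow> nat \<Rightarrow> bool" where
  "tensor_coercive N \<beta> \<alpha> k \<longleftrightarrow> (\<forall>u. \<beta> * ksum (\<lambda>i. idx (N i) k) (\<lambda>i. enm (N i) k) (\<lambda>i. mm (N i)) u u
      \<le> ksum (\<lambda>i. idx (N i) k) (\<lambda>i. ipm (N i) \<alpha> k) (\<lambda>i. mm (N i)) u u)"

text \<open>The constant has energy from the penalty at the two boundary nodes only. Divided by its
  mass \<open>N\<close> this is the mass term by which a constant factor supports the other
  directions.\<close>

lemma forms_one:
  assumes "0 < N"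
  shows "mass N (\<lambda>_. 1) (\<lambda>_. 1) = real N" "ip N \<alpha> k (\<lambda>_. 1) (\<lambda>_. 1) = 2 * \<alpha> * (real k)\<^sup>2" "0 \<le> en N k (\<lambda>_. 1) (\<lambda>_. 1)"
proof -
  show "mass N (\<lambda>_. 1) (\<lambda>_. 1) = real N" by (simp add: mass_def)
  have "(\<Sum>j\<le>N. jmp N j (\<lambda>_. 1) * jmp N j (\<lambda>_. 1)) = (\<Sum>q<N. jmp N (Suc q) (\<lambda>_. 1) - jmp N q (\<lambda>_. 1))"
    by (subst sum_jmp) simp
  also have "\<dots> = jmp N N (\<lambda>_. 1) - jmp N 0 (\<lambda>_. 1)" by (rule sum_lessThan_telescope)
  also have "\<dots> = 2" using assms by (simp add: jmp_def)
  finally have "jmps N (\<lambda>_. 1) (\<lambda>_. 1) = 2" by (simp add: jmps_def)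
  moreover have "dir N (\<lambda>_. 1) (\<lambda>_. 1) = 0" by (simp add: dir_def)
  moreover have "flux N (\<lambda>_. 1) (\<lambda>_. 1) = 0" by (simp add: flux_def avg_def)
  ultimately show "ip N \<alpha> k (\<lambda>_. 1) (\<lambda>_. 1) = 2 * \<alpha> * (real k)\<^sup>2" by (simp add: ip_def)
  show "0 \<le> en N k (\<lambda>_. 1) (\<lambda>_. 1)" by (rule en_nonneg)
qed

lemma rep_one: "q < N \<Longrightarrow> rep N k (\<lambda>s. if snd s = 0 then 1 else 0) q = 1"
proof -
  assume "q < N"
  then have "rep N k (\<lambda>s. if snd s = 0 then 1 else 0) q = (\<Sum>n\<le>k. if n = 0 then Polynomial.smult 1 (legendre n) else 0)"
    unfolding rep_eq[OF \<open>q < N\<close>] by (intro sum.cong) auto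
  also have "\<dots> = 1" by (simp add: sum.delta)
  finally show ?thesis .
qed

text \<open>After division by \<open>W\<close>, the product of the other cell numbers, direction i
  contributes its own form and each j \<noteq> i contributes 2 \<alpha> k^2 / N_j times the mass of
  \<open>x\<close>. The energies of the other directions are nonnegative and dropped on the
  left.\<close>

lemma garding_1d:
  fixes N :: "'d::finite \<Rightarrow> nat"
  assumes N: "\<And>i. 0 < N i" and \<beta>: "0 < \<beta>" and st: "tensor_coercive N \<beta> \<alpha> k"
    and x: "x \<in> bpoly (N i) k"
  shows "\<beta> * en (N i) k x x - (\<Sum>j\<in>UNIV - {i}. 2 * \<alpha> * (real k)\<^sup>2 / real (N j)) * mass (N i) x x \<le> ip (N i) \<alpha> k x x"
proof -
  define c where "c j = (if j = i then coe x else (\<lambda>s. if snd s = 0 then 1 else 0))" for j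
  define u where "u I = (\<Prod>j\<in>UNIV. c j (I j))" for I :: "'d \<Rightarrow> nat \<times> nat"
  let ?X = "\<lambda>i. idx (N i) k"
  define W where "W = (\<Prod>j\<in>UNIV - {i}. real (N j))"
  have W: "0 < W" unfolding W_def using N by (intro prod_pos) auto
  define z where "z j = (if j = i then x else (\<lambda>_. 1))" for j
  have rz: "rep (N j) k (c j) q = z j q" if "q < N j" for j q
    using that rep_coe[OF x, of q] rep_one[of q "N j" k] by (cases "j = i") (simp_all add: c_def z_def)
  have qm: "qf (?X j) (mm (N j)) (c j) = mass (N j) (z j) (z j)" for j
    unfolding qf_mm by (rule mass_cong) (simp_all add: rz)
  have qi: "qf (?X j) (ipm (N j) \<alpha> k) (c j) = ip (N j) \<alpha> k (z j) (z j)" for j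
    unfolding qf_ipm by (rule ip_cong) (simp_all add: rz N)
  have qe: "qf (?X j) (enm (N j) k) (c j) = en (N j) k (z j) (z j)" for j
  proof -
    have "en (N j) k (rep (N j) k (c j)) (rep (N j) k (c j)) = en (N j) k (z j) (z j)"
      unfolding en_def
      using dir_cong[of "N j" "rep (N j) k (c j)" "z j" "rep (N j) k (c j)" "z j"]
        jmps_cong[of "N j" "rep (N j) k (c j)" "z j" "rep (N j) k (c j)" "z j"] rz by simp
    then show ?thesis by (simp add: qf_enm)
  qed
  have pr: "tform ?X (slot j b (\<lambda>i. mm (N i))) u u = (\<Prod>l\<in>UNIV. slot j (\<lambda>l. qf (?X l) (b l) (c l)) (\<lambda>l. mass (N l) (z l) (z l)) l)" for j b
    unfolding u_def by (subst tform_product) (auto simp: slot_def qm intro!: prod.cong)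
  have sl_i: "(\<Prod>l\<in>UNIV. slot i f (\<lambda>l. mass (N l) (z l) (z l)) l) = f i * W" for f
  proof -
    have "(\<Prod>l\<in>UNIV - {i}. slot i f (\<lambda>l. mass (N l) (z l) (z l)) l) = W"
      unfolding W_def by (intro prod.cong) (auto simp: slot_def z_def forms_one N)
    then show ?thesis by (simp add: prod_split[where j = i] slot_def)
  qed
  have sl_j: "(\<Prod>l\<in>UNIV. slot j f (\<lambda>l. mass (N l) (z l) (z l)) l) = mass (N i) x x * (f j / real (N j) * W)" if "j \<noteq> i" for f j
  proof -
    have "(\<Prod>l\<in>UNIV - {i}. slot j f (\<lambda>l. mass (N l) (z l) (z l)) l)
        = f j * (\<Prod>l\<in>UNIV - {i} - {j}. slot j f (\<lambda>l. mass (N l) (z l) (z l)) l)"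
      using that by (subst prod.remove[where x = j]) (auto simp: slot_def)
    also have "(\<Prod>l\<in>UNIV - {i} - {j}. slot j f (\<lambda>l. mass (N l) (z l) (z l)) l) = (\<Prod>l\<in>UNIV - {i} - {j}. real (N l))"
      by (intro prod.cong) (auto simp: slot_def z_def forms_one N)
    also have "f j * \<dots> = f j / real (N j) * W"
      unfolding W_def using that N[of j] by (subst (2) prod.remove[where x = j]) auto
    finally show ?thesis using that by (simp add: prod_split[where j = i] slot_def z_def)
  qed
  have spl: "(\<Sum>j\<in>UNIV. h j) = h i + (\<Sum>j\<in>UNIV - {i}. h j)" for h :: "'d \<Rightarrow> real"
    by (rule sum.remove) auto
  have I: "ksum ?X (\<lambda>i. ipm (N i) \<alpha> k) (\<lambda>i. mm (N i)) u u
      = W * (ip (N i) \<alpha> k x x + (\<Sum>j\<in>UNIV - {i}. 2 * \<alpha> * (real k)\<^sup>2 / real (N j)) * mass (N i) x x)"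
  proof -
    have "(\<Sum>j\<in>UNIV - {i}. tform ?X (slot j (\<lambda>i. ipm (N i) \<alpha> k) (\<lambda>i. mm (N i))) u u)
      = (\<Sum>j\<in>UNIV - {i}. W * (2 * \<alpha> * (real k)\<^sup>2 / real (N j) * mass (N i) x x))"
    proof (intro sum.cong refl)
      fix j assume "j \<in> UNIV - {i}"
      then have j: "j \<noteq> i" by simp
      have "qf (idx (N j) k) (ipm (N j) \<alpha> k) (c j) = 2 * \<alpha> * (real k)\<^sup>2"
        using j unfolding qi by (simp add: z_def forms_one N)
      then show "tform ?X (slot j (\<lambda>i. ipm (N i) \<alpha> k) (\<lambda>i. mm (N i))) u u = W * (2 * \<alpha> * (real k)\<^sup>2 / real (N j) * mass (N i) x x)"
        unfolding pr sl_j[OF j] by simp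
    qed
    moreover have "tform ?X (slot i (\<lambda>i. ipm (N i) \<alpha> k) (\<lambda>i. mm (N i))) u u = W * ip (N i) \<alpha> k x x"
      unfolding pr sl_i qi by (simp add: z_def)
    ultimately show ?thesis unfolding ksum_def spl
      by (simp only: distrib_left sum_distrib_left sum_distrib_right)
  qed
  have "W * en (N i) k x x \<le> ksum ?X (\<lambda>i. enm (N i) k) (\<lambda>i. mm (N i)) u u"
  proof -
    have "tform ?X (slot i (\<lambda>i. enm (N i) k) (\<lambda>i. mm (N i))) u u = W * en (N i) k x x"
      unfolding pr sl_i qe by (simp add: z_def)
    moreover have "0 \<le> tform ?X (slot j (\<lambda>i. enm (N i) k) (\<lambda>i. mm (N i))) u u" for j
    proof (rule tform_psd)
      show "psd (idx (N l) k) (slot j (\<lambda>i. enm (N i) k) (\<lambda>i. mm (N i)) l)" for l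
        unfolding slot_def using psd_enm psd_mm by simp
    qed simp
    ultimately show ?thesis unfolding ksum_def spl by (simp add: sum_nonneg)
  qed
  then have "\<beta> * (W * en (N i) k x x) \<le> \<beta> * ksum ?X (\<lambda>i. enm (N i) k) (\<lambda>i. mm (N i)) u u"
    using \<beta> by (intro mult_left_mono) auto
  also have "\<dots> \<le> ksum ?X (\<lambda>i. ipm (N i) \<alpha> k) (\<lambda>i. mm (N i)) u u"
    using st unfolding tensor_coercive_def by blast
  finally have "W * (\<beta> * en (N i) k x x) \<le> W * (ip (N i) \<alpha> k x x + (\<Sum>j\<in>UNIV - {i}. 2 * \<alpha> * (real k)\<^sup>2 / real (N j)) * mass (N i) x x)"
    unfolding I by (simp only: mult_ac)
  then have "\<beta> * en (N i) k x x \<le> ip (N i) \<alpha> k x x + (\<Sum>j\<in>UNIV - {i}. 2 * \<alpha> * (real k)\<^sup>2 / real (N j)) * mass (N i) x x"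
    using W by (simp only: mult_le_cancel_left_pos)
  then show ?thesis by simp
qed

text \<open>The Garding constant has to satisfy 8 K \<le> \<beta> k^3 for
  \<open>coercive_1d\<close>. Each other direction is allowed \<beta> k^3 / d of this, which is the
  origin of 16 d \<alpha>.\<close>

lemma coercive_fine:
  fixes N :: "'d::finite \<Rightarrow> nat"
  assumes N: "\<And>i. 0 < N i" and \<beta>: "0 < \<beta>" and \<alpha>: "0 \<le> \<alpha>" and k: "0 < k" and st: "tensor_coercive N \<beta> \<alpha> k"
    and fine: "\<And>i. 16 * real CARD('d) * \<alpha> \<le> \<beta> * (real (N i) * real k)"
    and x: "x \<in> bpoly (N i) k"
  shows "min (\<beta> / 2) 1 / 2 * en (N i) k x x \<le> ip (N i) \<alpha> k x x"
proof (rule coercive_1d[OF N k \<beta> garding_1d[OF N \<beta> st] _ _ x])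
  let ?K = "\<Sum>j\<in>UNIV - {i}. 2 * \<alpha> * (real k)\<^sup>2 / real (N j)"
  show "0 \<le> ?K" using \<alpha> by (intro sum_nonneg) auto
  have d: "0 < real CARD('d)" by simp
  have "8 * (2 * \<alpha> * (real k)\<^sup>2 / real (N j)) \<le> \<beta> * real k ^ 3 / real CARD('d)" for j
  proof -
    have "16 * real CARD('d) * \<alpha> * (real k)\<^sup>2 \<le> \<beta> * (real (N j) * real k) * (real k)\<^sup>2"
      by (intro mult_right_mono fine) auto
    then show ?thesis using N[of j] d by (simp add: field_simps power2_eq_square power3_eq_cube)
  qed
  then have "(\<Sum>j\<in>UNIV - {i}. 8 * (2 * \<alpha> * (real k)\<^sup>2 / real (N j))) \<le> (\<Sum>j\<in>UNIV - {i}. \<beta> * real k ^ 3 / real CARD('d))"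
    by (intro sum_mono)
  also have "\<dots> \<le> (\<Sum>j\<in>(UNIV::'d set). \<beta> * real k ^ 3 / real CARD('d))"
    using \<beta> by (intro sum_mono2) auto
  also have "\<dots> = \<beta> * real k ^ 3" by simp
  finally show "8 * ?K \<le> \<beta> * real k ^ 3" by (simp only: sum_distrib_left)
qed

section \<open>Coarse meshes\<close>

lemma tform_mass:
  fixes N :: "'d::finite \<Rightarrow> nat"
  shows "tform (\<lambda>i. idx (N i) k) (\<lambda>i. mm (N i)) v v = (\<Sum>I\<in>PiE UNIV (\<lambda>i. idx (N i) k). (\<Prod>l\<in>UNIV. leg_weight (I l)) * (v I)\<^sup>2)"
proof -
  let ?U = "PiE UNIV (\<lambda>i. idx (N i) k)"
  have "(\<Prod>i\<in>UNIV. mm (N i) (I i) (J i)) = (if J = I then \<Prod>l\<in>UNIV. leg_weight (I l) else 0)" if "I \<in> ?U" "J \<in> ?U" for I J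
  proof -
    have e: "mm (N i) (I i) (J i) = (if I i = J i then leg_weight (I i) else 0)" for i
      using that unfolding mm_def leg_weight_def by (intro mass_bas[where k = k]) auto
    show ?thesis
    proof (cases "J = I")
      case False
      then obtain l where "J l \<noteq> I l" by auto
      then have "mm (N l) (I l) (J l) = 0" by (simp add: e)
      then have "(\<Prod>i\<in>UNIV. mm (N i) (I i) (J i)) = 0" by (intro prod_zero) auto
      then show ?thesis using False by simp
    qed (use e in simp)
  qed
  then have "tform (\<lambda>i. idx (N i) k) (\<lambda>i. mm (N i)) v v = (\<Sum>I\<in>?U. \<Sum>J\<in>?U. if J = I then (\<Prod>l\<in>UNIV. leg_weight (I l)) * v I * v I else 0)"
    unfolding tform_def by (intro sum.cong) auto
  also have "\<dots> = (\<Sum>I\<in>?U. (\<Prod>l\<in>UNIV. leg_weight (I l)) * v I * v I)"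
    using finite_PiE_UNIV[of "\<lambda>i. idx (N i) k"] by (intro sum.cong refl) simp
  finally show ?thesis by (simp add: power2_eq_square mult_ac)
qed

lemma tform_slot_mono:
  fixes X :: "'d::finite \<Rightarrow> 's set"
  assumes fin: "\<And>l. finite (X l)" and m: "\<And>l. psd (X l) (m l)" and e: "psd (X i) (e i)" and e': "psd (X i) (e' i)"
    and c: "0 \<le> c" and le: "psd (X i) (\<lambda>s t. c * e' i s t - e i s t)"
  shows "tform X (slot i e m) v v \<le> c * tform X (slot i e' m) v v"
proof -
  have "tform X (slot i e m) v v \<le> (\<Prod>l\<in>UNIV. if l = i then c else 1) * tform X (slot i e' m) v v"
  proof (rule tform_mono_scale[OF fin])
    show "psd (X l) (slot i e m l)" for l using e m by (simp add: slot_def)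
    show "psd (X l) (slot i e' m l)" for l using e' m by (simp add: slot_def)
    show "0 \<le> (if l = i then c else 1)" for l using c by simp
    show "psd (X l) (\<lambda>s t. (if l = i then c else 1) * slot i e' m l s t - slot i e m l s t)" for l
      using le by (cases "l = i") (simp_all add: slot_def psd_def qf_def)
  qed
  then show ?thesis by (simp add: prod_split[where j = i])
qed

text \<open>The third bound uses the Poincare inequality in direction \<open>i\<close> alone, so a
  single direction with few cells suffices later.\<close>

lemma ksum_enm:
  fixes N :: "'d::finite \<Rightarrow> nat"
  defines "X \<equiv> \<lambda>k i. idx (N i) k" and "m \<equiv> \<lambda>i. mm (N i)"
  shows "0 \<le> tform (X l) (slot i (\<lambda>i. enm (N i) k) m) v v"
    and "0 \<le> ksum (X l) (\<lambda>i. enm (N i) k) m v v"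
    and "0 < k \<Longrightarrow> tform (X k) m v v \<le> 8 * (real (N i) + 1)\<^sup>2 * ksum (X k) (\<lambda>i. enm (N i) k) m v v"
    and "0 < k \<Longrightarrow> (real k)\<^sup>2 * ksum (X l) (\<lambda>i. jm (N i)) m v v \<le> ksum (X l) (\<lambda>i. enm (N i) k) m v v"
proof -
  have fin: "finite (X k i)" for k i by (simp add: X_def)
  have pm: "psd (X l i) (m i)" and pe: "psd (X l i) (enm (N i) k)" and pj: "psd (X l i) (jm (N i))" for i l k
    unfolding X_def m_def by (rule psd_mm, rule psd_enm, rule psd_jm)
  show nn: "0 \<le> tform (X l) (slot i (\<lambda>i. enm (N i) k) m) v v" for i l k
    by (rule tform_psd[OF fin]) (simp add: slot_def pe pm)
  show "0 \<le> ksum (X l) (\<lambda>i. enm (N i) k) m v v" unfolding ksum_def by (intro sum_nonneg nn)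
  show "tform (X k) m v v \<le> 8 * (real (N i) + 1)\<^sup>2 * ksum (X k) (\<lambda>i. enm (N i) k) m v v" if k: "0 < k"
  proof -
    have "tform (X k) (slot i m m) v v \<le> 8 * (real (N i) + 1)\<^sup>2 * tform (X k) (slot i (\<lambda>i. enm (N i) k) m) v v"
    proof (rule tform_slot_mono[OF fin pm pm pe])
      show "psd (X k i) (\<lambda>s t. 8 * (real (N i) + 1)\<^sup>2 * enm (N i) k s t - m i s t)"
        by (rule psdI) (metis m_def sym_forms(2,3), use mass_le_en[OF k] in \<open>simp add: qf_diff X_def m_def qf_enm qf_mm\<close>)
    qed simp
    also have "\<dots> \<le> 8 * (real (N i) + 1)\<^sup>2 * ksum (X k) (\<lambda>i. enm (N i) k) m v v"
      unfolding ksum_def using nn by (intro mult_left_mono member_le_sum) auto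
    also have "slot i m m = m" by (auto simp: slot_def)
    finally show ?thesis .
  qed
  show "(real k)\<^sup>2 * ksum (X l) (\<lambda>i. jm (N i)) m v v \<le> ksum (X l) (\<lambda>i. enm (N i) k) m v v" if k: "0 < k"
  proof -
    have "tform (X l) (slot i (\<lambda>i. jm (N i)) m) v v \<le> 1 / (real k)\<^sup>2 * tform (X l) (slot i (\<lambda>i. enm (N i) k) m) v v" for i
    proof (rule tform_slot_mono[OF fin pm pj pe])
      show "psd (X l i) (\<lambda>s t. 1 / (real k)\<^sup>2 * enm (N i) k s t - jm (N i) s t)"
      proof (rule psdI)
        show "0 \<le> qf (X l i) (\<lambda>s t. 1 / (real k)\<^sup>2 * enm (N i) k s t - jm (N i) s t) c" for c
          using k unfolding X_def qf_diff qf_enm qf_jm en_def by (simp add: add_divide_distrib dir_nonneg)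
      qed (metis sym_forms(3,4))
    qed simp
    then show ?thesis using k unfolding ksum_def sum_distrib_left by (intro sum_mono) (simp add: field_simps)
  qed
qed

text \<open>No cancellation between levels is used: \<open>R\<close> is the energy v A v, and R^2
  \<le> (v M v) (r M^-1 r) by Cauchy-Schwarz. The Poincare inequality and coercivity bound v M v by
  a multiple of \<open>R\<close>, so one factor cancels.\<close>

lemma approximation_coarse:
  fixes N :: "'d::finite \<Rightarrow> nat"
  assumes \<beta>: "0 < \<beta>" and k: "0 < k" and st: "tensor_coercive N \<beta> \<alpha> k"
  defines "X \<equiv> \<lambda>i. idx (N i) k" and "a \<equiv> \<lambda>i. ipm (N i) \<alpha> k" and "m \<equiv> \<lambda>i. mm (N i)"
  assumes v: "\<And>I. I \<in> PiE UNIV X \<Longrightarrow> resid X a m v I = r I"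
  defines "R \<equiv> (\<Sum>I\<in>PiE UNIV X. v I * r I)"
  shows "0 \<le> R" "R \<le> 8 * (real (N i) + 1)\<^sup>2 / \<beta> * (\<Sum>I\<in>PiE UNIV X. (r I)\<^sup>2 / (\<Prod>l\<in>UNIV. leg_weight (I l)))"
proof -
  let ?U = "PiE UNIV X"
  let ?wt = "\<lambda>I :: 'd \<Rightarrow> nat \<times> nat. \<Prod>l\<in>UNIV. leg_weight (I l)"
  have wt: "0 < ?wt I" for I by (intro prod_pos) (auto simp: leg_weight_def add_nonneg_pos)
  have fin: "finite (X i)" for i by (simp add: X_def)
  have R: "ksum X a m v v = R"
  proof -
    have "ksum X a m v v = (\<Sum>I\<in>?U. v I * resid X a m v I)"
      by (rule ksum_resid_sym) (simp_all add: a_def m_def, metis sym_forms(1), metis sym_forms(2))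
    then show ?thesis unfolding R_def by (simp add: v)
  qed
  let ?c = "8 * (real (N i) + 1)\<^sup>2"
  define M where "M = tform X m v v"
  have M: "M = (\<Sum>I\<in>?U. ?wt I * (v I)\<^sup>2)" unfolding M_def X_def m_def by (rule tform_mass)
  have M0: "0 \<le> M" unfolding M using wt by (intro sum_nonneg mult_nonneg_nonneg) (auto simp: less_imp_le)
  have "M \<le> ?c * ksum X (\<lambda>i. enm (N i) k) m v v"
    unfolding M_def X_def m_def by (rule ksum_enm(3)[OF k])
  moreover have e: "ksum X (\<lambda>i. enm (N i) k) m v v \<le> R / \<beta>"
    using st \<beta> unfolding R[symmetric] tensor_coercive_def X_def a_def m_def by (simp add: field_simps)
  ultimately have MR: "M \<le> ?c * (R / \<beta>)" by (elim order.trans) (rule mult_left_mono, assumption, simp)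
  have c0: "0 < ?c" by (simp add: add_nonneg_pos)
  show R0: "0 \<le> R"
  proof -
    have "0 \<le> R / \<beta>" using ksum_enm(2) e unfolding X_def m_def by (rule order.trans)
    then show ?thesis using \<beta> by (simp add: zero_le_divide_iff)
  qed
  define \<rho> where "\<rho> = (\<Sum>I\<in>?U. (r I)\<^sup>2 / ?wt I)"
  have "R\<^sup>2 \<le> M * \<rho>"
  proof -
    have "R = (\<Sum>I\<in>?U. (sqrt (?wt I) * v I) * (r I / sqrt (?wt I)))"
      unfolding R_def using wt by (intro sum.cong) (auto simp: less_imp_neq[symmetric])
    then have "R\<^sup>2 \<le> (\<Sum>I\<in>?U. (sqrt (?wt I) * v I)\<^sup>2) * (\<Sum>I\<in>?U. (r I / sqrt (?wt I))\<^sup>2)"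
      by (simp only: Cauchy_Schwarz_ineq_sum)
    also have "(\<Sum>I\<in>?U. (sqrt (?wt I) * v I)\<^sup>2) = M"
      unfolding M using wt by (intro sum.cong) (auto simp: power_mult_distrib less_imp_le)
    also have "(\<Sum>I\<in>?U. (r I / sqrt (?wt I))\<^sup>2) = \<rho>"
      unfolding \<rho>_def using wt by (intro sum.cong) (auto simp: power_divide less_imp_le)
    finally show ?thesis .
  qed
  also have "\<dots> \<le> ?c * (R / \<beta>) * \<rho>"
    unfolding \<rho>_def using wt by (intro mult_right_mono MR sum_nonneg divide_nonneg_nonneg) (auto simp: less_imp_le)
  finally have "R * R \<le> R * (?c / \<beta> * \<rho>)" by (simp add: power2_eq_square mult_ac)
  then have "R \<le> ?c / \<beta> * \<rho>" if "R > 0" using that by (simp only: mult_le_cancel_left_pos)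
  moreover have "0 \<le> ?c / \<beta> * \<rho>"
    unfolding \<rho>_def using wt \<beta> by (intro mult_nonneg_nonneg sum_nonneg divide_nonneg_nonneg) (auto simp: less_imp_le)
  ultimately show "R \<le> ?c / \<beta> * \<rho>" using R0 by linarith
qed

text \<open>Failure of the fineness condition means N_i (k - 1) < \<open>T\<close> for some
  direction, so both N_i and k are bounded. Then k^-2 is bounded below, and the two energies may be
  estimated separately.\<close>

theorem approximation_property:
  assumes \<beta>: "0 < \<beta>" and \<alpha>: "0 < \<alpha>"
  shows "\<exists>C>0. \<forall>(N :: 'd::finite \<Rightarrow> nat) k v w r. 2 \<le> k \<longrightarrow> (\<forall>i. 0 < N i) \<longrightarrow>
    tensor_coercive N \<beta> \<alpha> k \<longrightarrow> tensor_coercive N \<beta> \<alpha> (k - 1) \<longrightarrow>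
    (\<forall>I\<in>PiE UNIV (\<lambda>i. idx (N i) k). resid (\<lambda>i. idx (N i) k) (\<lambda>i. ipm (N i) \<alpha> k) (\<lambda>i. mm (N i)) v I = r I) \<longrightarrow>
    (\<forall>I\<in>PiE UNIV (\<lambda>i. idx (N i) (k - 1)). resid (\<lambda>i. idx (N i) (k - 1)) (\<lambda>i. ipm (N i) \<alpha> (k - 1)) (\<lambda>i. mm (N i)) w I = r I) \<longrightarrow>
    \<bar>(\<Sum>I\<in>PiE UNIV (\<lambda>i. idx (N i) k). v I * r I) - (\<Sum>I\<in>PiE UNIV (\<lambda>i. idx (N i) (k - 1)). w I * r I)\<bar>
    \<le> C / (real k)\<^sup>2 * (\<Sum>I\<in>PiE UNIV (\<lambda>i. idx (N i) k). (r I)\<^sup>2 / (\<Prod>l\<in>UNIV. leg_weight (I l)))"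
proof -
  define T where "T = 16 * real CARD('d) * \<alpha> / \<beta>"
  have T: "0 < T" using \<alpha> \<beta> by (simp add: T_def)
  define \<gamma> where "\<gamma> = min (\<beta> / 2) 1 / 2"
  have \<gamma>: "0 < \<gamma>" using \<beta> by (simp add: \<gamma>_def)
  define C1 where "C1 = real CARD('d) * (2 ^ (CARD('d) + 1) * (26 + 4 / \<gamma> + 1 / \<gamma> + 8 * (1 + 8 / \<gamma>\<^sup>2)) ^ CARD('d)) + 48 * \<alpha> * real CARD('d) / \<gamma>\<^sup>2"
  define C2 where "C2 = 8 * (T + 1)\<^sup>2 * (T + 1)\<^sup>2 / \<beta>"
  have C: "0 \<le> C1" "0 < C2" using \<alpha> \<beta> \<gamma> T by (auto simp: C1_def C2_def intro!: add_nonneg_nonneg mult_nonneg_nonneg)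
  show ?thesis
  proof (rule exI[of _ "C1 + C2"], intro conjI allI impI)
    show "0 < C1 + C2" using C by simp
    fix N :: "'d \<Rightarrow> nat" and k :: nat and v w r :: "('d \<Rightarrow> nat \<times> nat) \<Rightarrow> real"
    assume k: "2 \<le> k" and N': "\<forall>i. 0 < N i" and st: "tensor_coercive N \<beta> \<alpha> k" and st': "tensor_coercive N \<beta> \<alpha> (k - 1)"
      and v': "\<forall>I\<in>PiE UNIV (\<lambda>i. idx (N i) k). resid (\<lambda>i. idx (N i) k) (\<lambda>i. ipm (N i) \<alpha> k) (\<lambda>i. mm (N i)) v I = r I"
      and w': "\<forall>I\<in>PiE UNIV (\<lambda>i. idx (N i) (k - 1)). resid (\<lambda>i. idx (N i) (k - 1)) (\<lambda>i. ipm (N i) \<alpha> (k - 1)) (\<lambda>i. mm (N i)) w I = r I"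
    have N: "0 < N i" for i using N' by blast
    let ?U = "PiE UNIV (\<lambda>i. idx (N i) k)" and ?V = "PiE UNIV (\<lambda>i. idx (N i) (k - 1))"
    let ?wt = "\<lambda>I :: 'd \<Rightarrow> nat \<times> nat. \<Prod>l\<in>UNIV. leg_weight (I l)"
    define \<rho> where "\<rho> = (\<Sum>I\<in>?U. (r I)\<^sup>2 / ?wt I)"
    have wt: "0 \<le> ?wt I" for I by (intro prod_nonneg) (auto simp: leg_weight_def)
    have \<rho>: "0 \<le> \<rho>" "(\<Sum>I\<in>?V. (r I)\<^sup>2 / ?wt I) \<le> \<rho>"
    proof -
      show "0 \<le> \<rho>" unfolding \<rho>_def by (intro sum_nonneg divide_nonneg_nonneg wt) auto
      show "(\<Sum>I\<in>?V. (r I)\<^sup>2 / ?wt I) \<le> \<rho>" unfolding \<rho>_def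
      proof (rule sum_mono2)
        show "finite ?U" by (rule finite_PiE_UNIV) simp
        show "?V \<subseteq> ?U" by (intro PiE_mono idx_mono) simp
      qed (auto intro!: divide_nonneg_nonneg wt)
    qed
    let ?D = "(\<Sum>I\<in>?U. v I * r I) - (\<Sum>I\<in>?V. w I * r I)"
    have "\<bar>?D\<bar> \<le> C1 / (real k)\<^sup>2 * \<rho> \<or> \<bar>?D\<bar> \<le> C2 / (real k)\<^sup>2 * \<rho>"
    \<comment> \<open>The threshold is imposed at degree k - 1, so that the first case gives
      coercivity on both levels.\<close>
    proof (cases "\<forall>i. T \<le> real (N i) * real (k - 1)")
      case True
      have f: "16 * real CARD('d) * \<alpha> \<le> \<beta> * (real (N i) * real l)" if "l \<ge> k - 1" for i l
      proof -
        have "T \<le> real (N i) * real (k - 1)" using True by blast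
        also have "\<dots> \<le> real (N i) * real l" using that by (intro mult_left_mono) auto
        finally show ?thesis using \<beta> by (simp add: T_def field_simps)
      qed
      have c1: "\<gamma> * en (N i) k x x \<le> ip (N i) \<alpha> k x x" if "x \<in> bpoly (N i) k" for i x
        unfolding \<gamma>_def by (rule coercive_fine[OF N \<beta> _ _ st f that]) (use \<alpha> k in auto)
      have c2: "\<gamma> * en (N i) (k - 1) x x \<le> ip (N i) \<alpha> (k - 1) x x" if "x \<in> bpoly (N i) (k - 1)" for i x
        unfolding \<gamma>_def by (rule coercive_fine[OF N \<beta> _ _ st' f that]) (use \<alpha> k in auto)
      have "\<bar>?D\<bar> \<le> C1 / (real k)\<^sup>2 * \<rho>"
        unfolding C1_def \<rho>_def
        by (rule approximation_fine[where N = N and \<gamma> = \<gamma> and \<alpha> = \<alpha> and k = k and v = v and w = w and r = r, OF k N \<gamma> _ c1 c2])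
          (use \<alpha> v' w' in auto)
      then show ?thesis by blast
    next
      case False
      then obtain i where i: "real (N i) * real (k - 1) < T" by (auto simp: not_le)
      have "real (N i) * 1 \<le> real (N i) * real (k - 1)" using k by (intro mult_left_mono) auto
      then have NT: "real (N i) \<le> T" using i by simp
      have "1 * real (k - 1) \<le> real (N i) * real (k - 1)" using N[of i] by (intro mult_right_mono) auto
      then have "real (k - 1) < T" using i by linarith
      then have kT: "real k \<le> T + 1" using k by simp
      define M where "M = 8 * (real (N i) + 1)\<^sup>2 / \<beta>"
      have M: "0 \<le> M" "M \<le> 8 * (T + 1)\<^sup>2 / \<beta>" unfolding M_def using \<beta> NT
        by (auto intro!: divide_right_mono mult_left_mono power_mono)
      have a: "0 \<le> (\<Sum>I\<in>?U. v I * r I)" "(\<Sum>I\<in>?U. v I * r I) \<le> M * \<rho>"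
        unfolding M_def \<rho>_def
        by (rule approximation_coarse(1)[where N = N and k = k and v = v and r = r, OF \<beta> _ st]
            approximation_coarse(2)[where N = N and k = k and v = v and r = r and i = i, OF \<beta> _ st]; use k v' in auto)+
      have b: "0 \<le> (\<Sum>I\<in>?V. w I * r I)" "(\<Sum>I\<in>?V. w I * r I) \<le> M * (\<Sum>I\<in>?V. (r I)\<^sup>2 / ?wt I)"
        unfolding M_def
        by (rule approximation_coarse(1)[where N = N and k = "k - 1" and v = w and r = r, OF \<beta> _ st']
            approximation_coarse(2)[where N = N and k = "k - 1" and v = w and r = r and i = i, OF \<beta> _ st']; use k w' in auto)+
      have "M * (\<Sum>I\<in>?V. (r I)\<^sup>2 / ?wt I) \<le> M * \<rho>" by (intro mult_left_mono M \<rho>)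
      then have "\<bar>?D\<bar> \<le> M * \<rho>" using a b by (simp add: abs_le_iff)
      also have "\<dots> \<le> 8 * (T + 1)\<^sup>2 / \<beta> * \<rho>" by (intro mult_right_mono M \<rho>)
      also have "\<dots> \<le> C2 / (real k)\<^sup>2 * \<rho>"
      proof (intro mult_right_mono \<rho>(1))
        have "8 * (T + 1)\<^sup>2 / \<beta> * (real k)\<^sup>2 \<le> 8 * (T + 1)\<^sup>2 / \<beta> * (T + 1)\<^sup>2"
          using kT \<beta> by (intro mult_left_mono power_mono) auto
        then have "8 * (T + 1)\<^sup>2 / \<beta> * (real k)\<^sup>2 \<le> C2" by (simp add: C2_def)
        moreover have "0 < (real k)\<^sup>2" using k by simp
        ultimately show "8 * (T + 1)\<^sup>2 / \<beta> \<le> C2 / (real k)\<^sup>2" by (simp only: pos_le_divide_eq)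
      qed
      finally show ?thesis by blast
    qed
    moreover have "C1 / (real k)\<^sup>2 * \<rho> \<le> (C1 + C2) / (real k)\<^sup>2 * \<rho>" "C2 / (real k)\<^sup>2 * \<rho> \<le> (C1 + C2) / (real k)\<^sup>2 * \<rho>"
      using C \<rho> by (intro mult_right_mono divide_right_mono; simp)+
    ultimately show "\<bar>?D\<bar> \<le> (C1 + C2) / (real k)\<^sup>2 * (\<Sum>I\<in>?U. (r I)\<^sup>2 / ?wt I)"
      unfolding \<rho>_def[symmetric] by linarith
  qed
qed

section \<open>Chebyshev smoothing\<close>

text \<open>Chebyshev polynomials of the fourth and third kind in 1 - 2 x, generated together by the
  addition theorems for an increment of 2 t. Doubling is written as a sum, so that the identities
  below are instances of identities in an arbitrary commutative ring.\<close>

fun chW :: "nat \<Rightarrow> real poly" and chV :: "nat \<Rightarrow> real poly" where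
  "chW 0 = 1"
| "chW (Suc m) = (1 - [:0, 1:] - [:0, 1:]) * chW m + ((1 - [:0, 1:]) + (1 - [:0, 1:])) * chV m"
| "chV 0 = 1"
| "chV (Suc m) = (1 - [:0, 1:] - [:0, 1:]) * chV m - ([:0, 1:] + [:0, 1:]) * chW m"

text \<open>With \<open>x = sin\<^sup>2 t\<close> one has \<open>chW m = sin ((2 m + 1) t) / sin t\<close> and
  \<open>chV m = cos ((2 m + 1) t) / cos t\<close>; the identity below is \<open>sin\<^sup>2 + cos\<^sup>2 = 1\<close>.\<close>

lemma chWV_identity: "[:0, 1:] * (chW m * chW m) + (1 - [:0, 1:]) * (chV m * chV m) = 1"
proof (induction m)
  case (Suc m)
  have gen: "x * (((1 - x - x) * W + ((1 - x) + (1 - x)) * V) * ((1 - x - x) * W + ((1 - x) + (1 - x)) * V))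
      + (1 - x) * (((1 - x - x) * V - (x + x) * W) * ((1 - x - x) * V - (x + x) * W))
      = x * (W * W) + (1 - x) * (V * V)" for x V W :: "'a :: comm_ring_1"
    by (simp add: algebra_simps)
  show ?case unfolding chW.simps chV.simps gen by (rule Suc)
qed simp

lemma chW_rec: "chW (Suc (Suc m)) = (1 - [:0, 1:] - [:0, 1:]) * chW (Suc m) + (1 - [:0, 1:] - [:0, 1:]) * chW (Suc m) - chW m"
proof -
  have gen: "(1 - x - x) * ((1 - x - x) * W + ((1 - x) + (1 - x)) * V) + ((1 - x) + (1 - x)) * ((1 - x - x) * V - (x + x) * W)
      = (1 - x - x) * ((1 - x - x) * W + ((1 - x) + (1 - x)) * V) + (1 - x - x) * ((1 - x - x) * W + ((1 - x) + (1 - x)) * V) - W"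
    for x V W :: "'a :: comm_ring_1"
    by (simp add: algebra_simps)
  show ?thesis unfolding chW.simps chV.simps by (rule gen)
qed

fun chP :: "nat \<Rightarrow> real poly" where
  "chP 0 = 1"
| "chP (Suc 0) = 1 - Polynomial.smult (4 / 3) [:0, 1:]"
| "chP (Suc (Suc n)) = Polynomial.smult ((4 * real (Suc (Suc n)) - 2) / (2 * real (Suc (Suc n)) + 1)) ((1 - Polynomial.smult 2 [:0, 1:]) * chP (Suc n))
     - Polynomial.smult ((2 * real (Suc (Suc n)) - 3) / (2 * real (Suc (Suc n)) + 1)) (chP n)"

text \<open>Multiplication by 2 m + 1 turns the recursion of the smoother into
  \<open>chW_rec\<close>: \<open>chP\<close> is the fourth-kind polynomial normalised to 1 at x =
  0.\<close>

lemma chP_chW: "Polynomial.smult (2 * real m + 1) (chP m) = chW m"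
proof (induction m rule: chP.induct)
  case 2
  show ?case by (simp add: one_pCons numeral_poly)
next
  case (3 n)
  define Y :: "real poly" where "Y = 1 - [:0, 1:] - [:0, 1:]"
  have X: "1 - Polynomial.smult 2 [:0, 1:] = Y" by (simp add: Y_def one_pCons)
  have "Polynomial.smult (2 * real (Suc (Suc n)) + 1) (chP (Suc (Suc n)))
    = Polynomial.smult (2 * (2 * real (Suc n) + 1)) (Y * chP (Suc n)) - Polynomial.smult (2 * real n + 1) (chP n)"
    unfolding chP.simps X smult_diff_right smult_smult
    by (intro arg_cong2[of _ _ _ _ "(-)"] arg_cong2[of _ _ _ _ Polynomial.smult]) (auto simp: field_simps)
  also have "\<dots> = Polynomial.smult 2 (Y * Polynomial.smult (2 * real (Suc n) + 1) (chP (Suc n))) - Polynomial.smult (2 * real n + 1) (chP n)"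
    by simp
  also have "\<dots> = Polynomial.smult 2 (Y * chW (Suc n)) - chW n" unfolding 3 ..
  also have "\<dots> = chW (Suc (Suc n))"
  proof -
    have "Polynomial.smult 2 p = p + p" for p :: "real poly"
      by (metis smult_1_left smult_add_left one_add_one)
    then show ?thesis unfolding chW_rec Y_def by simp
  qed
  finally show ?case .
qed simp

text \<open>Functions on the naturals replace vectors to keep dimensions out of the polynomial
  calculus. \<open>X_pos\<close> and \<open>X_le\<close> express that the spectrum lies in [0, 1]
  without eigenvalues; \<open>E\<close> is only semidefinite.\<close>

locale sym_op =
  fixes X :: "(nat \<Rightarrow> real) \<Rightarrow> nat \<Rightarrow> real" and E :: "(nat \<Rightarrow> real) \<Rightarrow> (nat \<Rightarrow> real) \<Rightarrow> real"
  assumes X_add: "X (\<lambda>i. u i + w i) = (\<lambda>i. X u i + X w i)"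
    and X_scale: "X (\<lambda>i. c * u i) = (\<lambda>i. c * X u i)"
    and E_add: "E (\<lambda>i. u i + w i) z = E u z + E w z"
    and E_scale: "E (\<lambda>i. c * u i) z = c * E u z"
    and E_sym: "E u w = E w u"
    and E_pos: "0 \<le> E u u"
    and X_sa: "E (X u) w = E u (X w)"
    and X_pos: "0 \<le> E (X u) u"
    and X_le: "E (X u) u \<le> E u u"
begin

text \<open>p(X) v by the Horner scheme.\<close>

definition ev :: "real poly \<Rightarrow> (nat \<Rightarrow> real) \<Rightarrow> nat \<Rightarrow> real" where
  "ev p v = fold_coeffs (\<lambda>a f i. a * v i + X f i) p (\<lambda>_. 0)"

lemma X_zero: "X (\<lambda>_. 0) = (\<lambda>_. 0)"
  using X_scale[of 0 "\<lambda>_. 0"] by simp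

lemma ev_0 [simp]: "ev 0 v = (\<lambda>_. 0)"
  by (simp add: ev_def)

lemma ev_pCons [simp]: "ev (pCons a p) v = (\<lambda>i. a * v i + X (ev p v) i)"
  by (cases "a = 0 \<and> p = 0") (auto simp: ev_def X_zero)

lemma ev_add: "ev (p + q) v = (\<lambda>i. ev p v i + ev q v i)"
  by (induction p q rule: poly_induct2) (auto simp: X_add algebra_simps)

lemma ev_smult: "ev (Polynomial.smult c p) v = (\<lambda>i. c * ev p v i)"
  by (induction p) (auto simp: X_scale algebra_simps)

lemma ev_diff: "ev (p - q) v = (\<lambda>i. ev p v i - ev q v i)"
proof -
  have "p - q = p + Polynomial.smult (-1) q" by simp
  then show ?thesis by (simp only: ev_add ev_smult) simp
qed

lemma ev_X: "ev p (X v) = X (ev p v)"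
proof (induction p)
  case (pCons c p)
  have "X (\<lambda>i. c * v i + X (ev p v) i) = (\<lambda>i. c * X v i + X (X (ev p v)) i)"
    using X_add[of "\<lambda>i. c * v i" "X (ev p v)"] by (simp add: X_scale)
  then show ?case using pCons.IH by simp
qed (simp add: X_zero)

lemma ev_mult: "ev (p * q) v = ev p (ev q v)"
  by (induction p) (auto simp: ev_add ev_smult)

lemma ev_1 [simp]: "ev 1 v = v"
  by (simp add: one_pCons X_zero)

lemma ev_x: "ev [:0, 1:] v = X v"
  by (simp add: X_zero)

lemma ev_sa: "E (ev p u) w = E u (ev p w)"
proof (induction p arbitrary: u w)
  case 0
  show ?case using E_scale[of 0 "\<lambda>_. 0" w] E_scale[of 0 "\<lambda>_. 0" u] by (simp add: E_sym[of u])
next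
  case (pCons c p)
  have "E (\<lambda>i. c * u i + X (ev p u) i) w = c * E u w + E (X (ev p u)) w"
    using E_add[of "\<lambda>i. c * u i" "X (ev p u)" w] by (simp add: E_scale)
  also have "E (X (ev p u)) w = E u (X (ev p w))"
    unfolding X_sa pCons.IH ev_X ..
  also have "c * E u w + E u (X (ev p w)) = E u (\<lambda>i. c * w i + X (ev p w) i)"
    using E_add[of "\<lambda>i. c * w i" "X (ev p w)" u] by (simp add: E_scale E_sym[of u])
  finally show ?case by simp
qed

text \<open>A positive functional on polynomials, in place of integration against a spectral measure
  on [0, 1]. An inequality on [0, 1] is transferred by exhibiting the difference as squares weighted
  with 1, x or 1 - x.\<close>

definition L :: "(nat \<Rightarrow> real) \<Rightarrow> real poly \<Rightarrow> real" where
  "L v p = E (ev p v) v"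

lemma L_add: "L v (p + q) = L v p + L v q"
  by (simp add: L_def ev_add E_add)

lemma L_smult: "L v (Polynomial.smult c p) = c * L v p"
  by (simp add: L_def ev_smult E_scale)

lemma L_diff: "L v (p - q) = L v p - L v q"
proof -
  have "p - q = p + Polynomial.smult (-1) q" by simp
  then show ?thesis by (simp only: L_add L_smult)
qed

lemma L_square: "L v (p * p) = E (ev p v) (ev p v)"
  by (simp add: L_def ev_mult ev_sa[of p "ev p v" v])

lemma L_x_square: "L v ([:0, 1:] * (p * p)) = E (X (ev p v)) (ev p v)"
proof -
  have "L v ([:0, 1:] * (p * p)) = E (ev [:0, 1:] (ev (p * p) v)) v" unfolding L_def by (simp only: ev_mult)
  also have "\<dots> = E (ev p (X (ev p v))) v" unfolding ev_x ev_mult ev_X ..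
  also have "\<dots> = E (X (ev p v)) (ev p v)" by (rule ev_sa)
  finally show ?thesis .
qed

lemma L_nonneg: "0 \<le> L v (p * p)" "0 \<le> L v ([:0, 1:] * (p * p))" "0 \<le> L v ((1 - [:0, 1:]) * (p * p))"
proof -
  show "0 \<le> L v (p * p)" unfolding L_square by (rule E_pos)
  show "0 \<le> L v ([:0, 1:] * (p * p))" unfolding L_x_square by (rule X_pos)
  show "0 \<le> L v ((1 - [:0, 1:]) * (p * p))"
    unfolding left_diff_distrib L_diff L_x_square mult_1_left unfolding L_square using X_le by simp
qed

text \<open>x (1 - x) = x (1 - x)^2 + (1 - x) x^2 reduces the product weight to the two weights at
  hand.\<close>

lemma L_x1x_nonneg: "0 \<le> L v ([:0, 1:] * (1 - [:0, 1:]) * (p * p))"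
proof -
  have gen: "x * (1 - x) * (p * p) = x * (((1 - x) * p) * ((1 - x) * p)) + (1 - x) * ((x * p) * (x * p))" for x p :: "'a :: comm_ring_1"
    by (simp add: algebra_simps)
  show ?thesis unfolding gen L_add by (intro add_nonneg_nonneg L_nonneg)
qed

lemma chW_weighted: "L v ([:0, 1:] * (chW m * chW m)) \<le> L v 1" "L v ((1 - [:0, 1:]) * (chV m * chV m)) \<le> L v 1"
  using arg_cong[OF chWV_identity[of m], of "L v"] L_nonneg[of v "chW m"] L_nonneg[of v "chV m"]
  unfolding L_add by auto

text \<open>The estimate of \<open>chW m\<close> by 2 m + 1 on [0, 1] in functional form. In the
  recursion the next polynomial is a + b, with a bounded by 2 m + 1 and b by 2, and the bounds add
  up to 2 m + 3.\<close>

lemma chW_bound: "L v (chW m * chW m) \<le> (2 * real m + 1)\<^sup>2 * L v 1"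
proof (induction m)
  case (Suc m)
  let ?x = "[:0, 1:] :: real poly"
  define a b where "a = (1 - ?x - ?x) * chW m" and "b = ((1 - ?x) + (1 - ?x)) * chV m"
  \<comment> \<open>The ratio of the bounds for a and b. With this weight, (1 + 1 / c) a^2 + (1 + c)
    b^2 yields exactly the square of the sum of the bounds.\<close>
  define c where "c = (2 * real m + 1) / 2"
  have c: "0 < c" by (simp add: c_def)
  have "L v (a * a) = L v (chW m * chW m) - 4 * L v (?x * (1 - ?x) * (chW m * chW m))"
  proof -
    have gen: "((1 - x - x) * w) * ((1 - x - x) * w) = w * w - (x * (1 - x) * (w * w) + x * (1 - x) * (w * w)
        + x * (1 - x) * (w * w) + x * (1 - x) * (w * w))" for x w :: "'a :: comm_ring_1"
      by (simp add: algebra_simps)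
    show ?thesis unfolding a_def gen L_diff L_add by simp
  qed
  then have La: "L v (a * a) \<le> (2 * real m + 1)\<^sup>2 * L v 1"
    using Suc.IH L_x1x_nonneg[of v "chW m"] by simp
  have "L v (b * b) = 4 * L v ((1 - ?x) * (chV m * chV m)) - 4 * L v (?x * (1 - ?x) * (chV m * chV m))"
  proof -
    have gen: "(((1 - x) + (1 - x)) * w) * (((1 - x) + (1 - x)) * w)
      = ((1 - x) * (w * w) + (1 - x) * (w * w) + (1 - x) * (w * w) + (1 - x) * (w * w)) - (x * (1 - x) * (w * w) + x * (1 - x) * (w * w)
        + x * (1 - x) * (w * w) + x * (1 - x) * (w * w))" for x w :: "'a :: comm_ring_1"
      by (simp add: algebra_simps)
    show ?thesis unfolding b_def gen L_diff L_add by simp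
  qed
  then have Lb: "L v (b * b) \<le> 4 * L v 1"
    using chW_weighted(2)[of v m] L_x1x_nonneg[of v "chV m"] by simp
  have "L v ((a - Polynomial.smult c b) * (a - Polynomial.smult c b)) = L v (a * a) - 2 * c * L v (a * b) + c * c * L v (b * b)"
    unfolding left_diff_distrib right_diff_distrib mult_smult_left mult_smult_right L_diff L_smult mult.commute[of b a] by simp
  then have "0 \<le> 1 / c * (L v (a * a) - 2 * c * L v (a * b) + c * c * L v (b * b))"
    using c L_nonneg(1)[of v "a - Polynomial.smult c b"] by simp
  also have "\<dots> = 1 / c * L v (a * a) - 2 * L v (a * b) + c * L v (b * b)"
    using c by (simp add: field_simps)
  finally have "L v (a * a) + 2 * L v (a * b) + L v (b * b) \<le> (1 + 1 / c) * L v (a * a) + (1 + c) * L v (b * b)"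
    by (simp add: algebra_simps)
  moreover have "L v ((a + b) * (a + b)) = L v (a * a) + 2 * L v (a * b) + L v (b * b)"
    unfolding distrib_left distrib_right L_add mult.commute[of b a] by simp
  ultimately have "L v ((a + b) * (a + b)) \<le> (1 + 1 / c) * L v (a * a) + (1 + c) * L v (b * b)" by simp
  also have "\<dots> \<le> (1 + 1 / c) * ((2 * real m + 1)\<^sup>2 * L v 1) + (1 + c) * (4 * L v 1)"
    using c by (intro add_mono mult_left_mono La Lb) auto
  also have "\<dots> = ((1 + 1 / c) * (2 * real m + 1)\<^sup>2 + (1 + c) * 4) * L v 1" by (simp add: algebra_simps)
  also have "(1 + 1 / c) * (2 * real m + 1)\<^sup>2 + (1 + c) * 4 = (2 * real (Suc m) + 1)\<^sup>2"
  proof -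
    have "1 / c * (2 * real m + 1)\<^sup>2 = 2 * (2 * real m + 1)" by (simp add: c_def power2_eq_square)
    then show ?thesis by (simp add: distrib_right) (simp add: c_def power2_eq_square algebra_simps)
  qed
  finally show ?case by (simp add: a_def b_def)
qed (simp add: L_def)

lemma smoothing:
  fixes m :: nat
  defines "G \<equiv> ev (chP m)"
  shows "E (G v) (G v) \<le> E v v" "E (X (G v)) (G v) \<le> E v v / (2 * real m + 1)\<^sup>2" "E (G u) w = E u (G w)"
proof -
  have p: "0 < (2 * real m + 1)\<^sup>2" by (intro zero_less_power) (simp add: add_nonneg_pos)
  have W: "chW m * chW m = Polynomial.smult ((2 * real m + 1)\<^sup>2) (chP m * chP m)"
    unfolding chP_chW[symmetric] by (simp add: power2_eq_square)
  have L1: "L v 1 = E v v" by (simp add: L_def)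
  show "E (G v) (G v) \<le> E v v"
    using chW_bound[of v m] p unfolding W L_smult L1 G_def L_square by simp
  have "(2 * real m + 1)\<^sup>2 * E (X (G v)) (G v) \<le> E v v"
    using chW_weighted(1)[of v m] unfolding W mult_smult_right L_smult L1 G_def L_x_square .
  then show "E (X (G v)) (G v) \<le> E v v / (2 * real m + 1)\<^sup>2"
    using p by (simp add: pos_le_divide_eq mult.commute)
  show "E (G u) w = E u (G w)" unfolding G_def by (rule ev_sa)
qed

end

section \<open>Matrices as operators\<close>

text \<open>Extension by zero, so that matrix identities become equalities of functions on all
  indices, as \<open>sym_op\<close> demands.\<close>

definition vf :: "real Matrix.vec \<Rightarrow> nat \<Rightarrow> real" where
  "vf v i = (if i < dim_vec v then vec_index v i else 0)"

definition mv :: "nat \<Rightarrow> real mat \<Rightarrow> (nat \<Rightarrow> real) \<Rightarrow> nat \<Rightarrow> real" where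
  "mv n M f i = (if i < n then \<Sum>j<n. M $$ (i, j) * f j else 0)"

definition qe :: "nat \<Rightarrow> real mat \<Rightarrow> (nat \<Rightarrow> real) \<Rightarrow> (nat \<Rightarrow> real) \<Rightarrow> real" where
  "qe n M f g = (\<Sum>i<n. \<Sum>j<n. M $$ (i, j) * f i * g j)"

lemma vf_mat: "M \<in> carrier_mat n n \<Longrightarrow> v \<in> carrier_vec n \<Longrightarrow> vf (M *\<^sub>v v) = mv n M (vf v)"
  by (intro ext) (auto simp: vf_def mv_def scalar_prod_def row_def atLeast0LessThan intro!: sum.cong)

lemma vf_diff: "u \<in> carrier_vec n \<Longrightarrow> w \<in> carrier_vec n \<Longrightarrow> vf (u - w) = (\<lambda>i. vf u i - vf w i)"
  by (intro ext) (auto simp: vf_def)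

lemma vf_smult: "vf (c \<cdot>\<^sub>v u) = (\<lambda>i. c * vf u i)"
  by (intro ext) (auto simp: vf_def)

lemma qe_vec: "M \<in> carrier_mat n n \<Longrightarrow> u \<in> carrier_vec n \<Longrightarrow> w \<in> carrier_vec n \<Longrightarrow> u \<bullet> (M *\<^sub>v w) = qe n M (vf u) (vf w)"
  by (auto simp: vf_def qe_def scalar_prod_def row_def atLeast0LessThan sum_distrib_left mult_ac intro!: sum.cong)

lemma qe_mv: "qe n M f g = (\<Sum>i<n. f i * mv n M g i)"
  unfolding qe_def mv_def by (intro sum.cong refl) (simp add: sum_distrib_left mult_ac)

lemma qe_sym:
  assumes "\<And>i j. i < n \<Longrightarrow> j < n \<Longrightarrow> M $$ (i, j) = M $$ (j, i)"
  shows "qe n M f g = qe n M g f"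
proof -
  have "qe n M f g = (\<Sum>j<n. \<Sum>i<n. M $$ (i, j) * f i * g j)" unfolding qe_def by (rule sum.swap)
  also have "\<dots> = qe n M g f" unfolding qe_def
  proof (intro sum.cong refl)
    fix i j assume "i \<in> {..<n}" "j \<in> {..<n}"
    then show "M $$ (j, i) * f j * g i = M $$ (i, j) * g i * f j" using assms[of i j] by simp
  qed
  finally show ?thesis .
qed

lemma minv_diag_part:
  assumes A: "A \<in> carrier_mat n n" and pos: "\<And>i. i < n \<Longrightarrow> A $$ (i, i) \<noteq> 0"
  shows "minv (diag_part A) = mat_diag n (\<lambda>i. 1 / A $$ (i, i))" "invertible_mat (diag_part A)"
proof -
  have D: "diag_part A = mat_diag n (\<lambda>i. A $$ (i, i))" using A by (simp add: diag_part_def)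
  let ?D = "mat_diag n (\<lambda>i. A $$ (i, i))" and ?I = "mat_diag n (\<lambda>i. 1 / A $$ (i, i))"
  have DI: "?D * ?I = 1\<^sub>m n" "?I * ?D = 1\<^sub>m n"
    unfolding mat_diag_diag using pos by (auto intro!: eq_matI simp: mat_diag_def)
  have c: "?D \<in> carrier_mat n n" "?I \<in> carrier_mat n n" by auto
  show inv: "invertible_mat (diag_part A)"
  proof -
    have "dim_row ?D = n" "dim_col ?D = n" "dim_row ?I = n" by (simp_all add: mat_diag_def)
    then show ?thesis
      unfolding D invertible_mat_def inverts_mat_def square_mat.simps
      by (intro conjI exI[of _ ?I]) (simp_all only: DI)
  qed
  note M = minv_mult[OF c(1) inv[unfolded D]]
  have "minv ?D = minv ?D * (?D * ?I)" unfolding DI using M(1) by simp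
  also have "\<dots> = (minv ?D * ?D) * ?I" by (rule assoc_mult_mat[OF M(1) c, symmetric])
  also have "\<dots> = ?I" unfolding M(2) by (rule left_mult_one_mat[OF c(2)])
  finally show "minv (diag_part A) = ?I" unfolding D .
qed

lemma precond_entry:
  assumes "A \<in> carrier_mat n n" "\<And>i. i < n \<Longrightarrow> A $$ (i, i) \<noteq> 0"
  shows "precond A \<in> carrier_mat n n" "i < n \<Longrightarrow> j < n \<Longrightarrow> precond A $$ (i, j) = A $$ (i, j) / A $$ (i, i)"
proof -
  have p: "precond A = mat_diag n (\<lambda>i. 1 / A $$ (i, i)) * A"
    unfolding precond_def using minv_diag_part(1)[OF assms(1)] assms(2) by simp
  show "precond A \<in> carrier_mat n n" unfolding p using assms(1) by (simp add: mat_diag_mult_left)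
  show "precond A $$ (i, j) = A $$ (i, j) / A $$ (i, i)" if "i < n" "j < n"
    unfolding p using assms(1) that by (simp add: mat_diag_mult_left)
qed

text \<open>For X = \<omega> D^-1 A, self-adjointness in the energy product holds by symmetry of A
  D^-1 A, and X \<le> 1 is the damping condition \<omega> A \<le> D. The latter is a Rayleigh bound,
  later obtained from the spectral radius.\<close>

lemma spd_sym_op:
  assumes A: "A \<in> carrier_mat n n" and sym: "\<And>i j. i < n \<Longrightarrow> j < n \<Longrightarrow> A $$ (i, j) = A $$ (j, i)"
    and psd: "\<And>f. 0 \<le> qe n A f f" and dpos: "\<And>i. i < n \<Longrightarrow> 0 < A $$ (i, i)"
    and \<omega>: "0 \<le> \<omega>" and damp: "\<And>f. \<omega> * qe n A f f \<le> (\<Sum>i<n. A $$ (i, i) * (f i)\<^sup>2)"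
  shows "sym_op (mv n (\<omega> \<cdot>\<^sub>m precond A)) (qe n A)"
    and "qe n A (mv n (\<omega> \<cdot>\<^sub>m precond A) f) f = \<omega> * (\<Sum>i<n. (mv n A f i)\<^sup>2 / A $$ (i, i))"
proof -
  have nz: "i < n \<Longrightarrow> A $$ (i, i) \<noteq> 0" for i using dpos by force
  note pc = precond_entry[OF A nz]
  define X where "X = mv n (\<omega> \<cdot>\<^sub>m precond A)"
  have X: "X f i = (if i < n then \<omega> * (mv n A f i / A $$ (i, i)) else 0)" for f i
    using pc unfolding X_def mv_def by (auto simp: sum_distrib_left sum_divide_distrib intro!: sum.cong)
  have EX: "qe n A (X u) w = \<omega> * (\<Sum>i<n. mv n A u i * mv n A w i / A $$ (i, i))" for u w
    unfolding qe_mv by (simp add: X sum_distrib_left mult_ac)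
  show "qe n A (mv n (\<omega> \<cdot>\<^sub>m precond A) f) f = \<omega> * (\<Sum>i<n. (mv n A f i)\<^sup>2 / A $$ (i, i))"
    unfolding X_def[symmetric] EX by (simp add: power2_eq_square)
  have s: "qe n A u w = qe n A w u" for u w by (rule qe_sym) (rule sym)
  show "sym_op (mv n (\<omega> \<cdot>\<^sub>m precond A)) (qe n A)"
    unfolding X_def[symmetric]
  proof
    fix u w z :: "nat \<Rightarrow> real" and c :: real
    show "X (\<lambda>i. u i + w i) = (\<lambda>i. X u i + X w i)"
      by (intro ext) (simp add: X_def mv_def distrib_left sum.distrib)
    show "X (\<lambda>i. c * u i) = (\<lambda>i. c * X u i)"
      by (intro ext) (simp add: X_def mv_def sum_distrib_left mult_ac)
    show "qe n A (\<lambda>i. u i + w i) z = qe n A u z + qe n A w z"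
      by (simp add: qe_mv distrib_right sum.distrib)
    show "qe n A (\<lambda>i. c * u i) z = c * qe n A u z"
      by (simp add: qe_mv sum_distrib_left mult_ac)
    show "qe n A u w = qe n A w u" by (rule s)
    show "0 \<le> qe n A u u" by (rule psd)
    show "qe n A (X u) w = qe n A u (X w)"
      unfolding s[of u "X w"] EX by (simp add: mult.commute)
    show "0 \<le> qe n A (X u) u"
      unfolding EX power2_eq_square[symmetric] using \<omega> dpos
      by (intro mult_nonneg_nonneg sum_nonneg divide_nonneg_nonneg) (auto simp: less_imp_le)
    \<comment> \<open>With S the squared D^-1 norm of A u, the energy product of X u and u is
      \<omega> S, and \<open>damp\<close> at X u bounds the energy of X u by \<omega> S if \<omega>
      \<noteq> 0. Expanding the energy of u - X u then leaves energy of u minus \<omega> S \<ge>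
      0.\<close>
    show "qe n A (X u) u \<le> qe n A u u"
    proof -
      define S where "S = (\<Sum>i<n. (mv n A u i)\<^sup>2 / A $$ (i, i))"
      have a: "qe n A (X u) u = \<omega> * S" unfolding EX S_def by (simp add: power2_eq_square)
      have "\<omega> * qe n A (X u) (X u) \<le> (\<Sum>i<n. A $$ (i, i) * (X u i)\<^sup>2)" by (rule damp)
      also have "\<dots> = \<omega>\<^sup>2 * S"
        unfolding S_def sum_distrib_left by (intro sum.cong refl) (simp add: X power2_eq_square nz field_simps)
      finally have b: "\<omega> * qe n A (X u) (X u) \<le> \<omega> * (\<omega> * S)" by (simp add: power2_eq_square)
      have lin: "qe n A (\<lambda>i. u i + (-1) * X u i) (\<lambda>i. u i + (-1) * X u i) = qe n A u u - 2 * qe n A (X u) u + qe n A (X u) (X u)"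
      proof -
        have l: "qe n A (\<lambda>i. u i + (-1) * X u i) z = qe n A u z - qe n A (X u) z" for z
          by (simp add: qe_mv left_diff_distrib sum_subtractf)
        have r: "qe n A z (\<lambda>i. u i + (-1) * X u i) = qe n A z u - qe n A z (X u)" for z
          unfolding s[of z] l ..
        show ?thesis unfolding l r using s[of u "X u"] by simp
      qed
      have d: "0 \<le> qe n A u u - 2 * (\<omega> * S) + qe n A (X u) (X u)" using psd[of "\<lambda>i. u i + (-1) * X u i"] unfolding lin a .
      show ?thesis
      proof (cases "\<omega> = 0")
        case True
        then show ?thesis unfolding a using psd by simp
      next
        case False
        then have "qe n A (X u) (X u) \<le> \<omega> * S" using b \<omega> by simp
        then show ?thesis using d unfolding a by simp
      qed
    qed
  qed
qed

lemma vf_cheb: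
  assumes M: "M \<in> carrier_mat n n" and so: "sym_op (mv n M) E" and v: "v \<in> carrier_vec n"
  shows "vf (cheb_mat M m *\<^sub>v v) = sym_op.ev (mv n M) (chP m) (vf v)"
proof -
  interpret sym_op "mv n M" E by (rule so)
  have C: "cheb_mat M i \<in> carrier_mat n n" for i by (rule cheb_mat_carrier[OF M])
  have Cv: "cheb_mat M i *\<^sub>v v \<in> carrier_vec n" for i using C v by (metis mult_mat_vec_carrier)
  show ?thesis
  proof (induction m rule: chP.induct)
    case 1
    show ?case using M v by simp
  next
    case 2
    have "cheb_mat M (Suc 0) *\<^sub>v v = v - (4/3) \<cdot>\<^sub>v (M *\<^sub>v v)"
      using M v by (simp add: minus_mult_distrib_mat_vec[of _ n n] smult_mat_vec)
    moreover have "M *\<^sub>v v \<in> carrier_vec n" using M v by (metis mult_mat_vec_carrier)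
    moreover have "ev (chP (Suc 0)) (vf v) = (\<lambda>i. vf v i - 4 / 3 * mv n M (vf v) i)"
      unfolding chP.simps ev_diff ev_smult ev_x by simp
    ultimately show ?case using v by (simp only: vf_diff[of _ n] smult_carrier_vec vf_smult vf_mat[OF M v])
  next
    case (3 i)
    let ?a = "cheb_mat M (Suc i) *\<^sub>v v" and ?b = "cheb_mat M i *\<^sub>v v"
    define B where "B = 1\<^sub>m n - 2 \<cdot>\<^sub>m M"
    have B: "B \<in> carrier_mat n n" unfolding B_def by (rule minus_carrier_mat, rule smult_carrier_mat, rule M)
    have Ba: "B *\<^sub>v ?a = ?a - 2 \<cdot>\<^sub>v (M *\<^sub>v ?a)"
      unfolding B_def using minus_mult_distrib_mat_vec[of "1\<^sub>m n" n n "2 \<cdot>\<^sub>m M" ?a] M Cv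
      by (simp add: smult_mat_vec[OF M Cv] del: cheb_mat.simps)
    have Ma: "M *\<^sub>v ?a \<in> carrier_vec n" using M Cv by (metis mult_mat_vec_carrier)
    have BC: "B * cheb_mat M (Suc i) \<in> carrier_mat n n" using B C by (meson mult_carrier_mat)
    let ?c = "(4 * real (Suc (Suc i)) - 2) / (2 * real (Suc (Suc i)) + 1)" and ?d = "(2 * real (Suc (Suc i)) - 3) / (2 * real (Suc (Suc i)) + 1)"
    have rec: "cheb_mat M (Suc (Suc i)) = ?c \<cdot>\<^sub>m (B * cheb_mat M (Suc i)) - ?d \<cdot>\<^sub>m cheb_mat M i"
      using M by (simp add: Let_def B_def)
    have c: "cheb_mat M (Suc (Suc i)) *\<^sub>v v = ?c \<cdot>\<^sub>v (?a - 2 \<cdot>\<^sub>v (M *\<^sub>v ?a)) - ?d \<cdot>\<^sub>v ?b"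
      unfolding rec Ba[symmetric] assoc_mult_mat_vec[OF B C v, symmetric]
        smult_mat_vec[OF BC v, symmetric] smult_mat_vec[OF C v, symmetric]
      by (rule minus_mult_distrib_mat_vec[OF smult_carrier_mat[OF BC] smult_carrier_mat[OF C] v])
    have "vf (cheb_mat M (Suc (Suc i)) *\<^sub>v v) = (\<lambda>j. ?c * (vf ?a j - 2 * mv n M (vf ?a) j) - ?d * vf ?b j)"
      unfolding c using Cv[of "Suc i"] Cv[of i] Ma
      by (subst vf_diff[of _ n]) (auto simp: vf_smult vf_diff[of _ n] vf_mat[OF M Cv] simp del: cheb_mat.simps)
    also have "\<dots> = ev (chP (Suc (Suc i))) (vf v)"
      unfolding chP.simps ev_diff ev_smult ev_mult 3[symmetric]
      by (simp add: X_zero del: cheb_mat.simps)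
    finally show ?case .
  qed
qed

text \<open>The properties through which the smoother enters the cycle: no growth of energy, decay
  of the D^-1 norm of the residual with the number of steps, and self-adjointness in the energy
  product.\<close>

lemma smoother_bounds:
  fixes m :: nat
  assumes A: "A \<in> carrier_mat n n" and sym: "\<And>i j. i < n \<Longrightarrow> j < n \<Longrightarrow> A $$ (i, j) = A $$ (j, i)"
    and psd: "\<And>f. 0 \<le> qe n A f f" and dpos: "\<And>i. i < n \<Longrightarrow> 0 < A $$ (i, i)"
    and \<omega>: "0 \<le> \<omega>" and damp: "\<And>f. \<omega> * qe n A f f \<le> (\<Sum>i<n. A $$ (i, i) * (f i)\<^sup>2)"
  defines "G \<equiv> cheb_mat (\<omega> \<cdot>\<^sub>m precond A) m"
  shows "G \<in> carrier_mat n n"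
    and "g \<in> carrier_vec n \<Longrightarrow> (G *\<^sub>v g) \<bullet> (A *\<^sub>v (G *\<^sub>v g)) \<le> g \<bullet> (A *\<^sub>v g)"
    and "g \<in> carrier_vec n \<Longrightarrow> \<omega> * (\<Sum>i<n. (vec_index (A *\<^sub>v (G *\<^sub>v g)) i)\<^sup>2 / A $$ (i, i)) \<le> g \<bullet> (A *\<^sub>v g) / (2 * real m + 1)\<^sup>2"
    and "u \<in> carrier_vec n \<Longrightarrow> w \<in> carrier_vec n \<Longrightarrow> (G *\<^sub>v u) \<bullet> (A *\<^sub>v w) = u \<bullet> (A *\<^sub>v (G *\<^sub>v w))"
proof -
  have nz: "i < n \<Longrightarrow> A $$ (i, i) \<noteq> 0" for i using dpos by force
  have X: "\<omega> \<cdot>\<^sub>m precond A \<in> carrier_mat n n" using precond_entry(1)[OF A nz] by simp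
  show G: "G \<in> carrier_mat n n" unfolding G_def by (rule cheb_mat_carrier[OF X])
  note so = spd_sym_op(1)[OF A sym psd dpos \<omega> damp]
  have so2: "qe n A (mv n (\<omega> \<cdot>\<^sub>m precond A) f) f = \<omega> * (\<Sum>i<n. (mv n A f i)\<^sup>2 / A $$ (i, i))" for f
    by (rule spd_sym_op(2)[OF A]) (fact sym psd dpos \<omega> damp)+
  interpret sym_op "mv n (\<omega> \<cdot>\<^sub>m precond A)" "qe n A" by (rule so)
  have Gv: "G *\<^sub>v u \<in> carrier_vec n" if "u \<in> carrier_vec n" for u using G that by (metis mult_mat_vec_carrier)
  have vG: "vf (G *\<^sub>v u) = ev (chP m) (vf u)" if "u \<in> carrier_vec n" for u
    unfolding G_def by (rule vf_cheb[OF X so that])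
  show "(G *\<^sub>v g) \<bullet> (A *\<^sub>v (G *\<^sub>v g)) \<le> g \<bullet> (A *\<^sub>v g)" if g: "g \<in> carrier_vec n"
    unfolding qe_vec[OF A Gv[OF g] Gv[OF g]] qe_vec[OF A g g] vG[OF g] by (rule smoothing(1))
  show "(G *\<^sub>v u) \<bullet> (A *\<^sub>v w) = u \<bullet> (A *\<^sub>v (G *\<^sub>v w))" if u: "u \<in> carrier_vec n" and w: "w \<in> carrier_vec n"
    unfolding qe_vec[OF A Gv[OF u] w] qe_vec[OF A u Gv[OF w]] vG[OF u] vG[OF w] by (rule smoothing(3))
  show "\<omega> * (\<Sum>i<n. (vec_index (A *\<^sub>v (G *\<^sub>v g)) i)\<^sup>2 / A $$ (i, i)) \<le> g \<bullet> (A *\<^sub>v g) / (2 * real m + 1)\<^sup>2" if g: "g \<in> carrier_vec n"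
  proof -
    have "(\<Sum>i<n. (vec_index (A *\<^sub>v (G *\<^sub>v g)) i)\<^sup>2 / A $$ (i, i)) = (\<Sum>i<n. (mv n A (vf (G *\<^sub>v g)) i)\<^sup>2 / A $$ (i, i))"
    proof (intro sum.cong refl)
      fix i assume "i \<in> {..<n}"
      then have "vec_index (A *\<^sub>v (G *\<^sub>v g)) i = vf (A *\<^sub>v (G *\<^sub>v g)) i" using A by (simp add: vf_def)
      then show "(vec_index (A *\<^sub>v (G *\<^sub>v g)) i)\<^sup>2 / A $$ (i, i) = (mv n A (vf (G *\<^sub>v g)) i)\<^sup>2 / A $$ (i, i)"
        unfolding vf_mat[OF A Gv[OF g]] by simp
    qed
    then have "\<omega> * (\<Sum>i<n. (vec_index (A *\<^sub>v (G *\<^sub>v g)) i)\<^sup>2 / A $$ (i, i))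
      = qe n A (mv n (\<omega> \<cdot>\<^sub>m precond A) (ev (chP m) (vf g))) (ev (chP m) (vf g))"
      unfolding so2 vG[OF g] by simp
    also have "\<dots> \<le> g \<bullet> (A *\<^sub>v g) / (2 * real m + 1)\<^sup>2"
      unfolding qe_vec[OF A g g] by (rule smoothing(2))
    finally show ?thesis .
  qed
qed

subsection \<open>Spectral radius\<close>

text \<open>For self-adjoint \<open>X\<close> of spectral radius less than 1 the squared norms of \<open>X\<^sup>k f\<close> are bounded and, by
  Cauchy-Schwarz, log-convex; hence they decrease. This replaces the spectral theorem.\<close>

lemma log_convex_bounded:
  fixes b :: "nat \<Rightarrow> real"
  assumes pos: "\<And>k. 0 \<le> b k" and conv: "\<And>k. (b (Suc k))\<^sup>2 \<le> b k * b (Suc (Suc k))" and bd: "\<And>k. b k \<le> K"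
  shows "b 1 \<le> b 0"
proof (rule ccontr)
  assume "\<not> b 1 \<le> b 0"
  then have lt: "b 0 < b 1" by simp
  have b0: "0 < b 0"
  proof (rule ccontr)
    assume "\<not> 0 < b 0"
    then have "b 0 = 0" using pos[of 0] by simp
    then have "b 1 = 0" using conv[of 0] by simp
    then show False using lt pos[of 0] by simp
  qed
  \<comment> \<open>Log-convexity makes the quotients of successive terms nondecreasing, so a first
    quotient above 1 forces geometric growth.\<close>
  define r where "r = b 1 / b 0"
  have r: "1 < r" using lt b0 by (simp add: r_def)
  have step: "0 < b k \<and> r * b k \<le> b (Suc k)" for k
  proof (induction k)
    case 0
    then show ?case using b0 by (simp add: r_def)
  next
    case (Suc k)
    have "0 < r * b k" using Suc r by simp
    then have p: "0 < b (Suc k)" using Suc by linarith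
    have "b k * (r * b (Suc k)) \<le> b (Suc k) * b (Suc k)"
      using Suc p mult_right_mono[of "r * b k" "b (Suc k)" "b (Suc k)"] by (simp add: mult_ac)
    also have "\<dots> \<le> b k * b (Suc (Suc k))" using conv[of k] by (simp add: power2_eq_square)
    finally have "r * b (Suc k) \<le> b (Suc (Suc k))" using Suc by (simp only: mult_le_cancel_left_pos)
    then show ?case using p by simp
  qed
  have "r ^ k * b 0 \<le> b k" for k
  proof (induction k)
    case (Suc k)
    have "r ^ Suc k * b 0 = r * (r ^ k * b 0)" by simp
    also have "\<dots> \<le> r * b k" using Suc r by (intro mult_left_mono) auto
    finally show ?case using step[of k] by simp
  qed simp
  moreover obtain k where "K / b 0 < r ^ k" using real_arch_pow[OF r] by blast
  moreover from this b0 have "K < r ^ k * b 0" by (simp add: pos_divide_less_eq)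
  ultimately show False using bd[of k] by (meson leD order.trans)
qed

text \<open>Turns the spectral condition on the damping parameter into the form inequality A \<le>
  \<rho> D. The sequence argument is applied to D^-1 A, which is self-adjoint in the D
  product.\<close>

lemma rayleigh_spec_rad:
  assumes A: "A \<in> carrier_mat n n" and n: "0 < n" and sym: "\<And>i j. i < n \<Longrightarrow> j < n \<Longrightarrow> A $$ (i, j) = A $$ (j, i)"
    and dpos: "\<And>i. i < n \<Longrightarrow> 0 < A $$ (i, i)"
  shows "qe n A f f \<le> spec_rad (precond A) * (\<Sum>i<n. A $$ (i, i) * (f i)\<^sup>2)"
proof -
  have nz: "i < n \<Longrightarrow> A $$ (i, i) \<noteq> 0" for i using dpos by force
  note pc = precond_entry[OF A nz]
  let ?X = "precond A"
  define dd where "dd u w = (\<Sum>i<n. A $$ (i, i) * u i * w i)" for u w :: "nat \<Rightarrow> real"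
  have dd0: "0 \<le> dd u u" for u unfolding dd_def using dpos by (intro sum_nonneg) (simp add: less_imp_le mult.assoc)
  have dCS: "(dd u w)\<^sup>2 \<le> dd u u * dd w w" for u w
  proof -
    have "(\<Sum>i<n. (sqrt (A $$ (i, i)) * u i) * (sqrt (A $$ (i, i)) * w i))\<^sup>2
      \<le> (\<Sum>i<n. (sqrt (A $$ (i, i)) * u i)\<^sup>2) * (\<Sum>i<n. (sqrt (A $$ (i, i)) * w i)\<^sup>2)"
      by (rule Cauchy_Schwarz_ineq_sum)
    moreover have "(\<Sum>i<n. (sqrt (A $$ (i, i)) * u i) * (sqrt (A $$ (i, i)) * w i)) = dd u w" for u w
      unfolding dd_def using dpos by (intro sum.cong refl) (simp add: less_imp_le real_sqrt_mult_self mult_ac flip: mult.assoc)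
    ultimately show ?thesis by (simp add: power2_eq_square)
  qed
  have ddX: "dd (mv n ?X u) w = qe n A w u" for u w
    unfolding dd_def qe_mv using pc(2) nz
    by (intro sum.cong refl) (simp add: mv_def sum_distrib_left sum_distrib_right mult_ac)
  \<comment> \<open>Power boundedness needs a spectral radius strictly below 1, so the matrix is
    divided by an arbitrary t above the spectral radius; t is let down to it at the end by
    \<open>dense_ge\<close>.\<close>
  have main: "qe n A f f \<le> t * dd f f" if t: "spec_rad ?X < t" for t
  proof -
    have C: "map_mat complex_of_real ?X \<in> carrier_mat n n" using pc(1) by simp
    have sr0: "0 \<le> spec_rad ?X" unfolding spec_rad_def using spectral_radius_mem_max(1)[OF C n] by auto
    have t0: "0 < t" using t sr0 by simp
    define Y where "Y = (1 / t) \<cdot>\<^sub>m ?X"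
    have Y: "Y \<in> carrier_mat n n" using pc(1) by (simp add: Y_def)
    let ?C = "map_mat complex_of_real Y"
    have CY: "?C \<in> carrier_mat n n" using Y by simp
    have "spectral_radius ?C < 1"
    proof -
      obtain e where e: "eigenvalue ?C e" "spectral_radius ?C = norm e"
        using spectral_radius_mem_max(1)[OF CY n] by (auto simp: spectrum_def)
      then obtain v where v: "v \<in> carrier_vec n" "v \<noteq> 0\<^sub>v n" "?C *\<^sub>v v = e \<cdot>\<^sub>v v"
        using CY unfolding eigenvalue_def eigenvector_def by auto
      have "map_mat complex_of_real ?X = of_real t \<cdot>\<^sub>m ?C"
        using t0 pc(1) by (intro eq_matI) (auto simp: Y_def)
      then have "map_mat complex_of_real ?X *\<^sub>v v = (of_real t * e) \<cdot>\<^sub>v v"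
        using v CY by (simp add: smult_smult_assoc[symmetric]) (intro eq_vecI, auto simp: v(3)[symmetric])
      then have "eigenvalue (map_mat complex_of_real ?X) (of_real t * e)"
        using v C unfolding eigenvalue_def eigenvector_def by auto
      then have "norm (of_real t * e) \<le> spec_rad ?X"
        unfolding spec_rad_def using spectral_radius_mem_max(2)[OF C n, of "norm (of_real t * e)"] by (auto simp: spectrum_def)
      then have "t * norm e \<le> spec_rad ?X" using t0 by (simp add: norm_mult)
      then have "t * norm e < t * 1" using t by simp
      then have "norm e < 1" using t0 by (simp only: mult_less_cancel_left_pos)
      then show ?thesis using e by simp
    qed
    \<comment> \<open>Bounded powers come from Jordan normal form theory over the complex numbers,
      the reason for the detour through \<open>map_mat\<close>.\<close>
    then obtain c where c: "\<And>k. norm_bound (?C ^\<^sub>m k) c"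
      using spectral_radius_jnf_norm_bound_less_1_upper_triangular[OF CY] by blast
    have pw: "?C ^\<^sub>m k = map_mat complex_of_real (Y ^\<^sub>m k)" for k
      by (rule of_real_hom.mat_hom_pow[OF Y, symmetric])
    have Yk: "Y ^\<^sub>m k \<in> carrier_mat n n" for k using Y by simp
    have bnd: "\<bar>(Y ^\<^sub>m k) $$ (i, j)\<bar> \<le> c" if "i < n" "j < n" for i j k
      using c[of k] that carrier_matD[OF Yk[of k]] unfolding norm_bound_def pw by (auto simp del: pow_mat_dim)
    have c0: "0 \<le> c" using bnd[OF n n, of 0] by linarith
    define v where "v = Matrix.vec n f"
    have v: "v \<in> carrier_vec n" by (simp add: v_def)
    define g where "g k = vf (Y ^\<^sub>m k *\<^sub>v v)" for k
    have gS: "g (Suc k) = mv n Y (g k)" for k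
    proof -
      have "Y ^\<^sub>m Suc k = Y * Y ^\<^sub>m k"
      proof (induction k)
        case (Suc k)
        have "Y ^\<^sub>m Suc (Suc k) = (Y * Y ^\<^sub>m k) * Y" unfolding Suc[symmetric] by simp
        also have "\<dots> = Y * (Y ^\<^sub>m k * Y)" by (rule assoc_mult_mat[OF Y Yk Y])
        finally show ?case by simp
      qed (use Y in simp)
      then have "Y ^\<^sub>m Suc k *\<^sub>v v = Y *\<^sub>v (Y ^\<^sub>m k *\<^sub>v v)" using assoc_mult_mat_vec[OF Y Yk v] by simp
      moreover have "Y ^\<^sub>m k *\<^sub>v v \<in> carrier_vec n" using Yk v by (metis mult_mat_vec_carrier)
      ultimately show ?thesis unfolding g_def by (simp add: vf_mat[OF Y])
    qed
    have g0: "g 0 i = f i" if "i < n" for i using that Y v by (simp add: g_def vf_def v_def)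
    have ddY: "dd (mv n Y u) w = qe n A w u / t" for u w
    proof -
      have "mv n Y u = (\<lambda>i. (1 / t) * mv n ?X u i)"
        unfolding Y_def mv_def using pc(1) by (intro ext) (auto simp: sum_distrib_left sum_divide_distrib intro!: sum.cong)
      then have "dd (mv n Y u) w = (1 / t) * dd (mv n ?X u) w" by (simp add: dd_def sum_distrib_left mult_ac)
      then show ?thesis by (simp add: ddX)
    qed
    have dds: "dd u w = dd w u" for u w by (simp add: dd_def mult_ac)
    have qs: "qe n A u w = qe n A w u" for u w by (rule qe_sym) (rule sym)
    define b where "b k = dd (g k) (g k)" for k
    have "b 1 \<le> b 0"
    proof (rule log_convex_bounded)
      show "0 \<le> b k" for k by (simp add: b_def dd0)
      show "(b (Suc k))\<^sup>2 \<le> b k * b (Suc (Suc k))" for k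
      proof -
        have "b (Suc k) = dd (g k) (g (Suc (Suc k)))"
          unfolding b_def gS[of "Suc k"] dds[of "g k"] ddY unfolding gS[of k] ddY qs[of "mv n Y (g k)" "g k"]
          by simp
        then show ?thesis unfolding b_def using dCS by simp
      qed
      show "b k \<le> (\<Sum>i<n. A $$ (i, i) * (\<Sum>j<n. c * \<bar>f j\<bar>)\<^sup>2)" for k
        unfolding b_def dd_def
      proof (rule sum_mono)
        fix i assume i: "i \<in> {..<n}"
        have "g k i = (\<Sum>j<n. (Y ^\<^sub>m k) $$ (i, j) * f j)"
          unfolding g_def vf_mat[OF Yk v] using i by (simp add: mv_def vf_def v_def)
        then have "\<bar>g k i\<bar> \<le> (\<Sum>j<n. \<bar>(Y ^\<^sub>m k) $$ (i, j) * f j\<bar>)" by simp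
        also have "\<dots> \<le> (\<Sum>j<n. c * \<bar>f j\<bar>)"
          using i bnd by (intro sum_mono) (auto simp: abs_mult intro!: mult_right_mono)
        finally have "(g k i)\<^sup>2 \<le> (\<Sum>j<n. c * \<bar>f j\<bar>)\<^sup>2"
          by (subst abs_le_square_iff[symmetric]) (auto intro: order.trans[OF _ abs_ge_self])
        then show "A $$ (i, i) * g k i * g k i \<le> A $$ (i, i) * (\<Sum>j<n. c * \<bar>f j\<bar>)\<^sup>2"
          using dpos i by (simp add: power2_eq_square mult.assoc mult_left_mono less_imp_le)
      qed
    qed
    have "(dd (g 1) (g 0))\<^sup>2 \<le> b 1 * b 0" unfolding b_def by (rule dCS)
    also have "\<dots> \<le> b 0 * b 0" using \<open>b 1 \<le> b 0\<close> by (intro mult_right_mono) (simp_all add: b_def dd0)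
    finally have "(dd (g 1) (g 0))\<^sup>2 \<le> (b 0)\<^sup>2" by (simp add: power2_eq_square)
    then have "\<bar>dd (g 1) (g 0)\<bar> \<le> \<bar>b 0\<bar>" by (subst abs_le_square_iff)
    then have "dd (g 1) (g 0) \<le> b 0" by (simp add: b_def dd0)
    moreover have "dd (g 1) (g 0) = qe n A (g 0) (g 0) / t" using gS[of 0] ddY by simp
    moreover have "qe n A (g 0) (g 0) = qe n A f f" unfolding qe_def using g0 by (intro sum.cong) auto
    moreover have "b 0 = dd f f" unfolding b_def dd_def using g0 by (intro sum.cong) auto
    ultimately have "qe n A f f / t \<le> dd f f" by simp
    then show ?thesis using t0 by (simp add: pos_divide_le_eq mult.commute)
  qed
  have "qe n A f f \<le> spec_rad ?X * dd f f"
  proof (cases "dd f f = 0")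
    case True
    then show ?thesis using main[of "spec_rad ?X + 1"] by simp
  next
    case False
    then have p: "0 < dd f f" using dd0[of f] by simp
    have "qe n A f f / dd f f \<le> spec_rad ?X"
      by (rule dense_ge) (use main p in \<open>simp add: pos_divide_le_eq\<close>)
    then show ?thesis using p by (simp add: pos_divide_le_eq)
  qed
  then show ?thesis by (simp add: dd_def power2_eq_square mult.assoc)
qed

section \<open>Contraction of the W-cycle\<close>

locale spd =
  fixes n :: nat and A :: "real mat"
  assumes A: "A \<in> carrier_mat n n"
    and sym: "\<And>i j. i < n \<Longrightarrow> j < n \<Longrightarrow> A $$ (i, j) = A $$ (j, i)"
    and pd: "\<And>f. \<exists>i<n. f i \<noteq> 0 \<Longrightarrow> 0 < qe n A f f"
begin

lemma psd_qe: "0 \<le> qe n A f f"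
proof (cases "\<exists>i<n. f i \<noteq> 0")
  case True
  then show ?thesis using pd[of f] by simp
next
  case False
  then show ?thesis by (simp add: qe_def)
qed

lemma dpos: "i < n \<Longrightarrow> 0 < A $$ (i, i)"
proof -
  assume i: "i < n"
  let ?f = "\<lambda>j. if j = i then 1 else 0 :: real"
  have "qe n A ?f ?f = (\<Sum>j<n. if j = i then A $$ (i, i) else 0)"
  proof -
    have "(\<Sum>l<n. A $$ (j, l) * ?f j * ?f l) = (if j = i then A $$ (i, i) else 0)" for j
    proof -
      have "(\<Sum>l<n. A $$ (j, l) * ?f j * ?f l) = (\<Sum>l<n. if l = i then A $$ (j, i) * ?f j else 0)"
        by (intro sum.cong) auto
      then show ?thesis using i by simp
    qed
    then show ?thesis unfolding qe_def by simp
  qed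
  then show ?thesis using pd[of ?f] i by auto
qed

lemma inv: "invertible_mat A"
proof -
  have "Determinant.det A \<noteq> 0"
  proof
    assume "Determinant.det A = 0"
    then obtain v where v: "v \<in> carrier_vec n" "v \<noteq> 0\<^sub>v n" "A *\<^sub>v v = 0\<^sub>v n"
      using det_0_iff_vec_prod_zero[OF A] by blast
    have "qe n A (vf v) (vf v) = 0" unfolding qe_vec[OF A v(1) v(1), symmetric] v(3) using v(1) by simp
    moreover have "\<exists>i<n. vf v i \<noteq> 0"
    proof (rule ccontr)
      assume "\<not> ?thesis"
      then have "v = 0\<^sub>v n" using v(1) by (intro eq_vecI) (auto simp: vf_def)
      then show False using v(2) by simp
    qed
    ultimately show False using pd[of "vf v"] by simp
  qed
  from det_non_zero_imp_unit[OF A this, of "()"] obtain B where "B \<in> carrier_mat n n" "A * B = 1\<^sub>m n" "B * A = 1\<^sub>m n"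
    by (auto simp: Units_def ring_mat_def)
  then show ?thesis using A unfolding invertible_mat_def inverts_mat_def by auto
qed

lemma inner_sym: "u \<in> carrier_vec n \<Longrightarrow> w \<in> carrier_vec n \<Longrightarrow> u \<bullet> (A *\<^sub>v w) = w \<bullet> (A *\<^sub>v u)"
  by (simp add: qe_vec[OF A] qe_sym[of n A "vf u", OF sym])

lemma inner_nonneg: "u \<in> carrier_vec n \<Longrightarrow> 0 \<le> u \<bullet> (A *\<^sub>v u)"
  by (simp add: qe_vec[OF A] psd_qe)

lemma inner_CS: "u \<in> carrier_vec n \<Longrightarrow> w \<in> carrier_vec n \<Longrightarrow> (u \<bullet> (A *\<^sub>v w))\<^sup>2 \<le> (u \<bullet> (A *\<^sub>v u)) * (w \<bullet> (A *\<^sub>v w))"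
proof -
  assume u: "u \<in> carrier_vec n" and w: "w \<in> carrier_vec n"
  show ?thesis unfolding qe_vec[OF A u w] qe_vec[OF A u u] qe_vec[OF A w w]
  proof (rule CS_of_nonneg)
    fix s t :: real
    have "0 \<le> qe n A (\<lambda>i. s * vf u i + t * vf w i) (\<lambda>i. s * vf u i + t * vf w i)" by (rule psd_qe)
    also have "\<dots> = qe n A (vf u) (vf u) * s\<^sup>2 + s * t * qe n A (vf u) (vf w) + s * t * qe n A (vf w) (vf u) + qe n A (vf w) (vf w) * t\<^sup>2"
      unfolding qe_def by (simp add: algebra_simps sum.distrib sum_distrib_left power2_eq_square)
    also have "qe n A (vf w) (vf u) = qe n A (vf u) (vf w)" by (rule qe_sym) (rule sym)
    finally show "0 \<le> qe n A (vf u) (vf u) * s\<^sup>2 + 2 * qe n A (vf u) (vf w) * s * t + qe n A (vf w) (vf w) * t\<^sup>2"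
      by (simp add: algebra_simps)
  qed
qed

lemma inner_le: "u \<in> carrier_vec n \<Longrightarrow> w \<in> carrier_vec n \<Longrightarrow> u \<bullet> (A *\<^sub>v w) \<le> energy_norm A u * energy_norm A w"
  using inner_CS[of u w] inner_nonneg[of u] inner_nonneg[of w]
  by (simp add: energy_norm_def real_sqrt_mult[symmetric] real_le_rsqrt)

lemma energy_nonneg: "0 \<le> energy_norm A u" if "u \<in> carrier_vec n"
  using inner_nonneg[OF that] by (simp add: energy_norm_def)

lemma energy_sq: "u \<in> carrier_vec n \<Longrightarrow> (energy_norm A u)\<^sup>2 = u \<bullet> (A *\<^sub>v u)"
  using inner_nonneg[of u] by (simp add: energy_norm_def)

lemma energy_triangle:
  assumes u: "u \<in> carrier_vec n" and w: "w \<in> carrier_vec n"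
  shows "energy_norm A (u + w) \<le> energy_norm A u + energy_norm A w"
proof -
  have "(energy_norm A (u + w))\<^sup>2 = u \<bullet> (A *\<^sub>v u) + u \<bullet> (A *\<^sub>v w) + w \<bullet> (A *\<^sub>v u) + w \<bullet> (A *\<^sub>v w)"
    using u w A by (simp add: energy_sq mult_add_distrib_mat_vec[OF A] add_scalar_prod_distrib[of _ n] scalar_prod_add_distrib[of _ n])
  also have "\<dots> \<le> (energy_norm A u + energy_norm A w)\<^sup>2"
    using inner_le[OF u w] inner_sym[OF u w] energy_sq[OF u] energy_sq[OF w] by (simp add: power2_sum)
  finally show ?thesis
    by (rule power2_le_imp_le) (use energy_nonneg[OF u] energy_nonneg[OF w] in simp)
qed

end

section \<open>Two-grid and multilevel convergence\<close>

lemma scalar_prod_transpose: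
  fixes M :: "real mat"
  assumes "M \<in> carrier_mat nr nc" "u \<in> carrier_vec nr" "w \<in> carrier_vec nc"
  shows "(M\<^sup>T *\<^sub>v u) \<bullet> w = u \<bullet> (M *\<^sub>v w)"
  using transpose_vec_mult_scalar[OF assms(1,3,2)] assms by (metis comm_scalar_prod mult_mat_vec_carrier transpose_carrier_mat)

lemma vec_diff_interchange:
  fixes u w x z :: "real Matrix.vec"
  assumes "u \<in> carrier_vec n" "w \<in> carrier_vec n" "x \<in> carrier_vec n" "z \<in> carrier_vec n"
  shows "(u + w) - (x + z) = (u - x) + (w - z)" "(u - w) - (x - z) = (u - x) - (w - z)"
    "c \<cdot>\<^sub>v u - c \<cdot>\<^sub>v x = c \<cdot>\<^sub>v (u - x)"
  using assms by (auto intro!: eq_vecI simp: right_diff_distrib)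

text \<open>\<open>B\<close> is the error A^-1 - P A'^-1 P^T of the coarse correction, symmetric but
  not necessarily semidefinite. So the bound on the modulus of its diagonal values is polarised, and
  the smoothing property is used on both sides, for the pre-smoothed \<open>g\<close> and the
  post-smoothed \<open>q\<close>.\<close>

lemma two_grid_bound:
  fixes A A' P :: "real mat" and m :: nat
  assumes spd: "spd n A" and spd': "spd n' A'" and P: "P \<in> carrier_mat n n'"
    and \<omega>: "0 \<le> \<omega>" and damp: "\<And>f. \<omega> * qe n A f f \<le> (\<Sum>i<n. A $$ (i, i) * (f i)\<^sup>2)"
    and \<kappa>: "0 < \<kappa>"
    and appr: "\<And>r v w. r \<in> carrier_vec n \<Longrightarrow> v \<in> carrier_vec n \<Longrightarrow> w \<in> carrier_vec n' \<Longrightarrow> A *\<^sub>v v = r \<Longrightarrow> A' *\<^sub>v w = P\<^sup>T *\<^sub>v r \<Longrightarrow>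
      \<bar>r \<bullet> v - (P\<^sup>T *\<^sub>v r) \<bullet> w\<bar> \<le> \<kappa> * (\<omega> * (\<Sum>i<n. (vec_index r i)\<^sup>2 / A $$ (i, i)))"
    and g: "g \<in> carrier_vec n"
  defines "G \<equiv> cheb_mat (\<omega> \<cdot>\<^sub>m precond A) m"
  defines "y \<equiv> G *\<^sub>v g"
  shows "energy_norm A (G *\<^sub>v (y - P *\<^sub>v (minv A' *\<^sub>v (P\<^sup>T *\<^sub>v (A *\<^sub>v y))))) \<le> \<kappa> / (2 * real m + 1)\<^sup>2 * energy_norm A g"
proof -
  interpret s: spd n A by (rule spd)
  interpret s': spd n' A' by (rule spd')
  note A = s.A and A' = s'.A
  note M' = minv_mult[OF A' s'.inv] and M = minv_mult[OF A s.inv]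
  note sm = smoother_bounds[OF A s.sym s.psd_qe s.dpos \<omega> damp, where m = m, folded G_def]
  have G: "G \<in> carrier_mat n n" unfolding G_def
    by (rule smoother_bounds(1)[OF A s.sym s.psd_qe s.dpos \<omega> damp])
  have PT: "P\<^sup>T \<in> carrier_mat n' n" using P by simp
  have cG: "G *\<^sub>v u \<in> carrier_vec n" if "u \<in> carrier_vec n" for u using G that by (metis mult_mat_vec_carrier)
  have cA: "A *\<^sub>v u \<in> carrier_vec n" if "u \<in> carrier_vec n" for u using A that by (metis mult_mat_vec_carrier)
  have cP: "P *\<^sub>v u \<in> carrier_vec n" if "u \<in> carrier_vec n'" for u using P that by (metis mult_mat_vec_carrier)
  have cPT: "P\<^sup>T *\<^sub>v u \<in> carrier_vec n'" if "u \<in> carrier_vec n" for u using PT that by (metis mult_mat_vec_carrier)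
  have cM: "minv A *\<^sub>v u \<in> carrier_vec n" if "u \<in> carrier_vec n" for u using M(1) that by (metis mult_mat_vec_carrier)
  have cM': "minv A' *\<^sub>v u \<in> carrier_vec n'" if "u \<in> carrier_vec n'" for u using M'(1) that by (metis mult_mat_vec_carrier)
  define B where "B z = minv A *\<^sub>v z - P *\<^sub>v (minv A' *\<^sub>v (P\<^sup>T *\<^sub>v z))" for z
  have cB: "B z \<in> carrier_vec n" if "z \<in> carrier_vec n" for z unfolding B_def using that by (intro minus_carrier_vec cM cP cM' cPT)
  define S where "S z = \<omega> * (\<Sum>i<n. (vec_index z i)\<^sup>2 / A $$ (i, i))" for z
  have AM: "A *\<^sub>v (minv A *\<^sub>v z) = z" if "z \<in> carrier_vec n" for z
    unfolding assoc_mult_mat_vec[OF A M(1) that, symmetric] M(3) using that by (rule one_mult_mat_vec)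
  have AM': "A' *\<^sub>v (minv A' *\<^sub>v z) = z" if "z \<in> carrier_vec n'" for z
    unfolding assoc_mult_mat_vec[OF A' M'(1) that, symmetric] M'(3) using that by (rule one_mult_mat_vec)
  have MA: "minv A *\<^sub>v (A *\<^sub>v z) = z" if "z \<in> carrier_vec n" for z
    unfolding assoc_mult_mat_vec[OF M(1) A that, symmetric] M(2) using that by (rule one_mult_mat_vec)
  have b_expand: "x \<bullet> B z = x \<bullet> (minv A *\<^sub>v z) - (P\<^sup>T *\<^sub>v x) \<bullet> (minv A' *\<^sub>v (P\<^sup>T *\<^sub>v z))"
    if "x \<in> carrier_vec n" "z \<in> carrier_vec n" for x z
    unfolding B_def using that
    by (simp add: scalar_prod_minus_distrib[of _ n] cM cP cM' cPT scalar_prod_transpose[OF P that(1)])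
  have bB: "\<bar>x \<bullet> B x\<bar> \<le> \<kappa> * S x" if x: "x \<in> carrier_vec n" for x
    unfolding b_expand[OF x x] S_def by (rule appr) (use x cM cM' cPT AM AM' in auto)
  have msym: "x \<bullet> (minv A *\<^sub>v z) = z \<bullet> (minv A *\<^sub>v x)" if "x \<in> carrier_vec n" "z \<in> carrier_vec n" for x z
  proof -
    have "x \<bullet> (minv A *\<^sub>v z) = (minv A *\<^sub>v z) \<bullet> (A *\<^sub>v (minv A *\<^sub>v x))"
      using that cM by (simp add: AM comm_scalar_prod[of x n])
    also have "\<dots> = (minv A *\<^sub>v x) \<bullet> (A *\<^sub>v (minv A *\<^sub>v z))" using that cM by (intro s.inner_sym) auto
    also have "\<dots> = z \<bullet> (minv A *\<^sub>v x)" using that cM by (simp add: AM comm_scalar_prod[of z n])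
    finally show ?thesis .
  qed
  have msym': "x \<bullet> (minv A' *\<^sub>v z) = z \<bullet> (minv A' *\<^sub>v x)" if "x \<in> carrier_vec n'" "z \<in> carrier_vec n'" for x z
  proof -
    have "x \<bullet> (minv A' *\<^sub>v z) = (minv A' *\<^sub>v z) \<bullet> (A' *\<^sub>v (minv A' *\<^sub>v x))"
      using that cM' by (simp add: AM' comm_scalar_prod[of x n'])
    also have "\<dots> = (minv A' *\<^sub>v x) \<bullet> (A' *\<^sub>v (minv A' *\<^sub>v z))" using that cM' by (intro s'.inner_sym) auto
    also have "\<dots> = z \<bullet> (minv A' *\<^sub>v x)" using that cM' by (simp add: AM' comm_scalar_prod[of z n'])
    finally show ?thesis .
  qed
  have bsym: "x \<bullet> B z = z \<bullet> B x" if "x \<in> carrier_vec n" "z \<in> carrier_vec n" for x z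
    unfolding b_expand[OF that] b_expand[OF that(2,1)] msym[OF that] msym'[OF cPT[OF that(1)] cPT[OF that(2)]] ..
  have Badd: "B (x + z) = B x + B z" and Bdiff: "B (x - z) = B x - B z" if "x \<in> carrier_vec n" "z \<in> carrier_vec n" for x z
  proof -
    note c = that cM cM' cP cPT
    show "B (x + z) = B x + B z" unfolding B_def
      mult_add_distrib_mat_vec[OF M(1) that] mult_add_distrib_mat_vec[OF PT that]
      mult_add_distrib_mat_vec[OF M'(1) cPT[OF that(1)] cPT[OF that(2)]]
      mult_add_distrib_mat_vec[OF P cM'[OF cPT[OF that(1)]] cM'[OF cPT[OF that(2)]]]
      by (rule vec_diff_interchange(1)[of _ n]) (use c in auto)
    show "B (x - z) = B x - B z" unfolding B_def
      mult_minus_distrib_mat_vec[OF M(1) that] mult_minus_distrib_mat_vec[OF PT that]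
      mult_minus_distrib_mat_vec[OF M'(1) cPT[OF that(1)] cPT[OF that(2)]]
      mult_minus_distrib_mat_vec[OF P cM'[OF cPT[OF that(1)]] cM'[OF cPT[OF that(2)]]]
      by (rule vec_diff_interchange(2)[of _ n]) (use c in auto)
  qed
  have Bsmult: "B (c \<cdot>\<^sub>v x) = c \<cdot>\<^sub>v B x" if "x \<in> carrier_vec n" for c x
    unfolding B_def mult_mat_vec[OF M(1) that] mult_mat_vec[OF PT that] mult_mat_vec[OF M'(1) cPT[OF that]]
      mult_mat_vec[OF P cM'[OF cPT[OF that]]]
    by (rule vec_diff_interchange(3)[of _ n _ _]) (use that cM cM' cP cPT in auto)
  \<comment> \<open>\<open>S\<close> is a quadratic form; its parallelogram law turns the bounds at
    x + z and x - z into one in S x + S z.\<close>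
  have polar: "2 * (x \<bullet> B z) \<le> \<kappa> * (S x + S z)" if x: "x \<in> carrier_vec n" and z: "z \<in> carrier_vec n" for x z
  proof -
    have p: "x + z \<in> carrier_vec n" "x - z \<in> carrier_vec n" using x z by auto
    have "(x + z) \<bullet> B (x + z) = x \<bullet> B x + 2 * (x \<bullet> B z) + z \<bullet> B z"
      using x z cB bsym[OF z x] by (simp add: Badd add_scalar_prod_distrib[of _ n] scalar_prod_add_distrib[of _ n])
    moreover have "(x - z) \<bullet> B (x - z) = x \<bullet> B x - 2 * (x \<bullet> B z) + z \<bullet> B z"
      using x z cB bsym[OF z x] by (simp add: Bdiff minus_scalar_prod_distrib[of _ n] scalar_prod_minus_distrib[of _ n])
    ultimately have "4 * (x \<bullet> B z) = (x + z) \<bullet> B (x + z) - (x - z) \<bullet> B (x - z)" by simp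
    also have "\<dots> \<le> \<kappa> * S (x + z) + \<kappa> * S (x - z)" using bB[OF p(1)] bB[OF p(2)] by linarith
    also have "\<dots> = \<kappa> * (S (x + z) + S (x - z))" by (simp add: distrib_left)
    also have "S (x + z) + S (x - z) = 2 * (S x + S z)"
    proof -
      have "(\<Sum>i<n. (vec_index (x + z) i)\<^sup>2 / A $$ (i, i)) + (\<Sum>i<n. (vec_index (x - z) i)\<^sup>2 / A $$ (i, i))
        = (\<Sum>i<n. 2 * ((vec_index x i)\<^sup>2 / A $$ (i, i) + (vec_index z i)\<^sup>2 / A $$ (i, i)))"
        unfolding sum.distrib[symmetric]
        by (intro sum.cong refl) (use x z in \<open>simp add: power2_eq_square add_divide_distrib[symmetric] algebra_simps\<close>)
      also have "\<dots> = 2 * ((\<Sum>i<n. (vec_index x i)\<^sup>2 / A $$ (i, i)) + (\<Sum>i<n. (vec_index z i)\<^sup>2 / A $$ (i, i)))"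
        by (simp only: sum_distrib_left[symmetric] sum.distrib)
      finally show ?thesis unfolding S_def distrib_left[symmetric] by simp
    qed
    finally show ?thesis by (simp add: distrib_left)
  qed
  have Ssmult: "S (c \<cdot>\<^sub>v x) = c\<^sup>2 * S x" if "x \<in> carrier_vec n" for c x
  proof -
    have "(\<Sum>i<n. (vec_index (c \<cdot>\<^sub>v x) i)\<^sup>2 / A $$ (i, i)) = c\<^sup>2 * (\<Sum>i<n. (vec_index x i)\<^sup>2 / A $$ (i, i))"
      unfolding sum_distrib_left by (intro sum.cong refl) (use that in \<open>simp add: power_mult_distrib\<close>)
    then show ?thesis by (simp add: S_def mult_ac)
  qed
  define \<theta> where "\<theta> = \<kappa> / (2 * real m + 1)\<^sup>2"
  have \<theta>: "0 < \<theta>" using \<kappa> by (simp add: \<theta>_def add_nonneg_pos)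
  have y: "y \<in> carrier_vec n" unfolding y_def by (rule cG[OF g])
  define u where "u = y - P *\<^sub>v (minv A' *\<^sub>v (P\<^sup>T *\<^sub>v (A *\<^sub>v y)))"
  have uB: "u = B (A *\<^sub>v y)" unfolding u_def B_def MA[OF y] ..
  have u: "u \<in> carrier_vec n" unfolding uB by (rule cB[OF cA[OF y]])
  define q where "q = G *\<^sub>v u"
  have q: "q \<in> carrier_vec n" unfolding q_def by (rule cG[OF u])
  have smo: "\<kappa> * S (A *\<^sub>v (G *\<^sub>v w)) \<le> \<theta> * (w \<bullet> (A *\<^sub>v w))" if "w \<in> carrier_vec n" for w
  proof -
    have "S (A *\<^sub>v (G *\<^sub>v w)) \<le> w \<bullet> (A *\<^sub>v w) / (2 * real m + 1)\<^sup>2"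
      unfolding S_def G_def by (rule smoother_bounds(3)[OF A s.sym s.psd_qe s.dpos \<omega> damp that])
    then have "\<kappa> * S (A *\<^sub>v (G *\<^sub>v w)) \<le> \<kappa> * (w \<bullet> (A *\<^sub>v w) / (2 * real m + 1)\<^sup>2)" using \<kappa> by (intro mult_left_mono) auto
    then show ?thesis by (simp add: \<theta>_def)
  qed
  define x where "x = A *\<^sub>v (G *\<^sub>v q)"
  define z where "z = A *\<^sub>v y"
  have x: "x \<in> carrier_vec n" and z: "z \<in> carrier_vec n" unfolding x_def z_def by (intro cA cG q y)+
  \<comment> \<open>The post-smoother is moved onto q by self-adjointness. The energy of q becomes x
    \<bullet> B z, where x = A G q and z = A G g are both smoothed residuals.\<close>
  have "q \<bullet> (A *\<^sub>v q) = u \<bullet> (A *\<^sub>v (G *\<^sub>v q))"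
    unfolding q_def G_def
    by (rule smoother_bounds(4)[OF A s.sym s.psd_qe s.dpos \<omega> damp u cG[OF u, unfolded G_def]])
  also have "\<dots> = x \<bullet> B z" unfolding uB z_def[symmetric] x_def[symmetric] by (rule comm_scalar_prod[OF cB[OF z] x])
  finally have qq: "q \<bullet> (A *\<^sub>v q) = x \<bullet> B z" .
  \<comment> \<open>Scaling x by 1 / t and z by t keeps the pairing and balances the two terms: the
    one with x is then at most the energy of q and is absorbed on the left.\<close>
  define t where "t = sqrt \<theta>"
  have t: "0 < t" "t\<^sup>2 = \<theta>" using \<theta> by (simp_all add: t_def)
  have "2 * (((1 / t) \<cdot>\<^sub>v x) \<bullet> B (t \<cdot>\<^sub>v z)) \<le> \<kappa> * (S ((1 / t) \<cdot>\<^sub>v x) + S (t \<cdot>\<^sub>v z))"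
    using x z by (intro polar) auto
  moreover have "((1 / t) \<cdot>\<^sub>v x) \<bullet> B (t \<cdot>\<^sub>v z) = x \<bullet> B z"
    using x z cB[OF z] t by (simp add: Bsmult)
  moreover have "\<kappa> * (S ((1 / t) \<cdot>\<^sub>v x) + S (t \<cdot>\<^sub>v z)) = \<kappa> * S x / \<theta> + \<theta> * (\<kappa> * S z)"
    using t by (simp add: Ssmult[OF x] Ssmult[OF z] power_divide algebra_simps)
  moreover have "\<kappa> * S x / \<theta> \<le> q \<bullet> (A *\<^sub>v q)"
    using smo[OF q] \<theta> by (simp add: x_def pos_divide_le_eq mult.commute)
  moreover have "\<theta> * (\<kappa> * S z) \<le> \<theta> * (\<theta> * (g \<bullet> (A *\<^sub>v g)))"
    using smo[OF g] \<theta> by (intro mult_left_mono) (auto simp: z_def y_def)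
  ultimately have "q \<bullet> (A *\<^sub>v q) \<le> \<theta>\<^sup>2 * (g \<bullet> (A *\<^sub>v g))"
    unfolding qq by (simp add: power2_eq_square mult.assoc)
  then have "sqrt (q \<bullet> (A *\<^sub>v q)) \<le> sqrt (\<theta>\<^sup>2 * (g \<bullet> (A *\<^sub>v g)))" by simp
  then show ?thesis using \<kappa> by (simp add: energy_norm_def real_sqrt_mult q_def u_def \<theta>_def abs_of_pos)
qed

text \<open>\<open>S\<close> arises as the square root of \<open>S\<close> twice, from the
  prolongation and from its adjoint with respect to the two energies; it may exceed 1 because the
  forms are not inherited. The bound 2 \<eta> passes to the next level when S (2 \<eta>)^2 \<le>
  \<eta>, which follows from 4 S \<eta> \<le> 1.\<close>

theorem wcycle_contraction:
  fixes A P :: "nat \<Rightarrow> real mat" and m :: nat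
  assumes spd: "\<And>j. 1 \<le> j \<Longrightarrow> j \<le> k \<Longrightarrow> spd (n j) (A j)"
    and P: "\<And>j. 2 \<le> j \<Longrightarrow> j \<le> k \<Longrightarrow> P j \<in> carrier_mat (n j) (n (j - 1))"
    and stab: "\<And>j w. 2 \<le> j \<Longrightarrow> j \<le> k \<Longrightarrow> w \<in> carrier_vec (n (j - 1)) \<Longrightarrow>
      (P j *\<^sub>v w) \<bullet> (A j *\<^sub>v (P j *\<^sub>v w)) \<le> S * (w \<bullet> (A (j - 1) *\<^sub>v w))"
    and S: "0 \<le> S"
    and \<omega>: "\<And>j. 2 \<le> j \<Longrightarrow> j \<le> k \<Longrightarrow> 0 \<le> \<omega> j"
    and damp: "\<And>j f. 2 \<le> j \<Longrightarrow> j \<le> k \<Longrightarrow> \<omega> j * qe (n j) (A j) f f \<le> (\<Sum>i<n j. A j $$ (i, i) * (f i)\<^sup>2)"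
    and \<kappa>: "0 < \<kappa>"
    and appr: "\<And>j r v w. 2 \<le> j \<Longrightarrow> j \<le> k \<Longrightarrow> r \<in> carrier_vec (n j) \<Longrightarrow> v \<in> carrier_vec (n j) \<Longrightarrow> w \<in> carrier_vec (n (j - 1)) \<Longrightarrow>
      A j *\<^sub>v v = r \<Longrightarrow> A (j - 1) *\<^sub>v w = (P j)\<^sup>T *\<^sub>v r \<Longrightarrow>
      \<bar>r \<bullet> v - ((P j)\<^sup>T *\<^sub>v r) \<bullet> w\<bar> \<le> \<kappa> * (\<omega> j * (\<Sum>i<n j. (vec_index r i)\<^sup>2 / A j $$ (i, i)))"
    and \<eta>: "\<kappa> / (2 * real m + 1)\<^sup>2 \<le> \<eta>" "4 * S * \<eta> \<le> 1"
    and k: "1 \<le> k" and g: "g \<in> carrier_vec (n k)"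
  shows "energy_norm (A k) (wcycle_err A P \<omega> m k *\<^sub>v g) \<le> 2 * \<eta> * energy_norm (A k) g"
proof -
  have \<eta>0: "0 \<le> \<eta>" using \<eta>(1) \<kappa> by (meson order.trans divide_nonneg_nonneg less_imp_le zero_le_power2)
  have "1 \<le> j \<Longrightarrow> j \<le> k \<Longrightarrow> wcycle_err A P \<omega> m j \<in> carrier_mat (n j) (n j) \<and>
    (\<forall>g\<in>carrier_vec (n j). energy_norm (A j) (wcycle_err A P \<omega> m j *\<^sub>v g) \<le> 2 * \<eta> * energy_norm (A j) g)" for j
  proof (induction j rule: nat_less_induct)
    case (1 j)
    show ?case
    proof (cases "j = 1")
      case True
      interpret s: spd "n 1" "A 1" using spd[of 1] k by simp
      have d: "dim_row (A 1) = n 1" using s.A by simp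
      have "energy_norm (A 1) (0\<^sub>v (n 1)) = 0" using s.A by (simp add: energy_norm_def)
      moreover have "0\<^sub>m (n 1) (n 1) *\<^sub>v g = 0\<^sub>v (n 1)" if "g \<in> carrier_vec (n 1)" for g :: "real Matrix.vec"
        using that by (intro eq_vecI) auto
      ultimately show ?thesis using \<eta>0 True s.energy_nonneg d by (simp add: d[simplified])
    next
      case False
      then obtain l where j: "j = Suc (Suc l)" using 1(2) by (metis One_nat_def not0_implies_Suc not_one_le_zero)
      let ?l = "Suc l"
      have lj: "?l < j" "1 \<le> ?l" "?l \<le> k" "j - 1 = ?l" "2 \<le> j" using 1(3) j by auto
      interpret s: spd "n j" "A j" using spd 1(2,3) by blast
      interpret s': spd "n ?l" "A ?l" using spd lj by blast
      note A = s.A and A' = s'.A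
      note M' = minv_mult[OF A' s'.inv] and M = minv_mult[OF A s.inv]
      have Pj: "P j \<in> carrier_mat (n j) (n ?l)" using P[of j] lj 1(3) by simp
      have PT: "(P j)\<^sup>T \<in> carrier_mat (n ?l) (n j)" using Pj by simp
      define E where "E = wcycle_err A P \<omega> m ?l"
      have IH: "E \<in> carrier_mat (n ?l) (n ?l)"
        "\<And>g. g \<in> carrier_vec (n ?l) \<Longrightarrow> energy_norm (A ?l) (E *\<^sub>v g) \<le> 2 * \<eta> * energy_norm (A ?l) g"
        using 1(1) lj unfolding E_def by blast+
      define G where "G = cheb_mat (\<omega> j \<cdot>\<^sub>m precond (A j)) m"
      have \<omega>j: "0 \<le> \<omega> j" using \<omega> lj 1(3) by blast
      have dampj: "\<omega> j * qe (n j) (A j) f f \<le> (\<Sum>i<n j. A j $$ (i, i) * (f i)\<^sup>2)" for f using damp lj 1(3) by blast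
      have G: "G \<in> carrier_mat (n j) (n j)" unfolding G_def
        by (rule smoother_bounds(1)[OF A s.sym s.psd_qe s.dpos \<omega>j dampj])
      have Gc: "energy_norm (A j) (G *\<^sub>v v) \<le> energy_norm (A j) v" if "v \<in> carrier_vec (n j)" for v
        unfolding energy_norm_def G_def real_sqrt_le_iff
        by (rule smoother_bounds(2)[OF A s.sym s.psd_qe s.dpos \<omega>j dampj that])
      define Q where "Q = (1\<^sub>m (n ?l) - E * E) * minv (A ?l) * (P j)\<^sup>T"
      have IE: "1\<^sub>m (n ?l) - E * E \<in> carrier_mat (n ?l) (n ?l)"
        by (rule minus_carrier_mat, rule mult_carrier_mat, rule IH(1), rule IH(1))
      have Q: "Q \<in> carrier_mat (n ?l) (n j)" unfolding Q_def using IE M'(1) PT by (meson mult_carrier_mat)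
      have err: "wcycle_err A P \<omega> m j = G * (minv (A j) - P j * Q) * A j * G"
        using A' unfolding j by (simp add: Let_def Q_def E_def G_def j)
      have PQ: "P j * Q \<in> carrier_mat (n j) (n j)" using Pj Q by (meson mult_carrier_mat)
      have B: "minv (A j) - P j * Q \<in> carrier_mat (n j) (n j)" using PQ by (rule minus_carrier_mat)
      have GB: "G * (minv (A j) - P j * Q) \<in> carrier_mat (n j) (n j)" using G B by (meson mult_carrier_mat)
      have GBA: "G * (minv (A j) - P j * Q) * A j \<in> carrier_mat (n j) (n j)" using GB A by (meson mult_carrier_mat)
      have cG: "G *\<^sub>v u \<in> carrier_vec (n j)" if "u \<in> carrier_vec (n j)" for u using G that by (metis mult_mat_vec_carrier)
      have cA: "A j *\<^sub>v u \<in> carrier_vec (n j)" if "u \<in> carrier_vec (n j)" for u using A that by (metis mult_mat_vec_carrier)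
      have cP: "P j *\<^sub>v u \<in> carrier_vec (n j)" if "u \<in> carrier_vec (n ?l)" for u using Pj that by (metis mult_mat_vec_carrier)
      have cPT: "(P j)\<^sup>T *\<^sub>v u \<in> carrier_vec (n ?l)" if "u \<in> carrier_vec (n j)" for u using PT that by (metis mult_mat_vec_carrier)
      have cM': "minv (A ?l) *\<^sub>v u \<in> carrier_vec (n ?l)" if "u \<in> carrier_vec (n ?l)" for u using M'(1) that by (metis mult_mat_vec_carrier)
      have cE: "E *\<^sub>v u \<in> carrier_vec (n ?l)" if "u \<in> carrier_vec (n ?l)" for u using IH(1) that by (metis mult_mat_vec_carrier)
      have main: "energy_norm (A j) (wcycle_err A P \<omega> m j *\<^sub>v g) \<le> 2 * \<eta> * energy_norm (A j) g" if g: "g \<in> carrier_vec (n j)" for g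
      proof -
        define y where "y = G *\<^sub>v g"
        have y: "y \<in> carrier_vec (n j)" unfolding y_def by (rule cG[OF g])
        define s where "s = minv (A ?l) *\<^sub>v ((P j)\<^sup>T *\<^sub>v (A j *\<^sub>v y))"
        have s: "s \<in> carrier_vec (n ?l)" unfolding s_def by (intro cM' cPT cA y)
        have Qs: "Q *\<^sub>v (A j *\<^sub>v y) = s - E *\<^sub>v (E *\<^sub>v s)"
          unfolding Q_def assoc_mult_mat_vec[OF mult_carrier_mat[OF IE M'(1)] PT cA[OF y]]
            assoc_mult_mat_vec[OF IE M'(1) cPT[OF cA[OF y]]] s_def[symmetric]
            minus_mult_distrib_mat_vec[OF one_carrier_mat mult_carrier_mat[OF IH(1) IH(1)] s]
            assoc_mult_mat_vec[OF IH(1) IH(1) s] using s by simp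
        have "wcycle_err A P \<omega> m j *\<^sub>v g = G *\<^sub>v ((minv (A j) - P j * Q) *\<^sub>v (A j *\<^sub>v y))"
          unfolding err y_def using assoc_mult_mat_vec[OF GBA G g] assoc_mult_mat_vec[OF GB A cG[OF g]] assoc_mult_mat_vec[OF G B cA[OF cG[OF g]]]
          by simp
        also have "(minv (A j) - P j * Q) *\<^sub>v (A j *\<^sub>v y) = y - P j *\<^sub>v (s - E *\<^sub>v (E *\<^sub>v s))"
        proof -
          have "minv (A j) *\<^sub>v (A j *\<^sub>v y) = y"
            unfolding assoc_mult_mat_vec[OF M(1) A y, symmetric] M(2) using y by (rule one_mult_mat_vec)
          then show ?thesis
            unfolding minus_mult_distrib_mat_vec[OF M(1) PQ cA[OF y]] assoc_mult_mat_vec[OF Pj Q cA[OF y]] Qs by simp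
        qed
        also have "\<dots> = (y - P j *\<^sub>v s) + P j *\<^sub>v (E *\<^sub>v (E *\<^sub>v s))"
          unfolding mult_minus_distrib_mat_vec[OF Pj s cE[OF cE[OF s]]]
          using y cP[OF s] cP[OF cE[OF cE[OF s]]] by (intro eq_vecI) (auto simp: carrier_vecD[OF cP[OF s]] carrier_vecD[OF cP[OF cE[OF cE[OF s]]]])
        also have "G *\<^sub>v \<dots> = G *\<^sub>v (y - P j *\<^sub>v s) + G *\<^sub>v (P j *\<^sub>v (E *\<^sub>v (E *\<^sub>v s)))"
          using y cP[OF s] cP[OF cE[OF cE[OF s]]] by (intro mult_add_distrib_mat_vec[OF G]) auto
        finally have split: "wcycle_err A P \<omega> m j *\<^sub>v g = G *\<^sub>v (y - P j *\<^sub>v s) + G *\<^sub>v (P j *\<^sub>v (E *\<^sub>v (E *\<^sub>v s)))" .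
        have c1: "G *\<^sub>v (y - P j *\<^sub>v s) \<in> carrier_vec (n j)" using y cP[OF s] by (intro cG) auto
        have c2: "G *\<^sub>v (P j *\<^sub>v (E *\<^sub>v (E *\<^sub>v s))) \<in> carrier_vec (n j)" by (intro cG cP cE s)
        have "energy_norm (A j) (G *\<^sub>v (y - P j *\<^sub>v s)) \<le> \<kappa> / (2 * real m + 1)\<^sup>2 * energy_norm (A j) g"
          unfolding s_def y_def G_def
          by (rule two_grid_bound[OF s.spd_axioms s'.spd_axioms Pj \<omega>j dampj \<kappa> _ g])
            (use appr[of j] lj 1(3) in auto)
        also have "\<dots> \<le> \<eta> * energy_norm (A j) g" by (intro mult_right_mono \<eta> s.energy_nonneg g)
        finally have p1: "energy_norm (A j) (G *\<^sub>v (y - P j *\<^sub>v s)) \<le> \<eta> * energy_norm (A j) g" .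
        have Pn: "energy_norm (A j) (P j *\<^sub>v w) \<le> sqrt S * energy_norm (A ?l) w" if "w \<in> carrier_vec (n ?l)" for w
          using stab[of j w] that lj 1(3) unfolding energy_norm_def real_sqrt_mult[symmetric] by simp
        \<comment> \<open>s is the energy adjoint of the prolongation applied to y, so it obeys the
          same norm bound: pair s with itself, move the transpose over and cancel one
          factor.\<close>
        have sn: "energy_norm (A ?l) s \<le> sqrt S * energy_norm (A j) y"
        proof -
          have "(energy_norm (A ?l) s)\<^sup>2 = s \<bullet> (A ?l *\<^sub>v s)" by (rule s'.energy_sq[OF s])
          also have "A ?l *\<^sub>v s = (P j)\<^sup>T *\<^sub>v (A j *\<^sub>v y)"
            unfolding s_def assoc_mult_mat_vec[OF A' M'(1) cPT[OF cA[OF y]], symmetric] M'(3)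
            by (rule one_mult_mat_vec[OF cPT[OF cA[OF y]]])
          also have "s \<bullet> \<dots> = (P j *\<^sub>v s) \<bullet> (A j *\<^sub>v y)"
            using scalar_prod_transpose[OF Pj cA[OF y] s] comm_scalar_prod[OF s cPT[OF cA[OF y]]] comm_scalar_prod[OF cA[OF y] cP[OF s]] by simp
          also have "\<dots> \<le> energy_norm (A j) (P j *\<^sub>v s) * energy_norm (A j) y" by (rule s.inner_le[OF cP[OF s] y])
          also have "\<dots> \<le> (sqrt S * energy_norm (A ?l) s) * energy_norm (A j) y"
            by (intro mult_right_mono Pn s s.energy_nonneg y)
          finally have le: "energy_norm (A ?l) s * energy_norm (A ?l) s \<le> energy_norm (A ?l) s * (sqrt S * energy_norm (A j) y)"
            by (simp add: power2_eq_square mult_ac)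
          show ?thesis
          proof (cases "energy_norm (A ?l) s = 0")
            case True
            then show ?thesis using S s.energy_nonneg[OF y] by simp
          next
            case False
            then have "0 < energy_norm (A ?l) s" using s'.energy_nonneg[OF s] by simp
            then show ?thesis using le by (simp only: mult_le_cancel_left_pos)
          qed
        qed
        have "energy_norm (A j) (G *\<^sub>v (P j *\<^sub>v (E *\<^sub>v (E *\<^sub>v s)))) \<le> energy_norm (A j) (P j *\<^sub>v (E *\<^sub>v (E *\<^sub>v s)))"
          by (intro Gc cP cE s)
        also have "\<dots> \<le> sqrt S * energy_norm (A ?l) (E *\<^sub>v (E *\<^sub>v s))" by (intro Pn cE s)
        also have "\<dots> \<le> sqrt S * (2 * \<eta> * (2 * \<eta> * energy_norm (A ?l) s))"
        proof (intro mult_left_mono)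
          have "2 * \<eta> * energy_norm (A ?l) (E *\<^sub>v s) \<le> 2 * \<eta> * (2 * \<eta> * energy_norm (A ?l) s)"
            using \<eta>0 by (intro mult_left_mono IH(2) s) auto
          then show "energy_norm (A ?l) (E *\<^sub>v (E *\<^sub>v s)) \<le> 2 * \<eta> * (2 * \<eta> * energy_norm (A ?l) s)"
            using IH(2)[OF cE[OF s]] by simp
        qed (use S in simp)
        also have "\<dots> \<le> sqrt S * (2 * \<eta> * (2 * \<eta> * (sqrt S * energy_norm (A j) y)))"
          using sn \<eta>0 S by (intro mult_left_mono) auto
        also have "\<dots> = 4 * (sqrt S * sqrt S) * \<eta> * \<eta> * energy_norm (A j) y" by (simp add: algebra_simps)
        also have "\<dots> = (4 * S * \<eta>) * (\<eta> * energy_norm (A j) y)" using S by simp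
        also have "\<dots> \<le> 1 * (\<eta> * energy_norm (A j) y)"
          using \<eta> \<eta>0 s.energy_nonneg[OF y] by (intro mult_right_mono) auto
        also have "\<dots> \<le> \<eta> * energy_norm (A j) g"
          unfolding y_def using Gc[OF g] \<eta>0 by (simp add: mult_left_mono)
        finally have p2: "energy_norm (A j) (G *\<^sub>v (P j *\<^sub>v (E *\<^sub>v (E *\<^sub>v s)))) \<le> \<eta> * energy_norm (A j) g" .
        show ?thesis unfolding split using s.energy_triangle[OF c1 c2] p1 p2 by simp
      qed
      have "wcycle_err A P \<omega> m j \<in> carrier_mat (n j) (n j)" unfolding err using GBA G by (meson mult_carrier_mat)
      then show ?thesis using main by blast
    qed
  qed
  then show ?thesis using k g by blast
qed

section \<open>Tensor structure of the bilinear form\<close>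

text \<open>Integrals of products are to be split into one-dimensional ones. For this, Lebesgue
  measure on vectors is written as the image of the product measure indexed by coordinates, the form
  in which \<open>face_integral\<close> is already given.\<close>

lemma lborel_eq_distr_PiM:
  "(lborel :: (real^'d) measure) = distr (Pi\<^sub>M UNIV (\<lambda>_. lborel)) borel (\<lambda>f. \<chi> i. f i)"
proof (rule lborel_eqI)
  interpret product_sigma_finite "\<lambda>_::'d. lborel :: real measure" by standard
  have meas: "(\<lambda>f. \<chi> i. f i) \<in> Pi\<^sub>M UNIV (\<lambda>_. lborel) \<rightarrow>\<^sub>M (borel :: (real^'d) measure)"
    by (subst borel_measurable_euclidean_space)
      (auto simp: Basis_vec_def inner_axis intro!: measurable_component_singleton borel_measurable_const)
  fix l u :: "real^'d"
  assume le: "\<And>b. b \<in> Basis \<Longrightarrow> inner l b \<le> inner u b"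
  have lu: "vec_nth l i \<le> vec_nth u i" for i
    using le[of "axis i 1"] by (simp add: inner_axis)
  have "(\<lambda>f. \<chi> i. f i) -` box l u \<inter> space (Pi\<^sub>M UNIV (\<lambda>_. lborel)) = PiE UNIV (\<lambda>i. {vec_nth l i<..<vec_nth u i})"
    by (auto simp: mem_box_cart space_PiM PiE_iff)
  then have "emeasure (distr (Pi\<^sub>M UNIV (\<lambda>_. lborel)) borel (\<lambda>f. \<chi> i. f i)) (box l u)
      = emeasure (Pi\<^sub>M UNIV (\<lambda>_::'d. lborel)) (PiE UNIV (\<lambda>i. {vec_nth l i<..<vec_nth u i}))"
    by (subst emeasure_distr[OF meas]) auto
  also have "\<dots> = (\<Prod>i\<in>UNIV. emeasure lborel {vec_nth l i<..<vec_nth u i})"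
    by (rule emeasure_PiM) auto
  also have "\<dots> = ennreal (\<Prod>i\<in>UNIV. vec_nth u i - vec_nth l i)"
    using lu by (simp add: prod_ennreal)
  also have "(\<Prod>i\<in>UNIV. vec_nth u i - vec_nth l i) = (\<Prod>b\<in>Basis. inner (u - l) b)"
  proof -
    have B: "(Basis :: (real^'d) set) = (\<lambda>i. axis i 1) ` UNIV" by (auto simp: Basis_vec_def)
    have inj: "inj (\<lambda>i. axis i (1::real) :: real^'d)" by (simp add: inj_on_def axis_eq_axis)
    show ?thesis unfolding B prod.reindex[OF inj] by (simp add: inner_axis)
  qed
  finally show "emeasure (distr (Pi\<^sub>M UNIV (\<lambda>_. lborel)) borel (\<lambda>f. \<chi> i. f i)) (box l u) = ennreal (\<Prod>b\<in>Basis. inner (u - l) b)" .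
qed simp

text \<open>The closed interval serves the faces, the open one the interiors of cells.\<close>

lemma interval_poly_integral:
  fixes a h :: real and q :: nat
  assumes h: "0 < h"
  defines "lo \<equiv> a + h * real q" and "hi \<equiv> a + h * (real q + 1)"
  shows "has_bochner_integral lborel (\<lambda>t. indicator {lo..hi} t * poly r (2 * (t - a) / h - 2 * real q - 1)) (h / 2 * pint r)"
    and "has_bochner_integral lborel (\<lambda>t. indicator {lo<..<hi} t * poly r (2 * (t - a) / h - 2 * real q - 1)) (h / 2 * pint r)"
proof -
  obtain R where R: "pderiv R = r" by (rule antiderivative_poly)
  let ?f = "\<lambda>t. poly r (2 * (t - a) / h - 2 * real q - 1)" and ?F = "\<lambda>t. h / 2 * poly R (2 * (t - a) / h - 2 * real q - 1)"
  have D: "DERIV ?F t :> ?f t" for t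
    using h unfolding R[symmetric] by (auto intro!: derivative_eq_intros)
  have A: "has_bochner_integral lborel (\<lambda>t. ?f t * indicator {lo..hi} t) (?F hi - ?F lo)"
  proof (rule has_bochner_integral_FTC_Icc_real)
    show "lo \<le> hi" using h by (simp add: lo_def hi_def)
    show "isCont ?f t" for t by (intro continuous_intros) (use h in auto)
  qed (rule D)
  have eq: "?F hi - ?F lo = h / 2 * pint r"
  proof -
    have "2 * (hi - a) / h - 2 * real q - 1 = 1" "2 * (lo - a) / h - 2 * real q - 1 = -1"
      using h by (simp_all add: hi_def lo_def field_simps)
    then show ?thesis unfolding R[symmetric] pint_pderiv by (simp add: right_diff_distrib)
  qed
  show 1: "has_bochner_integral lborel (\<lambda>t. indicator {lo..hi} t * ?f t) (h / 2 * pint r)"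
    using A unfolding eq by (subst mult.commute)
  have ae: "AE t in lborel. indicator {lo..hi} t * ?f t = indicator {lo<..<hi} t * ?f t"
    using AE_lborel_singleton[of lo] AE_lborel_singleton[of hi]
    by eventually_elim (auto simp: indicator_def)
  have "(\<lambda>t. indicator {lo<..<hi} t * ?f t) \<in> borel_measurable lborel"
  proof -
    have "continuous_on UNIV ?f" by (intro continuous_intros) (use h in auto)
    then have "?f \<in> borel_measurable borel" by (rule borel_measurable_continuous_onI)
    then show ?thesis by measurable
  qed
  then show "has_bochner_integral lborel (\<lambda>t. indicator {lo<..<hi} t * ?f t) (h / 2 * pint r)"
    using 1 ae by (subst has_bochner_integral_cong_AE[symmetric]) (auto dest: has_bochner_integral_integrable)
qed

definition xi :: "real^'d \<Rightarrow> real \<Rightarrow> ('d \<Rightarrow> nat) \<Rightarrow> real^'d \<Rightarrow> 'd \<Rightarrow> real" where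
  "xi a h q x j = 2 * (vec_nth x j - vec_nth a j) / h - 2 * real (q j) - 1"

lemma interior_cell: "interior (cell a h q) = {x. \<forall>j. vec_nth a j + h * real (q j) < vec_nth x j \<and> vec_nth x j < vec_nth a j + h * (real (q j) + 1)}"
  unfolding cell_def interior_cbox by (auto simp: mem_box_cart)

lemma mem_cell: "x \<in> cell a h q \<longleftrightarrow> (\<forall>j. vec_nth a j + h * real (q j) \<le> vec_nth x j \<and> vec_nth x j \<le> vec_nth a j + h * (real (q j) + 1))"
  unfolding cell_def by (auto simp: mem_box_cart)

lemma cell_integral_sum:
  fixes a :: "real^'d" and r :: "'s \<Rightarrow> 'd \<Rightarrow> real poly"
  assumes h: "0 < h" and S: "finite S"
  shows "set_lebesgue_integral lborel (interior (cell a h q)) (\<lambda>x. \<Sum>s\<in>S. c s * (\<Prod>p\<in>UNIV. poly (r s p) (xi a h q x p)))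
    = (\<Sum>s\<in>S. c s * (\<Prod>p\<in>UNIV. h / 2 * pint (r s p)))"
proof -
  interpret product_sigma_finite "\<lambda>_::'d. lborel :: real measure" by standard
  define g where "g s p t = indicator {vec_nth a p + h * real (q p)<..<vec_nth a p + h * (real (q p) + 1)} t
      * poly (r s p) (2 * (t - vec_nth a p) / h - 2 * real (q p) - 1)" for s p and t :: real
  have g: "has_bochner_integral lborel (g s p) (h / 2 * pint (r s p))" for s p
    unfolding g_def by (rule interval_poly_integral(2)[OF h])
  have meas: "(\<lambda>f. \<chi> i. f i) \<in> Pi\<^sub>M UNIV (\<lambda>_. lborel) \<rightarrow>\<^sub>M (borel :: (real^'d) measure)"
    by (subst borel_measurable_euclidean_space)
      (auto simp: Basis_vec_def inner_axis intro!: measurable_component_singleton borel_measurable_const)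
  let ?f = "\<lambda>x. \<Sum>s\<in>S. c s * (\<Prod>p\<in>UNIV. poly (r s p) (xi a h q x p))"
  have cont: "continuous_on UNIV ?f"
    unfolding xi_def by (intro continuous_intros) (use h in auto)
  have "(\<lambda>x. indicator (interior (cell a h q)) x *\<^sub>R ?f x) \<in> borel_measurable borel"
    using borel_measurable_continuous_onI[OF cont] by measurable
  then have "set_lebesgue_integral lborel (interior (cell a h q)) ?f
    = (\<integral>y. indicator (interior (cell a h q)) (\<chi> i. y i) *\<^sub>R ?f (\<chi> i. y i) \<partial>Pi\<^sub>M UNIV (\<lambda>_. lborel))"
    unfolding set_lebesgue_integral_def lborel_eq_distr_PiM by (rule integral_distr[OF meas])
  also have "\<dots> = (\<integral>y. (\<Sum>s\<in>S. c s * (\<Prod>p\<in>UNIV. g s p (y p))) \<partial>Pi\<^sub>M UNIV (\<lambda>_. lborel))"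
  proof (rule Bochner_Integration.integral_cong[OF refl])
    fix y :: "'d \<Rightarrow> real"
    have ind: "indicator (interior (cell a h q)) (\<chi> i. y i)
        = (\<Prod>p\<in>UNIV. indicator {vec_nth a p + h * real (q p)<..<vec_nth a p + h * (real (q p) + 1)} (y p) :: real)"
      unfolding interior_cell by (auto simp: indicator_def prod_zero_iff intro!: prod.neutral)
    show "indicator (interior (cell a h q)) (\<chi> i. y i) *\<^sub>R ?f (\<chi> i. y i) = (\<Sum>s\<in>S. c s * (\<Prod>p\<in>UNIV. g s p (y p)))"
      unfolding ind g_def prod.distrib xi_def by (simp add: sum_distrib_left mult_ac)
  qed
  also have "\<dots> = (\<Sum>s\<in>S. c s * (\<integral>y. (\<Prod>p\<in>UNIV. g s p (y p)) \<partial>Pi\<^sub>M UNIV (\<lambda>_. lborel)))"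
    using g by (subst Bochner_Integration.integral_sum)
      (auto intro!: integrable_mult_right product_integrable_prod dest: has_bochner_integral_integrable simp: has_bochner_integral_iff)
  also have "\<dots> = (\<Sum>s\<in>S. c s * (\<Prod>p\<in>UNIV. h / 2 * pint (r s p)))"
  proof -
    have "integrable lborel (g s p)" "integral\<^sup>L lborel (g s p) = h / 2 * pint (r s p)" for s p
      using g[of s p] by (simp_all only: has_bochner_integral_iff)
    then show ?thesis by (subst product_integral_prod) (simp_all only: finite)
  qed
  finally show ?thesis .
qed

definition on_face :: "real^'d \<Rightarrow> real \<Rightarrow> 'd \<Rightarrow> ('d \<Rightarrow> nat) \<Rightarrow> real^'d \<Rightarrow> bool" where
  "on_face a h i q x \<longleftrightarrow> vec_nth x i = vec_nth a i + h * real (q i) \<and>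
    (\<forall>j. j \<noteq> i \<longrightarrow> vec_nth a j + h * real (q j) \<le> vec_nth x j \<and> vec_nth x j \<le> vec_nth a j + h * (real (q j) + 1))"

lemma face_integral_sum:
  fixes a :: "real^'d" and r :: "'s \<Rightarrow> 'd \<Rightarrow> real poly"
  assumes h: "0 < h" and S: "finite S"
    and f: "\<And>x. on_face a h i q x \<Longrightarrow> f x = (\<Sum>s\<in>S. c s * (\<Prod>p\<in>UNIV - {i}. poly (r s p) (xi a h q x p)))"
  shows "face_integral a h (i, q) f = (\<Sum>s\<in>S. c s * (\<Prod>p\<in>UNIV - {i}. h / 2 * pint (r s p)))"
proof -
  interpret product_sigma_finite "\<lambda>_::'d. lborel :: real measure" by standard
  define g where "g s p t = indicator {vec_nth a p + h * real (q p)..vec_nth a p + h * (real (q p) + 1)} t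
      * poly (r s p) (2 * (t - vec_nth a p) / h - 2 * real (q p) - 1)" for s p and t :: real
  have g: "has_bochner_integral lborel (g s p) (h / 2 * pint (r s p))" for s p
    unfolding g_def by (rule interval_poly_integral(1)[OF h])
  let ?K = "UNIV - {i}"
  let ?B = "\<Pi>\<^sub>E j\<in>?K. {vec_nth a j + h * real (q j)..vec_nth a j + h * (real (q j) + 1)}"
  let ?x = "\<lambda>y. \<chi> j. if j = i then vec_nth a i + h * real (q i) else y j"
  have "face_integral a h (i, q) f = (\<integral>y. indicator ?B y *\<^sub>R f (?x y) \<partial>Pi\<^sub>M ?K (\<lambda>_. lborel))"
    unfolding face_integral_def set_lebesgue_integral_def by simp
  also have "\<dots> = (\<integral>y. (\<Sum>s\<in>S. c s * (\<Prod>p\<in>?K. g s p (y p))) \<partial>Pi\<^sub>M ?K (\<lambda>_. lborel))"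
  proof (rule Bochner_Integration.integral_cong[OF refl])
    fix y :: "'d \<Rightarrow> real" assume y: "y \<in> space (Pi\<^sub>M ?K (\<lambda>_. lborel))"
    have ind: "indicator ?B y = (\<Prod>p\<in>?K. indicator {vec_nth a p + h * real (q p)..vec_nth a p + h * (real (q p) + 1)} (y p) :: real)"
    proof (cases "y \<in> ?B")
      case True
      then show ?thesis by (auto simp: indicator_def PiE_iff intro!: prod.neutral[symmetric])
    next
      case False
      then obtain p where "p \<in> ?K" "y p \<notin> {vec_nth a p + h * real (q p)..vec_nth a p + h * (real (q p) + 1)}"
        using y by (auto simp: space_PiM PiE_iff)
      then have "(\<Prod>p\<in>?K. indicator {vec_nth a p + h * real (q p)..vec_nth a p + h * (real (q p) + 1)} (y p) :: real) = 0"
        by (intro prod_zero bexI[of _ p]) auto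
      then show ?thesis using False by simp
    qed
    show "indicator ?B y *\<^sub>R f (?x y) = (\<Sum>s\<in>S. c s * (\<Prod>p\<in>?K. g s p (y p)))"
    proof (cases "y \<in> ?B")
      case True
      then have "on_face a h i q (?x y)" by (auto simp: on_face_def PiE_iff)
      then have e: "f (?x y) = (\<Sum>s\<in>S. c s * (\<Prod>p\<in>?K. poly (r s p) (xi a h q (?x y) p)))" by (rule f)
      have "(\<Prod>p\<in>?K. poly (r s p) (xi a h q (?x y) p)) = (\<Prod>p\<in>?K. g s p (y p))" for s
        using True by (intro prod.cong refl) (auto simp: g_def xi_def PiE_iff indicator_def)
      then show ?thesis unfolding e using True by simp
    next
      case False
      then have "(\<Prod>p\<in>?K. g s p (y p)) = 0" for s
        unfolding g_def prod.distrib ind[symmetric] by simp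
      then show ?thesis using False by simp
    qed
  qed
  also have "\<dots> = (\<Sum>s\<in>S. c s * (\<integral>y. (\<Prod>p\<in>?K. g s p (y p)) \<partial>Pi\<^sub>M ?K (\<lambda>_. lborel)))"
    using g by (subst Bochner_Integration.integral_sum)
      (auto intro!: integrable_mult_right product_integrable_prod simp: has_bochner_integral_iff)
  also have "\<dots> = (\<Sum>s\<in>S. c s * (\<Prod>p\<in>?K. h / 2 * pint (r s p)))"
  proof -
    have "integrable lborel (g s p)" "integral\<^sup>L lborel (g s p) = h / 2 * pint (r s p)" for s p
      using g[of s p] by (simp_all only: has_bochner_integral_iff)
    then show ?thesis by (subst product_integral_prod) (simp_all only: finite)
  qed
  finally show ?thesis .
qed

subsection \<open>Values and traces\<close>

text \<open>Regroups a cell multi-index and a degree multi-index into one pair of cell and degree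
  per direction, the index type of the tensor forms.\<close>

definition dec :: "('d \<Rightarrow> nat) \<times> ('d \<Rightarrow> nat) \<Rightarrow> 'd \<Rightarrow> nat \<times> nat" where
  "dec j = (\<lambda>i. (fst j i, snd j i))"

text \<open>The polynomial that a basis function equals inside cell \<open>q\<close>, continued to
  the whole space; it is zero if the basis function lives on another cell. Traces from
  \<open>q\<close> are its values.\<close>

definition loc :: "real^'d \<Rightarrow> real \<Rightarrow> ('d \<Rightarrow> nat) \<Rightarrow> ('d \<Rightarrow> nat \<times> nat) \<Rightarrow> real^'d \<Rightarrow> real" where
  "loc a h q I x = (\<Prod>p\<in>UNIV. poly (bas (I p) (q p)) (xi a h q x p))"

definition dloc :: "real^'d \<Rightarrow> real \<Rightarrow> ('d \<Rightarrow> nat) \<Rightarrow> 'd \<Rightarrow> ('d \<Rightarrow> nat \<times> nat) \<Rightarrow> real^'d \<Rightarrow> real" where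
  "dloc a h q i I x = 2 / h * (poly (pderiv (bas (I i) (q i))) (xi a h q x i) * (\<Prod>p\<in>UNIV - {i}. poly (bas (I p) (q p)) (xi a h q x p)))"

lemma basis_fun_interior:
  assumes h: "0 < h" and x: "x \<in> interior (cell a h q)"
  shows "basis_fun a h j x = loc a h q (dec j) x"
proof (cases "fst j = q")
  case True
  have "x \<in> cell a h q" using x interior_subset by blast
  then show ?thesis using True by (cases j) (auto simp: basis_fun_def loc_def dec_def bas_def xi_def)
next
  case False
  then obtain p where p: "fst j p \<noteq> q p" by auto
  have "x \<notin> cell a h (fst j)"
  proof
    assume "x \<in> cell a h (fst j)"
    then have "vec_nth a p + h * real (fst j p) \<le> vec_nth x p" "vec_nth x p \<le> vec_nth a p + h * (real (fst j p) + 1)"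
      by (auto simp: mem_cell)
    moreover have "vec_nth a p + h * real (q p) < vec_nth x p" "vec_nth x p < vec_nth a p + h * (real (q p) + 1)"
      using x by (auto simp: interior_cell)
    ultimately have "h * real (fst j p) < h * (real (q p) + 1)" "h * real (q p) < h * (real (fst j p) + 1)" by linarith+
    then have "real (fst j p) < real (q p) + 1" "real (q p) < real (fst j p) + 1" using h by (simp_all only: mult_less_cancel_left_pos)
    then show False using p by linarith
  qed
  then have "basis_fun a h j x = 0" by (cases j) (auto simp: basis_fun_def)
  moreover have "loc a h q (dec j) x = 0" unfolding loc_def
    by (intro prod_zero bexI[of _ p]) (use p in \<open>auto simp: dec_def bas_def\<close>)
  ultimately show ?thesis by simp
qed

lemma continuous_loc: "h \<noteq> 0 \<Longrightarrow> continuous_on UNIV (loc a h q I)"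
  unfolding loc_def[abs_def] xi_def by (intro continuous_intros) auto

lemma continuous_dloc: "h \<noteq> 0 \<Longrightarrow> continuous_on UNIV (dloc a h q i I)"
  unfolding dloc_def[abs_def] xi_def by (intro continuous_intros) auto

lemma loc_has_derivative:
  assumes h: "h \<noteq> 0"
  shows "(loc a h q I has_derivative (\<lambda>y. \<Sum>i\<in>UNIV. vec_nth y i * dloc a h q i I x)) (at x)"
proof -
  have "((\<lambda>x. poly (bas (I p) (q p)) (xi a h q x p)) has_derivative
      (\<lambda>y. vec_nth y p * (2 / h) * poly (pderiv (bas (I p) (q p))) (xi a h q x p))) (at x)" for p
  proof -
    have "((\<lambda>x. xi a h q x p) has_derivative (\<lambda>y. vec_nth y p * (2 / h))) (at x)"
      unfolding xi_def by (auto intro!: derivative_eq_intros bounded_linear.has_derivative[OF bounded_linear_vec_nth] simp: h)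
    moreover have "(poly (bas (I p) (q p)) has_derivative (\<lambda>t. t * poly (pderiv (bas (I p) (q p))) (xi a h q x p))) (at (xi a h q x p))"
      using poly_DERIV[of "bas (I p) (q p)" "xi a h q x p"] by (simp add: has_field_derivative_def mult_commute_abs)
    ultimately show ?thesis using has_derivative_compose by (fastforce simp: mult_ac)
  qed
  from has_derivative_prod[of UNIV "\<lambda>p x. poly (bas (I p) (q p)) (xi a h q x p)", OF this]
  have "(loc a h q I has_derivative (\<lambda>y. \<Sum>i\<in>UNIV. (vec_nth y i * (2 / h) * poly (pderiv (bas (I i) (q i))) (xi a h q x i))
      * (\<Prod>p\<in>UNIV - {i}. poly (bas (I p) (q p)) (xi a h q x p)))) (at x)"
    unfolding loc_def[abs_def] by simp
  then show ?thesis unfolding dloc_def by (simp add: mult_ac)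
qed

lemma grad_interior:
  assumes h: "0 < h" and S: "finite S" and x: "x \<in> interior (cell a h q)"
  shows "grad (\<lambda>x. \<Sum>j\<in>S. c j * basis_fun a h j x) x = (\<chi> i. \<Sum>j\<in>S. c j * dloc a h q i (dec j) x)"
proof -
  let ?D = "\<lambda>y. \<Sum>j\<in>S. c j * (\<Sum>i\<in>UNIV. vec_nth y i * dloc a h q i (dec j) x)"
  have "((\<lambda>x. \<Sum>j\<in>S. c j * loc a h q (dec j) x) has_derivative ?D) (at x)"
    using h by (intro has_derivative_sum has_derivative_mult_right loc_has_derivative) auto
  then have "((\<lambda>x. \<Sum>j\<in>S. c j * basis_fun a h j x) has_derivative ?D) (at x)"
    by (rule has_derivative_transform_within_open[OF _ open_interior x]) (simp add: basis_fun_interior[OF h])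
  then have "frechet_derivative (\<lambda>x. \<Sum>j\<in>S. c j * basis_fun a h j x) (at x) = ?D"
    by (rule frechet_derivative_at[symmetric])
  moreover have "(\<Sum>l\<in>UNIV. vec_nth (axis i 1 :: real^'a) l * f l) = f i" for i :: 'a and f :: "'a \<Rightarrow> real"
  proof -
    have "(\<Sum>l\<in>UNIV. vec_nth (axis i 1 :: real^'a) l * f l) = (\<Sum>l\<in>UNIV. if l = i then f i else 0)"
      by (intro sum.cong) (auto simp: axis_def)
    then show ?thesis by simp
  qed
  ultimately show ?thesis unfolding grad_def by (simp add: vec_eq_iff)
qed

text \<open>Every point of the closed cell is a limit point of its interior, so the limit defining
  the trace is unique and equals the value of any continuous function that agrees with
  \<open>g\<close> inside.\<close>

lemma cell_trace_eq:
  fixes a :: "real^'d" and g g' :: "real^'d \<Rightarrow> 'b::t2_space"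
  assumes h: "0 < h" and x: "x \<in> cell a h q" and cont: "continuous_on UNIV g'"
    and eq: "\<And>y. y \<in> interior (cell a h q) \<Longrightarrow> g y = g' y"
  shows "cell_trace (cell a h q) g x = g' x"
  unfolding cell_trace_def
proof (rule tendsto_Lim)
  let ?lo = "\<chi> i. vec_nth a i + h * real (q i)" and ?hi = "\<chi> i. vec_nth a i + h * (real (q i) + 1)"
  have int: "interior (cell a h q) = box ?lo ?hi" by (simp add: cell_def interior_cbox)
  have "box ?lo ?hi \<noteq> {}" using h by (simp add: interval_ne_empty_cart)
  then have "x \<in> closure (box ?lo ?hi)" using x by (simp add: closure_box cell_def)
  have "x islimpt box ?lo ?hi"
  proof (cases "x \<in> box ?lo ?hi")
    case True
    then show ?thesis by (intro interior_limit_point) (simp add: interior_open open_box)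
  next
    case False
    then show ?thesis using \<open>x \<in> closure (box ?lo ?hi)\<close> by (simp add: closure_def)
  qed
  then show "at x within interior (cell a h q) \<noteq> bot" by (simp add: int trivial_limit_within)
  have "(g' \<longlongrightarrow> g' x) (at x)" using cont by (simp add: continuous_on_eq_continuous_at isCont_def)
  then have "(g' \<longlongrightarrow> g' x) (at x within interior (cell a h q))" by (rule tendsto_within_subset) simp
  then show "(g \<longlongrightarrow> g' x) (at x within interior (cell a h q))"
    by (rule Lim_transform_eventually) (auto simp: eventually_at_filter eq)
qed

lemma cells_eq:
  assumes "0 < h" "\<And>i. vec_nth b i - vec_nth a i = real (N i) * h"
  shows "cells a b h = {q. \<forall>i. q i < N i}"
proof -
  have "vec_nth a i + h * (real (q i) + 1) \<le> vec_nth b i \<longleftrightarrow> q i < N i" for q i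
  proof -
    have "vec_nth a i + h * (real (q i) + 1) \<le> vec_nth b i \<longleftrightarrow> h * (real (q i) + 1) \<le> h * real (N i)"
      using assms(2)[of i] by (simp add: mult.commute) linarith
    also have "\<dots> \<longleftrightarrow> real (q i) + 1 \<le> real (N i)" using assms(1) by simp
    also have "\<dots> \<longleftrightarrow> q i < N i" by linarith
    finally show ?thesis .
  qed
  then show ?thesis by (auto simp: cells_def)
qed

locale mesh =
  fixes a b :: "real^'d" and h :: real and N :: "'d \<Rightarrow> nat"
  assumes h: "0 < h" and Npos: "\<And>i. 0 < N i" and cells: "cells a b h = {q. \<forall>i. q i < N i}"
begin

text \<open>On the lower boundary the outward normal is minus the axis and the jump is the plain
  trace, opposite to \<open>jmp\<close> at node 0. Jump and normal flux both carry this sign, so it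
  cancels in every face term.\<close>

definition sg :: "'d \<Rightarrow> ('d \<Rightarrow> nat) \<Rightarrow> real" where
  "sg i q = (if q i = 0 then -1 else 1)"

text \<open>The part of a basis function that depends on the coordinates within a face normal to
  direction \<open>i\<close>.\<close>

definition side :: "'d \<Rightarrow> ('d \<Rightarrow> nat) \<Rightarrow> ('d \<Rightarrow> nat \<times> nat) \<Rightarrow> real^'d \<Rightarrow> real" where
  "side i q I x = (\<Prod>p\<in>UNIV - {i}. poly (bas (I p) (q p)) (xi a h q x p))"

text \<open>In its normal direction a face has one position more than there are cells, the nodes 0
  to N_i; in the other directions it is addressed like a cell.\<close>

lemma faces_eq: "faces a b h = Sigma UNIV (\<lambda>i. PiE UNIV (\<lambda>p. if p = i then {..N i} else {..<N p}))"
proof -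
  have "(i, q) \<in> faces a b h \<longleftrightarrow> q i \<le> N i \<and> (\<forall>p. p \<noteq> i \<longrightarrow> q p < N p)" for i q
  proof -
    have "(i, q) \<in> faces a b h \<longleftrightarrow> (0 < q i \<and> q i - 1 < N i \<and> (\<forall>p. p \<noteq> i \<longrightarrow> q p < N p)) \<or> (\<forall>p. q p < N p)"
      unfolding faces_def has_below_def has_above_def cells by (auto split: if_splits)
    also have "\<dots> \<longleftrightarrow> q i \<le> N i \<and> (\<forall>p. p \<noteq> i \<longrightarrow> q p < N p)"
    proof -
      have "(\<forall>p. q p < N p) \<longleftrightarrow> q i < N i \<and> (\<forall>p. p \<noteq> i \<longrightarrow> q p < N p)" by metis
      moreover have "(0 < q i \<and> q i - 1 < N i) \<or> q i < N i \<longleftrightarrow> q i \<le> N i" using Npos[of i] by linarith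
      ultimately show ?thesis by blast
    qed
    finally show ?thesis .
  qed
  then show ?thesis by (auto simp: PiE_iff split: if_splits)
qed

context
  fixes i :: 'd and q :: "'d \<Rightarrow> nat"
  assumes face: "q i \<le> N i" "\<And>p. p \<noteq> i \<Longrightarrow> q p < N p"
begin

lemma has_below_iff: "has_below a b h (i, q) \<longleftrightarrow> 0 < q i"
  unfolding has_below_def cells using face by auto

lemma has_above_iff: "has_above a b h (i, q) \<longleftrightarrow> q i < N i"
  unfolding has_above_def cells using face by auto metis

context
  fixes S :: "(('d \<Rightarrow> nat) \<times> ('d \<Rightarrow> nat)) set" and c :: "('d \<Rightarrow> nat) \<times> ('d \<Rightarrow> nat) \<Rightarrow> real" and x :: "real^'d"
  assumes S: "finite S" and x: "on_face a h i q x"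
begin

lemma cell_above: "x \<in> cell a h q"
proof -
  have "vec_nth a p + h * real (q p) \<le> vec_nth x p \<and> vec_nth x p \<le> vec_nth a p + h * (real (q p) + 1)" for p
    using x h by (cases "p = i") (auto simp: on_face_def)
  then show ?thesis by (simp add: mem_cell)
qed

lemma cell_below: "q i = Suc k \<Longrightarrow> x \<in> cell a h (q(i := k))"
  using x h by (auto simp: mem_cell on_face_def)

lemma xi_above: "xi a h q x i = -1"
  using x h by (simp add: xi_def on_face_def)

lemma xi_below: "q i = Suc k \<Longrightarrow> xi a h (q(i := k)) x i = 1"
  using x h by (simp add: xi_def on_face_def)

lemma xi_other: "p \<noteq> i \<Longrightarrow> xi a h (q(i := l)) x p = xi a h q x p"
  by (simp add: xi_def)

lemma loc_above: "loc a h q I x = poly (bas (I i) (q i)) (-1) * side i q I x"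
  unfolding loc_def side_def by (subst prod_split[where j = i]) (simp add: xi_above)

lemma loc_below: "q i = Suc k \<Longrightarrow> loc a h (q(i := k)) I x = poly (bas (I i) k) 1 * side i q I x"
  unfolding loc_def side_def by (subst prod_split[where j = i]) (simp add: xi_below xi_other)

lemma dloc_above: "dloc a h q i I x = 2 / h * (poly (pderiv (bas (I i) (q i))) (-1) * side i q I x)"
  unfolding dloc_def side_def by (simp add: xi_above)

lemma dloc_below: "q i = Suc k \<Longrightarrow> dloc a h (q(i := k)) i I x = 2 / h * (poly (pderiv (bas (I i) k)) 1 * side i q I x)"
  unfolding dloc_def side_def by (simp add: xi_below xi_other)

abbreviation "expansion \<equiv> \<lambda>x. \<Sum>j\<in>S. c j * basis_fun a h j x"

lemma trace_u_above: "trace_above a h (i, q) expansion x = (\<Sum>j\<in>S. c j * loc a h q (dec j) x)"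
  unfolding trace_above_def
  by (simp, rule cell_trace_eq[OF h cell_above])
    (use h in \<open>auto intro!: continuous_intros continuous_loc simp: basis_fun_interior\<close>)

lemma trace_u_below: "q i = Suc k \<Longrightarrow> trace_below a h (i, q) expansion x = (\<Sum>j\<in>S. c j * loc a h (q(i := k)) (dec j) x)"
  unfolding trace_below_def
  by (simp, rule cell_trace_eq[OF h cell_below, where g' = "\<lambda>x. \<Sum>j\<in>S. c j * loc a h (q(i := k)) (dec j) x"])
    (use h in \<open>auto intro!: continuous_intros continuous_loc simp: basis_fun_interior\<close>)

lemma trace_grad_above: "trace_above a h (i, q) (grad expansion) x = (\<chi> l. \<Sum>j\<in>S. c j * dloc a h q l (dec j) x)"
  unfolding trace_above_def
  by (simp, rule cell_trace_eq[OF h cell_above])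
    (use h in \<open>auto intro!: continuous_intros continuous_dloc simp: grad_interior[OF h S]\<close>)

lemma trace_grad_below: "q i = Suc k \<Longrightarrow> trace_below a h (i, q) (grad expansion) x = (\<chi> l. \<Sum>j\<in>S. c j * dloc a h (q(i := k)) l (dec j) x)"
  unfolding trace_below_def
  by (simp, rule cell_trace_eq[OF h cell_below, where g' = "\<lambda>x. \<chi> l. \<Sum>j\<in>S. c j * dloc a h (q(i := k)) l (dec j) x"])
    (use h in \<open>auto intro!: continuous_intros continuous_dloc simp: grad_interior[OF h S]\<close>)

lemma jump_u: "jump a b h (i, q) expansion x = sg i q * (\<Sum>j\<in>S. c j * (jmp (N i) (q i) (bas (dec j i)) * side i q (dec j) x))"
proof -
  consider "q i = 0" | k where "q i = Suc k" "q i < N i" | k where "q i = Suc k" "q i = N i"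
    using face(1) by (cases "q i") (auto simp: le_eq_less_or_eq)
  then show ?thesis
  proof cases
    case 1
    then show ?thesis using Npos[of i]
      by (simp add: jump_def has_below_iff has_above_iff trace_u_above loc_above sg_def jmp_def sum_negf)
  next
    case (2 k)
    then show ?thesis
      by (simp add: jump_def has_below_iff has_above_iff trace_u_above trace_u_below loc_above loc_below sg_def jmp_def
          left_diff_distrib right_diff_distrib sum_subtractf)
  next
    case (3 k)
    then show ?thesis
      by (simp add: jump_def has_below_iff has_above_iff trace_u_below loc_below sg_def jmp_def)
  qed
qed

lemma flux_u: "inner (average a b h (i, q) (grad expansion) x) (face_normal a b h (i, q))
    = sg i q * (\<Sum>j\<in>S. c j * (2 / h * (avg (N i) (q i) (\<lambda>p. pderiv (bas (dec j i) p)) * side i q (dec j) x)))"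
proof -
  consider "q i = 0" | k where "q i = Suc k" "q i < N i" | k where "q i = Suc k" "q i = N i"
    using face(1) by (cases "q i") (auto simp: le_eq_less_or_eq)
  then show ?thesis
  proof cases
    case 1
    then show ?thesis using Npos[of i]
      by (simp add: average_def face_normal_def has_below_iff has_above_iff trace_grad_above dloc_above sg_def avg_def inner_axis)
  next
    case (2 k)
    have "inner (average a b h (i, q) (grad expansion) x) (face_normal a b h (i, q))
      = 1 / 2 * ((\<Sum>j\<in>S. c j * dloc a h (q(i := k)) i (dec j) x) + (\<Sum>j\<in>S. c j * dloc a h q i (dec j) x))"
      using 2 by (simp add: average_def face_normal_def has_below_iff has_above_iff trace_grad_above trace_grad_below inner_axis)
    also have "\<dots> = (\<Sum>j\<in>S. c j * (2 / h * (avg (N i) (q i) (\<lambda>p. pderiv (bas (dec j i) p)) * side i q (dec j) x)))"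
      unfolding sum.distrib[symmetric] sum_distrib_left dloc_above dloc_below[OF 2(1)]
      by (intro sum.cong refl) (use 2 in \<open>simp add: avg_def distrib_left distrib_right add_divide_distrib mult_ac\<close>)
    finally show ?thesis using 2 by (simp add: sg_def)
  next
    case (3 k)
    then show ?thesis
      by (simp add: average_def face_normal_def has_below_iff has_above_iff trace_grad_below dloc_below sg_def avg_def inner_axis)
  qed
qed

end

end

end

section \<open>Summation of cell and face integrals\<close>

lemma prod_slot: "(\<Prod>p\<in>UNIV. slot i A B p (J p) (L p)) = A i (J i) (L i) * (\<Prod>p\<in>UNIV - {i}. B p (J p) (L p) :: real)"
  for J L :: "'d::finite \<Rightarrow> 's"
  by (subst prod_split[where j = i]) (simp add: slot_def)

context mesh begin

text \<open>The mass factors of all directions but \<open>i\<close> that are left after summation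
  over cells, with their powers of h split off.\<close>

definition other :: "'d \<Rightarrow> ('d \<Rightarrow> nat) \<times> ('d \<Rightarrow> nat) \<Rightarrow> ('d \<Rightarrow> nat) \<times> ('d \<Rightarrow> nat) \<Rightarrow> real" where
  "other i j l = (\<Prod>p\<in>UNIV - {i}. mm (N p) (dec j p) (dec l p))"

lemma cells_PiE: "cells a b h = PiE UNIV (\<lambda>p. {..<N p})"
  unfolding cells by (auto simp: PiE_iff)

lemma finite_cells: "finite (cells a b h)"
  unfolding cells_PiE by (intro finite_PiE) auto

lemma mm_scaled: "(\<Sum>t<N p. h / 2 * pint (bas s t * bas s' t)) = h * mm (N p) s s'"
  by (simp add: mm_def mass_def sum_distrib_left sum_divide_distrib)

lemma power_pred: "h ^ (CARD('d) - 1) = h ^ CARD('d) / h"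
  using h by (simp add: power_diff)

lemma inner_gradients:
  assumes S: "finite S" and x: "x \<in> interior (cell a h q)"
  defines "r \<equiv> \<lambda>s p. if p = fst s then pderiv (bas (dec (fst (snd s)) p) (q p)) * pderiv (bas (dec (snd (snd s)) p) (q p))
      else bas (dec (fst (snd s)) p) (q p) * bas (dec (snd (snd s)) p) (q p)"
  shows "inner (grad (\<lambda>x. \<Sum>j\<in>S. c j * basis_fun a h j x) x) (grad (\<lambda>x. \<Sum>j\<in>S. c' j * basis_fun a h j x) x)
    = (\<Sum>s\<in>UNIV \<times> S \<times> S. c (fst (snd s)) * c' (snd (snd s)) * (4 / h\<^sup>2) * (\<Prod>p\<in>UNIV. poly (r s p) (xi a h q x p)))"
proof -
  have d: "dloc a h q i (dec j) x * dloc a h q i (dec l) x = 4 / h\<^sup>2 * (\<Prod>p\<in>UNIV. poly (r (i, j, l) p) (xi a h q x p))" for i j l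
  proof -
    have "(\<Prod>p\<in>UNIV. poly (r (i, j, l) p) (xi a h q x p))
      = poly (pderiv (bas (dec j i) (q i))) (xi a h q x i) * poly (pderiv (bas (dec l i) (q i))) (xi a h q x i)
        * (\<Prod>p\<in>UNIV - {i}. poly (bas (dec j p) (q p)) (xi a h q x p) * poly (bas (dec l p) (q p)) (xi a h q x p))"
      by (subst prod_split[where j = i]) (simp add: r_def)
    then show ?thesis unfolding dloc_def prod.distrib by (simp add: power2_eq_square)
  qed
  have "inner (grad (\<lambda>x. \<Sum>j\<in>S. c j * basis_fun a h j x) x) (grad (\<lambda>x. \<Sum>j\<in>S. c' j * basis_fun a h j x) x)
    = (\<Sum>i\<in>UNIV. \<Sum>j\<in>S. \<Sum>l\<in>S. c j * c' l * (dloc a h q i (dec j) x * dloc a h q i (dec l) x))"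
    unfolding grad_interior[OF h S x] inner_vec_def by (simp add: sum_product mult_ac)
  also have "\<dots> = (\<Sum>s\<in>UNIV \<times> S \<times> S. c (fst (snd s)) * c' (snd (snd s)) * (4 / h\<^sup>2) * (\<Prod>p\<in>UNIV. poly (r s p) (xi a h q x p)))"
    unfolding d sum.cartesian_product by (intro sum.cong) (auto simp: mult.assoc)
  finally show ?thesis .
qed

text \<open>A sum over all cells of a product of one-dimensional integrals is the product of the
  sums, so whole one-dimensional forms appear. The two derivatives give 4 / h^2 and each integral h
  / 2.\<close>

lemma volume_sum:
  assumes S: "finite S"
  shows "(\<Sum>q\<in>cells a b h. set_lebesgue_integral lborel (interior (cell a h q))
      (\<lambda>x. inner (grad (\<lambda>x. \<Sum>j\<in>S. c j * basis_fun a h j x) x) (grad (\<lambda>x. \<Sum>j\<in>S. c' j * basis_fun a h j x) x)))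
    = h ^ CARD('d) / h\<^sup>2 * (\<Sum>j\<in>S. \<Sum>l\<in>S. c j * c' l * (\<Sum>i\<in>UNIV. dir (N i) (bas (dec j i)) (bas (dec l i)) * other i j l))"
proof -
  define r where "r q s p = (if p = fst s then pderiv (bas (dec (fst (snd s)) p) (q p)) * pderiv (bas (dec (snd (snd s)) p) (q p))
      else bas (dec (fst (snd s)) p) (q p) * bas (dec (snd (snd s)) p) (q p))"
    for q :: "'d \<Rightarrow> nat" and s :: "'d \<times> (('d \<Rightarrow> nat) \<times> ('d \<Rightarrow> nat)) \<times> (('d \<Rightarrow> nat) \<times> ('d \<Rightarrow> nat))" and p
  have one: "set_lebesgue_integral lborel (interior (cell a h q))
      (\<lambda>x. inner (grad (\<lambda>x. \<Sum>j\<in>S. c j * basis_fun a h j x) x) (grad (\<lambda>x. \<Sum>j\<in>S. c' j * basis_fun a h j x) x))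
    = (\<Sum>s\<in>UNIV \<times> S \<times> S. c (fst (snd s)) * c' (snd (snd s)) * (4 / h\<^sup>2) * (\<Prod>p\<in>UNIV. h / 2 * pint (r q s p)))" for q
  proof -
    have "set_lebesgue_integral lborel (interior (cell a h q))
      (\<lambda>x. inner (grad (\<lambda>x. \<Sum>j\<in>S. c j * basis_fun a h j x) x) (grad (\<lambda>x. \<Sum>j\<in>S. c' j * basis_fun a h j x) x))
      = set_lebesgue_integral lborel (interior (cell a h q))
      (\<lambda>x. \<Sum>s\<in>UNIV \<times> S \<times> S. c (fst (snd s)) * c' (snd (snd s)) * (4 / h\<^sup>2) * (\<Prod>p\<in>UNIV. poly (r q s p) (xi a h q x p)))"
      by (rule set_lebesgue_integral_cong) (auto simp: inner_gradients[OF S] r_def)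
    also have "\<dots> = (\<Sum>s\<in>UNIV \<times> S \<times> S. c (fst (snd s)) * c' (snd (snd s)) * (4 / h\<^sup>2) * (\<Prod>p\<in>UNIV. h / 2 * pint (r q s p)))"
      by (rule cell_integral_sum[OF h]) (use S in auto)
    finally show ?thesis .
  qed
  have two: "(\<Sum>q\<in>cells a b h. \<Prod>p\<in>UNIV. h / 2 * pint (r q (i, j, l) p))
    = h ^ CARD('d) / 4 * (dir (N i) (bas (dec j i)) (bas (dec l i)) * other i j l)" for i j l
  proof -
    define f where "f p t = h / 2 * pint (if p = i then pderiv (bas (dec j p) t) * pderiv (bas (dec l p) t)
      else bas (dec j p) t * bas (dec l p) t)" for p t
    have "(\<Sum>q\<in>cells a b h. \<Prod>p\<in>UNIV. h / 2 * pint (r q (i, j, l) p)) = (\<Sum>q\<in>cells a b h. \<Prod>p\<in>UNIV. f p (q p))"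
      by (simp add: f_def r_def cong: if_cong)
    also have "\<dots> = (\<Prod>p\<in>UNIV. \<Sum>t<N p. f p t)"
      unfolding cells_PiE by (rule prod_sum_PiE_UNIV[symmetric]) simp
    also have "\<dots> = (\<Sum>t<N i. f i t) * (\<Prod>p\<in>UNIV - {i}. \<Sum>t<N p. f p t)" by (rule prod_split)
    also have "(\<Sum>t<N i. f i t) = h / 4 * dir (N i) (bas (dec j i)) (bas (dec l i))"
      by (simp add: f_def dir_def sum_distrib_left)
    also have "(\<Prod>p\<in>UNIV - {i}. \<Sum>t<N p. f p t) = (\<Prod>p\<in>UNIV - {i}. h * mm (N p) (dec j p) (dec l p))"
      by (intro prod.cong refl) (simp only: f_def mm_scaled[symmetric], simp)
    also have "\<dots> = h ^ CARD('d) / h * other i j l"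
      unfolding prod.distrib other_def using power_pred by (simp add: card_Diff_singleton)
    finally show ?thesis using h by simp
  qed
  have "(\<Sum>q\<in>cells a b h. \<Sum>s\<in>UNIV \<times> S \<times> S. c (fst (snd s)) * c' (snd (snd s)) * (4 / h\<^sup>2) * (\<Prod>p\<in>UNIV. h / 2 * pint (r q s p)))
    = (\<Sum>s\<in>UNIV \<times> S \<times> S. c (fst (snd s)) * c' (snd (snd s)) * (4 / h\<^sup>2) * (\<Sum>q\<in>cells a b h. \<Prod>p\<in>UNIV. h / 2 * pint (r q s p)))"
    by (subst sum.swap) (simp add: sum_distrib_left)
  also have "\<dots> = (\<Sum>s\<in>UNIV \<times> S \<times> S. case s of (i, j, l) \<Rightarrow>
      h ^ CARD('d) / h\<^sup>2 * (c j * c' l * (dir (N i) (bas (dec j i)) (bas (dec l i)) * other i j l)))"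
    by (intro sum.cong refl) (clarsimp simp only: two split: prod.splits, simp)
  also have "\<dots> = (\<Sum>i\<in>UNIV. \<Sum>j\<in>S. \<Sum>l\<in>S. h ^ CARD('d) / h\<^sup>2 * (c j * c' l * (dir (N i) (bas (dec j i)) (bas (dec l i)) * other i j l)))"
    by (simp add: sum.cartesian_product)
  also have "\<dots> = (\<Sum>j\<in>S. \<Sum>l\<in>S. \<Sum>i\<in>UNIV. h ^ CARD('d) / h\<^sup>2 * (c j * c' l * (dir (N i) (bas (dec j i)) (bas (dec l i)) * other i j l)))"
    by (subst sum.swap, intro sum.cong refl, rule sum.swap)
  finally show ?thesis unfolding one by (simp add: sum_distrib_left)
qed

text \<open>The common pattern of jump and flux terms: \<open>\<xi>\<close> and
  \<open>\<eta>\<close> are nodal values in the normal direction, while the other directions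
  contribute masses.\<close>

lemma face_sum:
  fixes \<xi> \<eta> :: "'d \<Rightarrow> ('d \<Rightarrow> nat) \<times> ('d \<Rightarrow> nat) \<Rightarrow> nat \<Rightarrow> real"
  assumes S: "finite S"
    and f: "\<And>i q x. q i \<le> N i \<Longrightarrow> (\<And>p. p \<noteq> i \<Longrightarrow> q p < N p) \<Longrightarrow> on_face a h i q x \<Longrightarrow>
      f (i, q) x = (\<Sum>j\<in>S. c j * (\<xi> i j (q i) * side i q (dec j) x)) * (\<Sum>l\<in>S. c' l * (\<eta> i l (q i) * side i q (dec l) x))"
  shows "(\<Sum>F\<in>faces a b h. face_integral a h F (f F))
    = h ^ CARD('d) / h * (\<Sum>j\<in>S. \<Sum>l\<in>S. c j * c' l * (\<Sum>i\<in>UNIV. (\<Sum>t\<le>N i. \<xi> i j t * \<eta> i l t) * other i j l))"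
proof -
  let ?Q = "\<lambda>i. PiE UNIV (\<lambda>p. if p = i then {..N i} else {..<N p})"
  have fin: "finite (?Q i)" for i by (intro finite_PiE) auto
  have one: "face_integral a h (i, q) (f (i, q)) = (\<Sum>j\<in>S. \<Sum>l\<in>S. c j * c' l *
      (\<xi> i j (q i) * \<eta> i l (q i) * (\<Prod>p\<in>UNIV - {i}. h / 2 * pint (bas (dec j p) (q p) * bas (dec l p) (q p)))))"
    if q: "q \<in> ?Q i" for i q
  proof -
    have qi: "q i \<le> N i" "\<And>p. p \<noteq> i \<Longrightarrow> q p < N p" using q by (auto simp: PiE_iff split: if_splits)
    have "face_integral a h (i, q) (f (i, q)) = (\<Sum>s\<in>S \<times> S. (c (fst s) * c' (snd s) * (\<xi> i (fst s) (q i) * \<eta> i (snd s) (q i)))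
        * (\<Prod>p\<in>UNIV - {i}. h / 2 * pint (bas (dec (fst s) p) (q p) * bas (dec (snd s) p) (q p))))"
    proof (rule face_integral_sum[OF h])
      show "finite (S \<times> S)" using S by simp
      fix x assume x: "on_face a h i q x"
      have e: "f (i, q) x = (\<Sum>j\<in>S. c j * (\<xi> i j (q i) * side i q (dec j) x)) * (\<Sum>l\<in>S. c' l * (\<eta> i l (q i) * side i q (dec l) x))"
        by (rule f) (use qi x in auto)
      have "f (i, q) x = (\<Sum>j\<in>S. \<Sum>l\<in>S. (c j * c' l * (\<xi> i j (q i) * \<eta> i l (q i))) * (side i q (dec j) x * side i q (dec l) x))"
        unfolding e by (simp add: sum_product mult_ac)
      also have "\<dots> = (\<Sum>s\<in>S \<times> S. (c (fst s) * c' (snd s) * (\<xi> i (fst s) (q i) * \<eta> i (snd s) (q i)))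
        * (\<Prod>p\<in>UNIV - {i}. poly (bas (dec (fst s) p) (q p) * bas (dec (snd s) p) (q p)) (xi a h q x p)))"
        unfolding sum.cartesian_product side_def by (intro sum.cong) (auto simp: prod.distrib)
      finally show "f (i, q) x = (\<Sum>s\<in>S \<times> S. (c (fst s) * c' (snd s) * (\<xi> i (fst s) (q i) * \<eta> i (snd s) (q i)))
        * (\<Prod>p\<in>UNIV - {i}. poly (bas (dec (fst s) p) (q p) * bas (dec (snd s) p) (q p)) (xi a h q x p)))" .
    qed
    then show ?thesis unfolding sum.cartesian_product by (simp add: case_prod_unfold mult.assoc)
  qed
  have two: "(\<Sum>q\<in>?Q i. \<xi> i j (q i) * \<eta> i l (q i) * (\<Prod>p\<in>UNIV - {i}. h / 2 * pint (bas (dec j p) (q p) * bas (dec l p) (q p))))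
    = h ^ CARD('d) / h * ((\<Sum>t\<le>N i. \<xi> i j t * \<eta> i l t) * other i j l)" for i j l
  proof -
    define g where "g p t = (if p = i then \<xi> i j t * \<eta> i l t else h / 2 * pint (bas (dec j p) t * bas (dec l p) t))" for p t
    have "(\<Sum>q\<in>?Q i. \<xi> i j (q i) * \<eta> i l (q i) * (\<Prod>p\<in>UNIV - {i}. h / 2 * pint (bas (dec j p) (q p) * bas (dec l p) (q p))))
      = (\<Sum>q\<in>?Q i. \<Prod>p\<in>UNIV. g p (q p))"
      by (intro sum.cong refl, subst prod_split[where j = i]) (simp add: g_def)
    also have "\<dots> = (\<Prod>p\<in>UNIV. \<Sum>t\<in>(if p = i then {..N i} else {..<N p}). g p t)"
      by (rule prod_sum_PiE_UNIV[symmetric]) simp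
    also have "\<dots> = (\<Sum>t\<le>N i. g i t) * (\<Prod>p\<in>UNIV - {i}. \<Sum>t<N p. g p t)"
      by (subst prod_split[where j = i]) simp
    also have "(\<Sum>t\<le>N i. g i t) = (\<Sum>t\<le>N i. \<xi> i j t * \<eta> i l t)" by (simp add: g_def)
    also have "(\<Prod>p\<in>UNIV - {i}. \<Sum>t<N p. g p t) = (\<Prod>p\<in>UNIV - {i}. h * mm (N p) (dec j p) (dec l p))"
      by (intro prod.cong refl) (simp only: g_def mm_scaled[symmetric], simp)
    also have "\<dots> = h ^ CARD('d) / h * other i j l"
      unfolding prod.distrib other_def using power_pred by (simp add: card_Diff_singleton)
    finally show ?thesis by simp
  qed
  have "(\<Sum>F\<in>faces a b h. face_integral a h F (f F)) = (\<Sum>i\<in>UNIV. \<Sum>q\<in>?Q i. face_integral a h (i, q) (f (i, q)))"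
    unfolding faces_eq by (subst sum.Sigma) (use fin in auto)
  also have "\<dots> = (\<Sum>i\<in>UNIV. \<Sum>q\<in>?Q i. \<Sum>j\<in>S. \<Sum>l\<in>S. c j * c' l *
      (\<xi> i j (q i) * \<eta> i l (q i) * (\<Prod>p\<in>UNIV - {i}. h / 2 * pint (bas (dec j p) (q p) * bas (dec l p) (q p)))))"
    by (intro sum.cong refl one)
  also have "\<dots> = (\<Sum>i\<in>UNIV. \<Sum>j\<in>S. \<Sum>q\<in>?Q i. \<Sum>l\<in>S. c j * c' l *
      (\<xi> i j (q i) * \<eta> i l (q i) * (\<Prod>p\<in>UNIV - {i}. h / 2 * pint (bas (dec j p) (q p) * bas (dec l p) (q p)))))"
    by (intro sum.cong refl sum.swap)
  also have "\<dots> = (\<Sum>i\<in>UNIV. \<Sum>j\<in>S. \<Sum>l\<in>S. \<Sum>q\<in>?Q i. c j * c' l *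
      (\<xi> i j (q i) * \<eta> i l (q i) * (\<Prod>p\<in>UNIV - {i}. h / 2 * pint (bas (dec j p) (q p) * bas (dec l p) (q p)))))"
    by (intro sum.cong refl sum.swap)
  also have "\<dots> = (\<Sum>i\<in>UNIV. \<Sum>j\<in>S. \<Sum>l\<in>S. c j * c' l * (h ^ CARD('d) / h * ((\<Sum>t\<le>N i. \<xi> i j t * \<eta> i l t) * other i j l)))"
    unfolding sum_distrib_left[symmetric] two ..
  also have "\<dots> = (\<Sum>j\<in>S. \<Sum>l\<in>S. \<Sum>i\<in>UNIV. c j * c' l * (h ^ CARD('d) / h * ((\<Sum>t\<le>N i. \<xi> i j t * \<eta> i l t) * other i j l)))"
    by (subst sum.swap, intro sum.cong refl, rule sum.swap)
  also have "\<dots> = h ^ CARD('d) / h * (\<Sum>j\<in>S. \<Sum>l\<in>S. c j * c' l * (\<Sum>i\<in>UNIV. (\<Sum>t\<le>N i. \<xi> i j t * \<eta> i l t) * other i j l))"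
    by (simp add: sum_distrib_left mult_ac)
  finally show ?thesis .
qed

lemma jumps_sum:
  assumes S: "finite S"
  shows "(\<Sum>F\<in>faces a b h. face_integral a h F (\<lambda>x. jump a b h F (\<lambda>x. \<Sum>j\<in>S. c j * basis_fun a h j x) x
      * jump a b h F (\<lambda>x. \<Sum>j\<in>S. c' j * basis_fun a h j x) x))
    = h ^ CARD('d) / h * (\<Sum>j\<in>S. \<Sum>l\<in>S. c j * c' l * (\<Sum>i\<in>UNIV. jmps (N i) (bas (dec j i)) (bas (dec l i)) * other i j l))"
  unfolding jmps_def
proof (rule face_sum[OF S])
  fix i q x
  assume f: "q i \<le> N i" "\<And>p. p \<noteq> i \<Longrightarrow> q p < N p" "on_face a h i q x"
  have J: "jump a b h (i, q) (\<lambda>x. \<Sum>j\<in>S. c j * basis_fun a h j x) x = sg i q * (\<Sum>j\<in>S. c j * (jmp (N i) (q i) (bas (dec j i)) * side i q (dec j) x))" for c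
    by (rule jump_u) (use f S in auto)
  show "jump a b h (i, q) (\<lambda>x. \<Sum>j\<in>S. c j * basis_fun a h j x) x * jump a b h (i, q) (\<lambda>x. \<Sum>j\<in>S. c' j * basis_fun a h j x) x
    = (\<Sum>j\<in>S. c j * (jmp (N i) (q i) (bas (dec j i)) * side i q (dec j) x)) * (\<Sum>l\<in>S. c' l * (jmp (N i) (q i) (bas (dec l i)) * side i q (dec l) x))"
    unfolding J by (simp add: sg_def)
qed

lemma fluxes_sum:
  assumes S: "finite S"
  shows "(\<Sum>F\<in>faces a b h. face_integral a h F (\<lambda>x. inner (average a b h F (grad (\<lambda>x. \<Sum>j\<in>S. c j * basis_fun a h j x)) x) (face_normal a b h F)
      * jump a b h F (\<lambda>x. \<Sum>j\<in>S. c' j * basis_fun a h j x) x))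
    = h ^ CARD('d) / h\<^sup>2 * (\<Sum>j\<in>S. \<Sum>l\<in>S. c j * c' l * (\<Sum>i\<in>UNIV. flux (N i) (bas (dec j i)) (bas (dec l i)) * other i j l))"
proof -
  have "(\<Sum>F\<in>faces a b h. face_integral a h F (\<lambda>x. inner (average a b h F (grad (\<lambda>x. \<Sum>j\<in>S. c j * basis_fun a h j x)) x) (face_normal a b h F)
      * jump a b h F (\<lambda>x. \<Sum>j\<in>S. c' j * basis_fun a h j x) x))
    = h ^ CARD('d) / h * (\<Sum>j\<in>S. \<Sum>l\<in>S. c j * c' l * (\<Sum>i\<in>UNIV. (\<Sum>t\<le>N i.
        (2 / h * avg (N i) t (\<lambda>p. pderiv (bas (dec j i) p))) * jmp (N i) t (bas (dec l i))) * other i j l))"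
  proof (rule face_sum[OF S])
    fix i q x
    assume f: "q i \<le> N i" "\<And>p. p \<noteq> i \<Longrightarrow> q p < N p" "on_face a h i q x"
    have J: "jump a b h (i, q) (\<lambda>x. \<Sum>j\<in>S. c' j * basis_fun a h j x) x = sg i q * (\<Sum>j\<in>S. c' j * (jmp (N i) (q i) (bas (dec j i)) * side i q (dec j) x))"
      by (rule jump_u) (use f S in auto)
    have A: "inner (average a b h (i, q) (grad (\<lambda>x. \<Sum>j\<in>S. c j * basis_fun a h j x)) x) (face_normal a b h (i, q))
      = sg i q * (\<Sum>j\<in>S. c j * (2 / h * (avg (N i) (q i) (\<lambda>p. pderiv (bas (dec j i) p)) * side i q (dec j) x)))"
      by (rule flux_u) (use f S in auto)
    show "inner (average a b h (i, q) (grad (\<lambda>x. \<Sum>j\<in>S. c j * basis_fun a h j x)) x) (face_normal a b h (i, q))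
        * jump a b h (i, q) (\<lambda>x. \<Sum>j\<in>S. c' j * basis_fun a h j x) x
      = (\<Sum>j\<in>S. c j * (2 / h * avg (N i) (q i) (\<lambda>p. pderiv (bas (dec j i) p)) * side i q (dec j) x))
        * (\<Sum>l\<in>S. c' l * (jmp (N i) (q i) (bas (dec l i)) * side i q (dec l) x))"
      unfolding J A by (simp add: sg_def mult.assoc)
  qed
  also have "\<dots> = h ^ CARD('d) / h * (\<Sum>j\<in>S. \<Sum>l\<in>S. c j * c' l * (\<Sum>i\<in>UNIV. 1 / h * (flux (N i) (bas (dec j i)) (bas (dec l i)) * other i j l)))"
  proof -
    have "(\<Sum>t\<le>N i. (2 / h * avg (N i) t g) * jmp (N i) t y) = 1 / h * (2 * (\<Sum>t\<le>N i. avg (N i) t g * jmp (N i) t y))" for i g y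
      by (simp add: sum_distrib_left mult.assoc)
    then show ?thesis unfolding flux_def by (simp only: mult.assoc)
  qed
  finally show ?thesis by (simp add: sum_distrib_left power2_eq_square mult_ac)
qed

text \<open>A face has one dimension less than a cell; with 1 / h from the penalty, or from the
  derivative in the flux, every face term gets the same power of h as the gradients.\<close>

theorem dg_form_tensor:
  assumes S: "finite S"
  shows "dg_form a b \<alpha> h k (\<lambda>x. \<Sum>j\<in>S. c j * basis_fun a h j x) (\<lambda>x. \<Sum>j\<in>S. c' j * basis_fun a h j x)
    = h ^ CARD('d) / h\<^sup>2 * (\<Sum>j\<in>S. \<Sum>l\<in>S. c j * c' l *
      (\<Sum>i\<in>UNIV. \<Prod>p\<in>UNIV. slot i (\<lambda>l. ipm (N l) \<alpha> k) (\<lambda>l. mm (N l)) p (dec j p) (dec l p)))"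
proof -
  let ?G = "\<lambda>f. \<Sum>j\<in>S. \<Sum>l\<in>S. c j * c' l * (\<Sum>i\<in>UNIV. f i (bas (dec j i)) (bas (dec l i)) * other i j l)"
  have swap: "(\<Sum>j\<in>S. \<Sum>l\<in>S. c' j * c l * (\<Sum>i\<in>UNIV. flux (N i) (bas (dec j i)) (bas (dec l i)) * other i j l))
    = ?G (\<lambda>i x y. flux (N i) y x)"
  proof -
    have "other i j l = other i l j" for i j l unfolding other_def by (simp add: sym_forms(2)[of "N p" "dec j p" for p])
    then show ?thesis by (subst sum.swap) (intro sum.cong refl, simp add: mult_ac)
  qed
  have "dg_form a b \<alpha> h k (\<lambda>x. \<Sum>j\<in>S. c j * basis_fun a h j x) (\<lambda>x. \<Sum>j\<in>S. c' j * basis_fun a h j x)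
    = h ^ CARD('d) / h\<^sup>2 * (?G (\<lambda>i. dir (N i)) - ?G (\<lambda>i. flux (N i)) - ?G (\<lambda>i x y. flux (N i) y x) + \<alpha> * (real k)\<^sup>2 * ?G (\<lambda>i. jmps (N i)))"
    unfolding dg_form_def volume_sum[OF S] fluxes_sum[OF S] sum_distrib_left[symmetric] jumps_sum[OF S] swap
    by (simp add: right_diff_distrib distrib_left power2_eq_square)
  also have "?G (\<lambda>i. dir (N i)) - ?G (\<lambda>i. flux (N i)) - ?G (\<lambda>i x y. flux (N i) y x) + \<alpha> * (real k)\<^sup>2 * ?G (\<lambda>i. jmps (N i))
    = ?G (\<lambda>i. ip (N i) \<alpha> k)"
    by (simp add: ip_def left_diff_distrib right_diff_distrib distrib_left distrib_right sum.distrib sum_subtractf sum_distrib_left mult_ac)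
  also have "\<dots> = (\<Sum>j\<in>S. \<Sum>l\<in>S. c j * c' l *
      (\<Sum>i\<in>UNIV. \<Prod>p\<in>UNIV. slot i (\<lambda>l. ipm (N l) \<alpha> k) (\<lambda>l. mm (N l)) p (dec j p) (dec l p)))"
    unfolding prod_slot other_def ipm_def ..
  finally show ?thesis .
qed

text \<open>The modulus appears because the square of \<open>sqrt x\<close> is the modulus of x for
  every real x. Nonnegativity of the form is supplied by \<open>ksum_enm\<close> where it is
  used.\<close>

theorem dg_norm_tensor:
  assumes S: "finite S"
  shows "(dg_norm a b h k (\<lambda>x. \<Sum>j\<in>S. c j * basis_fun a h j x))\<^sup>2
    = \<bar>h ^ CARD('d) / h\<^sup>2 * (\<Sum>j\<in>S. \<Sum>l\<in>S. c j * c l *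
      (\<Sum>i\<in>UNIV. \<Prod>p\<in>UNIV. slot i (\<lambda>l. enm (N l) k) (\<lambda>l. mm (N l)) p (dec j p) (dec l p)))\<bar>"
proof -
  let ?v = "\<lambda>x. \<Sum>j\<in>S. c j * basis_fun a h j x"
  let ?G = "\<lambda>f. \<Sum>j\<in>S. \<Sum>l\<in>S. c j * c l * (\<Sum>i\<in>UNIV. f i (bas (dec j i)) (bas (dec l i)) * other i j l)"
  have "(\<Sum>q\<in>cells a b h. set_lebesgue_integral lborel (interior (cell a h q)) (\<lambda>x. (norm (grad ?v x))\<^sup>2))
   + (real k)\<^sup>2 / h * (\<Sum>F\<in>faces a b h. face_integral a h F (\<lambda>x. (jump a b h F ?v x)\<^sup>2))
   = h ^ CARD('d) / h\<^sup>2 * (?G (\<lambda>i. dir (N i)) + (real k)\<^sup>2 * ?G (\<lambda>i. jmps (N i)))"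
    unfolding power2_norm_eq_inner volume_sum[OF S] power2_eq_square[of "jump _ _ _ _ _ _"] jumps_sum[OF S]
    by (simp add: distrib_left power2_eq_square)
  also have "?G (\<lambda>i. dir (N i)) + (real k)\<^sup>2 * ?G (\<lambda>i. jmps (N i)) = ?G (\<lambda>i. en (N i) k)"
    by (simp add: en_def distrib_left distrib_right sum.distrib sum_distrib_left mult_ac)
  also have "\<dots> = (\<Sum>j\<in>S. \<Sum>l\<in>S. c j * c l *
      (\<Sum>i\<in>UNIV. \<Prod>p\<in>UNIV. slot i (\<lambda>l. enm (N l) k) (\<lambda>l. mm (N l)) p (dec j p) (dec l p)))"
    unfolding prod_slot other_def enm_def ..
  finally show ?thesis unfolding dg_norm_def by (simp only: real_sqrt_power[symmetric] real_sqrt_abs)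
qed

end

section \<open>Matrices in tensor form\<close>

lemma pderiv_legendre_endpoints:
  "poly (pderiv (legendre n)) 1 = real n * (real n + 1) / 2"
  "poly (pderiv (legendre n)) (-1) = - ((-1) ^ n * (real n * (real n + 1) / 2))"
proof (induction n)
  case (Suc n)
  have e: "pderiv (legendre (Suc n)) = Polynomial.smult (real n + 1) (legendre n) + [:0, 1:] * pderiv (legendre n)"
    using legendre_deriv_aux[of n] by blast
  {
    case 1
    show ?case unfolding e using Suc(1) by (simp add: poly_legendre_1 field_simps)
  next
    case 2
    show ?case unfolding e using Suc(2) by (simp add: poly_legendre_minus_1 field_simps)
  }
qed simp_all

text \<open>By parts, the second derivative is orthogonal to \<open>legendre n\<close> by degree,
  and only the endpoint values are left.\<close>

lemma pint_pderiv_legendre: "pint (pderiv (legendre n) * pderiv (legendre n)) = real n * (real n + 1)"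
proof -
  have "pint (legendre n * pderiv (pderiv (legendre n))) = 0"
  proof (cases "n = 0")
    case False
    then have "degree (pderiv (pderiv (legendre n))) < n"
      using degree_pderiv_legendre_less[of n] by (simp add: degree_pderiv)
    then show ?thesis by (rule legendre_orthogonal_poly)
  qed simp
  then show ?thesis
    using pint_by_parts[of "legendre n" "pderiv (legendre n)"]
    by (simp add: poly_legendre_1 poly_legendre_minus_1 pderiv_legendre_endpoints flip: power_mult_distrib)
qed

text \<open>For a single mode, slope and jump have the same sign at both nodes of its cell, so the
  flux only lowers the value. What remains is 2 n (n + 1) from the derivative and the penalty of two
  jumps of modulus 1.\<close>

lemma ipm_diagonal:
  assumes s: "s \<in> idx N k" and \<alpha>: "0 \<le> \<alpha>" and k: "1 \<le> k"
  shows "ipm N \<alpha> k s s \<le> (4 + 2 * \<alpha>) * (real k)\<^sup>2"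
proof -
  obtain q n where sq: "s = (q, n)" "q < N" "n \<le> k" using s by (auto simp: idx_def)
  have b: "bas s = (\<lambda>t. if t = q then legendre n else 0)" by (simp add: sq bas_def fun_eq_iff)
  have j: "jmp N t (bas s) = (if t = Suc q then 1 else 0) - (if t = q then (-1) ^ n else 0)" if "t \<le> N" for t
    using sq(2) that by (auto simp: jmp_def b poly_legendre_1 poly_legendre_minus_1)
  have "jmps N (bas s) (bas s) = (\<Sum>t\<le>N. (if t = Suc q then 1 else 0) + (if t = q then 1 else 0))"
    unfolding jmps_def by (intro sum.cong refl) (auto simp: j simp flip: power_mult_distrib)
  also have "\<dots> = 2" using sq(2) by (simp add: sum.distrib)
  finally have J: "jmps N (bas s) (bas s) = 2" .
  have sg: "(-1) ^ n * x * (-1) ^ n = x" for x :: real by (cases "even n") auto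
  have "0 \<le> avg N t (\<lambda>p. pderiv (bas s p)) * jmp N t (bas s)" if "t \<le> N" for t
    using sq(2) that unfolding j[OF that]
    by (auto simp: avg_def b pderiv_legendre_endpoints sg)
  then have F: "0 \<le> flux N (bas s) (bas s)" unfolding flux_def by (intro mult_nonneg_nonneg[of 2], simp, intro sum_nonneg) simp
  have "(\<Sum>p<N. pint (pderiv (bas s p) * pderiv (bas s p))) = (\<Sum>p<N. if p = q then real n * (real n + 1) else 0)"
    by (intro sum.cong) (auto simp: b pint_pderiv_legendre)
  then have D: "dir N (bas s) (bas s) = 2 * (real n * (real n + 1))" using sq(2) by (simp add: dir_def)
  have "real n * (real n + 1) \<le> real k * (real k + real k)" using sq(3) k by (intro mult_mono) auto
  then have "dir N (bas s) (bas s) \<le> 4 * (real k)\<^sup>2" unfolding D by (simp add: power2_eq_square)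
  then show ?thesis using F J by (simp add: ipm_def ip_def distrib_right)
qed

lemma leg_weight_pos: "0 < leg_weight s"
  by (simp add: leg_weight_def add_nonneg_pos)

text \<open>The diagonal entry is compared with the mass weight of the same mode. In the slot of the
  second-order form a bound of order k^2 meets a weight that may be as small as 1 / (3 k), which
  costs the third power of k.\<close>

lemma ksum_diagonal:
  fixes I :: "'d::finite \<Rightarrow> nat \<times> nat"
  assumes I: "I \<in> PiE UNIV (\<lambda>i. idx (N i) k)" and \<alpha>: "0 \<le> \<alpha>" and k: "1 \<le> k"
  shows "(\<Sum>i\<in>UNIV. \<Prod>p\<in>UNIV. slot i (\<lambda>l. ipm (N l) \<alpha> k) (\<lambda>l. mm (N l)) p (I p) (I p))
    \<le> 3 * real CARD('d) * (4 + 2 * \<alpha>) * real k ^ 3 * (\<Prod>l\<in>UNIV. leg_weight (I l))"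
proof -
  have Ii: "I i \<in> idx (N i) k" for i using I by auto
  have "(\<Prod>p\<in>UNIV. slot i (\<lambda>l. ipm (N l) \<alpha> k) (\<lambda>l. mm (N l)) p (I p) (I p))
    \<le> (4 + 2 * \<alpha>) * (real k)\<^sup>2 * (3 * real k) * (\<Prod>l\<in>UNIV. leg_weight (I l))" for i
  proof -
    have m: "mm (N p) (I p) (I p) = leg_weight (I p)" for p
      unfolding mm_def leg_weight_def using mass_bas[OF Ii Ii] by simp
    have P: "0 \<le> (\<Prod>p\<in>UNIV - {i}. leg_weight (I p))" by (intro prod_nonneg) (simp add: less_imp_le leg_weight_pos)
    have "2 * real (snd (I i)) + 1 \<le> 3 * real k" using Ii[of i] k by (auto simp: idx_def)
    then have w: "1 \<le> 3 * real k * leg_weight (I i)" by (simp add: leg_weight_def field_simps)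
    have "ipm (N i) \<alpha> k (I i) (I i) \<le> (4 + 2 * \<alpha>) * (real k)\<^sup>2 * 1" using ipm_diagonal[OF Ii \<alpha> k] by simp
    also have "\<dots> \<le> (4 + 2 * \<alpha>) * (real k)\<^sup>2 * (3 * real k * leg_weight (I i))" using \<alpha> by (intro mult_left_mono w) auto
    finally have "ipm (N i) \<alpha> k (I i) (I i) * (\<Prod>p\<in>UNIV - {i}. leg_weight (I p))
      \<le> (4 + 2 * \<alpha>) * (real k)\<^sup>2 * (3 * real k * leg_weight (I i)) * (\<Prod>p\<in>UNIV - {i}. leg_weight (I p))"
      by (rule mult_right_mono[OF _ P])
    then show ?thesis unfolding prod_slot m prod_split[where j = i and f = "\<lambda>l. leg_weight (I l)"] by (simp add: mult_ac)
  qed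
  then have "(\<Sum>i\<in>UNIV. \<Prod>p\<in>UNIV. slot i (\<lambda>l. ipm (N l) \<alpha> k) (\<lambda>l. mm (N l)) p (I p) (I p))
    \<le> (\<Sum>i\<in>(UNIV :: 'd set). (4 + 2 * \<alpha>) * (real k)\<^sup>2 * (3 * real k) * (\<Prod>l\<in>UNIV. leg_weight (I l)))"
    by (intro sum_mono)
  also have "\<dots> = 3 * real CARD('d) * (4 + 2 * \<alpha>) * real k ^ 3 * (\<Prod>l\<in>UNIV. leg_weight (I l))"
    by (simp add: power2_eq_square power3_eq_cube mult_ac)
  finally show ?thesis .
qed

lemma resid_alt:
  fixes X :: "'d::finite \<Rightarrow> 's set"
  shows "resid X a m v I = (\<Sum>J\<in>PiE UNIV X. (\<Sum>i\<in>UNIV. \<Prod>p\<in>UNIV. slot i a m p (I p) (J p)) * v J)"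
  unfolding resid_def tapp_def by (subst sum.swap) (simp add: sum_distrib_right)

lemma ksum_alt:
  fixes X :: "'d::finite \<Rightarrow> 's set"
  shows "ksum X a m v w = (\<Sum>I\<in>PiE UNIV X. \<Sum>J\<in>PiE UNIV X. (\<Sum>i\<in>UNIV. \<Prod>p\<in>UNIV. slot i a m p (I p) (J p)) * v I * w J)"
  unfolding ksum_def tform_def sum_distrib_right
  by (subst sum.swap, intro sum.cong refl, rule sum.swap)

section \<open>Numbering of the basis and stiffness matrix\<close>

context mesh begin

definition X :: "nat \<Rightarrow> 'd \<Rightarrow> (nat \<times> nat) set" where "X k i = idx (N i) k"

abbreviation U :: "nat \<Rightarrow> ('d \<Rightarrow> nat \<times> nat) set" where "U k \<equiv> PiE UNIV (X k)"

abbreviation aa :: "real \<Rightarrow> nat \<Rightarrow> 'd \<Rightarrow> nat \<times> nat \<Rightarrow> nat \<times> nat \<Rightarrow> real" where "aa \<alpha> k \<equiv> \<lambda>i. ipm (N i) \<alpha> k"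
abbreviation ma :: "'d \<Rightarrow> nat \<times> nat \<Rightarrow> nat \<times> nat \<Rightarrow> real" where "ma \<equiv> \<lambda>i. mm (N i)"

definition scale :: real where "scale = h ^ CARD('d) / h\<^sup>2"

lemma scale_pos: "0 < scale" using h by (simp add: scale_def)

lemma finite_basis_index: "finite (basis_index a b h k)"
proof -
  have "{\<sigma> :: 'd \<Rightarrow> nat. \<forall>i. \<sigma> i \<le> k} = PiE UNIV (\<lambda>_. {..k})" by (auto simp: PiE_iff)
  then show ?thesis unfolding basis_index_def using finite_cells by (simp add: finite_PiE)
qed

lemma bij_dec: "bij_betw dec (basis_index a b h k) (U k)"
proof (rule bij_betw_byWitness[where f' = "\<lambda>I. (\<lambda>i. fst (I i), \<lambda>i. snd (I i))"])
  show "dec ` basis_index a b h k \<subseteq> U k"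
    unfolding basis_index_def cells by (auto simp: dec_def X_def idx_def)
  show "(\<lambda>I. (\<lambda>i. fst (I i), \<lambda>i. snd (I i))) ` U k \<subseteq> basis_index a b h k"
    unfolding basis_index_def cells by (auto simp: X_def idx_def PiE_iff mem_Times_iff)
qed (auto simp: dec_def)

definition index :: "nat \<Rightarrow> nat \<Rightarrow> 'd \<Rightarrow> nat \<times> nat" where
  "index k i = dec (basis_enum a b h k i)"

abbreviation dim :: "nat \<Rightarrow> nat" where "dim k \<equiv> dg_dim a b h k"

lemma bij_enum: "bij_betw (basis_enum a b h k) {..<dim k} (basis_index a b h k)"
  unfolding basis_enum_def dg_dim_def by (rule bij_betw_from_nat_into_finite) (rule finite_basis_index)

lemma bij_index: "bij_betw (index k) {..<dim k} (U k)"
  using bij_betw_trans[OF bij_enum bij_dec] by (simp add: o_def index_def[abs_def])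

text \<open>Transports coordinates from row numbers to tensor indices by the inverse of the
  numbering; nothing is claimed about the values outside \<open>U k\<close>.\<close>

definition spread :: "nat \<Rightarrow> (nat \<Rightarrow> real) \<Rightarrow> ('d \<Rightarrow> nat \<times> nat) \<Rightarrow> real" where
  "spread k f I = f (the_inv_into {..<dim k} (index k) I)"

lemma spread_index: "i < dim k \<Longrightarrow> spread k f (index k i) = f i"
  using bij_index[of k] by (simp add: spread_def the_inv_into_f_f bij_betw_def)

lemma index_in: "i < dim k \<Longrightarrow> index k i \<in> U k"
  using bij_index[of k] by (auto simp: bij_betw_def)

lemma index_cases: "I \<in> U k \<Longrightarrow> \<exists>i<dim k. I = index k i"
  using bij_index[of k] unfolding bij_betw_def by auto

lemma sum_index: "(\<Sum>i<dim k. F (index k i)) = (\<Sum>I\<in>U k. F I)"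
  by (rule sum.reindex_bij_betw[OF bij_index])

lemma sum_spread: "(\<Sum>I\<in>U k. F I (spread k f I)) = (\<Sum>i<dim k. F (index k i) (f i))"
  unfolding sum_index[symmetric] by (intro sum.cong) (simp_all add: spread_index)

lemma dim_pos: "0 < dim k"
proof -
  have "(\<lambda>_. (0, 0)) \<in> U k" using Npos by (auto simp: X_def idx_def)
  then show ?thesis using index_cases by fastforce
qed

definition kernel :: "real \<Rightarrow> nat \<Rightarrow> ('d \<Rightarrow> nat \<times> nat) \<Rightarrow> ('d \<Rightarrow> nat \<times> nat) \<Rightarrow> real" where
  "kernel \<alpha> k I J = (\<Sum>i\<in>UNIV. \<Prod>p\<in>UNIV. slot i (aa \<alpha> k) ma p (I p) (J p))"

lemma stiff_entry:
  assumes "i < dim k" "j < dim k"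
  shows "stiff a b \<alpha> h k $$ (i, j) = scale * kernel \<alpha> k (index k i) (index k j)"
proof -
  let ?e = "basis_enum a b h k"
  let ?S = "{?e i, ?e j}"
  \<comment> \<open>The tensor formula expects both arguments to be expanded over one index set. The
    two indices at hand form that set, with indicator coefficients; they may coincide.\<close>
  have one: "basis_fun a h l = (\<lambda>x. \<Sum>t\<in>?S. of_bool (t = l) * basis_fun a h t x)" if "l \<in> ?S" for l
    using that by (cases "?e i = ?e j") (auto simp: fun_eq_iff)
  have "dg_form a b \<alpha> h k (basis_fun a h (?e i)) (basis_fun a h (?e j))
    = h ^ CARD('d) / h\<^sup>2 * (\<Sum>s\<in>?S. \<Sum>t\<in>?S. of_bool (s = ?e i) * of_bool (t = ?e j) * kernel \<alpha> k (dec s) (dec t))"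
    unfolding kernel_def by (subst one[of "?e i"], simp, subst one[of "?e j"], simp, rule dg_form_tensor) simp
  also have "\<dots> = scale * kernel \<alpha> k (index k i) (index k j)"
    unfolding scale_def index_def by (cases "?e i = ?e j") auto
  finally show ?thesis using assms by (simp add: stiff_def)
qed

lemma stiff_carrier: "stiff a b \<alpha> h k \<in> carrier_mat (dim k) (dim k)"
  by (simp add: stiff_def)

lemma qe_stiff: "qe (dim k) (stiff a b \<alpha> h k) f g = scale * ksum (X k) (aa \<alpha> k) ma (spread k f) (spread k g)"
proof -
  have "qe (dim k) (stiff a b \<alpha> h k) f g = (\<Sum>i<dim k. \<Sum>j<dim k. scale * kernel \<alpha> k (index k i) (index k j) * f i * g j)"
    unfolding qe_def by (intro sum.cong refl) (simp add: stiff_entry)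
  also have "\<dots> = (\<Sum>I\<in>U k. \<Sum>J\<in>U k. scale * kernel \<alpha> k I J * spread k f I * spread k g J)"
    unfolding sum_spread[where F = "\<lambda>J y. scale * kernel \<alpha> k I J * spread k f I * y" for I]
      sum_spread[where F = "\<lambda>I x. \<Sum>j<dim k. scale * kernel \<alpha> k I (index k j) * x * g j"] ..
  also have "\<dots> = scale * ksum (X k) (aa \<alpha> k) ma (spread k f) (spread k g)"
    unfolding ksum_alt kernel_def[symmetric] by (simp add: sum_distrib_left mult.assoc)
  finally show ?thesis .
qed

text \<open>Every coefficient tensor is the expansion of a function in the space, and the common
  positive factor \<open>scale\<close> cancels.\<close>

lemma stable_tensor_coercive:
  assumes "\<forall>v\<in>dg_space a b h k. \<beta> * (dg_norm a b h k v)\<^sup>2 \<le> dg_form a b \<alpha> h k v v"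
  shows "tensor_coercive N \<beta> \<alpha> k"
  unfolding tensor_coercive_def X_def[symmetric, abs_def]
proof
  fix u :: "('d \<Rightarrow> nat \<times> nat) \<Rightarrow> real"
  let ?S = "basis_index a b h k" and ?v = "\<lambda>x. \<Sum>j\<in>basis_index a b h k. u (dec j) * basis_fun a h j x"
  have re: "(\<Sum>j\<in>?S. \<Sum>l\<in>?S. u (dec j) * u (dec l) * F (dec j) (dec l)) = (\<Sum>I\<in>U k. \<Sum>J\<in>U k. F I J * u I * u J)" for F
  proof -
    have "(\<Sum>l\<in>?S. u I * u (dec l) * F I (dec l)) = (\<Sum>J\<in>U k. F I J * u I * u J)" for I
      by (subst sum.reindex_bij_betw[OF bij_dec, symmetric]) (simp add: mult_ac)
    then have "(\<Sum>j\<in>?S. \<Sum>l\<in>?S. u (dec j) * u (dec l) * F (dec j) (dec l)) = (\<Sum>j\<in>?S. \<Sum>J\<in>U k. F (dec j) J * u (dec j) * u J)" by simp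
    also have "\<dots> = (\<Sum>I\<in>U k. \<Sum>J\<in>U k. F I J * u I * u J)" by (rule sum.reindex_bij_betw[OF bij_dec])
    finally show ?thesis .
  qed
  have n: "(dg_norm a b h k ?v)\<^sup>2 = \<bar>scale * ksum (X k) (\<lambda>i. enm (N i) k) ma u u\<bar>"
    unfolding dg_norm_tensor[OF finite_basis_index] ksum_alt scale_def
      re[of "\<lambda>I J. \<Sum>i\<in>UNIV. \<Prod>p\<in>UNIV. slot i (\<lambda>i. enm (N i) k) ma p (I p) (J p)"] ..
  have f: "dg_form a b \<alpha> h k ?v ?v = scale * ksum (X k) (aa \<alpha> k) ma u u"
    unfolding dg_form_tensor[OF finite_basis_index] ksum_alt scale_def
      re[of "\<lambda>I J. \<Sum>i\<in>UNIV. \<Prod>p\<in>UNIV. slot i (aa \<alpha> k) ma p (I p) (J p)"] ..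
  have "?v \<in> dg_space a b h k" unfolding dg_space_def by (intro CollectI exI[of _ "\<lambda>j. u (dec j)"]) simp
  then have "\<beta> * (dg_norm a b h k ?v)\<^sup>2 \<le> dg_form a b \<alpha> h k ?v ?v" using assms by blast
  moreover have "0 \<le> ksum (X k) (\<lambda>i. enm (N i) k) ma u u" unfolding X_def[abs_def] by (rule ksum_enm(2))
  ultimately have "scale * (\<beta> * ksum (X k) (\<lambda>i. enm (N i) k) ma u u) \<le> scale * ksum (X k) (aa \<alpha> k) ma u u"
    unfolding n f using scale_pos by (simp add: mult.left_commute)
  then show "\<beta> * ksum (X k) (\<lambda>i. enm (N i) k) ma u u \<le> ksum (X k) (aa \<alpha> k) ma u u"
    using scale_pos by (simp only: mult_le_cancel_left_pos)
qed

abbreviation wt :: "('d \<Rightarrow> nat \<times> nat) \<Rightarrow> real" where "wt I \<equiv> \<Prod>l\<in>UNIV. leg_weight (I l)"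

lemma wt_pos: "0 < wt I" by (intro prod_pos) (simp add: leg_weight_pos)

lemma kernel_sym: "kernel \<alpha> k I J = kernel \<alpha> k J I"
proof -
  have "slot i (aa \<alpha> k) ma p s t = slot i (aa \<alpha> k) ma p t s" for i p s t
    unfolding slot_def by (auto intro: sym_forms)
  then show ?thesis unfolding kernel_def by (intro sum.cong prod.cong refl)
qed

lemma stiff_spd:
  assumes k: "1 \<le> k" and \<beta>: "0 < \<beta>" and coer: "tensor_coercive N \<beta> \<alpha> k"
  shows "spd (dim k) (stiff a b \<alpha> h k)"
proof
  show "stiff a b \<alpha> h k \<in> carrier_mat (dim k) (dim k)" by (rule stiff_carrier)
  show "stiff a b \<alpha> h k $$ (i, j) = stiff a b \<alpha> h k $$ (j, i)" if "i < dim k" "j < dim k" for i j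
    using that kernel_sym by (simp add: stiff_entry)
  fix f :: "nat \<Rightarrow> real" assume "\<exists>i<dim k. f i \<noteq> 0"
  then obtain i where i: "i < dim k" "f i \<noteq> 0" by blast
  \<comment> \<open>Definiteness comes from the Poincare inequality in one direction, and any
    direction serves.\<close>
  let ?v = "spread k f" and ?p = "undefined :: 'd"
  have "0 < wt (index k i) * (?v (index k i))\<^sup>2" using i wt_pos by (simp add: spread_index)
  also have "\<dots> \<le> (\<Sum>I\<in>U k. wt I * (?v I)\<^sup>2)"
    using index_in[OF i(1)] wt_pos by (intro member_le_sum) (auto simp: less_imp_le X_def intro!: finite_PiE)
  also have "\<dots> = tform (X k) ma ?v ?v" unfolding X_def[abs_def] by (rule tform_mass[symmetric])
  also have "\<dots> \<le> 8 * (real (N ?p) + 1)\<^sup>2 * ksum (X k) (\<lambda>i. enm (N i) k) ma ?v ?v"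
    unfolding X_def[abs_def] by (rule ksum_enm(3)) (use k in simp)
  finally have "0 < ksum (X k) (\<lambda>i. enm (N i) k) ma ?v ?v"
    by (simp add: zero_less_mult_iff)
  then have "0 < \<beta> * ksum (X k) (\<lambda>i. enm (N i) k) ma ?v ?v" using \<beta> by simp
  also have "\<dots> \<le> ksum (X k) (aa \<alpha> k) ma ?v ?v" using coer unfolding tensor_coercive_def X_def[abs_def] by blast
  finally show "0 < qe (dim k) (stiff a b \<alpha> h k) f f" unfolding qe_stiff using scale_pos by simp
qed

end

section \<open>Residuals, transfer between levels and diagonal scaling\<close>

context mesh begin

lemma resid_stiff:
  assumes v: "v \<in> carrier_vec (dim k)" and i: "i < dim k"
  shows "vec_index (stiff a b \<alpha> h k *\<^sub>v v) i = scale * resid (X k) (aa \<alpha> k) ma (spread k (vf v)) (index k i)"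
proof -
  have "vec_index (stiff a b \<alpha> h k *\<^sub>v v) i = (\<Sum>j<dim k. stiff a b \<alpha> h k $$ (i, j) * vf v j)"
    using v i stiff_carrier[of \<alpha> k] by (auto simp: scalar_prod_def row_def vf_def atLeast0LessThan intro!: sum.cong)
  also have "\<dots> = (\<Sum>j<dim k. scale * kernel \<alpha> k (index k i) (index k j) * vf v j)"
    by (intro sum.cong refl) (simp add: stiff_entry i)
  also have "\<dots> = (\<Sum>J\<in>U k. scale * kernel \<alpha> k (index k i) J * spread k (vf v) J)" by (rule sum_spread[symmetric])
  also have "\<dots> = scale * resid (X k) (aa \<alpha> k) ma (spread k (vf v)) (index k i)"
    unfolding resid_alt kernel_def[symmetric] by (simp add: sum_distrib_left mult.assoc)
  finally show ?thesis .
qed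

lemma U_mono: "U (k - 1) \<subseteq> U k"
  unfolding X_def[abs_def] using idx_mono[of "k - 1" k] by (intro PiE_mono) auto

lemma prolong_carrier: "prolong a b h k \<in> carrier_mat (dim k) (dim (k - 1))"
  by (simp add: prolong_def)

lemma prolong_entry:
  assumes "i < dim k" "j < dim (k - 1)"
  shows "prolong a b h k $$ (i, j) = (if index k i = index (k - 1) j then 1 else 0)"
proof -
  have "x = y \<longleftrightarrow> dec x = dec y" for x y :: "('d \<Rightarrow> nat) \<times> ('d \<Rightarrow> nat)"
    by (auto simp: dec_def fun_eq_iff prod_eq_iff)
  then show ?thesis using assms by (simp add: prolong_def index_def)
qed

text \<open>The Legendre basis is hierarchical, so the injection extends coefficient tensors by
  zero.\<close>

lemma prolong_spread:
  assumes w: "w \<in> carrier_vec (dim (k - 1))" and I: "I \<in> U k"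
  shows "spread k (vf (prolong a b h k *\<^sub>v w)) I = (if I \<in> U (k - 1) then spread (k - 1) (vf w) I else 0)"
proof -
  obtain i where i: "i < dim k" "I = index k i" using index_cases[OF I] by blast
  have fin: "finite (U (k - 1))" by (auto simp: X_def intro!: finite_PiE)
  have "vf (prolong a b h k *\<^sub>v w) i = (\<Sum>j<dim (k - 1). prolong a b h k $$ (i, j) * vf w j)"
    using w i prolong_carrier[of k] by (auto simp: scalar_prod_def row_def vf_def atLeast0LessThan intro!: sum.cong)
  also have "\<dots> = (\<Sum>j<dim (k - 1). (if I = index (k - 1) j then 1 else 0) * vf w j)"
    by (intro sum.cong refl) (simp add: prolong_entry i)
  also have "\<dots> = (\<Sum>J\<in>U (k - 1). (if I = J then 1 else 0) * spread (k - 1) (vf w) J)" by (rule sum_spread[symmetric])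
  also have "\<dots> = (\<Sum>J\<in>U (k - 1). if I = J then spread (k - 1) (vf w) J else 0)" by (intro sum.cong) auto
  also have "\<dots> = (if I \<in> U (k - 1) then spread (k - 1) (vf w) I else 0)" using fin by (rule sum.delta')
  finally show ?thesis using i by (simp add: spread_index)
qed

lemma restrict_spread:
  assumes r: "r \<in> carrier_vec (dim k)" and j: "j < dim (k - 1)"
  shows "vec_index ((prolong a b h k)\<^sup>T *\<^sub>v r) j = spread k (vf r) (index (k - 1) j)"
proof -
  have fin: "finite (U k)" by (auto simp: X_def intro!: finite_PiE)
  have "vec_index ((prolong a b h k)\<^sup>T *\<^sub>v r) j = (\<Sum>i<dim k. prolong a b h k $$ (i, j) * vf r i)"
    using r j prolong_carrier[of k] by (auto simp: scalar_prod_def row_def vf_def atLeast0LessThan intro!: sum.cong)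
  also have "\<dots> = (\<Sum>i<dim k. (if index (k - 1) j = index k i then 1 else 0) * vf r i)"
    by (intro sum.cong refl, subst prolong_entry) (use j in auto)
  also have "\<dots> = (\<Sum>I\<in>U k. (if index (k - 1) j = I then 1 else 0) * spread k (vf r) I)" by (rule sum_spread[symmetric])
  also have "\<dots> = (\<Sum>I\<in>U k. if index (k - 1) j = I then spread k (vf r) I else 0)" by (intro sum.cong) auto
  also have "\<dots> = spread k (vf r) (index (k - 1) j)"
    using index_in[OF j] U_mono[of k] by (subst sum.delta'[OF fin]) auto
  finally show ?thesis .
qed

lemma scalar_prod_spread:
  assumes "y \<in> carrier_vec (dim k)" "v \<in> carrier_vec (dim k)"
  shows "y \<bullet> v = (\<Sum>I\<in>U k. spread k (vf y) I * spread k (vf v) I)"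
proof -
  have "y \<bullet> v = (\<Sum>i<dim k. vf y i * vf v i)"
    using assms by (auto simp: scalar_prod_def vf_def atLeast0LessThan intro!: sum.cong)
  also have "\<dots> = (\<Sum>i<dim k. spread k (vf y) (index k i) * spread k (vf v) (index k i))"
    by (intro sum.cong refl) (simp add: spread_index)
  also have "\<dots> = (\<Sum>I\<in>U k. spread k (vf y) I * spread k (vf v) I)" by (rule sum_index)
  finally show ?thesis .
qed

text \<open>On coarse functions the two forms differ by \<alpha> (2 k - 1) times the squared jumps.
  For k \<ge> 2 this is at most 3 \<alpha> (k - 1)^2 times them, a multiple of the coarse penalty,
  which coarse coercivity controls.\<close>

lemma prolongation_stable:
  assumes k: "2 \<le> k" and \<beta>: "0 < \<beta>" and \<alpha>: "0 \<le> \<alpha>" and coer: "tensor_coercive N \<beta> \<alpha> (k - 1)"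
    and w: "w \<in> carrier_vec (dim (k - 1))"
  shows "(prolong a b h k *\<^sub>v w) \<bullet> (stiff a b \<alpha> h k *\<^sub>v (prolong a b h k *\<^sub>v w))
    \<le> (1 + 3 * \<alpha> / \<beta>) * (w \<bullet> (stiff a b \<alpha> h (k - 1) *\<^sub>v w))"
proof -
  let ?K = "k - 1" and ?Pw = "prolong a b h k *\<^sub>v w"
  let ?W = "spread (k - 1) (vf w)" and ?V = "spread k (vf (prolong a b h k *\<^sub>v w))"
  have Pw: "?Pw \<in> carrier_vec (dim k)" using prolong_carrier w by (rule mult_mat_vec_carrier)
  have fin: "finite (X k i)" for i k by (simp add: X_def)
  have sub: "X ?K i \<subseteq> X k i" for i unfolding X_def by (rule idx_mono) simp
  have e: "tform (X k) B ?V ?V = tform (X ?K) B ?W ?W" for B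
  proof -
    have "tform (X k) B ?V ?V = tform (X ?K) B ?V ?V"
      by (rule tform_subset[OF fin sub]) (simp_all add: prolong_spread[OF w])
    also have "\<dots> = tform (X ?K) B ?W ?W"
      using U_mono[of k] by (intro tform_cong) (auto simp: prolong_spread[OF w] subset_iff)
    finally show ?thesis .
  qed
  have j: "(real ?K)\<^sup>2 * ksum (X ?K) (\<lambda>i. jm (N i)) ma ?W ?W \<le> ksum (X ?K) (\<lambda>i. enm (N i) ?K) ma ?W ?W"
    unfolding X_def[abs_def] by (rule ksum_enm(4)) (use k in simp)
  have c: "\<beta> * ksum (X ?K) (\<lambda>i. enm (N i) ?K) ma ?W ?W \<le> ksum (X ?K) (aa \<alpha> ?K) ma ?W ?W"
    using coer unfolding tensor_coercive_def X_def[abs_def] by blast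
  have jp: "0 \<le> ksum (X ?K) (\<lambda>i. jm (N i)) ma ?W ?W"
    unfolding ksum_def X_def[abs_def]
    by (intro sum_nonneg tform_psd) (auto simp: slot_def psd_mm psd_jm)
  have "(x + 1)\<^sup>2 - x\<^sup>2 \<le> 3 * x\<^sup>2" if "1 \<le> x" for x :: real
  proof -
    have "x * 1 \<le> x * x" using that by (intro mult_left_mono) auto
    then show ?thesis using that unfolding power2_eq_square distrib_left distrib_right by linarith
  qed
  moreover have kK: "real k = real ?K + 1" "1 \<le> real ?K" using k by auto
  ultimately have "(real k)\<^sup>2 - (real ?K)\<^sup>2 \<le> 3 * (real ?K)\<^sup>2" unfolding kK(1) by blast
  then have "((real k)\<^sup>2 - (real ?K)\<^sup>2) * ksum (X ?K) (\<lambda>i. jm (N i)) ma ?W ?W \<le> 3 * (real ?K)\<^sup>2 * ksum (X ?K) (\<lambda>i. jm (N i)) ma ?W ?W"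
    by (rule mult_right_mono[OF _ jp])
  also have "\<dots> \<le> 3 * ksum (X ?K) (\<lambda>i. enm (N i) ?K) ma ?W ?W" using j by simp
  also have "\<dots> \<le> 3 * (ksum (X ?K) (aa \<alpha> ?K) ma ?W ?W / \<beta>)" using c \<beta> by (simp add: field_simps)
  finally have "\<alpha> * (((real k)\<^sup>2 - (real ?K)\<^sup>2) * ksum (X ?K) (\<lambda>i. jm (N i)) ma ?W ?W)
    \<le> \<alpha> * (3 * (ksum (X ?K) (aa \<alpha> ?K) ma ?W ?W / \<beta>))" by (rule mult_left_mono[OF _ \<alpha>])
  then have "ksum (X ?K) (aa \<alpha> k) ma ?W ?W \<le> (1 + 3 * \<alpha> / \<beta>) * ksum (X ?K) (aa \<alpha> ?K) ma ?W ?W"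
    using ksum_level_diff[of "X ?K" N \<alpha> k ma ?W ?W ?K] by (simp add: distrib_right mult_ac)
  then have "scale * ksum (X k) (aa \<alpha> k) ma ?V ?V \<le> (1 + 3 * \<alpha> / \<beta>) * (scale * ksum (X ?K) (aa \<alpha> ?K) ma ?W ?W)"
    unfolding ksum_def e using scale_pos by (simp add: mult.left_commute)
  then show ?thesis
    unfolding qe_vec[OF stiff_carrier Pw Pw] qe_vec[OF stiff_carrier w w] qe_stiff .
qed

lemma stiff_diagonal:
  assumes i: "i < dim k" and k: "1 \<le> k" and \<alpha>: "0 \<le> \<alpha>"
  shows "stiff a b \<alpha> h k $$ (i, i) \<le> scale * (3 * real CARD('d) * (4 + 2 * \<alpha>) * real k ^ 3 * wt (index k i))"
proof -
  have "kernel \<alpha> k (index k i) (index k i) \<le> 3 * real CARD('d) * (4 + 2 * \<alpha>) * real k ^ 3 * wt (index k i)"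
    unfolding kernel_def by (rule ksum_diagonal[OF _ \<alpha> k]) (use index_in[OF i] in \<open>simp add: X_def[abs_def]\<close>)
  then show ?thesis unfolding stiff_entry[OF i i] using scale_pos by simp
qed

text \<open>The approximation property in terms of matrices. Its weight M^-1 is exchanged for the
  inverse diagonal at the price of k^3, which together with k^-2 leaves one power of k.\<close>

lemma coarse_correction:
  fixes C \<beta> \<alpha> :: real
  assumes C: "\<forall>(N :: 'd \<Rightarrow> nat) k v w r. 2 \<le> k \<longrightarrow> (\<forall>i. 0 < N i) \<longrightarrow>
    tensor_coercive N \<beta> \<alpha> k \<longrightarrow> tensor_coercive N \<beta> \<alpha> (k - 1) \<longrightarrow>
    (\<forall>I\<in>PiE UNIV (\<lambda>i. idx (N i) k). resid (\<lambda>i. idx (N i) k) (\<lambda>i. ipm (N i) \<alpha> k) (\<lambda>i. mm (N i)) v I = r I) \<longrightarrow>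
    (\<forall>I\<in>PiE UNIV (\<lambda>i. idx (N i) (k - 1)). resid (\<lambda>i. idx (N i) (k - 1)) (\<lambda>i. ipm (N i) \<alpha> (k - 1)) (\<lambda>i. mm (N i)) w I = r I) \<longrightarrow>
    \<bar>(\<Sum>I\<in>PiE UNIV (\<lambda>i. idx (N i) k). v I * r I) - (\<Sum>I\<in>PiE UNIV (\<lambda>i. idx (N i) (k - 1)). w I * r I)\<bar>
    \<le> C / (real k)\<^sup>2 * (\<Sum>I\<in>PiE UNIV (\<lambda>i. idx (N i) k). (r I)\<^sup>2 / (\<Prod>l\<in>UNIV. leg_weight (I l)))"
    and C0: "0 < C" and \<beta>: "0 < \<beta>" and \<alpha>: "0 < \<alpha>" and k: "2 \<le> k"
    and coer: "tensor_coercive N \<beta> \<alpha> k" "tensor_coercive N \<beta> \<alpha> (k - 1)"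
    and r: "r \<in> carrier_vec (dim k)" and v: "v \<in> carrier_vec (dim k)" and w: "w \<in> carrier_vec (dim (k - 1))"
    and Av: "stiff a b \<alpha> h k *\<^sub>v v = r" and Aw: "stiff a b \<alpha> h (k - 1) *\<^sub>v w = (prolong a b h k)\<^sup>T *\<^sub>v r"
  shows "\<bar>r \<bullet> v - ((prolong a b h k)\<^sup>T *\<^sub>v r) \<bullet> w\<bar>
    \<le> C * (3 * real CARD('d) * (4 + 2 * \<alpha>)) * real k * (\<Sum>i<dim k. (vec_index r i)\<^sup>2 / stiff a b \<alpha> h k $$ (i, i))"
proof -
  \<comment> \<open>The tensor forms do not contain h, so \<open>scale\<close> is divided out of the
    residual.\<close>
  let ?K = "k - 1" and ?R = "\<lambda>I. spread k (vf r) I / scale" and ?V = "spread k (vf v)" and ?W = "spread (k - 1) (vf w)"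
    and ?D = "3 * real CARD('d) * (4 + 2 * \<alpha>)" and ?r = "(prolong a b h k)\<^sup>T *\<^sub>v r"
  have k1: "1 \<le> k" using k by simp
  interpret s: spd "dim k" "stiff a b \<alpha> h k" by (rule stiff_spd[OF k1 \<beta> coer(1)])
  have r': "?r \<in> carrier_vec (dim ?K)" by (rule mult_mat_vec_carrier[OF _ r]) (simp only: transpose_carrier_mat prolong_carrier)
  have rV: "resid (X k) (aa \<alpha> k) ma ?V I = ?R I" if I: "I \<in> U k" for I
  proof -
    obtain i where i: "i < dim k" "I = index k i" using index_cases[OF I] by blast
    have "vf r i = scale * resid (X k) (aa \<alpha> k) ma ?V I"
      using resid_stiff[OF v i(1), of \<alpha>] i r unfolding Av by (auto simp: vf_def)
    then show ?thesis using i scale_pos by (simp add: spread_index)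
  qed
  have spr: "spread ?K (vf ?r) I = spread k (vf r) I" if I: "I \<in> U ?K" for I
  proof -
    obtain j where j: "j < dim ?K" "I = index ?K j" using index_cases[OF I] by blast
    have "spread ?K (vf ?r) I = vec_index ?r j"
      unfolding j(2) spread_index[OF j(1)] vf_def carrier_vecD[OF r'] using j(1) by (simp only: if_True)
    then show ?thesis using restrict_spread[OF r j(1)] j by simp
  qed
  have rW: "resid (X ?K) (aa \<alpha> ?K) ma ?W I = ?R I" if I: "I \<in> U ?K" for I
  proof -
    obtain j where j: "j < dim ?K" "I = index ?K j" using index_cases[OF I] by blast
    have "vec_index ?r j = scale * resid (X ?K) (aa \<alpha> ?K) ma ?W I"
      using resid_stiff[OF w j(1), of \<alpha>] j unfolding Aw by simp
    then show ?thesis using restrict_spread[OF r j(1)] j scale_pos by simp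
  qed
  have B: "\<bar>(\<Sum>I\<in>U k. ?V I * ?R I) - (\<Sum>I\<in>U ?K. ?W I * ?R I)\<bar> \<le> C / (real k)\<^sup>2 * (\<Sum>I\<in>U k. (?R I)\<^sup>2 / wt I)"
    using C[rule_format, where N = N and k = k and v = ?V and w = ?W and r = ?R] k Npos coer rV rW
    unfolding X_def[abs_def] by blast
  have e1: "r \<bullet> v = scale * (\<Sum>I\<in>U k. ?V I * ?R I)"
    unfolding scalar_prod_spread[OF r v] sum_distrib_left using scale_pos by (intro sum.cong) auto
  have e2: "?r \<bullet> w = scale * (\<Sum>I\<in>U ?K. ?W I * ?R I)"
    unfolding scalar_prod_spread[OF r' w] sum_distrib_left using scale_pos by (intro sum.cong refl) (simp only: spr, simp)
  have "\<bar>r \<bullet> v - ?r \<bullet> w\<bar> \<le> scale * (C / (real k)\<^sup>2 * (\<Sum>I\<in>U k. (?R I)\<^sup>2 / wt I))"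
    unfolding e1 e2 right_diff_distrib[symmetric] abs_mult abs_of_pos[OF scale_pos]
    by (rule mult_left_mono[OF B less_imp_le[OF scale_pos]])
  also have "(\<Sum>I\<in>U k. (?R I)\<^sup>2 / wt I) = (\<Sum>i<dim k. (vec_index r i / scale)\<^sup>2 / wt (index k i))"
    unfolding sum_index[symmetric] using r by (intro sum.cong refl) (auto simp: spread_index vf_def)
  also have "scale * (C / (real k)\<^sup>2 * (\<Sum>i<dim k. (vec_index r i / scale)\<^sup>2 / wt (index k i)))
    = C / (real k)\<^sup>2 * (\<Sum>i<dim k. (vec_index r i)\<^sup>2 / (scale * wt (index k i)))"
    unfolding sum_distrib_left using scale_pos by (intro sum.cong refl) (simp add: power_divide power2_eq_square)
  also have "\<dots> \<le> C / (real k)\<^sup>2 * (\<Sum>i<dim k. ?D * real k ^ 3 * ((vec_index r i)\<^sup>2 / stiff a b \<alpha> h k $$ (i, i)))"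
  proof (intro mult_left_mono sum_mono)
    fix i assume "i \<in> {..<dim k}"
    then have i: "i < dim k" by simp
    have "stiff a b \<alpha> h k $$ (i, i) \<le> ?D * real k ^ 3 * (scale * wt (index k i))"
      using stiff_diagonal[OF i k1, of \<alpha>] \<alpha> by (simp add: mult_ac)
    then have "1 / (scale * wt (index k i)) \<le> ?D * real k ^ 3 / stiff a b \<alpha> h k $$ (i, i)"
      using s.dpos[OF i] scale_pos wt_pos[of "index k i"] by (simp add: field_simps)
    then have "(vec_index r i)\<^sup>2 * (1 / (scale * wt (index k i))) \<le> (vec_index r i)\<^sup>2 * (?D * real k ^ 3 / stiff a b \<alpha> h k $$ (i, i))"
      by (rule mult_left_mono) simp
    then show "(vec_index r i)\<^sup>2 / (scale * wt (index k i)) \<le> ?D * real k ^ 3 * ((vec_index r i)\<^sup>2 / stiff a b \<alpha> h k $$ (i, i))"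
      by (simp add: mult_ac)
  qed (use C0 in simp)
  also have "\<dots> = C * ?D * real k * (\<Sum>i<dim k. (vec_index r i)\<^sup>2 / stiff a b \<alpha> h k $$ (i, i))"
    unfolding sum_distrib_left[symmetric] using k by (simp add: power2_eq_square power3_eq_cube)
  finally show ?thesis .
qed

end

theorem theorem4p9:
  fixes a b :: "real^'d" and \<alpha>0 c C :: real
  assumes "\<forall>i. a $ i < b $ i"
    and "0 < \<alpha>0"
    and "uniformly_stable a b \<alpha>0"
    and "0 < c" and "0 < C"
  shows "\<exists>C0>0. \<exists>\<delta>. 0 < \<delta> \<and> \<delta> < 1 \<and>
    (\<forall>(h::real) (p::nat) (\<omega> :: nat \<Rightarrow> real).
      uniform_mesh a b h \<longrightarrow>
      (\<forall>j\<in>{2..p}. 0 < \<omega> j * spec_rad (precond (stiff a b \<alpha>0 h j)) \<and>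
                   \<omega> j * spec_rad (precond (stiff a b \<alpha>0 h j)) \<le> 1 \<and>
                   \<omega> j \<le> C / (real j + 1) \<and> c / (real j + 1) \<le> \<omega> j) \<longrightarrow>
      (\<forall>k\<in>{2..p}. \<forall>m::nat. real m > C0 * real k \<longrightarrow>
        (\<forall>g\<in>carrier_vec (dg_dim a b h k).
          energy_norm (stiff a b \<alpha>0 h k)
            (wcycle_err (stiff a b \<alpha>0 h) (prolong a b h) \<omega> m k *\<^sub>v g)
          \<le> \<delta> * energy_norm (stiff a b \<alpha>0 h k) g)))"
proof -
  obtain \<beta> where \<beta>: "0 < \<beta>" and st: "\<And>h k v. uniform_mesh a b h \<Longrightarrow> 1 \<le> k \<Longrightarrow> v \<in> dg_space a b h k \<Longrightarrow>
      \<beta> * (dg_norm a b h k v)\<^sup>2 \<le> dg_form a b \<alpha>0 h k v v"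
    using assms(3) unfolding uniformly_stable_def by blast
  obtain Ca where Ca: "0 < Ca" and appr: "\<forall>(N :: 'd \<Rightarrow> nat) k v w r. 2 \<le> k \<longrightarrow> (\<forall>i. 0 < N i) \<longrightarrow>
    tensor_coercive N \<beta> \<alpha>0 k \<longrightarrow> tensor_coercive N \<beta> \<alpha>0 (k - 1) \<longrightarrow>
    (\<forall>I\<in>PiE UNIV (\<lambda>i. idx (N i) k). resid (\<lambda>i. idx (N i) k) (\<lambda>i. ipm (N i) \<alpha>0 k) (\<lambda>i. mm (N i)) v I = r I) \<longrightarrow>
    (\<forall>I\<in>PiE UNIV (\<lambda>i. idx (N i) (k - 1)). resid (\<lambda>i. idx (N i) (k - 1)) (\<lambda>i. ipm (N i) \<alpha>0 (k - 1)) (\<lambda>i. mm (N i)) w I = r I) \<longrightarrow>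
    \<bar>(\<Sum>I\<in>PiE UNIV (\<lambda>i. idx (N i) k). v I * r I) - (\<Sum>I\<in>PiE UNIV (\<lambda>i. idx (N i) (k - 1)). w I * r I)\<bar>
    \<le> Ca / (real k)\<^sup>2 * (\<Sum>I\<in>PiE UNIV (\<lambda>i. idx (N i) k). (r I)\<^sup>2 / (\<Prod>l\<in>UNIV. leg_weight (I l)))"
    using approximation_property[OF \<beta> assms(2), where 'd = 'd] by blast
  define CD where "CD = 3 * real CARD('d) * (4 + 2 * \<alpha>0)"
  define S where "S = 1 + 3 * \<alpha>0 / \<beta>"
  \<comment> \<open>Small enough for 4 S \<eta> \<le> 1, the condition of the induction over levels,
    and for 2 \<eta> < 1, as 2 \<eta> will be the rate.\<close>
  define \<eta> where "\<eta> = 1 / (8 * (S + 1))"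
  \<comment> \<open>\<open>Ca * CD\<close> is the approximation constant against the inverse
    diagonal. Division by \<open>c\<close> comes from the lower bound on the damping parameters, and
    the 2 from j (j + 1) \<le> 2 k^2 for j \<le> k.\<close>
  define K0 where "K0 = 2 * (Ca * CD) / c"
  \<comment> \<open>The summand 1 ensures C0 \<le> C0^2, so m > C0 k implies (2 m + 1)^2 \<ge> C0
    k^2; the other summand makes K0 / C0 at most \<eta>.\<close>
  define C0 where "C0 = 1 + K0 / \<eta>"
  have CD: "0 < CD" using assms(2) by (simp add: CD_def)
  have S: "1 \<le> S" using assms(2) \<beta> by (simp add: S_def)
  have \<eta>: "0 < \<eta>" "2 * \<eta> < 1" "4 * S * \<eta> \<le> 1" using S by (auto simp: \<eta>_def field_simps)
  have K0: "0 < K0" using Ca CD assms(4) by (simp add: K0_def)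
  have C0: "1 \<le> C0" "K0 \<le> \<eta> * C0" using K0 \<eta>(1) by (auto simp: C0_def distrib_left)
  have main: "energy_norm (stiff a b \<alpha>0 h k) (wcycle_err (stiff a b \<alpha>0 h) (prolong a b h) \<omega> m k *\<^sub>v g)
      \<le> 2 * \<eta> * energy_norm (stiff a b \<alpha>0 h k) g"
    if um: "uniform_mesh a b h"
      and \<omega>: "\<And>j. j \<in> {2..p} \<Longrightarrow> \<omega> j * spec_rad (precond (stiff a b \<alpha>0 h j)) \<le> 1 \<and> c / (real j + 1) \<le> \<omega> j"
      and k: "k \<in> {2..p}" and m: "real m > C0 * real k" and g: "g \<in> carrier_vec (dg_dim a b h k)"
    for h p \<omega> k g and m :: nat
  proof -
    have h: "0 < h" using um by (simp add: uniform_mesh_def)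
    obtain N where N: "\<And>i. vec_nth b i - vec_nth a i = real (N i) * h"
      using um unfolding uniform_mesh_def by metis
    have Npos: "0 < N i" for i
    proof (rule ccontr)
      assume "\<not> 0 < N i"
      then show False using N[of i] assms(1)[rule_format, of i] by simp
    qed
    interpret mesh a b h N
      by standard (rule h, rule Npos, rule cells_eq[OF h N])
    have coer: "tensor_coercive N \<beta> \<alpha>0 j" if "1 \<le> j" for j
      using st[OF um that] by (intro stable_tensor_coercive) blast
    have spd: "spd (dim j) (stiff a b \<alpha>0 h j)" if "1 \<le> j" for j
      by (rule stiff_spd[OF that \<beta> coer[OF that]])
    have \<omega>j: "c / (real j + 1) \<le> \<omega> j" "\<omega> j * spec_rad (precond (stiff a b \<alpha>0 h j)) \<le> 1" if "2 \<le> j" "j \<le> k" for j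
      using \<omega>[of j] that k by auto
    have \<omega>0: "0 \<le> \<omega> j" if "2 \<le> j" "j \<le> k" for j
      using \<omega>j(1)[OF that] assms(4) by (meson divide_nonneg_nonneg less_imp_le of_nat_0_le_iff add_nonneg_nonneg zero_le_one order.trans)
    show ?thesis
    \<comment> \<open>The number m of smoothing steps is the same on all levels, so the constant K0
      k^2 of the finest level is used for every j \<le> k.\<close>
    proof (rule wcycle_contraction[where n = dim and S = S and \<kappa> = "K0 * (real k)\<^sup>2"])
      show "spd (dim j) (stiff a b \<alpha>0 h j)" if "1 \<le> j" "j \<le> k" for j by (rule spd[OF that(1)])
      show "prolong a b h j \<in> carrier_mat (dim j) (dim (j - 1))" for j by (rule prolong_carrier)
      show "(prolong a b h j *\<^sub>v w) \<bullet> (stiff a b \<alpha>0 h j *\<^sub>v (prolong a b h j *\<^sub>v w)) \<le> S * (w \<bullet> (stiff a b \<alpha>0 h (j - 1) *\<^sub>v w))"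
        if "2 \<le> j" "j \<le> k" "w \<in> carrier_vec (dim (j - 1))" for j w
        unfolding S_def by (rule prolongation_stable[OF that(1) \<beta> _ coer that(3)]) (use assms(2) that in auto)
      show "0 \<le> S" using S by simp
      show "0 \<le> \<omega> j" if "2 \<le> j" "j \<le> k" for j by (rule \<omega>0[OF that])
      show "\<omega> j * qe (dim j) (stiff a b \<alpha>0 h j) f f \<le> (\<Sum>i<dim j. stiff a b \<alpha>0 h j $$ (i, i) * (f i)\<^sup>2)"
        if j: "2 \<le> j" "j \<le> k" for j f
      proof -
        interpret s: spd "dim j" "stiff a b \<alpha>0 h j" by (rule spd) (use j in simp)
        let ?D = "\<Sum>i<dim j. stiff a b \<alpha>0 h j $$ (i, i) * (f i)\<^sup>2"
        have D: "0 \<le> ?D" using s.dpos by (intro sum_nonneg) (simp add: less_imp_le)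
        have "\<omega> j * qe (dim j) (stiff a b \<alpha>0 h j) f f \<le> \<omega> j * (spec_rad (precond (stiff a b \<alpha>0 h j)) * ?D)"
          by (rule mult_left_mono[OF rayleigh_spec_rad[OF s.A dim_pos s.sym s.dpos] \<omega>0[OF j]])
        also have "\<dots> \<le> 1 * ?D" unfolding mult.assoc[symmetric] by (rule mult_right_mono[OF \<omega>j(2)[OF j] D])
        finally show ?thesis by simp
      qed
      show "0 < K0 * (real k)\<^sup>2" using K0 k by simp
      show "\<bar>r \<bullet> v - ((prolong a b h j)\<^sup>T *\<^sub>v r) \<bullet> w\<bar>
          \<le> K0 * (real k)\<^sup>2 * (\<omega> j * (\<Sum>i<dim j. (vec_index r i)\<^sup>2 / stiff a b \<alpha>0 h j $$ (i, i)))"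
        if j: "2 \<le> j" "j \<le> k" and "r \<in> carrier_vec (dim j)" "v \<in> carrier_vec (dim j)" "w \<in> carrier_vec (dim (j - 1))"
          "stiff a b \<alpha>0 h j *\<^sub>v v = r" "stiff a b \<alpha>0 h (j - 1) *\<^sub>v w = (prolong a b h j)\<^sup>T *\<^sub>v r" for j r v w
      proof -
        interpret s: spd "dim j" "stiff a b \<alpha>0 h j" by (rule spd) (use j in simp)
        let ?Q = "\<Sum>i<dim j. (vec_index r i)\<^sup>2 / stiff a b \<alpha>0 h j $$ (i, i)"
        have Q: "0 \<le> ?Q" using s.dpos by (intro sum_nonneg) (simp add: less_imp_le)
        have "\<bar>r \<bullet> v - ((prolong a b h j)\<^sup>T *\<^sub>v r) \<bullet> w\<bar> \<le> Ca * CD * real j * ?Q"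
          unfolding CD_def by (rule coarse_correction[OF appr Ca \<beta> assms(2) j(1) coer coer that(3-7)]) (use j in auto)
        also have "\<dots> \<le> K0 * (real k)\<^sup>2 * \<omega> j * ?Q"
        proof (rule mult_right_mono[OF _ Q])
          have "real j * (real j + 1) \<le> real k * (2 * real k)" using j by (intro mult_mono) auto
          then have "real j \<le> 2 * (real k)\<^sup>2 / (real j + 1)" by (simp add: field_simps power2_eq_square)
          also have "\<dots> = 2 * (real k)\<^sup>2 / c * (c / (real j + 1))" using assms(4) by simp
          also have "\<dots> \<le> 2 * (real k)\<^sup>2 / c * \<omega> j" using assms(4) by (intro mult_left_mono \<omega>j(1)[OF j]) simp
          finally have "Ca * CD * real j \<le> Ca * CD * (2 * (real k)\<^sup>2 / c * \<omega> j)" using Ca CD by (intro mult_left_mono) auto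
          then show "Ca * CD * real j \<le> K0 * (real k)\<^sup>2 * \<omega> j" by (simp add: K0_def mult_ac)
        qed
        finally show ?thesis by (simp add: mult.assoc)
      qed
      show "K0 * (real k)\<^sup>2 / (2 * real m + 1)\<^sup>2 \<le> \<eta>"
      proof -
        have "C0 * (real k)\<^sup>2 \<le> (C0 * real k)\<^sup>2"
          using C0(1) mult_right_mono[of 1 C0 "C0 * (real k)\<^sup>2"] by (simp add: power_mult_distrib power2_eq_square mult_ac)
        also have "\<dots> \<le> (2 * real m + 1)\<^sup>2" using m C0(1) by (intro power_mono) auto
        finally have "\<eta> * (C0 * (real k)\<^sup>2) \<le> \<eta> * (2 * real m + 1)\<^sup>2" using \<eta>(1) by simp
        moreover have "K0 * (real k)\<^sup>2 \<le> \<eta> * C0 * (real k)\<^sup>2" by (intro mult_right_mono C0(2)) simp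
        ultimately have "K0 * (real k)\<^sup>2 \<le> \<eta> * (2 * real m + 1)\<^sup>2" by simp
        moreover have "0 < (2 * real m + 1)\<^sup>2" by (simp add: add_nonneg_pos)
        ultimately show ?thesis by (simp only: pos_divide_le_eq)
      qed
      show "4 * S * \<eta> \<le> 1" by (rule \<eta>(3))
      show "1 \<le> k" using k by simp
      show "g \<in> carrier_vec (dim k)" by (rule g)
    qed
  qed
  show ?thesis
  proof (rule exI[of _ C0], intro conjI exI[of _ "2 * \<eta>"] allI impI ballI)
    show "0 < C0" "0 < 2 * \<eta>" "2 * \<eta> < 1" using C0 \<eta> by auto
  qed (rule main; blast)
qed

end
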